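(* Let $N\ge3$ and let $\Omega\subset S^{N-1}$ be a domain such that $\lambda_1(\Omega)>0$, where $\lambda_1(\Omega)$ is the principal eigenvalue of the Dirichlet Laplace–Beltrami operator $-\Delta_\omega$ in $\Omega$. Then for every $p\in(1,\frac{N}{N-2})$ there exists a symmetric measurable uniformly elliptic matrix $a_p$ such that $p^*(a_p,\mathcal{C}_\Omega)=p$.
   Context: A symmetric measurable matrix $a=(a_{ij}(x))$ is uniformly elliptic if there is $\nu>0$ with $\nu^{-1}|\xi|^2\le \sum_{i,j}a_{ij}(x)\xi_i\xi_j\le \nu|\xi|^2$ for all $\xi\in\mathbb{R}^N$ and a.e. $x$. $\mathcal{C}_\Omega=\{(r,\omega):\omega\in\Omega,\ r>0\}$ in polar coordinates. For a domain $G$ and $p>1$, $u\in H^1_{loc}(G)$ is a supersolution of $-\nabla\cdot(a\nabla u)=u^p$ in $G$ if $\int_G\nabla u\cdot a\cdot\nabla\varphi\,dx\ge\int_G u^p\varphi\,dx$ for all $0\le\varphi\in H^1_c(G)$ (compactly supported elements of $H^1_{loc}(G)$). A positive supersolution at infinity in $G$ is a positive supersolution in $G\setminus\bar B_\rho$ for some closed ball $\bar B_\rho$ centered at $0$. The critical exponent is $p^*(a,G)=\inf\{p>1:\ -\nabla\cdot(a\nabla u)=u^p\text{ has a positive supersolution at infinity in }G\}$. *)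

theory Defs
  imports "HOL-Analysis.Analysis"
begin

definition sphere_domain :: "(real^'n) set \<Rightarrow> bool" where
  "sphere_domain \<Omega> \<longleftrightarrow> \<Omega> \<noteq> {} \<and> connected \<Omega> \<and>
     openin (top_of_set (sphere 0 1)) \<Omega>"

definition cone_over :: "(real^'n) set \<Rightarrow> (real^'n) set" where
  "cone_over \<Omega> = {r *\<^sub>R \<omega> | r \<omega>. r > 0 \<and> \<omega> \<in> \<Omega>}"

text \<open>Test functions for the Dirichlet Laplace-Beltrami operator on Omega, represented by
  their 0-homogeneous extension psi(x) = phi(x/|x|) to R^N minus 0 (C^1, with support
  on the sphere a compact subset of Omega, not identically zero).  Dpsi is the
  Euclidean gradient of psi; |x| |Dpsi(x)| = |grad_omega phi(x/|x|)|.\<close>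
definition sphere_test :: "(real^'n) set \<Rightarrow> (real^'n \<Rightarrow> real) \<Rightarrow> (real^'n \<Rightarrow> real^'n) \<Rightarrow> bool" where
  "sphere_test \<Omega> \<psi> D\<psi> \<longleftrightarrow>
     (\<forall>x t. x \<noteq> 0 \<and> t > 0 \<longrightarrow> \<psi> (t *\<^sub>R x) = \<psi> x) \<and>
     (\<forall>x. x \<noteq> 0 \<longrightarrow> (\<psi> has_derivative (\<lambda>h. D\<psi> x \<bullet> h)) (at x)) \<and>
     continuous_on (- {0}) D\<psi> \<and>
     (\<exists>K. compact K \<and> K \<subseteq> \<Omega> \<and> (\<forall>\<omega>\<in>sphere 0 1. \<omega> \<notin> K \<longrightarrow> \<psi> \<omega> = 0)) \<and>
     (\<exists>\<omega>\<in>sphere 0 1. \<psi> \<omega> \<noteq> 0)"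

text \<open>Principal Dirichlet eigenvalue of -Delta_omega in Omega, as the infimum of the
  Rayleigh quotient  int_Omega |grad_omega phi|^2 / int_Omega phi^2.  Both sphere
  integrals are computed through the annulus 1 <= |x| <= 2 (the common radial factor
  int_1^2 r^{N-1} dr cancels).\<close>
definition annulus12 :: "(real^'n) set" where
  "annulus12 = {x. 1 \<le> norm x \<and> norm x \<le> 2}"

definition lambda1 :: "(real^'n) set \<Rightarrow> real" where
  "lambda1 \<Omega> = Inf {(LINT x:annulus12|lebesgue. (norm x)\<^sup>2 * (norm (D\<psi> x))\<^sup>2) /
                      (LINT x:annulus12|lebesgue. (\<psi> x)\<^sup>2) | \<psi> D\<psi>. sphere_test \<Omega> \<psi> D\<psi>}"

definition sym_meas_unif_elliptic :: "(real^'n \<Rightarrow> real^'n^'n) \<Rightarrow> bool" where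
  "sym_meas_unif_elliptic a \<longleftrightarrow>
     a \<in> borel_measurable lebesgue \<and>
     (\<forall>x. transpose (a x) = a x) \<and>
     (\<exists>\<nu>>0. AE x in lebesgue. \<forall>\<xi>.
        inverse \<nu> * (norm \<xi>)\<^sup>2 \<le> \<xi> \<bullet> (a x *v \<xi>) \<and> \<xi> \<bullet> (a x *v \<xi>) \<le> \<nu> * (norm \<xi>)\<^sup>2)"

definition C1c :: "(real^'n) set \<Rightarrow> (real^'n \<Rightarrow> real) \<Rightarrow> (real^'n \<Rightarrow> real^'n) \<Rightarrow> bool" where
  "C1c G \<phi> D\<phi> \<longleftrightarrow>
     (\<forall>x. (\<phi> has_derivative (\<lambda>h. D\<phi> x \<bullet> h)) (at x)) \<and> continuous_on UNIV D\<phi> \<and>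
     (\<exists>K. compact K \<and> K \<subseteq> G \<and> (\<forall>x. x \<notin> K \<longrightarrow> \<phi> x = 0))"

definition H1loc :: "(real^'n) set \<Rightarrow> (real^'n \<Rightarrow> real) \<Rightarrow> (real^'n \<Rightarrow> real^'n) \<Rightarrow> bool" where
  "H1loc G u g \<longleftrightarrow>
     u \<in> borel_measurable lebesgue \<and> g \<in> borel_measurable lebesgue \<and>
     (\<forall>K. compact K \<and> K \<subseteq> G \<longrightarrow>
        set_integrable lebesgue K (\<lambda>x. (u x)\<^sup>2) \<and>
        set_integrable lebesgue K (\<lambda>x. (norm (g x))\<^sup>2)) \<and>
     (\<forall>\<phi> D\<phi> i. C1c G \<phi> D\<phi> \<longrightarrow>
        (LINT x:G|lebesgue. u x * D\<phi> x $ i) = - (LINT x:G|lebesgue. g x $ i * \<phi> x))"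

text \<open>u > 0 is a positive supersolution of -div(a grad u) = u^p in G.  The right-hand
  side integral is taken as a nonnegative (extended) integral, which forces it to be finite.\<close>
definition pos_supersolution ::
  "(real^'n \<Rightarrow> real^'n^'n) \<Rightarrow> real \<Rightarrow> (real^'n) set \<Rightarrow> (real^'n \<Rightarrow> real) \<Rightarrow> bool" where
  "pos_supersolution a p G u \<longleftrightarrow>
     (AE x in lebesgue. x \<in> G \<longrightarrow> u x > 0) \<and>
     (\<exists>Du. H1loc G u Du \<and>
        (\<forall>\<phi> D\<phi>. H1loc G \<phi> D\<phi> \<and> (AE x in lebesgue. x \<in> G \<longrightarrow> 0 \<le> \<phi> x) \<and>
            (\<exists>K. compact K \<and> K \<subseteq> G \<and> (AE x in lebesgue. x \<notin> K \<longrightarrow> \<phi> x = 0)) \<longrightarrow>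
          (\<integral>\<^sup>+x. indicator G x * ennreal (u x powr p * \<phi> x) \<partial>lebesgue)
            \<le> ennreal (LINT x:G|lebesgue. Du x \<bullet> (a x *v D\<phi> x))))"

definition crit_exp :: "(real^'n \<Rightarrow> real^'n^'n) \<Rightarrow> (real^'n) set \<Rightarrow> ereal" where
  "crit_exp a G = Inf {ereal p | p. p > 1 \<and>
      (\<exists>\<rho>>0. \<exists>u. pos_supersolution a p (G - cball 0 \<rho>) u)}"

end

theory Submission
 imports Defs
begin

text \<open>Take \<open>a = aniso d\<close>, which acts as the identity in the radial direction and as \<open>d\<close> times the
  identity in the directions tangent to spheres.  For a positively 0-homogeneous \<open>v\<close> with
  \<open>- \<Delta> v = \<mu> r\<^sup>-\<^sup>2 v\<close> the function \<open>u = r\<^sup>\<beta> v\<close> satisfies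
  \<open>- div (a grad u) = (d \<mu> - \<beta> (\<beta> + N - 2)) r\<^sup>\<beta>\<^sup>-\<^sup>2 v\<close>, and \<open>r\<^sup>\<beta>\<^sup>-\<^sup>2\<close> scales like \<open>u\<^sup>q\<close> exactly for
  \<open>\<beta> = - 2 / (q - 1)\<close>.  Hence the critical exponent is the \<open>q\<close> for which \<open>d \<lambda>\<^sub>1 = \<beta> (\<beta> + N - 2)\<close>, and
  \<open>d\<close> is chosen so that this \<open>q\<close> is \<open>p\<close>.

  Above the critical exponent some \<open>\<mu> < \<lambda>\<^sub>1\<close> still gives a positive factor.  No eigenfunction is needed:
  \<open>v = 1 + \<phi>\<close>, where \<open>\<phi>\<close> minimises the Dirichlet energy associated with \<open>- \<Delta> \<phi> = \<mu> (1 + \<phi>)\<close>; it is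
  bounded since \<open>r\<^sup>\<gamma> v\<close> is subharmonic for large \<open>\<gamma>\<close>.

  Below the critical exponent choose a test function \<open>\<Theta>\<close> on the sphere whose Rayleigh quotient is close to
  \<open>\<lambda>\<^sub>1\<close> and let \<open>m t\<close> be the mean of \<open>ln u\<close> over the shell \<open>ln r \<approx> t\<close> with weight \<open>\<Theta>\<^sup>2\<close>.  Testing with
  \<open>\<Theta>\<^sup>2 / u\<close> gives \<open>m'' + (N - 2) m' + m'\<^sup>2 + exp (2 t + (q - 1) m) \<le> d R\<close> up to a constant in the exponent, where
  \<open>R\<close> is the Rayleigh quotient; this has no global solution when \<open>d R < \<beta> (\<beta> + N - 2)\<close>.\<close>

text \<open>The bound \<open>p < N / (N - 2)\<close> says that \<open>2 / (p - 1)\<close>, which is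
  \<open>- \<beta>\<close>, exceeds \<open>N - 2\<close>; so
  \<open>\<beta> (\<beta> + N - 2) > 0\<close> and \<open>d\<close> comes out positive. Three
  obstacles shape the proof. \<open>\<Omega>\<close> is an arbitrary domain without boundary
  regularity; but for \<open>\<mu> < \<lambda>\<^sub>1\<close> the energy is uniformly convex, so
  minimising sequences are Cauchy, and one-sided inequalities for the minimiser are enough. A
  supersolution is only in H1loc and positive almost everywhere, with no lower bound, so
  \<open>1 / u\<close> cannot be used in a test function: the work is done with
  \<open>ln (u + ep)\<close>, and \<open>ln u\<close> must be shown locally integrable before
  \<open>ep\<close> tends to 0. Since \<open>m\<close> averages over angle and logarithmic radius,
  \<open>t\<close>-derivatives fall on the bump, and the differential inequality holds classically
  although \<open>u\<close> has only a weak gradient; Jensen's inequality moves the nonlinearity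
  onto \<open>m\<close>. The sphere never appears as a manifold: functions on it are 0-homogeneous
  functions on space, integrated against a finite measure on an annulus.\<close>

abbreviation scR :: "real => 'a::real_vector => 'a" (infixr "*R" 75) where "r *R x == r *\<^sub>R x"
abbreviation dvR :: "'a::real_vector => real => 'a" (infixl "'/R" 70) where "x /R r == x /\<^sub>R r"
abbreviation inn :: "'a::real_inner => 'a => real" (infixl "<.>" 70) where "x <.> y == x \<bullet> y"
abbreviation lms :: "(nat => 'a::topological_space) => 'a => bool" (infixr ">->" 60) where "f >-> l == f \<longlonglongrightarrow> l"
abbreviation ind :: "'a set => 'a => 'b::zero_neq_one" where "ind == indicator"
abbreviation intl :: "('a::euclidean_space => 'b::{banach,second_countable_topology}) => bool" where "intl == integrable lborel"
abbreviation bmb :: "('a::topological_space => 'b::topological_space) set" where "bmb == borel_measurable borel"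

lemmas B_integrable_add = Bochner_Integration.integrable_add
 and B_integrable_bound = Bochner_Integration.integrable_bound
 and B_integrable_diff = Bochner_Integration.integrable_diff
 and B_integrable_sum = Bochner_Integration.integrable_sum
 and B_integral_add = Bochner_Integration.integral_add
 and B_integral_cong = Bochner_Integration.integral_cong
 and B_integral_diff = Bochner_Integration.integral_diff
 and B_integral_sum = Bochner_Integration.integral_sum

section \<open>Smooth functions with compact support\<close>

definition C1_on :: "(real^'n) set => (real^'n => real) => (real^'n => real^'n) => bool" where
 "C1_on G f Df \<longleftrightarrow> (\<forall>x\<in>G. (f has_derivative (%h. Df x <.> h)) (at x)) & continuous_on G Df"

lemma C1_onD: "C1_on G f Df ==> x \<in> G ==> (f has_derivative (%h. Df x <.> h)) (at x)"
 by (simp add: C1_on_def)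

lemma C1_on_continuous: "C1_on G f Df ==> continuous_on G f"
 unfolding C1_on_def by (meson continuous_at_imp_continuous_on has_derivative_continuous)

lemma C1_on_subset: "C1_on G f Df ==> H \<subseteq> G ==> C1_on H f Df"
 unfolding C1_on_def by (meson continuous_on_subset subsetD)

lemma C1_on_add:
 "C1_on G f Df ==> C1_on G g Dg ==> C1_on G (%x. f x + g x) (%x. Df x + Dg x)"
 unfolding C1_on_def
 by (auto intro!: continuous_intros derivative_eq_intros simp: inner_add_left)

lemma C1_on_cmult: "C1_on G f Df ==> C1_on G (%x. c * f x) (%x. c *R Df x)"
 unfolding C1_on_def by (auto intro!: continuous_intros derivative_eq_intros)

lemma C1_on_mult:
 assumes "C1_on G f Df" "C1_on G g Dg"
 shows "C1_on G (%x. f x * g x) (%x. f x *R Dg x + g x *R Df x)"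
 using assms C1_on_continuous[OF assms(1)] C1_on_continuous[OF assms(2)]
 unfolding C1_on_def
 by (auto intro!: continuous_intros derivative_eq_intros simp: algebra_simps)

lemma C1_on_compose:
 assumes f: "C1_on G f Df"
 and F: "!!x. x \<in> G ==> (F has_real_derivative F' (f x)) (at (f x))"
 and F': "continuous_on (f ` G) F'"
 shows "C1_on G (%x. F (f x)) (%x. F' (f x) *R Df x)"
proof -
 have "((%x. F (f x)) has_derivative (%h. (F' (f x) *R Df x) <.> h)) (at x)" if x: "x \<in> G" for x
 using has_derivative_compose[OF C1_onD[OF f x] F[OF x, unfolded has_field_derivative_def]]
 by simp
 moreover have "continuous_on G (%x. F' (f x))"
 using continuous_on_compose[OF C1_on_continuous[OF f] F'] by (simp add: o_def)
 ultimately show ?thesis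
 using f unfolding C1_on_def by (auto intro!: continuous_intros simp del: inner_scaleR_left)
qed

lemma C1cD1: "C1c G ph Dph ==> C1_on UNIV ph Dph"
 by (simp add: C1c_def C1_on_def)

text \<open>\<open>C1c\<close> only asks that the function vanish off a compact set; the gradient
  vanishes there too because the complement of that set is open.\<close>

lemma C1c_support:
 assumes "C1c G ph Dph"
 obtains K where "compact K" "K \<subseteq> G" "!!x. x \<notin> K ==> ph x = 0" "!!x. x \<notin> K ==> Dph x = 0"
proof -
 obtain K where K: "compact K" "K \<subseteq> G" "!!x. x \<notin> K ==> ph x = 0"
 using assms unfolding C1c_def by blast
 have "Dph x = 0" if x: "x \<notin> K" for x
 proof -
 have 1: "(ph has_derivative (%h. Dph x <.> h)) (at x)"
 using assms by (simp add: C1c_def)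
 have "open (- K)" using K(1) by (simp add: compact_imp_closed open_Compl)
 then have "(ph has_derivative (%h. 0)) (at x)"
 using K(3) x by (intro has_derivative_transform_within_open[OF has_derivative_const[of 0], of "-K"]) auto
 then have "(%h. Dph x <.> h) = (%h. 0)"
 using 1 has_derivative_unique by blast
 then have "Dph x <.> Dph x = 0" by metis
 then show ?thesis by simp
 qed
 with K that show thesis by blast
qed

lemma C1c_mono: "C1c G ph Dph ==> G \<subseteq> H ==> C1c H ph Dph"
 unfolding C1c_def by blast

text \<open>Gluing with zero: \<open>G\<close> and the open complement of \<open>K\<close> cover the
  space, and on the latter the function is locally zero.\<close>

lemma C1cI:
 assumes "open G" "C1_on G f Df" "compact K" "K \<subseteq> G"
 "!!x. x \<notin> K ==> f x = 0" "!!x. x \<notin> K ==> Df x = 0"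
 shows "C1c G f Df"
proof -
 have o: "open (-K)" using assms(3) by (simp add: compact_imp_closed open_Compl)
 have "(f has_derivative (%h. Df x <.> h)) (at x)" for x
 proof (cases "x \<in> K")
 case True
 then show ?thesis using assms by (auto simp: C1_on_def)
 next
 case False
 have "(f has_derivative (%h. 0)) (at x)"
 using o assms(5) False by (intro has_derivative_transform_within_open[OF has_derivative_const[of 0], of "-K"]) auto
 then show ?thesis using assms(6)[OF False] by simp
 qed
 moreover have "continuous_on UNIV Df"
 proof -
 have "continuous_on (-K) Df"
 using assms(6) by (subst continuous_on_cong[OF refl, where g = "%_. 0"]) auto
 then have "continuous_on (G \<union> -K) Df"
 using assms(1,2) o by (intro continuous_on_open_Un) (auto simp: C1_on_def)
 then show ?thesis using assms(4) by (metis Compl_partition2 Un_commute UNIV_eq_I UnCI UnI1 subsetD ComplI)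
 qed
 ultimately show ?thesis using assms unfolding C1c_def by blast
qed

lemma C1c_mult:
 assumes "open G" "C1_on G f Df" "C1c G ph Dph"
 shows "C1c G (%x. f x * ph x) (%x. f x *R Dph x + ph x *R Df x)"
proof -
 obtain K where K: "compact K" "K \<subseteq> G" "!!x. x \<notin> K ==> ph x = 0" "!!x. x \<notin> K ==> Dph x = 0"
 using C1c_support[OF assms(3)] by metis
 show ?thesis
 using C1_on_mult[OF assms(2) C1_on_subset[OF C1cD1[OF assms(3)]]] K assms(1)
 by (intro C1cI[where K=K]) auto
qed

text \<open>All cut-offs below are powers of a positive part; exponent two already gives a C1
  function, which is what the notion of test function asks for.\<close>

lemma DERIV_max0_power:
 "((%s. max 0 s ^ Suc (Suc n)) has_real_derivative (of_nat (Suc (Suc n)) * max 0 s ^ Suc n)) (at s)"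
proof -
 consider "s > 0" | "s < 0" | "s = 0" by linarith
 then show ?thesis
 proof cases
 case 1
 have "((%s. s ^ Suc (Suc n)) has_real_derivative (of_nat (Suc (Suc n)) * s ^ Suc n)) (at s)"
 by (rule DERIV_cong[OF DERIV_power[OF DERIV_ident]]) auto
 then have "((%s. max 0 s ^ Suc (Suc n)) has_real_derivative (of_nat (Suc (Suc n)) * s ^ Suc n)) (at s)"
 by (rule has_field_derivative_transform_within_open[of _ _ _ "{0<..}"]) (use 1 in auto)
 then show ?thesis using 1 by simp
 next
 case 2
 have "((%s. max 0 s ^ Suc (Suc n)) has_real_derivative 0) (at s)"
 by (rule has_field_derivative_transform_within_open[of "%_. 0" _ _ "{..<0}"]) (use 2 in auto)
 then show ?thesis using 2 by simp
 next
 case 3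
 have "((%h. max 0 h ^ Suc n) \<longlongrightarrow> max 0 0 ^ Suc n) (at (0::real))"
 by (intro tendsto_intros)
 then have "((%h. max 0 h ^ Suc n) \<longlongrightarrow> 0) (at (0::real))" by simp
 then have "((%h. max 0 h ^ Suc (Suc n) / h) \<longlongrightarrow> 0) (at (0::real))"
 by (rule Lim_transform_eventually) (auto simp: eventually_at_filter max_def)
 then show ?thesis using 3 by (simp add: DERIV_def)
 qed
qed

lemma C1_on_norm_sq: "C1_on UNIV (%x. (norm (x - a))^2) (%x. 2 *R (x - a))"
 unfolding C1_on_def power2_norm_eq_inner
 by (auto intro!: continuous_intros derivative_eq_intros simp: inner_commute algebra_simps)

lemma C1_on_radial_bump:
 "C1_on UNIV (%y. max 0 (r^2 - (norm (y - a))^2) ^ Suc (Suc n))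
 (%y. (- 2 * of_nat (Suc (Suc n)) * max 0 (r^2 - (norm (y - a))^2) ^ Suc n) *R (y - a))"
proof -
 let ?f = "%y. r^2 - (norm (y - a))^2"
 have "C1_on UNIV ?f (%y. (- 2) *R (y - a))"
 using C1_on_add[OF _ C1_on_cmult[OF C1_on_norm_sq, where c="-1"], of "%_. r^2" "%_. 0" a]
 by (simp add: C1_on_def algebra_simps)
 have "C1_on UNIV (%y. max 0 (?f y) ^ Suc (Suc n))
 (%y. (of_nat (Suc (Suc n)) * max 0 (?f y) ^ Suc n) *R ((- 2) *R (y - a)))"
 by (rule C1_on_compose[OF \<open>C1_on UNIV ?f _\<close> DERIV_max0_power]) (intro continuous_intros)
 then show ?thesis
 by (simp add: algebra_simps)
qed

text \<open>Mean value inequality on a ball over which \<open>Dk\<close> varies by at most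
  \<open>e\<close>. The radius does not depend on \<open>z\<close>, so the estimate survives
  integration over \<open>z\<close>.\<close>

lemma C1_on_imp_uniform_linearization:
 assumes "C1_on UNIV k Dk" "uniformly_continuous_on UNIV Dk" "e > 0"
 shows "\<exists>d>0. \<forall>z h. norm h < d --> \<bar>k (z + h) - k z - Dk z <.> h\<bar> <= e * norm h"
proof -
 obtain d where d: "d > 0" "!!x x'. dist x' x < d ==> dist (Dk x') (Dk x) < e"
 using assms(2,3) unfolding uniformly_continuous_on_def by blast
 have "\<bar>k (z + h) - k z - Dk z <.> h\<bar> <= e * norm h" if h: "norm h < d" for z h
 proof -
 have "norm (k (z + h) - k z - (%x h. Dk x <.> h) z ((z + h) - z)) <= norm ((z + h) - z) * e"
 proof (rule differentiable_bound_linearization[where S="ball z d" and f'="%x h. Dk x <.> h"])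
 fix t :: real assume t: "t \<in> {0..1}"
 have "norm (t *R h) <= norm h" using t by (simp add: mult_left_le_one_le)
 then show "z + t *R (z + h - z) \<in> ball z d" using h by (simp add: dist_norm)
 next
 fix x assume "x \<in> ball z d"
 then have *: "norm (Dk x - Dk z) <= e" using d(2)[of x z] by (simp add: dist_norm norm_minus_commute less_imp_le)
 show "onorm ((%h. Dk x <.> h) - (%h. Dk z <.> h)) <= e"
 unfolding fun_diff_def
 proof (rule onorm_bound)
 show "0 <= e" using assms by simp
 fix v show "norm (Dk x <.> v - Dk z <.> v) <= e * norm v"
 using Cauchy_Schwarz_ineq2[of "Dk x - Dk z" v] * mult_right_mono[OF *, of "norm v"]
 by (simp add: inner_diff_left)
 qed
 show "(k has_derivative (%h. Dk x <.> h)) (at x within ball z d)"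
 using assms(1) has_derivative_at_withinI unfolding C1_on_def by blast
 qed (use d in auto)
 then show ?thesis by (simp add: mult.commute)
 qed
 with d(1) show ?thesis by blast
qed

text \<open>Compactness gives uniform continuity on a ball of radius \<open>R + 1\<close>; two
  points closer than 1 that are not both in that ball both lie where \<open>f\<close>
  vanishes.\<close>

lemma uniformly_continuous_on_compact_support:
 fixes f :: "'a::euclidean_space => 'b::real_normed_vector"
 assumes "continuous_on UNIV f" "compact K" "!!x. x \<notin> K ==> f x = 0"
 shows "uniformly_continuous_on UNIV f"
proof -
 obtain R where R: "K \<subseteq> cball 0 R" "R > 0"
 using compact_imp_bounded[OF assms(2)] bounded_pos[of K] by (metis mem_cball_0 subsetI)
 have u: "uniformly_continuous_on (cball 0 (R+1)) f"
 using assms(1) by (intro compact_uniformly_continuous) (auto intro: continuous_on_subset)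
 show ?thesis
 unfolding uniformly_continuous_on_def
 proof (intro allI impI)
 fix e :: real assume "e > 0"
 then obtain d where d: "d > 0" "!!x x'. x \<in> cball 0 (R+1) ==> x' \<in> cball 0 (R+1) ==> dist x' x < d ==> dist (f x') (f x) < e"
 using u unfolding uniformly_continuous_on_def by metis
 have "dist (f x') (f x) < e" if dd: "dist x' x < min d 1" for x x'
 proof (cases "x \<in> cball 0 (R+1) & x' \<in> cball 0 (R+1)")
 case True then show ?thesis using d dd by auto
 next
 case False
 have "\<bar>norm x - norm x'\<bar> < 1" using dd norm_triangle_ineq3[of x x'] by (simp add: dist_norm norm_minus_commute)
 with False have "x \<notin> cball 0 R & x' \<notin> cball 0 R" by auto
 then have "f x = 0" "f x' = 0" using assms(3) R by blast+
 then show ?thesis using \<open>e > 0\<close> by simp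
 qed
 then show "\<exists>d>0. \<forall>x\<in>UNIV. \<forall>x'\<in>UNIV. dist x' x < d --> dist (f x') (f x) < e"
 using d(1) by (intro exI[of _ "min d 1"]) auto
 qed
qed

lemma C1c_uniform_linearization:
 assumes "C1c G k Dk" "e > 0"
 shows "\<exists>d>0. \<forall>z h. norm h < d --> \<bar>k (z + h) - k z - Dk z <.> h\<bar> <= e * norm h"
proof -
 obtain K where K: "compact K" "!!x. x \<notin> K ==> Dk x = 0"
 using C1c_support[OF assms(1)] by metis
 show ?thesis
 using uniformly_continuous_on_compact_support[OF _ K] assms
 by (intro C1_on_imp_uniform_linearization) (auto simp: C1_on_def C1c_def)
qed

lemma bounded_compact_support:
 fixes f :: "'a::euclidean_space => 'b::real_normed_vector"
 assumes "continuous_on UNIV f" "compact K" "!!x. x \<notin> K ==> f x = 0"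
 obtains B where "B > 0" "!!x. norm (f x) <= B * ind K x"
proof -
 have "bounded (f ` K)"
 using assms by (intro compact_imp_bounded compact_continuous_image) (auto intro: continuous_on_subset)
 then obtain B where B: "B > 0" "!!x. x \<in> K ==> norm (f x) <= B"
 unfolding bounded_pos by blast
 show thesis
 by (rule that[OF B(1)]) (use B assms(3) in \<open>auto simp: indicator_def\<close>)
qed

lemma integrable_compact_support_mult:
 fixes f :: "'a::euclidean_space => 'b::{real_normed_vector,banach,second_countable_topology}"
 assumes f: "continuous_on UNIV f" "compact K" "!!x. x \<notin> K ==> f x = 0"
 and u: "set_integrable lborel K u" "u \<in> bmb"
 shows "intl (%x. (u x :: real) *R f x)"
proof -
 obtain B where B: "B > 0" "!!x. norm (f x) <= B * ind K x"
 using bounded_compact_support[OF f] by blast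
 have [measurable]: "f \<in> bmb" using f(1) by (rule borel_measurable_continuous_onI)
 note u(2)[measurable]
 have "intl (%x. B * (ind K x *R \<bar>u x\<bar>))"
 using set_integrable_abs[OF u(1)] unfolding set_integrable_def by (intro integrable_mult_right) 
 then show ?thesis
 proof (rule B_integrable_bound)
 show "AE x in lborel. norm (u x *R f x) <= norm (B * (ind K x *R \<bar>u x\<bar>))"
 using B mult_left_mono[OF B(2), of "\<bar>u _\<bar>"] by (auto simp: mult.commute mult.assoc mult.left_commute)
 qed measurable
qed

lemma integrable_compact_support:
 fixes f :: "'a::euclidean_space => 'b::{real_normed_vector,banach,second_countable_topology}"
 assumes f: "continuous_on UNIV f" "compact K" "!!x. x \<notin> K ==> f x = 0"
 shows "intl f"
proof -
 have "set_integrable lborel K (%x. 1::real)"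
 unfolding set_integrable_def using emeasure_compact_finite[OF f(2)] borel_compact[OF f(2)] by simp
 from integrable_compact_support_mult[OF f this] show ?thesis by simp
qed

section \<open>Differentiation under the integral sign\<close>

text \<open>Dominated convergence for the difference quotients, which the mean value inequality
  bounds by \<open>w\<close>.\<close>

lemma DERIV_integral:
 fixes f :: "real => 'a => real"
 assumes e: "e > 0"
 and int: "!!t. \<bar>t - t0\<bar> < e ==> integrable M (f t)"
 and d: "!!t x. \<bar>t - t0\<bar> < e ==> x \<in> space M ==> ((%t. f t x) has_real_derivative f' t x) (at t)"
 and b: "!!t x. \<bar>t - t0\<bar> < e ==> x \<in> space M ==> \<bar>f' t x\<bar> <= w x" and w: "integrable M w"
 and m: "f' t0 \<in> borel_measurable M"
 shows "((%t. \<integral>x. f t x \<partial>M) has_real_derivative (\<integral>x. f' t0 x \<partial>M)) (at t0)"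
 unfolding DERIV_def tendsto_at_iff_sequentially
proof (intro allI impI)
 fix X :: "nat => real" assume X0: "\<forall>i. X i \<in> UNIV - {0}" and X: "X >-> 0"
 have ev: "eventually (%i. \<bar>X i\<bar> < e) sequentially"
 using tendstoD[OF X e] by (simp add: dist_norm)
 \<comment> \<open>Discarding the first \<open>n0\<close> terms keeps all increments inside the
   interval where the hypotheses hold and does not change the limit.\<close>
 then obtain n0 where n0: "!!i. i >= n0 ==> \<bar>X i\<bar> < e" by (auto simp: eventually_sequentially)
 let ?Y = "%i. X (i + n0)"
 let ?q = "%i x. (f (t0 + ?Y i) x - f t0 x) / ?Y i"
 have Y: "\<bar>?Y i\<bar> < e" "?Y i ~= 0" for i using n0 X0 by auto
 have iY: "integrable M (f (t0 + ?Y i))" "integrable M (f t0)" for i using int Y e by auto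
 have "(%i. \<integral>x. ?q i x \<partial>M) >-> (\<integral>x. f' t0 x \<partial>M)"
 proof (rule integral_dominated_convergence[where w=w])
 show "AE x in M. (%i. ?q i x) >-> f' t0 x"
 proof (rule AE_I2)
 fix x assume "x \<in> space M"
 then have "((%h. (f (t0 + h) x - f t0 x) / h) \<longlongrightarrow> f' t0 x) (at 0)"
 using d[of t0 x] e unfolding DERIV_def by simp
 moreover have "filterlim ?Y (at 0) sequentially"
 using LIMSEQ_ignore_initial_segment[OF X, of n0] Y by (auto simp: filterlim_at)
 ultimately show "(%i. ?q i x) >-> f' t0 x" by (rule filterlim_compose)
 qed
 show "AE x in M. norm (?q i x) <= w x" for i
 proof (rule AE_I2)
 fix x assume x: "x \<in> space M"
 have "\<bar>f (t0 + ?Y i) x - f t0 x\<bar> <= w x * \<bar>?Y i\<bar>"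
 using field_differentiable_bound[of "{t. \<bar>t - t0\<bar> < e}" "%t. f t x" "%t. f' t x" "w x" "t0 + ?Y i" t0]
 proof -
 have "convex {t. \<bar>t - t0\<bar> < e}"
 using convex_ball[of t0 e] by (simp add: ball_def dist_norm abs_minus_commute)
 then show ?thesis
 using field_differentiable_bound[of "{t. \<bar>t - t0\<bar> < e}" "%t. f t x" "%t. f' t x" "w x" "t0 + ?Y i" t0]
 d[OF _ x] b[OF _ x] Y(1)[of i] e by (simp add: has_field_derivative_at_within abs_minus_commute)
 qed
 then show "norm (?q i x) <= w x" using Y[of i] by (simp add: divide_le_eq abs_divide)
 qed
 qed (use iY w m in auto)
 then have "(%i. ((\<integral>x. f (t0 + ?Y i) x \<partial>M) - (\<integral>x. f t0 x \<partial>M)) / ?Y i) >-> (\<integral>x. f' t0 x \<partial>M)"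
 using iY by simp
 then show "((%h. ((\<integral>x. f (t0 + h) x \<partial>M) - (\<integral>x. f t0 x \<partial>M)) / h) \<circ> X) >-> (\<integral>x. f' t0 x \<partial>M)"
 unfolding o_def by (rule LIMSEQ_offset)
qed

section \<open>Translations and dilations of integrals\<close>

lemma integral_lborel_affine:
 fixes f :: "'a::euclidean_space => 'b::{banach, second_countable_topology}"
 assumes c: "c ~= 0" and f: "f \<in> bmb"
 shows "(LBINT x. f x) = \<bar>c\<bar> ^ DIM('a) *R (LBINT x. f (t + c *R x))"
 using f by (subst lborel_affine[OF c, of t]) (simp add: integral_density integral_distr)

lemma nn_integral_lborel_affine:
 fixes f :: "'a::euclidean_space => ennreal"
 assumes c: "c ~= 0" and f: "f \<in> bmb"
 shows "(\<integral>\<^sup>+x. f x \<partial>lborel) = ennreal (\<bar>c\<bar> ^ DIM('a)) * (\<integral>\<^sup>+x. f (t + c *R x) \<partial>lborel)"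
 using f by (subst lborel_affine[OF c, of t]) (simp add: nn_integral_density nn_integral_distr nn_integral_cmult)

lemma integrable_lborel_affine:
 fixes f :: "'a::euclidean_space => 'b::{banach, second_countable_topology}"
 assumes c: "c ~= 0" and f: "intl f"
 shows "intl (%x. f (t + c *R x))"
proof -
 have [measurable]: "f \<in> bmb" using f by auto
 have "(\<integral>\<^sup>+x. ennreal (norm (f x)) \<partial>lborel) < \<infinity>" using f by (simp add: integrable_iff_bounded)
 then show ?thesis
 unfolding integrable_iff_bounded using c
 by (subst (asm) nn_integral_lborel_affine[OF c, where t=t]) (auto simp: ennreal_mult_less_top)
qed

lemma integrable_lborel_translate:
 fixes f :: "'a::euclidean_space => 'b::{banach, second_countable_topology}"
 shows "intl f ==> intl (%x. f (x + a))"
 using integrable_lborel_affine[of 1 f a] by (simp add: add.commute)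

lemma integral_lborel_translate:
 fixes f :: "'a::euclidean_space => 'b::{banach, second_countable_topology}"
 assumes "f \<in> bmb"
 shows "(LBINT x. f (x + a)) = (LBINT x. f x)"
 using integral_lborel_affine[OF _ assms, of 1 a] by (simp add: add.commute)

lemma integral_lborel_reflect:
 fixes f :: "'a::euclidean_space => 'b::{banach, second_countable_topology}"
 assumes "f \<in> bmb"
 shows "(LBINT x. f (a - x)) = (LBINT x. f x)"
 using integral_lborel_affine[OF _ assms, of "-1" a] by simp

lemma integrable_lborel_reflect:
 fixes f :: "'a::euclidean_space => 'b::{banach, second_countable_topology}"
 shows "intl f ==> intl (%x. f (a - x))"
 using integrable_lborel_affine[of "-1" f a] by simp

text \<open>The integral of \<open>ph (x + t *R v)\<close> does not depend on \<open>t\<close>;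
  differentiating it under the integral sign at \<open>t = 0\<close> gives the component along
  \<open>v\<close>.\<close>

lemma C1c_integral_grad_eq_0:
 assumes "C1c G ph Dph"
 shows "(LBINT x. Dph x) = 0"
proof -
 obtain K where K: "compact K" "!!x. x \<notin> K ==> ph x = 0" "!!x. x \<notin> K ==> Dph x = 0"
 using C1c_support[OF assms] by metis
 have cont: "continuous_on UNIV ph" "continuous_on UNIV Dph"
 using C1_on_continuous[OF C1cD1[OF assms]] assms by (auto simp: C1c_def)
 have int: "intl ph" "intl Dph"
 using integrable_compact_support[OF cont(1) K(1,2)] integrable_compact_support[OF cont(2) K(1,3)] by auto
 obtain B where B: "B > 0" "!!x. norm (Dph x) <= B * ind K x"
 using bounded_compact_support[OF cont(2) K(1,3)] by blast
 have "(LBINT x. Dph x <.> v) = 0" if v: "norm v = 1" for v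
 proof -
 \<comment> \<open>The unit neighbourhood of \<open>K\<close> contains the supports of all
   translates with \<open>\<bar>t\<bar> < 1\<close>, so one integrable majorant serves them
   all.\<close>
 define K' where "K' = {x + y | x y. x \<in> K & y \<in> cball 0 1}"
 have K': "compact K'" unfolding K'_def by (intro compact_sums K(1)) auto
 have "((%t. \<integral>x. ph (x + t *R v) \<partial>lborel) has_real_derivative (LBINT x. Dph (x + 0 *R v) <.> v)) (at 0)"
 proof (rule DERIV_integral[where e=1 and w="%x. B * ind K' x" and f'="%t x. Dph (x + t *R v) <.> v"])
 show "intl (%x. ph (x + t *R v))" for t
 by (rule integrable_lborel_translate[OF int(1)])
 show "((%t. ph (x + t *R v)) has_real_derivative Dph (x + t *R v) <.> v) (at t)" for t x
 proof -
 have "((%t. ph (x + t *R v)) has_derivative (%s. Dph (x + t *R v) <.> (s *R v))) (at t)"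
 by (rule has_derivative_compose[where g=ph and f="%t. x + t *R v" and f'="%s. s *R v"])
 (use assms in \<open>auto simp: C1c_def intro!: derivative_eq_intros\<close>)
 then show ?thesis unfolding has_field_derivative_def by (simp add: mult.commute[of _ "Dph (x + t *R v) <.> v"])
 qed
 show "\<bar>Dph (x + t *R v) <.> v\<bar> <= B * ind K' x" if "\<bar>t - 0\<bar> < 1" for t x
 proof -
 have "\<bar>Dph (x + t *R v) <.> v\<bar> <= norm (Dph (x + t *R v))"
 using Cauchy_Schwarz_ineq2[of "Dph (x + t *R v)" v] v by simp
 also have "... <= B * ind K (x + t *R v)" by (rule B)
 also have "... <= B * ind K' x"
 proof -
 have "x \<in> K'" if "x + t *R v \<in> K"
 unfolding K'_def using that \<open>\<bar>t - 0\<bar> < 1\<close> v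
 by (intro CollectI exI[of _ "x + t *R v"] exI[of _ "- t *R v"]) auto
 then show ?thesis using B(1) by (auto simp: indicator_def)
 qed
 finally show ?thesis .
 qed
 show "intl (%x. B * ind K' x)"
 using emeasure_compact_finite[OF K'] borel_compact[OF K'] by simp
 show "(%x. Dph (x + 0 *R v) <.> v) \<in> borel_measurable lborel"
 using cont(2) by (auto intro!: borel_measurable_continuous_onI continuous_intros)
 qed auto
 moreover have "(%t. \<integral>x. ph (x + t *R v) \<partial>lborel) = (%t. \<integral>x. ph x \<partial>lborel)"
 using int(1) by (intro ext integral_lborel_translate) auto
 ultimately have "((%t. \<integral>x. ph x \<partial>lborel) has_real_derivative (LBINT x. Dph x <.> v)) (at (0::real))" by simp
 then show ?thesis using DERIV_unique DERIV_const by blast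
 qed
 then have 1: "(LBINT x. Dph x) <.> v = 0" if "norm v = 1" for v
 using that int(2) by simp
 have "(LBINT x. Dph x) <.> b = 0" if "b \<in> Basis" for b
 by (rule 1) (rule norm_Basis[OF that])
 then show ?thesis using euclidean_all_zero_iff by blast
qed

section \<open>Mollification\<close>

lemma norm_integral_le:
 fixes f :: "'a => 'b::{banach, second_countable_topology}"
 assumes "integrable M f" "integrable M g" "AE x in M. norm (f x) <= g x"
 shows "norm (\<integral>x. f x \<partial>M) <= (\<integral>x. g x \<partial>M)"
 by (rule order.trans[OF integral_norm_bound integral_mono_AE]) (use assms in auto)

text \<open>Induction over integrable functions. For an indicator the set is enlarged to an open
  \<open>U\<close> of nearly the same measure, since a point of an open set stays in it under every
  small shift.\<close>

lemma L1_translation_continuous: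
 fixes f :: "'a::euclidean_space => 'b::{banach, second_countable_topology}"
 assumes "intl f" "e > 0"
 shows "\<exists>d>0. \<forall>h. norm h < d --> (LBINT x. norm (f (x + h) - f x)) < e"
 using assms
proof (induction f arbitrary: e rule: integrable_induct)
 case (base A c)
 have A: "A \<in> sets borel" "emeasure lborel A < \<infinity>" using base by auto
 \<comment> \<open>Four terms of size at most \<open>norm c * e'\<close> occur at the end; the
   \<open>+ 1\<close> avoids division by zero.\<close>
 define e' where "e' = e / (4 * (norm c + 1))"
 have e': "e' > 0" unfolding e'_def
 using base(3) by (intro divide_pos_pos mult_pos_pos add_nonneg_pos) auto
 obtain U where U: "open U" "A \<subseteq> U" "emeasure lborel (U - A) < e'"
 using outer_regular_lborel[OF A(1), of e'] e' by auto
 have UA: "U - A \<in> sets borel" "U \<in> sets borel" using U A by auto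
 have fU: "emeasure lborel U < \<infinity>"
 proof -
 have "emeasure lborel U <= emeasure lborel A + emeasure lborel (U - A)"
 using emeasure_subadditive[of A lborel "U - A"] UA A U(2) by (simp add: Un_absorb1)
 also have "... < \<infinity>" using A(2) order.strict_trans[OF U(3) ennreal_less_top] by simp
 finally show ?thesis .
 qed
 have mUA: "measure lborel (U - A) < e'"
 using U(3) order.strict_trans[OF U(3) ennreal_less_top]
 by (subst (asm) emeasure_eq_ennreal_measure) (auto simp: ennreal_less_iff)
 \<comment> \<open>Measure of the part of \<open>U\<close> that leaves \<open>U\<close> under the
   shift by \<open>h\<close>; it tends to 0 because \<open>U\<close> is open.\<close>
 define P where "P h = (\<integral>x. ind U x * (1 - ind U (x + h)) \<partial>lborel :: real)" for h
 have [measurable]: "U \<in> sets borel" "A \<in> sets borel" using UA A by auto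
 have intU: "intl (%x. ind U x * (1 - ind U (x + h)) :: real)" for h
 by (rule B_integrable_bound[where f="ind U :: _ => real"])
 (use fU UA in \<open>auto simp: indicator_def\<close>)
 have "(P \<longlongrightarrow> 0) (at 0)"
 unfolding tendsto_at_iff_sequentially o_def
 proof (intro allI impI)
 fix X :: "nat => 'a" assume X: "X >-> 0"
 have "(%n. P (X n)) >-> (\<integral>x. (0::real) \<partial>(lborel :: 'a measure))"
 unfolding P_def
 proof (rule integral_dominated_convergence[where w="ind U"])
 show "intl (ind U :: _ => real)" using fU UA by auto
 show "AE x in lborel. (%n. ind U x * (1 - ind U (x + X n)) :: real) >-> 0"
 proof (rule AE_I2)
 fix x
 show "(%n. ind U x * (1 - ind U (x + X n)) :: real) >-> 0"
 proof (cases "x \<in> U")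
 case True
 have "(%n. x + X n) >-> x + 0" by (intro tendsto_intros X)
 then have "eventually (%n. x + X n \<in> U) sequentially"
 using topological_tendstoD[OF _ U(1)] True by simp
 then have "eventually (%n. ind U x * (1 - ind U (x + X n)) = (0::real)) sequentially"
 by eventually_elim simp
 then show ?thesis by (rule tendsto_eventually)
 qed simp
 qed
 qed (auto simp: indicator_def)
 then show "(%n. P (X n)) >-> 0" by simp
 qed
 moreover have "P 0 = 0"
 proof -
 have "(%x. ind U x * (1 - ind U (x + 0)) :: real) = (%_. 0)" by (auto simp: indicator_def)
 then show ?thesis unfolding P_def by (simp only: integral_zero)
 qed
 ultimately obtain d where d: "d > 0" "!!h. norm h < d ==> \<bar>P h\<bar> < e'"
 proof -
 assume P: "(P \<longlongrightarrow> 0) (at 0)" "P 0 = 0"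
 and *: "!!d. d > 0 ==> (!!h. norm h < d ==> \<bar>P h\<bar> < e') ==> thesis"
 obtain d where d: "d > 0" "!!h. h ~= 0 ==> dist h 0 < d ==> dist (P h) 0 < e'"
 using P(1) e' unfolding LIM_def by blast
 show thesis
 proof (rule *[OF d(1)])
 fix h :: 'a assume "norm h < d"
 then show "\<bar>P h\<bar> < e'" using d(2)[of h] P(2) e' by (cases "h = 0") (auto simp: dist_norm)
 qed
 qed
 have "(LBINT x. norm (ind A (x + h) *R c - ind A x *R c)) < e" if h: "norm h < d" for h
 proof -
 let ?B = "U - A"
 have iB: "intl (ind ?B :: _ => real)"
 using order.strict_trans[OF U(3) ennreal_less_top] UA by (intro integrable_real_indicator) auto
 have eqB: "(\<integral>x. ind ?B (x + h) \<partial>lborel :: real) = (LBINT x. ind ?B x)"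
 using iB by (intro integral_lborel_translate) auto
 have iB': "intl (%x. ind ?B (x + h) :: real)" by (rule integrable_lborel_translate[OF iB])
 have sw: "(\<integral>x. ind U (x + h) * (1 - ind U x) \<partial>lborel :: real) = P (- h)"
 unfolding P_def
 using integral_lborel_translate[of "%x. ind U x * (1 - ind U (x + - h)) :: real" h] by simp
 have isw: "intl (%x. ind U (x + h) * (1 - ind U x) :: real)"
 using integrable_lborel_translate[OF intU[of "-h"], of h] by simp
 have "(LBINT x. norm (ind A (x + h) *R c - ind A x *R c))
 <= (\<integral>x. norm c * (ind U x * (1 - ind U (x + h)) + ind U (x + h) * (1 - ind U x)
 + ind ?B (x + h) + ind ?B x) \<partial>lborel)"
 proof (rule integral_mono)
 have iA: "intl (%x. ind A x *R c)" using A by auto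
 show "intl (%x. norm (ind A (x + h) *R c - ind A x *R c))"
 using integrable_lborel_translate[OF iA, of h] iA by auto
 show "intl (%x. norm c * (ind U x * (1 - ind U (x + h)) + ind U (x + h) * (1 - ind U x)
 + ind ?B (x + h) + ind ?B x))"
 using intU[of h] isw iB iB' by (intro integrable_mult_right B_integrable_add)
 fix x
 show "norm (ind A (x + h) *R c - ind A x *R c) <= norm c * (ind U x * (1 - ind U (x + h)) + ind U (x + h) * (1 - ind U x)
 + ind ?B (x + h) + ind ?B x)"
 using U(2) by (auto simp: indicator_def algebra_simps)
 qed
 also have "... = norm c * (P h + P (-h) + 2 * measure lborel ?B)"
 using intU[of h] isw iB iB' sw eqB UA unfolding P_def by (simp add: P_def[symmetric])
 also have "... <= norm c * (4 * e')"
 using d(2)[of h] d(2)[of "-h"] h mUA by (intro mult_left_mono) auto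
 also have "... < e"
 proof -
 have "norm c * (4 * e') = e * (norm c / (norm c + 1))"
 proof -
 have "norm c + 1 ~= 0" using norm_ge_zero[of c] by linarith
 then show ?thesis unfolding e'_def by (simp add: field_simps)
 qed
 also have "... < e * 1" using base(3) by (intro mult_strict_left_mono) (auto simp: divide_less_eq add_nonneg_pos)
 finally show ?thesis by simp
 qed
 finally show ?thesis .
 qed
 then show ?case using d(1) by blast
next
 case (add f g)
 obtain d1 where d1: "d1 > 0" "!!h. norm h < d1 ==> (LBINT x. norm (f (x + h) - f x)) < e / 2"
 using add.IH(1)[of "e/2"] add.prems by auto
 obtain d2 where d2: "d2 > 0" "!!h. norm h < d2 ==> (LBINT x. norm (g (x + h) - g x)) < e / 2"
 using add.IH(2)[of "e/2"] add.prems by auto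
 have "(LBINT x. norm (f (x + h) + g (x + h) - (f x + g x))) < e" if h: "norm h < min d1 d2" for h
 proof -
 note i = add.hyps integrable_lborel_translate[OF add.hyps(1), of h] integrable_lborel_translate[OF add.hyps(2), of h]
 have "(LBINT x. norm (f (x + h) + g (x + h) - (f x + g x)))
 <= (LBINT x. norm (f (x + h) - f x) + norm (g (x + h) - g x))"
 using i by (intro integral_mono) (auto simp: add_diff_add norm_triangle_ineq)
 also have "... < e" using i d1(2)[of h] d2(2)[of h] h by simp
 finally show ?thesis .
 qed
 then show ?case using d1(1) d2(1) by (intro exI[of _ "min d1 d2"]) auto
next
 case (lim f s)
 have "(%n. \<integral>x. norm (s n x - f x) \<partial>lborel) >-> (\<integral>x. 0 \<partial>(lborel :: 'a measure))"
 proof (rule integral_dominated_convergence[where w="%x. 3 * norm (f x)"])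
 show "AE x in lborel. (%n. norm (s n x - f x)) >-> 0"
 using lim.hyps by (intro AE_I2 tendsto_norm_zero LIM_zero) auto
 show "AE x in lborel. norm (norm (s n x - f x)) <= 3 * norm (f x)" for n
 proof (rule AE_I2)
 fix x :: 'a
 have "norm (s n x) <= 2 * norm (f x)" using lim.hyps by simp
 then show "norm (norm (s n x - f x)) <= 3 * norm (f x)"
 using norm_triangle_ineq4[of "s n x" "f x"] by simp
 qed
 qed (use lim in auto)
 then obtain n where n: "(LBINT x. norm (s n x - f x)) < e / 3"
 proof -
 assume *: "(%n. \<integral>x. norm (s n x - f x) \<partial>lborel) >-> (\<integral>x. 0 \<partial>(lborel :: 'a measure))"
 and **: "!!n. (LBINT x. norm (s n x - f x)) < e / 3 ==> thesis"
 have "eventually (%n. (LBINT x. norm (s n x - f x)) < e / 3) sequentially"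
 using order_tendstoD(2)[OF *, of "e/3"] lim.prems by simp
 then show thesis using ** by (auto simp: eventually_sequentially)
 qed
 obtain d where d: "d > 0" "!!h. norm h < d ==> (LBINT x. norm (s n (x + h) - s n x)) < e / 3"
 using lim.IH[of "e/3" n] lim.prems by auto
 have "(LBINT x. norm (f (x + h) - f x)) < e" if h: "norm h < d" for h
 proof -
 note i = lim.hyps(1,4) integrable_lborel_translate[OF lim.hyps(1), of n h] integrable_lborel_translate[OF lim.hyps(4), of h]
 have eq: "(LBINT x. norm (s n (x + h) - f (x + h))) = (LBINT x. norm (s n x - f x))"
 using i by (intro integral_lborel_translate) auto
 have "(LBINT x. norm (f (x + h) - f x))
 <= (LBINT x. norm (s n (x + h) - f (x + h)) + (norm (s n (x + h) - s n x) + norm (s n x - f x)))"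
 proof (rule integral_mono)
 fix x
 show "norm (f (x + h) - f x) <= norm (s n (x + h) - f (x + h)) + (norm (s n (x + h) - s n x) + norm (s n x - f x))"
 using norm_triangle_ineq[of "f (x + h) - s n (x + h)" "s n (x + h) - f x"]
 norm_triangle_ineq[of "s n (x + h) - s n x" "s n x - f x"]
 by (simp add: norm_minus_commute)
 qed (use i in auto)
 also have "... < e" using i d(2)[OF h] n eq by simp
 finally show ?thesis .
 qed
 then show ?case using d(1) by blast
qed

definition bump_mass :: "'a::euclidean_space itself => real" where
 "bump_mass _ = (LBINT z. max 0 (1 - (norm (z::'a))^2) ^ 3)"

text \<open>Dilation contributes \<open>r ^ DIM('a)\<close> and the cube of a quadratic expression
  \<open>r ^ 6\<close>; so normalised, mollifiers of different radii are dilates of one another with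
  integral 1.\<close>

definition mollifier :: "real => 'a::euclidean_space => real" where
 "mollifier r y = max 0 (r^2 - (norm y)^2) ^ 3 / (bump_mass TYPE('a) * r ^ (DIM('a) + 6))"

definition mollifier_grad :: "real => 'a::euclidean_space => 'a" where
 "mollifier_grad r y = (- 6 * max 0 (r^2 - (norm y)^2) ^ 2 / (bump_mass TYPE('a) * r ^ (DIM('a) + 6))) *R y"

definition mollify :: "real => ('a::euclidean_space => 'b::{banach,second_countable_topology}) => 'a => 'b" where
 "mollify r U x = (LBINT y. mollifier r (x - y) *R U y)"

lemma max0_sq_diff_eq_0: "r > 0 ==> norm (y::'a::real_normed_vector) >= r ==> max 0 (r^2 - (norm y)^2) = (0::real)"
 using power_mono[of r "norm y" 2] by auto

lemma integrable_bump:
 "r > 0 ==> intl (%z::'a::euclidean_space. max 0 (r^2 - (norm z)^2) ^ 3)"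
 by (rule integrable_compact_support[of _ "cball 0 r"])
 (auto intro!: continuous_intros simp: max0_sq_diff_eq_0[of r, simplified])

lemma bump_mass_pos: "bump_mass TYPE('a::euclidean_space) > 0"
proof -
 let ?f = "%z::'a. max 0 (1 - (norm z)^2) ^ 3"
 have i: "intl ?f" using integrable_bump[of 1, where 'a='a] by simp
 have "(LBINT z. ?f z) ~= 0"
 proof
 assume "(LBINT z. ?f z) = 0"
 then have "AE z in lborel. ?f z = 0"
 using integral_nonneg_eq_0_iff_AE[OF i] by simp
 then have "AE z in lebesgue. z \<notin> ball (0::'a) 1"
 unfolding AE_completion_iff
 proof eventually_elim
 case (elim z)
 then have "max 0 (1 - (norm z)^2) = 0" by simp
 then have "1 <= (norm z)^2" by (simp add: max_def split: if_splits)
 then show ?case using abs_square_less_1[of "norm z"] by auto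
 qed
 then have "negligible (ball (0::'a) 1)"
 unfolding negligible_iff_null_sets by (subst AE_iff_null_sets) auto
 then show False using open_not_negligible[of "ball (0::'a) 1"] by simp
 qed
 moreover have "(LBINT z. ?f z) >= 0" by (intro integral_nonneg_AE) auto
 ultimately show ?thesis unfolding bump_mass_def by linarith
qed

lemma mollifier_nonneg: "r > 0 ==> mollifier r y >= 0"
 unfolding mollifier_def using bump_mass_pos[where 'a='a] by (intro divide_nonneg_pos) auto

lemma abs_mollifier: "r > 0 ==> \<bar>mollifier r y\<bar> = mollifier r y"
 by (simp add: mollifier_nonneg)

lemma mollifier_eq_0: "r > 0 ==> norm y >= r ==> mollifier r y = 0"
 unfolding mollifier_def by (simp only: max0_sq_diff_eq_0) simp

lemma mollifier_grad_eq_0: "r > 0 ==> norm y >= r ==> mollifier_grad r y = 0"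
 unfolding mollifier_grad_def by (simp only: max0_sq_diff_eq_0) simp

lemma mollifier_minus: "mollifier r (x - y) = mollifier r (y - x)"
 unfolding mollifier_def by (simp add: norm_minus_commute)

lemma continuous_mollifier [continuous_intros]:
 "continuous_on UNIV (mollifier r)" "continuous_on UNIV (mollifier_grad r)"
 unfolding mollifier_def[abs_def] mollifier_grad_def[abs_def] divide_inverse
 by (intro continuous_intros)+

lemma measurable_mollifier [measurable]:
 "mollifier r \<in> bmb" "mollifier_grad r \<in> bmb"
 by (intro borel_measurable_continuous_onI continuous_mollifier)+

lemma integrable_mollifier: "r > 0 ==> intl (mollifier r :: 'a::euclidean_space => real)"
 by (rule integrable_compact_support[of _ "cball 0 r"])
 (auto intro!: continuous_mollifier mollifier_eq_0)

lemma integral_mollifier: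
 assumes r: "r > 0" shows "(LBINT y. mollifier r (y::'a::euclidean_space)) = 1"
proof -
 have "(LBINT y. max 0 (r^2 - (norm (y::'a))^2) ^ 3) = r ^ DIM('a) * (LBINT y. max 0 (r^2 - (norm (r *R y::'a))^2) ^ 3)"
 using r by (subst integral_lborel_affine[of r _ 0]) auto
 also have "(%y::'a. max 0 (r^2 - (norm (r *R y::'a))^2) ^ 3) = (%y. r ^ 6 * max 0 (1 - (norm y)^2) ^ 3)"
 proof
 fix y :: 'a
 have "max 0 (r^2 - (norm (r *R y::'a))^2) = r^2 * max 0 (1 - (norm y)^2)"
 using r by (simp add: max_mult_distrib_left power_mult_distrib algebra_simps)
 then show "max 0 (r^2 - (norm (r *R y::'a))^2) ^ 3 = r ^ 6 * max 0 (1 - (norm y)^2) ^ 3"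
 by (simp add: power_mult_distrib flip: power_mult)
 qed
 finally have "(LBINT y. max 0 (r^2 - (norm (y::'a))^2) ^ 3) = r ^ (DIM('a) + 6) * bump_mass TYPE('a)"
 by (simp add: bump_mass_def power_add)
 then show ?thesis
 unfolding mollifier_def using r bump_mass_pos[where 'a='a] by simp
qed

lemma C1_on_mollifier: "C1_on UNIV (mollifier r) (mollifier_grad r :: real^'n => _)"
 using C1_on_cmult[OF C1_on_radial_bump[of r 0 1], of "1 / (bump_mass TYPE(real^'n) * r ^ (DIM(real^'n) + 6))"]
 by (simp add: mollifier_def[abs_def] mollifier_grad_def[abs_def] numeral_3_eq_3 numeral_2_eq_2)

lemma C1c_mollifier: "r > 0 ==> C1c UNIV (mollifier r) (mollifier_grad r :: real^'n => _)"
 by (rule C1cI[of _ _ _ "cball 0 r"]) (auto intro!: C1_on_mollifier mollifier_eq_0 mollifier_grad_eq_0)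

lemma C1c_mollifier_reflect:
 fixes x :: "real^'n"
 assumes "r > 0" "cball x r \<subseteq> G"
 shows "C1c G (%y. mollifier r (x - y)) (%y. - mollifier_grad r (x - y))"
proof -
 have "((%y. mollifier r (x - y)) has_derivative (%h. (- mollifier_grad r (x - y)) <.> h)) (at y)" for y
 proof -
 have 1: "((%y. x - y) has_derivative (%h. - h)) (at y)"
 by (auto intro!: derivative_eq_intros)
 show ?thesis
 using has_derivative_compose[OF 1 C1_onD[OF C1_on_mollifier, of "x - y" r]] by simp
 qed
 moreover have "continuous_on UNIV (%y. - mollifier_grad r (x - y))"
 by (intro continuous_intros continuous_on_compose2[OF continuous_mollifier(2)]) auto
 moreover have "mollifier r (x - y) = 0" if "y \<notin> cball x r" for y
 using that assms by (intro mollifier_eq_0) (auto simp: dist_norm)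
 ultimately show ?thesis
 using assms(2) unfolding C1c_def by (blast intro: compact_cball)
qed

lemma mollifier_bounded: 
 fixes dummy :: "'a::euclidean_space"
 assumes "r > 0"
 obtains B where "B > 0" "!!y::'a. mollifier r y <= B" "!!y::'a. norm (mollifier_grad r y) <= B"
proof -
 obtain B1 where B1: "B1 > 0" "!!y::'a. norm (mollifier r y) <= B1 * ind (cball 0 r) y"
 by (rule bounded_compact_support[of "mollifier r" "cball (0::'a) r"])
 (auto intro!: continuous_mollifier mollifier_eq_0 assms)
 obtain B2 where B2: "B2 > 0" "!!y::'a. norm (mollifier_grad r y) <= B2 * ind (cball 0 r) y"
 by (rule bounded_compact_support[of "mollifier_grad r" "cball (0::'a) r"])
 (auto intro!: continuous_mollifier mollifier_grad_eq_0 assms)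
 show thesis
 proof (rule that[of "max B1 B2"])
 show "mollifier r y <= max B1 B2" for y :: 'a
 using B1(2)[of y] B1(1) by (cases "y \<in> cball 0 r") auto
 show "norm (mollifier_grad r y) <= max B1 B2" for y :: 'a
 using B2(2)[of y] B2(1) B1(1) by (cases "y \<in> cball 0 r") auto
 qed (use B1 in auto)
qed

lemma integrable_mollifier_mult:
 fixes U :: "'a::euclidean_space => 'b::{banach,second_countable_topology}"
 assumes "r > 0" "intl U"
 shows "intl (%y. mollifier r (x - y) *R U y)"
proof -
 obtain B where B: "B > 0" "!!y::'a. mollifier r y <= B" using mollifier_bounded[OF assms(1)] by metis
 have [measurable]: "U \<in> bmb" using assms(2) by auto
 show ?thesis
 by (rule B_integrable_bound[OF integrable_scaleR_right[OF integrable_norm[OF assms(2)], of B]])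
 (use B in \<open>auto intro!: mult_right_mono AE_I2 simp: abs_mollifier[OF assms(1)]\<close>)
qed

lemma integrable_mollifier_grad_mult:
 fixes U :: "real^'n => real"
 assumes "r > 0" "intl U"
 shows "intl (%y. U y *R mollifier_grad r (x - y))"
proof -
 obtain B where B: "B > 0" "!!y::real^'n. norm (mollifier_grad r y) <= B" using mollifier_bounded[OF assms(1)] by metis
 have [measurable]: "U \<in> bmb" using assms(2) by auto
 show ?thesis
 by (rule B_integrable_bound[OF integrable_scaleR_right[OF integrable_norm[OF assms(2)], of B]])
 (use B in \<open>auto intro!: mult_left_mono simp: mult.commute[of B]\<close>)
qed

lemma measurable_mollify [measurable]:
 assumes [measurable]: "U \<in> bmb"
 shows "mollify r U \<in> bmb"
 unfolding mollify_def[abs_def] by measurable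

lemma mollify_eq_reflect:
 assumes [measurable]: "U \<in> bmb"
 shows "mollify r U x = (LBINT z. mollifier r z *R U (x - z))"
 unfolding mollify_def using integral_lborel_reflect[of "%y. mollifier r (x - y) *R U y" x] by simp

text \<open>The first-order remainder of the kernel is at most \<open>e / L * norm h\<close>
  uniformly, and integration against \<open>\<bar>U\<bar>\<close>, whose integral is less than
  \<open>L\<close>, leaves \<open>e * norm h\<close>.\<close>

lemma C1_on_mollify:
 fixes U :: "real^'n => real"
 assumes r: "r > 0" and U: "intl U"
 shows "C1_on UNIV (mollify r U) (%x. \<integral>y. U y *R mollifier_grad r (x - y) \<partial>lborel)"
 unfolding C1_on_def
proof (intro conjI ballI)
 let ?g = "%x. \<integral>y. U y *R mollifier_grad r (x - y) \<partial>lborel"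
 note i = integrable_mollifier_mult[OF r U] integrable_mollifier_grad_mult[OF r U]
 define L where "L = (LBINT y. \<bar>U y\<bar>) + 1"
 have L: "L > 0" unfolding L_def by (smt (verit) integral_nonneg_AE AE_I2 abs_ge_zero)
 fix x :: "real^'n"
 show "(mollify r U has_derivative (%h. ?g x <.> h)) (at x)"
 unfolding has_derivative_at_alt
 proof (intro conjI allI impI)
 fix e :: real assume e: "e > 0"
 obtain d where d: "d > 0" "!!z h. norm h < d ==>
 \<bar>mollifier r (z + h) - mollifier r z - mollifier_grad r z <.> h\<bar> <= e / L * norm (h :: real^'n)"
 using C1c_uniform_linearization[OF C1c_mollifier[OF r], of "e / L"] e L by auto
 have "norm (mollify r U y - mollify r U x - ?g x <.> (y - x)) <= e * norm (y - x)" if y: "norm (y - x) < d" for y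
 proof -
 let ?h = "y - x"
 have "mollify r U y - mollify r U x - ?g x <.> ?h
 = (LBINT z. U z * (mollifier r (y - z) - mollifier r (x - z) - mollifier_grad r (x - z) <.> ?h))"
 proof -
 have "intl (%z. U z * mollifier r (y - z))" "intl (%z. U z * mollifier r (x - z))"
 using i(1)[of x] i(1)[of y] by (simp_all add: mult.commute)
 moreover have "intl (%z. U z * (mollifier_grad r (x - z) <.> ?h))"
 using integrable_inner_left[of ?h, OF i(2)[of x]] by simp
 moreover have "?g x <.> ?h = (LBINT z. U z * (mollifier_grad r (x - z) <.> ?h))"
 using integral_inner_left[of ?h, OF i(2)[of x]] by simp
 ultimately show ?thesis
 unfolding mollify_def by (simp add: right_diff_distrib mult.commute)
 qed
 also have "norm ... <= (LBINT z. \<bar>U z\<bar> * (e / L * norm ?h))"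
 proof (rule norm_integral_le)
 show "intl (%z. U z * (mollifier r (y - z) - mollifier r (x - z) - mollifier_grad r (x - z) <.> ?h))"
 proof -
 have "intl (%z. mollifier r (y - z) *R U z - mollifier r (x - z) *R U z - (U z *R mollifier_grad r (x - z)) <.> ?h)"
 using i[of x] i(1)[of y] by (intro B_integrable_diff integrable_inner_left) auto
 then show ?thesis by (simp add: right_diff_distrib mult.commute)
 qed
 show "intl (%z. \<bar>U z\<bar> * (e / L * norm ?h))" using U by auto
 show "AE z in lborel. norm (U z * (mollifier r (y - z) - mollifier r (x - z) - mollifier_grad r (x - z) <.> ?h)) <= \<bar>U z\<bar> * (e / L * norm ?h)"
 proof (rule AE_I2)
 fix z
 have "y - z = (x - z) + ?h" by simp
 then show "norm (U z * (mollifier r (y - z) - mollifier r (x - z) - mollifier_grad r (x - z) <.> ?h)) <= \<bar>U z\<bar> * (e / L * norm ?h)"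
 using mult_left_mono[OF d(2)[OF y, of "x - z"], of "\<bar>U z\<bar>"] by (simp only: real_norm_def abs_mult)
 qed
 qed
 also have "... = (L - 1) * (e / L) * norm ?h" by (simp add: L_def)
 also have "... <= L * (e / L) * norm ?h" using e L by (intro mult_right_mono) auto
 also have "... = e * norm ?h" using L by simp
 finally show ?thesis .
 qed
 then show "\<exists>d>0. \<forall>y. norm (y - x) < d --> norm (mollify r U y - mollify r U x - ?g x <.> (y - x)) <= e * norm (y - x)"
 using d(1) by blast
 qed (rule bounded_linear_inner_right)
next
 obtain B where B: "B > 0" "!!y::real^'n. norm (mollifier_grad r y) <= B" using mollifier_bounded[OF r] by metis
 have [measurable]: "U \<in> bmb" using U by auto
 show "continuous_on UNIV (%x. \<integral>y. U y *R mollifier_grad r (x - y) \<partial>lborel)"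
 unfolding continuous_on_sequentially o_def
 proof (intro ballI allI impI)
 fix X :: "nat => real^'n" and a assume "(\<forall>n. X n \<in> UNIV) & X >-> a"
 then have X: "X >-> a" by simp
 show "(%n. \<integral>y. U y *R mollifier_grad r (X n - y) \<partial>lborel) >-> (LBINT y. U y *R mollifier_grad r (a - y))"
 proof (rule integral_dominated_convergence[where w="%y. \<bar>U y\<bar> * B"])
 show "AE y in lborel. (%n. U y *R mollifier_grad r (X n - y)) >-> U y *R mollifier_grad r (a - y)"
 by (intro AE_I2 tendsto_intros isCont_tendsto_compose[of _ "mollifier_grad r"] X)
 (use continuous_mollifier(2) continuous_on_eq_continuous_at open_UNIV in blast)
 show "AE y in lborel. norm (U y *R mollifier_grad r (X n - y)) <= \<bar>U y\<bar> * B" for n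
 using B by (auto intro!: mult_left_mono)
 qed (use U in auto)
 qed
qed

text \<open>Because the kernel has mass 1, \<open>mollify r f x - f x\<close> is an average of the
  differences \<open>f (x - z) - f x\<close> over shifts \<open>z\<close> shorter than
  \<open>r\<close>; Fubini exchanges this average with the L1 norm.\<close>

lemma mollify_diff_L1_le:
 fixes f :: "'a::euclidean_space => 'b::{banach, second_countable_topology}"
 assumes r: "r > 0" and f: "intl f" and e: "e >= 0"
 and *: "!!h. norm h < r ==> (LBINT x. norm (f (x + h) - f x)) <= e"
 shows "(\<integral>\<^sup>+x. norm (mollify r f x - f x) \<partial>lborel) <= e"
proof -
 have [measurable]: "f \<in> bmb" using f by auto
 have "(\<integral>\<^sup>+x. norm (mollify r f x - f x) \<partial>lborel)
 <= (\<integral>\<^sup>+x. \<integral>\<^sup>+z. ennreal (mollifier r z * norm (f (x - z) - f x)) \<partial>lborel \<partial>lborel)"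
 proof (intro nn_integral_mono)
 fix x
 have i1: "intl (%z. mollifier r z *R f (x - z))"
 using integrable_lborel_reflect[OF integrable_mollifier_mult[OF r f, of x], of x] by simp
 have i2: "intl (%z::'a. mollifier r z *R f x)" using integrable_mollifier[OF r] by auto
 have "mollify r f x - f x = (LBINT z. mollifier r z *R f (x - z)) - (LBINT z. mollifier r (z::'a) *R f x)"
 proof -
 have "(LBINT z. mollifier r (z::'a) *R f x) = f x"
 by (subst integral_scaleR_left) (simp_all add: integrable_mollifier[OF r] integral_mollifier[OF r])
 then show ?thesis by (simp add: mollify_eq_reflect)
 qed
 also have "... = (LBINT z. mollifier r z *R (f (x - z) - f x))"
 using i1 i2 by (simp add: scaleR_diff_right)
 finally have "norm (mollify r f x - f x) <= (LBINT z. norm (mollifier r z *R (f (x - z) - f x)))"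
 by (metis integral_norm_bound)
 moreover have "intl (%z. mollifier r z *R (f (x - z) - f x))"
 using B_integrable_diff[OF i1 i2] by (simp add: scaleR_diff_right)
 ultimately have "ennreal (norm (mollify r f x - f x)) <= (\<integral>\<^sup>+z. norm (mollifier r z *R (f (x - z) - f x)) \<partial>lborel)"
 by (subst nn_integral_eq_integral[OF integrable_norm]) (auto intro!: ennreal_leI)
 also have "... = (\<integral>\<^sup>+z. ennreal (mollifier r z * norm (f (x - z) - f x)) \<partial>lborel)"
 by (simp add: abs_mollifier[OF r])
 finally show "ennreal (norm (mollify r f x - f x)) <= (\<integral>\<^sup>+z. ennreal (mollifier r z * norm (f (x - z) - f x)) \<partial>lborel)" .
 qed
 also have "... = (\<integral>\<^sup>+z. \<integral>\<^sup>+x. ennreal (mollifier r z * norm (f (x - z) - f x)) \<partial>lborel \<partial>lborel)"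
 by (rule lborel_pair.Fubini') measurable
 also have "... <= (\<integral>\<^sup>+z. ennreal (mollifier r (z::'a)) * ennreal e \<partial>lborel)"
 proof (intro nn_integral_mono)
 fix z :: 'a
 show "(\<integral>\<^sup>+x. ennreal (mollifier r z * norm (f (x - z) - f x)) \<partial>lborel) <= ennreal (mollifier r z) * ennreal e"
 proof (cases "norm z < r")
 case True
 have i: "intl (%x. norm (f (x - z) - f x))"
 using integrable_lborel_translate[OF f, of "-z"] f by auto
 have "(\<integral>\<^sup>+x. ennreal (mollifier r z * norm (f (x - z) - f x)) \<partial>lborel)
 = ennreal (mollifier r z) * (\<integral>\<^sup>+x. norm (f (x - z) - f x) \<partial>lborel)"
 using mollifier_nonneg[OF r, of z] by (simp add: ennreal_mult nn_integral_cmult)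
 also have "(\<integral>\<^sup>+x. norm (f (x - z) - f x) \<partial>lborel) <= ennreal e"
 using i *[of "-z"] True by (subst nn_integral_eq_integral) (auto intro!: ennreal_leI)
 finally show ?thesis by (simp add: mult_left_mono)
 next
 case False
 then have "mollifier r z = 0" using mollifier_eq_0[OF r, of z] by simp
 then show ?thesis by simp
 qed
 qed
 also have "... = ennreal e"
 using integral_mollifier[OF r, where 'a='a] integrable_mollifier[OF r, where 'a='a] mollifier_nonneg[OF r, where 'a='a]
 by (simp add: nn_integral_multc nn_integral_eq_integral)
 finally show ?thesis .
qed

lemma integrable_mollify:
 fixes f :: "'a::euclidean_space => 'b::{banach, second_countable_topology}"
 assumes r: "r > 0" and f: "intl f"
 shows "intl (mollify r f)"
proof -
 have [measurable]: "f \<in> bmb" using f by auto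
 have "(LBINT x. norm (f (x + h) - f x)) <= 2 * (LBINT x. norm (f x))" for h
 proof -
 note i = integrable_lborel_translate[OF f, of h]
 have "(LBINT x. norm (f (x + h) - f x)) <= (LBINT x. norm (f (x + h)) + norm (f x))"
 using i f by (intro integral_mono) (auto simp: norm_triangle_ineq4)
 also have "... = 2 * (LBINT x. norm (f x))"
 using i f integral_lborel_translate[of "%x. norm (f x)" h] by simp
 finally show ?thesis .
 qed
 then have "(\<integral>\<^sup>+x. norm (mollify r f x - f x) \<partial>lborel) <= ennreal (2 * (LBINT x. norm (f x)))"
 by (intro mollify_diff_L1_le[OF r f]) auto
 then have "intl (%x. mollify r f x - f x)"
 unfolding integrable_iff_bounded by (auto intro: le_less_trans)
 from B_integrable_add[OF this f] show ?thesis by simp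
qed

lemma mollify_tendsto_L1:
 fixes f :: "'a::euclidean_space => 'b::{banach, second_countable_topology}"
 assumes f: "intl f" and X: "!!n. X n > 0" "X >-> 0"
 shows "(%n. \<integral>x. norm (mollify (X n) f x - f x) \<partial>lborel) >-> 0"
proof (rule LIMSEQ_I)
 fix e :: real assume e: "e > 0"
 obtain d where d: "d > 0" "!!h. norm h < d ==> (LBINT x. norm (f (x + h) - f x)) < e / 2"
 using L1_translation_continuous[OF f, of "e/2"] e by auto
 obtain n0 where n0: "!!n. n >= n0 ==> X n < d"
 using order_tendstoD(2)[OF X(2) d(1)] by (auto simp: eventually_sequentially)
 have "norm ((LBINT x. norm (mollify (X n) f x - f x)) - 0) < e" if n: "n >= n0" for n
 proof -
 have "(\<integral>\<^sup>+x. norm (mollify (X n) f x - f x) \<partial>lborel) <= ennreal (e/2)"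
 using d(2) n0[OF n] e by (intro mollify_diff_L1_le[OF X(1) f]) (auto intro!: less_imp_le)
 moreover have "intl (%x. norm (mollify (X n) f x - f x))"
 using integrable_mollify[OF X(1) f] f by auto
 ultimately have "(LBINT x. norm (mollify (X n) f x - f x)) <= e/2"
 using e by (subst (asm) nn_integral_eq_integral) auto
 moreover have "(LBINT x. norm (mollify (X n) f x - f x)) >= 0" by (intro integral_nonneg_AE) auto
 ultimately show ?thesis using e by auto
 qed
 then show "\<exists>no. \<forall>n\<ge>no. norm ((LBINT x. norm (mollify (X n) f x - f x)) - 0) < e" by blast
qed

lemma mollify_AE_subseq:
 fixes f :: "'a::euclidean_space => 'b::{banach, second_countable_topology}"
 assumes f: "intl f" and X: "!!n. X n > 0" "X >-> 0"
 obtains s :: "nat => nat" where "strict_mono s" "AE x in lborel. (%n. mollify (X (s n)) f x) >-> f x"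
proof -
 obtain s where "strict_mono s" "AE x in lborel. (%n. mollify (X (s n)) f x - f x) >-> 0"
 using tendsto_L1_AE_subseq[OF _ mollify_tendsto_L1[OF assms]] integrable_mollify[OF X(1) f] f by auto
 then show thesis by (intro that[of s]) (simp_all add: LIM_zero_iff)
qed

text \<open>Jensen's inequality, obtained by expanding the nonnegative variance of
  \<open>norm (f y)\<close> about its mean \<open>a\<close> under the probability density
  \<open>?k\<close>.\<close>

lemma mollify_norm_sq_le:
 fixes f :: "'a::euclidean_space => 'b::{banach, second_countable_topology}"
 assumes r: "r > 0" and f: "intl f" and f2: "intl (%x. (norm (f x))^2)"
 shows "(norm (mollify r f x))^2 <= (LBINT y. mollifier r (x - y) * (norm (f y))^2)"
proof -
 let ?k = "%y. mollifier r (x - y)"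
 have k: "intl ?k" "(LBINT y. ?k y) = 1"
 using integrable_lborel_reflect[OF integrable_mollifier[OF r], of x]
 integral_lborel_reflect[of "mollifier r" x] integral_mollifier[OF r, where 'a='a] by auto
 have i1: "intl (%y. ?k y * norm (f y))"
 using integrable_norm[OF integrable_mollifier_mult[OF r f, of x]] by (simp add: abs_mollifier[OF r])
 have i2: "intl (%y. ?k y * (norm (f y))^2)"
 using integrable_mollifier_mult[OF r f2, of x] by simp
 define a where "a = (LBINT y. ?k y * norm (f y))"
 have "norm (mollify r f x) <= (LBINT y. norm (?k y *R f y))"
 unfolding mollify_def by (rule integral_norm_bound)
 also have "... = a" unfolding a_def by (simp add: abs_mollifier[OF r])
 finally have 1: "(norm (mollify r f x))^2 <= a^2" by (intro power_mono) auto
 have "0 <= (LBINT y. ?k y * (norm (f y) - a)^2)"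
 by (intro integral_nonneg_AE AE_I2) (simp add: mollifier_nonneg[OF r])
 also have "... = (LBINT y. ?k y * (norm (f y))^2 - 2 * a * (?k y * norm (f y)) + a^2 * ?k y)"
 by (simp add: power2_diff algebra_simps)
 also have "... = (LBINT y. ?k y * (norm (f y))^2) - 2 * a * a + a^2"
 using i1 i2 k by (simp add: a_def[symmetric])
 finally show ?thesis using 1 by (simp add: power2_eq_square)
qed

text \<open>The pointwise Jensen inequality is integrated with Fubini; the kernel has mass 1 in the
  other variable as well.\<close>

lemma mollify_L2_le:
 fixes f :: "'a::euclidean_space => 'b::{banach, second_countable_topology}"
 assumes r: "r > 0" and f: "intl f" and f2: "intl (%x. (norm (f x))^2)"
 shows "intl (%x. (norm (mollify r f x))^2)"
 and "(LBINT x. (norm (mollify r f x))^2) <= (LBINT x. (norm (f x))^2)"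
proof -
 have [measurable]: "f \<in> bmb" using f by auto
 have "(\<integral>\<^sup>+x. ennreal ((norm (mollify r f x))^2) \<partial>lborel)
 <= (\<integral>\<^sup>+x. (\<integral>\<^sup>+y. ennreal (mollifier r (x - y) * (norm (f y))^2) \<partial>lborel) \<partial>lborel)"
 proof (intro nn_integral_mono)
 fix x
 show "ennreal ((norm (mollify r f x))^2) <= (\<integral>\<^sup>+y. ennreal (mollifier r (x - y) * (norm (f y))^2) \<partial>lborel)"
 using mollify_norm_sq_le[OF assms, of x] integrable_mollifier_mult[OF r f2, of x]
 by (subst nn_integral_eq_integral) (auto intro!: ennreal_leI simp: mollifier_nonneg[OF r])
 qed
 also have "... = (\<integral>\<^sup>+y. (\<integral>\<^sup>+x. ennreal (mollifier r (x - y) * (norm (f y))^2) \<partial>lborel) \<partial>lborel)"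
 by (rule lborel_pair.Fubini') measurable
 also have "... = (\<integral>\<^sup>+y. ennreal ((norm (f y))^2) \<partial>lborel)"
 proof (intro nn_integral_cong)
 fix y :: 'a
 have k: "intl (%x. mollifier r (x - y))" "(LBINT x. mollifier r (x - y)) = 1"
 using integrable_lborel_translate[OF integrable_mollifier[OF r], of "-y"]
 integral_lborel_translate[of "mollifier r" "-y"] integral_mollifier[OF r, where 'a='a] by auto
 have "(\<integral>\<^sup>+x. ennreal (mollifier r (x - y) * (norm (f y))^2) \<partial>lborel)
 = (\<integral>\<^sup>+x. ennreal (mollifier r (x - y)) \<partial>lborel) * ennreal ((norm (f y))^2)"
 by (subst nn_integral_multc[symmetric]) (simp_all add: ennreal_mult mollifier_nonneg[OF r])
 also have "(\<integral>\<^sup>+x. ennreal (mollifier r (x - y)) \<partial>lborel) = 1"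
 using k mollifier_nonneg[OF r] by (subst nn_integral_eq_integral) auto
 finally show "(\<integral>\<^sup>+x. ennreal (mollifier r (x - y) * (norm (f y))^2) \<partial>lborel) = ennreal ((norm (f y))^2)" by simp
 qed
 also have "... = ennreal (LBINT x. (norm (f x))^2)"
 using f2 by (intro nn_integral_eq_integral) auto
 finally have *: "(\<integral>\<^sup>+x. ennreal ((norm (mollify r f x))^2) \<partial>lborel) <= ennreal (LBINT x. (norm (f x))^2)" .
 show i: "intl (%x. (norm (mollify r f x))^2)"
 unfolding integrable_iff_bounded using * by (auto intro: le_less_trans)
 show "(LBINT x. (norm (mollify r f x))^2) <= (LBINT x. (norm (f x))^2)"
 using * i by (subst (asm) nn_integral_eq_integral) (auto intro!: integral_nonneg_AE)
qed

lemma mollify_nonneg: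
 assumes "r > 0" "AE x in lborel. 0 <= f x"
 shows "mollify r f x >= (0::real)"
 unfolding mollify_def
proof (rule integral_nonneg_AE)
 show "AE y in lborel. 0 <= mollifier r (x - y) *R f y"
 using assms(2) by eventually_elim (simp add: mollifier_nonneg[OF assms(1)])
qed

section \<open>Weak gradients\<close>

text \<open>Borel version of \<open>H1loc\<close>, with the coordinates of the integration by parts
  formula gathered in one vector identity. Borel representatives keep shifted and composed functions
  measurable, which Fubini's theorem requires.\<close>

definition weak_H1 :: "(real^'n) set => (real^'n => real) => (real^'n => real^'n) => bool" where
 "weak_H1 G u g \<longleftrightarrow>
 u \<in> bmb & g \<in> bmb &
 (\<forall>K. compact K & K \<subseteq> G -->
 set_integrable lborel K (%x. (u x)^2) & set_integrable lborel K (%x. (norm (g x))^2)) &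
 (\<forall>ph Dph. C1c G ph Dph --> (LBINT x. u x *R Dph x) = - (LBINT x. ph x *R g x))"

lemma set_integrable_of_norm_sq:
 fixes f :: "'a::euclidean_space => 'b::{banach, second_countable_topology}"
 assumes "compact K" "f \<in> bmb" "set_integrable lborel K (%x. (norm (f x))^2)"
 shows "set_integrable lborel K f"
proof -
 have [measurable]: "K \<in> sets borel" "f \<in> bmb" using assms borel_compact by auto
 have 1: "intl (ind K :: _ => real)"
 using emeasure_compact_finite[OF assms(1)] by simp
 have "intl (%x. ind K x + ind K x *R (norm (f x))^2)"
 using assms(3) 1 unfolding set_integrable_def by (intro B_integrable_add)
 then show ?thesis
 unfolding set_integrable_def
 proof (rule B_integrable_bound)
 have "norm (f x) <= 1 + (norm (f x))^2" for x
 using sum_squares_bound[of 1 "norm (f x)"] by (auto simp: power2_eq_square) (smt (verit) norm_ge_zero)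
 then show "AE x in lborel. norm (ind K x *R f x) <= norm (ind K x + ind K x *R (norm (f x))^2)"
 by (auto simp: indicator_def)
 qed measurable
qed

lemma weak_H1D:
 assumes "weak_H1 G u g"
 shows "u \<in> bmb" "g \<in> bmb"
 "!!K. compact K ==> K \<subseteq> G ==> intl (%x. ind K x *R u x)"
 "!!K. compact K ==> K \<subseteq> G ==> intl (%x. ind K x *R g x)"
 "!!K. compact K ==> K \<subseteq> G ==> intl (%x. ind K x * (u x)^2)"
 "!!K. compact K ==> K \<subseteq> G ==> intl (%x. ind K x * (norm (g x))^2)"
 "!!ph Dph. C1c G ph Dph ==> (LBINT x. u x *R Dph x) = - (LBINT x. ph x *R g x)"
 using assms set_integrable_of_norm_sq[of _ u] set_integrable_of_norm_sq[of _ g]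
 unfolding weak_H1_def set_integrable_def by auto

lemma integrable_scaleR_compact_support:
 fixes g :: "'a::euclidean_space => 'b::{banach, second_countable_topology}" and ph :: "'a => real"
 assumes "continuous_on UNIV ph" "compact K" "!!x. x \<notin> K ==> ph x = 0"
 and g: "intl (%x. ind K x *R g x)" "g \<in> bmb"
 shows "intl (%x. ph x *R g x)"
proof -
 obtain B where B: "B > 0" "!!x. norm (ph x) <= B * ind K x"
 using bounded_compact_support[OF assms(1-3)] by blast
 have [measurable]: "ph \<in> bmb" using assms(1) by (rule borel_measurable_continuous_onI)
 note g(2)[measurable]
 show ?thesis
 proof (rule B_integrable_bound[OF integrable_scaleR_right[OF integrable_norm[OF g(1)], of B]])
 show "AE x in lborel. norm (ph x *R g x) <= norm (B *R norm (ind K x *R g x))"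
 proof (rule AE_I2)
 fix x
 show "norm (ph x *R g x) <= norm (B *R norm (ind K x *R g x))"
 using mult_right_mono[OF B(2)[of x], of "norm (g x)"] B(1) by simp
 qed
 qed measurable
qed

lemma C1c_continuous: "C1c G ph Dph ==> continuous_on UNIV ph" "C1c G ph Dph ==> continuous_on UNIV Dph"
 using C1_on_continuous[OF C1cD1] by (auto simp: C1c_def)

lemma C1c_measurable: "C1c G ph Dph ==> ph \<in> bmb" "C1c G ph Dph ==> Dph \<in> bmb"
 using C1c_continuous borel_measurable_continuous_onI by blast+

lemma weak_H1_integrable_test:
 assumes "weak_H1 G u g" "C1c G ph Dph"
 shows "intl (%x. u x *R Dph x)" "intl (%x. ph x *R g x)"
proof -
 obtain K where K: "compact K" "K \<subseteq> G" "!!x. x \<notin> K ==> ph x = 0" "!!x. x \<notin> K ==> Dph x = 0"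
 using C1c_support[OF assms(2)] by metis
 show "intl (%x. u x *R Dph x)"
 using weak_H1D(1,3)[OF assms(1)] K C1c_continuous[OF assms(2)]
 by (intro integrable_compact_support_mult[of _ K]) (auto simp: set_integrable_def)
 show "intl (%x. ph x *R g x)"
 by (rule integrable_scaleR_compact_support[of _ K, OF C1c_continuous(1)[OF assms(2)] K(1,3) weak_H1D(4)[OF assms(1) K(1,2)] weak_H1D(2)[OF assms(1)]])
qed

lemma borel_measurable_vec_nth [measurable]:
 fixes f :: "'a => real^'n"
 assumes [measurable]: "f \<in> borel_measurable M"
 shows "(%x. f x $ i) \<in> borel_measurable M"
proof -
 have "(%x. f x <.> axis i 1) \<in> borel_measurable M" by measurable
 then show ?thesis by (simp add: inner_axis)
qed

text \<open>The way back to the original setting, both for the test functions fed to a given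
  supersolution and for the supersolution constructed at the end.\<close>

lemma weak_H1_imp_H1loc:
 assumes u: "weak_H1 G u g"
 shows "H1loc G u g"
 unfolding H1loc_def
proof (intro conjI allI impI)
 note [measurable] = weak_H1D(1,2)[OF u]
 show "u \<in> borel_measurable lebesgue" "g \<in> borel_measurable lebesgue"
 by (auto intro: measurable_completion)
 fix K assume K: "compact K & K \<subseteq> G"
 then have [measurable]: "K \<in> sets borel" using borel_compact by blast
 show "set_integrable lebesgue K (%x. (u x)^2)" "set_integrable lebesgue K (%x. (norm (g x))^2)"
 using weak_H1D(5,6)[OF u] K unfolding set_integrable_def
 by (auto simp: integrable_completion)
next
 fix ph Dph i assume ph: "C1c G ph Dph"
 note [measurable] = weak_H1D(1,2)[OF u] C1c_measurable[OF ph]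
 obtain K where K: "compact K" "K \<subseteq> G" "!!x. x \<notin> K ==> ph x = 0" "!!x. x \<notin> K ==> Dph x = 0"
 using C1c_support[OF ph] by metis
 have 1: "(%x. ind G x *R (u x * Dph x $ i)) = (%x. (u x *R Dph x) $ i)"
 "(%x. ind G x *R (g x $ i * ph x)) = (%x. (ph x *R g x) $ i)"
 proof -
 have "ind G x *R (u x * Dph x $ i) = (u x *R Dph x) $ i"
 "ind G x *R (g x $ i * ph x) = (ph x *R g x) $ i" for x
 using K(2) K(3,4)[of x] by (cases "x \<in> K"; auto)+
 then show "(%x. ind G x *R (u x * Dph x $ i)) = (%x. (u x *R Dph x) $ i)"
 "(%x. ind G x *R (g x $ i * ph x)) = (%x. (ph x *R g x) $ i)" by auto
 qed
 have "(LBINT x. (u x *R Dph x) $ i) = (LBINT x. u x *R Dph x) $ i"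
 by (rule integral_bounded_linear[OF bounded_linear_vec_nth weak_H1_integrable_test(1)[OF u ph]])
 moreover have "(LBINT x. (ph x *R g x) $ i) = (LBINT x. ph x *R g x) $ i"
 by (rule integral_bounded_linear[OF bounded_linear_vec_nth weak_H1_integrable_test(2)[OF u ph]])
 ultimately show "(LINT x:G|lebesgue. u x * Dph x $ i) = - (LINT x:G|lebesgue. g x $ i * ph x)"
 unfolding set_lebesgue_integral_def 1
 using weak_H1D(7)[OF u ph] by (subst (1 2) integral_completion) auto
qed

text \<open>The real case is applied to each coordinate; a finite union of null sets is
  null.\<close>

lemma completion_ex_borel_measurable_vec:
 fixes g :: "'a => 'b::euclidean_space"
 assumes "g \<in> borel_measurable (completion M)"
 shows "\<exists>g'\<in>borel_measurable M. (AE x in M. g x = g' x)"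
proof -
 have "\<exists>h\<in>borel_measurable M. AE x in M. g x <.> b = h x" for b
 by (intro completion_ex_borel_measurable_real borel_measurable_inner assms borel_measurable_const)
 then obtain h where h: "!!b. h b \<in> borel_measurable M" "!!b. AE x in M. g x <.> b = h b x"
 by metis
 have "AE x in M. \<forall>b\<in>Basis. g x <.> b = h b x"
 using h(2) by (intro AE_finite_allI) auto
 then have "AE x in M. g x = (\<Sum>b\<in>Basis. h b x *R b)"
 proof eventually_elim
 case (elim x)
 have "g x = (\<Sum>b\<in>Basis. (g x <.> b) *R b)" by (rule euclidean_representation[symmetric])
 also have "... = (\<Sum>b\<in>Basis. h b x *R b)" using elim by (intro sum.cong) auto
 finally show ?case .
 qed
 moreover have "(%x. \<Sum>b\<in>Basis. h b x *R b) \<in> borel_measurable M"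
 using h(1) by measurable
 ultimately show ?thesis by (rule bexI[of _ "%x. \<Sum>b\<in>Basis. h b x *R b"])
qed

text \<open>Every clause of the definition sees the functions only up to null sets and only on
  compact subsets of \<open>G\<close>, so agreement almost everywhere in \<open>G\<close> is
  enough.\<close>

lemma H1loc_imp_weak_H1:
 assumes "open G" and H: "H1loc G u g"
 and u': "u' \<in> bmb" "AE x in lebesgue. x \<in> G --> u x = u' x"
 and g': "g' \<in> bmb" "AE x in lebesgue. x \<in> G --> g x = g' x"
 shows "weak_H1 G u' g'"
 unfolding weak_H1_def
proof (intro conjI allI impI u' g')
 have [measurable]: "u \<in> borel_measurable lebesgue" "g \<in> borel_measurable lebesgue"
 "u' \<in> borel_measurable lebesgue" "g' \<in> borel_measurable lebesgue"
 using H u'(1) g'(1) unfolding H1loc_def by (auto intro: measurable_completion)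
 note [measurable] = u'(1) g'(1)
 {
 fix K assume K: "compact K & K \<subseteq> G"
 then have [measurable]: "K \<in> sets borel" "K \<in> sets lebesgue"
 using borel_compact fmeasurableD[OF lmeasurable_compact] by blast+
 have "integrable lebesgue (%x. ind K x *R (u x)^2)" "integrable lebesgue (%x. ind K x *R (norm (g x))^2)"
 using H K unfolding H1loc_def set_integrable_def by auto
 moreover have "AE x in lebesgue. ind K x *R (u x)^2 = ind K x *R (u' x)^2"
 using u'(2) by eventually_elim (use K in \<open>auto simp: indicator_def\<close>)
 moreover have "AE x in lebesgue. ind K x *R (norm (g x))^2 = ind K x *R (norm (g' x))^2"
 using g'(2) by eventually_elim (use K in \<open>auto simp: indicator_def\<close>)
 ultimately have "integrable lebesgue (%x. ind K x *R (u' x)^2)" "integrable lebesgue (%x. ind K x *R (norm (g' x))^2)"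
 using integrable_cong_AE_imp[of lebesgue _ "%x. ind K x *R (u' x)^2"]
 integrable_cong_AE_imp[of lebesgue _ "%x. ind K x *R (norm (g' x))^2"] by auto
 then show "set_integrable lborel K (%x. (u' x)^2)" "set_integrable lborel K (%x. (norm (g' x))^2)"
 unfolding set_integrable_def by (auto simp: integrable_completion)
 } note L2 = this
 fix ph Dph assume ph: "C1c G ph Dph"
 note [measurable] = C1c_measurable[OF ph]
 have [measurable]: "ph \<in> borel_measurable lebesgue" "Dph \<in> borel_measurable lebesgue" "G \<in> sets lebesgue"
 using C1c_measurable[OF ph] assms(1) by (auto intro: measurable_completion)
 obtain K where K: "compact K" "K \<subseteq> G" "!!x. x \<notin> K ==> ph x = 0" "!!x. x \<notin> K ==> Dph x = 0"
 using C1c_support[OF ph] by metis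
 have KL: "set_integrable lborel K u'" "set_integrable lborel K g'"
 using set_integrable_of_norm_sq[OF K(1) u'(1)] set_integrable_of_norm_sq[OF K(1) g'(1)] L2[of K] K(1,2) by simp_all
 have i: "intl (%x. u' x *R Dph x)" "intl (%x. ph x *R g' x)"
 using integrable_compact_support_mult[of Dph K u', OF C1c_continuous(2)[OF ph] K(1,4) KL(1) u'(1)]
 integrable_scaleR_compact_support[of ph K g', OF C1c_continuous(1)[OF ph] K(1,3) KL(2)[unfolded set_integrable_def] g'(1)]
 by simp_all
 show "(LBINT x. u' x *R Dph x) = - (LBINT x. ph x *R g' x)"
 proof (rule vec_eq_iff[THEN iffD2], rule allI)
 fix i
 have 1: "(LBINT x. u' x *R Dph x) $ i = (LBINT x. (u' x *R Dph x) $ i)"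
 by (rule integral_bounded_linear[OF bounded_linear_vec_nth i(1), symmetric])
 also have "... = (\<integral>x. (u' x *R Dph x) $ i \<partial>lebesgue)"
 by (rule integral_completion[symmetric]) measurable
 also have "... = (LINT x:G|lebesgue. u x * Dph x $ i)"
 unfolding set_lebesgue_integral_def
 proof (rule integral_cong_AE)
 show "AE x in lebesgue. (u' x *R Dph x) $ i = ind G x *R (u x * Dph x $ i)"
 using u'(2)
 proof eventually_elim
 case (elim x) then show ?case using K(2) K(3,4)[of x] by (cases "x \<in> K") auto
 qed
 qed (measurable)
 also have "... = - (LINT x:G|lebesgue. g x $ i * ph x)"
 using H ph unfolding H1loc_def by blast
 also have "(LINT x:G|lebesgue. g x $ i * ph x) = (\<integral>x. (ph x *R g' x) $ i \<partial>lebesgue)"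
 unfolding set_lebesgue_integral_def
 proof (rule integral_cong_AE)
 show "AE x in lebesgue. ind G x *R (g x $ i * ph x) = (ph x *R g' x) $ i"
 using g'(2)
 proof eventually_elim
 case (elim x) then show ?case using K(2) K(3,4)[of x] by (cases "x \<in> K") auto
 qed
 qed (measurable)
 also have "... = (LBINT x. (ph x *R g' x) $ i)"
 by (rule integral_completion) measurable
 also have "... = (LBINT x. ph x *R g' x) $ i"
 by (rule integral_bounded_linear[OF bounded_linear_vec_nth i(2)])
 finally show "(LBINT x. u' x *R Dph x) $ i = (- (LBINT x. ph x *R g' x)) $ i" by simp
 qed
qed

lemma integral_tendsto_L1:
 fixes f :: "nat => 'a => 'b::{banach, second_countable_topology}"
 assumes "!!n. integrable M (f n)" "integrable M h" "(%n. \<integral>x. norm (f n x - h x) \<partial>M) >-> 0"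
 shows "(%n. \<integral>x. f n x \<partial>M) >-> (\<integral>x. h x \<partial>M)"
proof -
 have "(%n. (\<integral>x. f n x \<partial>M) - (\<integral>x. h x \<partial>M)) >-> 0"
 proof (rule Lim_null_comparison[OF _ assms(3)], rule always_eventually, rule allI)
 fix n
 have "(\<integral>x. f n x \<partial>M) - (\<integral>x. h x \<partial>M) = (\<integral>x. f n x - h x \<partial>M)" using assms by simp
 then show "norm ((\<integral>x. f n x \<partial>M) - (\<integral>x. h x \<partial>M)) <= (\<integral>x. norm (f n x - h x) \<partial>M)"
 by (metis integral_norm_bound)
 qed
 then show ?thesis by (simp add: LIM_zero_iff)
qed

lemma integral_norm_tendsto_0:
 fixes f :: "nat => 'a => 'b::{banach, second_countable_topology}"
 assumes "!!n. AE x in M. norm (f n x) <= h n x" "!!n. integrable M (h n)" "(%n. \<integral>x. h n x \<partial>M) >-> 0"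
 "!!n. f n \<in> borel_measurable M"
 shows "(%n. \<integral>x. norm (f n x) \<partial>M) >-> 0"
proof (rule tendsto_sandwich[OF _ _ tendsto_const assms(3)])
 show "\<forall>\<^sub>F n in sequentially. 0 <= (\<integral>x. norm (f n x) \<partial>M)"
 by (intro always_eventually allI integral_nonneg_AE) auto
 show "\<forall>\<^sub>F n in sequentially. (\<integral>x. norm (f n x) \<partial>M) <= (\<integral>x. h n x \<partial>M)"
 proof (rule always_eventually, rule allI, rule integral_mono_AE)
 fix n
 show "integrable M (%x. norm (f n x))"
 proof (rule B_integrable_bound[OF assms(2)[of n]])
 show "AE x in M. norm (norm (f n x)) <= norm (h n x)"
 using assms(1)[of n] by eventually_elim simp
 qed (use assms(4) in measurable)
 show "AE x in M. norm (f n x) <= h n x" by (rule assms(1))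
 qed (use assms in auto)
qed

text \<open>Provides the margin by which supports may grow under mollification.\<close>

lemma compact_neighbourhood:
 fixes K0 :: "'a::euclidean_space set"
 assumes "compact K0" "open G" "K0 \<subseteq> G"
 obtains K d where "compact K" "K \<subseteq> G" "d > 0" "!!x. x \<in> K0 ==> cball x d \<subseteq> K" "K0 \<subseteq> K"
 "!!y. y \<in> K ==> \<exists>x\<in>K0. dist x y <= d"
proof -
 obtain d where d: "d > 0" "(\<Union>x\<in>K0. cball x d) \<subseteq> G"
 using compact_subset_open_imp_cball_epsilon_subset[OF assms] by blast
 define K where "K = {x + y | x y. x \<in> K0 & y \<in> cball 0 d}"
 have eq: "K = (\<Union>x\<in>K0. cball x d)"
 proof
 show "K \<subseteq> (\<Union>x\<in>K0. cball x d)" unfolding K_def by (auto simp: dist_norm)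
 show "(\<Union>x\<in>K0. cball x d) \<subseteq> K"
 proof
 fix y assume "y \<in> (\<Union>x\<in>K0. cball x d)"
 then obtain x where "x \<in> K0" "dist x y <= d" by auto
 then show "y \<in> K" unfolding K_def
 by (intro CollectI exI[of _ x] exI[of _ "y - x"]) (auto simp: dist_norm norm_minus_commute)
 qed
 qed
 have "compact K" unfolding K_def by (intro compact_sums assms(1)) auto
 then show thesis
 using d eq by (intro that[of K d]) (auto simp: less_imp_le)
qed

text \<open>As long as the ball of radius \<open>r\<close> about \<open>x\<close> stays in
  \<open>K\<close>, the reflected kernel is an admissible test function. Hence the gradient of the
  mollified function is the mollified weak gradient.\<close>

lemma mollify_grad_eq:
 assumes u: "weak_H1 G u g" and K: "compact K" "K \<subseteq> G" and r: "r > 0" and x: "cball x r \<subseteq> K"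
 shows "(LBINT y. (ind K y *R u y) *R mollifier_grad r (x - y)) = mollify r (%y. ind K y *R g y) x"
proof -
 have C: "C1c G (%y. mollifier r (x - y)) (%y. - mollifier_grad r (x - y))"
 using C1c_mollifier_reflect[OF r, of x G] K x by blast
 have z: "mollifier r (x - y) = 0" "mollifier_grad r (x - y) = 0" if "y \<notin> K" for y
 using that x mollifier_eq_0[OF r, of "x - y"] mollifier_grad_eq_0[OF r, of "x - y"]
 by (auto simp: dist_norm subset_iff) (meson le_cases)+
 have "(%y. (ind K y *R u y) *R mollifier_grad r (x - y)) = (%y. - (u y *R - mollifier_grad r (x - y)))"
 using z by (auto simp: fun_eq_iff indicator_def)
 then have "(LBINT y. (ind K y *R u y) *R mollifier_grad r (x - y)) = - (LBINT y. u y *R - mollifier_grad r (x - y))"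
 by (simp only: integral_minus)
 also have "... = (LBINT y. mollifier r (x - y) *R g y)"
 using weak_H1D(7)[OF u C] by simp
 also have "... = mollify r (%y. ind K y *R g y) x"
 unfolding mollify_def using z by (intro B_integral_cong) (auto simp: indicator_def)
 finally show ?thesis .
qed

text \<open>The classical chain rule is applied to mollifications. The bound on \<open>F'\<close>
  makes \<open>F\<close> Lipschitz, which takes the left side to the limit in L1; on the right
  \<open>F'\<close> is only continuous, which calls for convergence almost everywhere. Nonnegativity
  of \<open>u\<close> confines the smoothness required of \<open>F\<close> to the half line.\<close>

lemma weak_chain_rule:
 fixes G :: "(real^'n) set"
 assumes G: "open G" and u: "weak_H1 G u g" "!!x. u x >= 0" and ph: "C1c G ph Dph"
 and F: "!!s. s >= 0 ==> (F has_real_derivative F' s) (at s)" "continuous_on {0..} F'"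
 and B: "!!s. s >= 0 ==> \<bar>F' s\<bar> <= B"
 and m[measurable]: "F \<in> bmb" "F' \<in> bmb"
 shows "(LBINT x. F (u x) *R Dph x) = - (LBINT x. (ph x * F' (u x)) *R g x)"
proof -
 obtain K0 where K0: "compact K0" "K0 \<subseteq> G" "!!x. x \<notin> K0 ==> ph x = 0" "!!x. x \<notin> K0 ==> Dph x = 0"
 using C1c_support[OF ph] by metis
 obtain K d where K: "compact K" "K \<subseteq> G" "d > 0" "!!x. x \<in> K0 ==> cball x d \<subseteq> K" "K0 \<subseteq> K"
 using compact_neighbourhood[OF K0(1) G K0(2)] by metis
 note [measurable] = weak_H1D(1,2)[OF u(1)] C1c_measurable[OF ph]
 have [measurable]: "K \<in> sets borel" "K0 \<in> sets borel" using K(1) K0(1) borel_compact by auto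
 \<comment> \<open>Cutting off to \<open>K\<close> makes both functions globally integrable and
   changes nothing within distance \<open>d\<close> of the support of \<open>ph\<close>.\<close>
 define U where "U = (%y. ind K y *R u y)"
 define V where "V = (%y. ind K y *R g y)"
 have U: "intl U" and V: "intl V"
 unfolding U_def V_def using weak_H1D(3,4)[OF u(1) K(1,2)] by auto
 note [measurable] = borel_measurable_integrable[OF U] borel_measurable_integrable[OF V]
 define r0 where "r0 = (%n. d / real (Suc n))"
 have r0: "r0 n > 0" "r0 n <= d" for n using K(3) by (auto simp: r0_def divide_le_eq)
 have "r0 >-> 0" unfolding r0_def by (rule LIMSEQ_Suc[OF lim_const_over_n])
 then obtain s where s: "strict_mono s" "AE x in lborel. (%n. mollify (r0 (s n)) U x) >-> U x"
 by (rule mollify_AE_subseq[OF U r0(1)])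
 define r where "r = r0 \<circ> s"
 have r: "r n > 0" "r n <= d" for n using r0 by (auto simp: r_def)
 have r_lim: "r >-> 0" unfolding r_def using \<open>r0 >-> 0\<close> s(1) by (rule LIMSEQ_subseq_LIMSEQ)
 let ?u = "%n. mollify (r n) U" and ?v = "%n. mollify (r n) V"
 have AEu: "AE x in lborel. (%n. ?u n x) >-> U x" using s(2) by (simp add: r_def)
 have L1u: "(%n. \<integral>x. norm (?u n x - U x) \<partial>lborel) >-> 0" by (rule mollify_tendsto_L1[OF U r(1) r_lim])
 have L1v: "(%n. \<integral>x. norm (?v n x - V x) \<partial>lborel) >-> 0" by (rule mollify_tendsto_L1[OF V r(1) r_lim])
 have iu: "intl (?u n)" and iv: "intl (?v n)" for n
 using integrable_mollify[OF r(1)] U V by auto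
 have pos: "?u n x >= 0" "U x >= 0" for n x
 using u(2) by (auto intro!: mollify_nonneg[OF r(1)] simp: U_def indicator_def)
 obtain C1 where C1: "C1 > 0" "!!x. norm (ph x) <= C1 * ind K0 x"
 using bounded_compact_support[OF C1c_continuous(1)[OF ph] K0(1,3)] by blast
 obtain C2 where C2: "C2 > 0" "!!x. norm (Dph x) <= C2 * ind K0 x"
 using bounded_compact_support[OF C1c_continuous(2)[OF ph] K0(1,4)] by blast
 have B0: "B >= 0" using B[of 0] by auto
 have lip: "\<bar>F s - F t\<bar> <= B * \<bar>s - t\<bar>" if "s >= 0" "t >= 0" for s t
 using field_differentiable_bound[of "{0..}" F F' B s t] F(1) B that
 by (auto intro: has_field_derivative_at_within)
 have iK0: "intl (ind K0 :: _ => real)" using emeasure_compact_finite[OF K0(1)] by simp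
 have linF: "norm (F s *R Dph x) <= \<bar>F 0\<bar> * C2 * ind K0 x + B * C2 * \<bar>s\<bar>" if "s >= 0" for s x
 proof -
 have "\<bar>F s\<bar> <= \<bar>F 0\<bar> + B * \<bar>s\<bar>" using lip[OF that, of 0] by auto
 then have "norm (F s *R Dph x) <= (\<bar>F 0\<bar> + B * \<bar>s\<bar>) * (C2 * ind K0 x)"
 unfolding norm_scaleR using C2(2)[of x] by (intro mult_mono) auto
 also have "... <= \<bar>F 0\<bar> * C2 * ind K0 x + B * C2 * \<bar>s\<bar>"
 using B0 C2(1) by (auto simp: indicator_def algebra_simps)
 finally show ?thesis .
 qed
 have iF: "intl (%x. F (h x) *R Dph x)" if h: "intl h" "!!x. h x >= 0" for h
 proof (rule B_integrable_bound)
 show "intl (%x. \<bar>F 0\<bar> * C2 * ind K0 x + B * C2 * \<bar>h x\<bar>)"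
 using h(1) iK0 by auto
 show "AE x in lborel. norm (F (h x) *R Dph x) <= norm (\<bar>F 0\<bar> * C2 * ind K0 x + B * C2 * \<bar>h x\<bar>)"
 by (intro AE_I2 order.trans[OF linF[OF h(2)]]) simp
 qed (use h(1) in measurable)
 have bF': "norm ((ph x * F' t) *R w) <= C1 * B * norm w" if "t >= 0" for x t and w :: "real^'n"
 proof -
 have "\<bar>ph x\<bar> <= C1" using C1(2)[of x] C1(1) by (cases "x \<in> K0") auto
 then have "\<bar>ph x\<bar> * \<bar>F' t\<bar> <= C1 * B" using B[OF that] C1(1) by (intro mult_mono) auto
 then show ?thesis by (simp add: abs_mult mult_right_mono)
 qed
 have iF': "intl (%x. (ph x * F' (h x)) *R w x)" if h: "h \<in> bmb" "!!x. h x >= 0" and w: "intl w" for h and w :: "real^'n => real^'n"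
 proof (rule B_integrable_bound[OF integrable_mult_right[OF integrable_norm[OF w], of "C1 * B"]])
 show "AE x in lborel. norm ((ph x * F' (h x)) *R w x) <= norm (C1 * B * norm (w x))"
 by (intro AE_I2 order.trans[OF bF'[OF h(2)]]) simp
 qed (use h(1) borel_measurable_integrable[OF w] in measurable)
 have step: "(LBINT x. F (?u n x) *R Dph x) = - (LBINT x. (ph x * F' (?u n x)) *R ?v n x)" for n
 proof -
 let ?Du = "%x. \<integral>y. U y *R mollifier_grad (r n) (x - y) \<partial>lborel"
 have "C1_on UNIV (%x. F (?u n x)) (%x. F' (?u n x) *R ?Du x)"
 using pos F by (intro C1_on_compose[OF C1_on_mollify[OF r(1) U]]) (auto intro: continuous_on_subset)
 from C1c_mult[OF open_UNIV this C1c_mono[OF ph subset_UNIV]]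
 have 0: "(LBINT x. F (?u n x) *R Dph x + ph x *R F' (?u n x) *R ?Du x) = 0"
 by (rule C1c_integral_grad_eq_0)
 have "ph x *R F' (?u n x) *R ?Du x = (ph x * F' (?u n x)) *R ?v n x" for x
 proof (cases "x \<in> K0")
 case True
 have "cball x (r n) \<subseteq> K" using K(4)[OF True] r(2)[of n] by (meson subset_cball subset_trans)
 from mollify_grad_eq[OF u(1) K(1,2) r(1) this] show ?thesis by (simp add: U_def V_def)
 qed (use K0 in simp)
 then have "(LBINT x. F (?u n x) *R Dph x + (ph x * F' (?u n x)) *R ?v n x) = 0" using 0 by (simp only:)
 moreover have "intl (%x. F (?u n x) *R Dph x)" using iF[OF iu pos(1)] .
 moreover have "intl (%x. (ph x * F' (?u n x)) *R ?v n x)"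
 using iu iv pos by (intro iF') auto
 ultimately show ?thesis by (simp add: eq_neg_iff_add_eq_0)
 qed
 have lim1: "(%n. \<integral>x. F (?u n x) *R Dph x \<partial>lborel) >-> (LBINT x. F (U x) *R Dph x)"
 proof (rule integral_tendsto_L1[OF iF[OF iu pos(1)] iF[OF U pos(2)]], rule integral_norm_tendsto_0)
 show "AE x in lborel. norm (F (?u n x) *R Dph x - F (U x) *R Dph x) <= B * C2 * norm (?u n x - U x)" for n
 proof (rule AE_I2)
 fix x
 have "norm (Dph x) <= C2" using C2(2)[of x] C2(1) by (cases "x \<in> K0") auto
 then have "\<bar>F (?u n x) - F (U x)\<bar> * norm (Dph x) <= (B * \<bar>?u n x - U x\<bar>) * C2"
 using lip[OF pos(1)[of n x] pos(2)[of x]] B0 by (intro mult_mono) auto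
 then show "norm (F (?u n x) *R Dph x - F (U x) *R Dph x) <= B * C2 * norm (?u n x - U x)"
 by (simp add: scaleR_diff_left[symmetric] mult_ac del: scaleR_diff_left)
 qed
 show "(%n. \<integral>x. B * C2 * norm (?u n x - U x) \<partial>lborel) >-> 0"
 using tendsto_mult_right_zero[OF L1u, of "B * C2"] by simp
 qed (use iu U in auto)
 have lim2: "(%n. \<integral>x. (ph x * F' (?u n x)) *R ?v n x \<partial>lborel) >-> (LBINT x. (ph x * F' (U x)) *R V x)"
 proof (rule integral_tendsto_L1, goal_cases)
 case (1 n) show ?case using iu iv pos by (intro iF') auto
 next
 case 2 show ?case using U V pos by (intro iF') auto
 next
 case 3
 \<comment> \<open>Splitting of the error: the gradients converge in L1 against the bounded factor
   \<open>F' (?u n x)\<close>, and the change of \<open>F'\<close> is handled by dominated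
   convergence against the fixed \<open>V\<close>.\<close>
 let ?h1 = "%n x. C1 * B * norm (?v n x - V x)" and ?h2 = "%n x. norm ((ph x * (F' (?u n x) - F' (U x))) *R V x)"
 have ih2: "norm ((ph x * (F' (?u n x) - F' (U x))) *R V x) <= 2 * C1 * B * norm (V x)" for n x
 proof -
 have "norm ((ph x * (F' (?u n x) - F' (U x))) *R V x) = norm ((ph x * F' (?u n x)) *R V x - (ph x * F' (U x)) *R V x)"
 by (simp add: algebra_simps)
 also have "... <= C1 * B * norm (V x) + C1 * B * norm (V x)"
 by (rule order.trans[OF norm_triangle_ineq4 add_mono[OF bF' bF']]) (use pos in auto)
 finally show ?thesis by (simp add: mult_ac)
 qed
 have i2: "intl (?h2 n)" for n
 proof (rule B_integrable_bound[OF integrable_mult_right[OF integrable_norm[OF V], of "2 * C1 * B"]])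
 show "AE x in lborel. norm (?h2 n x) <= norm (2 * C1 * B * norm (V x))"
 by (rule AE_I2) (use ih2 B0 C1 in \<open>auto intro: order.trans\<close>)
 qed (use iu in measurable)
 have l2: "(%n. \<integral>x. ?h2 n x \<partial>lborel) >-> (\<integral>x. 0 \<partial>(lborel :: (real^'n) measure))"
 proof (rule integral_dominated_convergence[where w="%x. 2 * C1 * B * norm (V x)"])
 show "AE x in lborel. (%n. ?h2 n x) >-> 0"
 using AEu
 proof eventually_elim
 case (elim x)
 have "(%n. F' (?u n x)) >-> F' (U x)"
 using continuous_on_tendsto_compose[OF F(2) elim] pos by auto
 then have "(%n. F' (?u n x) - F' (U x)) >-> 0" by (simp add: LIM_zero_iff)
 from tendsto_norm_zero[OF tendsto_scaleR[OF tendsto_mult_right_zero[OF this] tendsto_const[of "V x"], simplified]]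
 show ?case by simp
 qed
 show "AE x in lborel. norm (?h2 n x) <= 2 * C1 * B * norm (V x)" for n
 by (rule AE_I2) (use ih2 in simp)
 qed (use iu V in \<open>auto intro!: integrable_mult_right\<close>)
 show ?case
 proof (rule integral_norm_tendsto_0)
 show "AE x in lborel. norm ((ph x * F' (?u n x)) *R ?v n x - (ph x * F' (U x)) *R V x) <= ?h1 n x + ?h2 n x" for n
 proof (rule AE_I2)
 fix x
 have "(ph x * F' (?u n x)) *R ?v n x - (ph x * F' (U x)) *R V x
 = (ph x * F' (?u n x)) *R (?v n x - V x) + (ph x * (F' (?u n x) - F' (U x))) *R V x"
 by (simp add: algebra_simps)
 then show "norm ((ph x * F' (?u n x)) *R ?v n x - (ph x * F' (U x)) *R V x) <= ?h1 n x + ?h2 n x"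
 by (simp only:) (intro order.trans[OF norm_triangle_ineq] add_mono bF' pos order_refl)
 qed
 show "intl (%x. ?h1 n x + ?h2 n x)" for n
 using i2[of n] iv[of n] V by auto
 show "(%n. \<integral>x. ?h1 n x + ?h2 n x \<partial>lborel) >-> 0"
 proof -
 have "(LBINT x. ?h1 n x + ?h2 n x) = C1 * B * (LBINT x. norm (?v n x - V x)) + (LBINT x. ?h2 n x)" for n
 using i2[of n] iv[of n] V by (subst B_integral_add) auto
 then show ?thesis
 using tendsto_add[OF tendsto_mult_right_zero[OF L1v, of "C1 * B"] l2] by simp
 qed
 qed (use iu iv in measurable)
 qed
 have "(LBINT x. F (U x) *R Dph x) = - (LBINT x. (ph x * F' (U x)) *R V x)"
 using LIMSEQ_unique[OF lim1[unfolded step] tendsto_minus[OF lim2]] .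
 moreover have "F (U x) *R Dph x = F (u x) *R Dph x" "(ph x * F' (U x)) *R V x = (ph x * F' (u x)) *R g x" for x
 using K0(3,4)[of x] K(5) by (cases "x \<in> K0"; auto simp: U_def V_def)+
 ultimately show ?thesis by simp
qed

text \<open>Makes functions such as \<open>ze / (u + ep)\<close> available as test functions.
  Because \<open>ze * ph\<close> is again a C1 test function, the product rule follows from
  \<open>weak_chain_rule\<close>.\<close>

lemma weak_H1_C1c_mult_compose:
 fixes G :: "(real^'n) set"
 assumes G: "open G" and u: "weak_H1 G u g" "!!x. u x >= 0" and ze: "C1c G ze Dze"
 and F: "!!s. s >= 0 ==> (F has_real_derivative F' s) (at s)" "continuous_on {0..} F'"
 and B: "!!s. s >= 0 ==> \<bar>F' s\<bar> <= B" "!!s. s >= 0 ==> \<bar>F s\<bar> <= B"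
 and m[measurable]: "F \<in> bmb" "F' \<in> bmb"
 shows "weak_H1 G (%x. ze x * F (u x)) (%x. F (u x) *R Dze x + (ze x * F' (u x)) *R g x)"
 unfolding weak_H1_def
proof (intro conjI allI impI)
 note [measurable] = weak_H1D(1,2)[OF u(1)] C1c_measurable[OF ze]
 show "(%x. ze x * F (u x)) \<in> bmb"
 "(%x. F (u x) *R Dze x + (ze x * F' (u x)) *R g x) \<in> bmb" by measurable
 obtain K0 where K0: "compact K0" "K0 \<subseteq> G" "!!x. x \<notin> K0 ==> ze x = 0" "!!x. x \<notin> K0 ==> Dze x = 0"
 using C1c_support[OF ze] by metis
 have [measurable]: "K0 \<in> sets borel" using K0(1) borel_compact by auto
 have iK0: "intl (ind K0 :: _ => real)" using emeasure_compact_finite[OF K0(1)] by simp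
 obtain C1 where C1: "C1 > 0" "!!x. norm (ze x) <= C1 * ind K0 x"
 using bounded_compact_support[OF C1c_continuous(1)[OF ze] K0(1,3)] by blast
 obtain C2 where C2: "C2 > 0" "!!x. norm (Dze x) <= C2 * ind K0 x"
 using bounded_compact_support[OF C1c_continuous(2)[OF ze] K0(1,4)] by blast
 have B0: "B >= 0" using B(1)[of 0] by auto
 have b1: "norm (ze x * F (u x)) <= C1 * B * ind K0 x" for x
 using mult_mono[OF C1(2)[of x] B(2)[OF u(2)[of x]]] C1(1) B0 by (simp add: abs_mult mult_ac)
 have b2: "norm (F (u x) *R Dze x) <= C2 * B * ind K0 x" for x
 using mult_mono[OF C2(2)[of x] B(2)[OF u(2)[of x]]] C2(1) B0 by (simp add: abs_mult mult_ac)
 have b3: "norm ((ze x * F' (u x)) *R g x) <= C1 * B * (ind K0 x * norm (g x))" for x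
 using mult_right_mono[OF mult_mono[OF C1(2)[of x] B(1)[OF u(2)[of x]]], of "norm (g x)"] C1(1) B0 by (simp add: abs_mult mult_ac)
 {
 fix K assume K: "compact K & K \<subseteq> G"
 then have [measurable]: "K \<in> sets borel" using borel_compact by blast
 show "set_integrable lborel K (%x. (ze x * F (u x))^2)"
 unfolding set_integrable_def
 proof (rule B_integrable_bound)
 show "intl (%x. (C1 * B)^2 * ind K0 x)" using iK0 by simp
 show "AE x in lborel. norm (ind K x *R (ze x * F (u x))^2) <= norm ((C1 * B)^2 * ind K0 x)"
 proof (rule AE_I2)
 fix x
 have "(ze x * F (u x))^2 <= (C1 * B * ind K0 x)^2"
 using power_mono[OF b1[of x], of 2] by simp
 then show "norm (ind K x *R (ze x * F (u x))^2) <= norm ((C1 * B)^2 * ind K0 x)"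
 by (auto simp: indicator_def split: if_splits)
 qed
 qed measurable
 show "set_integrable lborel K (%x. (norm (F (u x) *R Dze x + (ze x * F' (u x)) *R g x))^2)"
 unfolding set_integrable_def
 proof (rule B_integrable_bound)
 show "intl (%x. 2 * (C2 * B)^2 * ind K0 x + 2 * (C1 * B)^2 * (ind K0 x * (norm (g x))^2))"
 using iK0 weak_H1D(6)[OF u(1) K0(1,2)] by (intro B_integrable_add integrable_mult_right)
 show "AE x in lborel. norm (ind K x *R (norm (F (u x) *R Dze x + (ze x * F' (u x)) *R g x))^2)
 <= norm (2 * (C2 * B)^2 * ind K0 x + 2 * (C1 * B)^2 * (ind K0 x * (norm (g x))^2))"
 proof (rule AE_I2)
 fix x
 let ?w = "F (u x) *R Dze x + (ze x * F' (u x)) *R g x"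
 have "norm ?w <= C2 * B * ind K0 x + C1 * B * (ind K0 x * norm (g x))"
 by (rule norm_triangle_le[OF add_mono[OF b2 b3]])
 then have "(norm ?w)^2 <= (C2 * B * ind K0 x + C1 * B * (ind K0 x * norm (g x)))^2"
 by (intro power_mono) auto
 also have "... <= 2 * (C2 * B * ind K0 x)^2 + 2 * (C1 * B * (ind K0 x * norm (g x)))^2"
 using sum_squares_bound[of "C2 * B * ind K0 x" "C1 * B * (ind K0 x * norm (g x))"]
 by (simp add: power2_sum)
 also have "... = 2 * (C2 * B)^2 * ind K0 x + 2 * (C1 * B)^2 * (ind K0 x * (norm (g x))^2)"
 by (simp add: indicator_def power_mult_distrib)
 finally show "norm (ind K x *R (norm ?w)^2) <= norm (2 * (C2 * B)^2 * ind K0 x + 2 * (C1 * B)^2 * (ind K0 x * (norm (g x))^2))"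
 by (auto simp: indicator_def split: if_splits)
 qed
 qed measurable
 }
 fix ph Dph assume ph: "C1c G ph Dph"
 note [measurable] = C1c_measurable[OF ph]
 have P: "C1c G (%x. ze x * ph x) (%x. ze x *R Dph x + ph x *R Dze x)"
 by (rule C1c_mult[OF G C1_on_subset[OF C1cD1[OF ze] subset_UNIV] ph])
 have ch: "(LBINT x. F (u x) *R (ze x *R Dph x + ph x *R Dze x)) = - (LBINT x. ((ze x * ph x) * F' (u x)) *R g x)"
 by (rule weak_chain_rule[OF G u P F B(1) m])
 obtain B1 where B1: "B1 > 0" "!!x. norm (ph x) <= B1"
 using C1c_support[OF ph] bounded_compact_support[OF C1c_continuous(1)[OF ph]] by (smt (verit, ccfv_SIG) indicator_simps mult_cancel_left1 mult_zero_right norm_zero)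
 obtain B2 where B2: "B2 > 0" "!!x. norm (Dph x) <= B2"
 using C1c_support[OF ph] bounded_compact_support[OF C1c_continuous(2)[OF ph]] by (smt (verit, ccfv_SIG) indicator_simps mult_cancel_left1 mult_zero_right norm_zero)
 have i1: "intl (%x. (ze x * F (u x)) *R Dph x)"
 proof (rule B_integrable_bound[OF integrable_mult_right[OF iK0, of "C1 * B * B2"]])
 show "AE x in lborel. norm ((ze x * F (u x)) *R Dph x) <= norm (C1 * B * B2 * ind K0 x)"
 proof (rule AE_I2)
 fix x
 show "norm ((ze x * F (u x)) *R Dph x) <= norm (C1 * B * B2 * ind K0 x)"
 using mult_mono[OF b1[of x] B2(2)[of x]] C1(1) B0 B2(1) by (simp add: abs_mult mult_ac)
 qed
 qed measurable
 have i2: "intl (%x. ph x *R F (u x) *R Dze x)"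
 proof (rule B_integrable_bound[OF integrable_mult_right[OF iK0, of "B1 * (C2 * B)"]])
 show "AE x in lborel. norm (ph x *R F (u x) *R Dze x) <= norm (B1 * (C2 * B) * ind K0 x)"
 proof (rule AE_I2)
 fix x
 show "norm (ph x *R F (u x) *R Dze x) <= norm (B1 * (C2 * B) * ind K0 x)"
 using mult_mono[OF B1(2)[of x] b2[of x]] C2(1) B0 B1(1) by (simp add: abs_mult mult_ac)
 qed
 qed measurable
 have i3: "intl (%x. ph x *R (ze x * F' (u x)) *R g x)"
 proof (rule B_integrable_bound[OF integrable_mult_right[OF integrable_norm[OF weak_H1D(4)[OF u(1) K0(1,2)]], of "B1 * (C1 * B)"]])
 show "AE x in lborel. norm (ph x *R (ze x * F' (u x)) *R g x) <= norm (B1 * (C1 * B) * norm (ind K0 x *R g x))"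
 proof (rule AE_I2)
 fix x
 show "norm (ph x *R (ze x * F' (u x)) *R g x) <= norm (B1 * (C1 * B) * norm (ind K0 x *R g x))"
 using mult_mono[OF B1(2)[of x] b3[of x]] C1(1) B0 B1(1) by (simp add: abs_mult mult_ac)
 qed
 qed measurable
 have e1: "(LBINT x. F (u x) *R (ze x *R Dph x + ph x *R Dze x))
 = (LBINT x. (ze x * F (u x)) *R Dph x) + (LBINT x. ph x *R F (u x) *R Dze x)"
 using i1 i2 by (subst B_integral_add[symmetric]) (auto simp: algebra_simps)
 have e2: "(LBINT x. ph x *R (F (u x) *R Dze x + (ze x * F' (u x)) *R g x))
 = (LBINT x. ph x *R F (u x) *R Dze x) + (LBINT x. ph x *R (ze x * F' (u x)) *R g x)"
 using i2 i3 by (subst B_integral_add[symmetric]) (auto simp: scaleR_add_right)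
 have e3: "(LBINT x. ((ze x * ph x) * F' (u x)) *R g x) = (LBINT x. ph x *R (ze x * F' (u x)) *R g x)"
 by (simp add: mult_ac)
 have "a = - Y" if "X = a + b" "Y = b + c" "Z = c" "X = - Z" for a b c X Y Z :: "real^'n"
 proof -
 have "a + (b + c) = (a + b) + c" by (rule add.assoc[symmetric])
 also have "a + b = - c" using that by simp
 also have "- c + c = 0" by (rule left_minus)
 finally show ?thesis using that(2) by (simp only: eq_neg_iff_add_eq_0)
 qed
 from this[OF e1 e2 e3 ch] show "(LBINT x. (ze x * F (u x)) *R Dph x) = - (LBINT x. ph x *R (F (u x) *R Dze x + (ze x * F' (u x)) *R g x))"
 .
qed

text \<open>By Lindelof's theorem countably many of the balls cover \<open>S\<close>, so only
  countably many null sets are joined.\<close>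

lemma AE_open_local:
 fixes S :: "'a::euclidean_space set"
 assumes "!!x. x \<in> S ==> \<exists>e>0. AE y in lborel. y \<in> ball x e --> P y"
 shows "AE y in lborel. y \<in> S --> P y"
proof -
 obtain e where e: "!!x. x \<in> S ==> e x > 0" "!!x. x \<in> S ==> AE y in lborel. y \<in> ball x (e x) --> P y"
 using assms by metis
 obtain F where F: "F \<subseteq> (%x. ball x (e x)) ` S" "countable F" "\<Union>F = \<Union>((%x. ball x (e x)) ` S)"
 using Lindelof[of "(%x. ball x (e x)) ` S"] by blast
 have "AE y in lborel. \<forall>B\<in>F. y \<in> B --> P y"
 using F(1,2) e(2) by (subst AE_ball_countable) auto
 then show ?thesis
 proof eventually_elim
 case (elim y)
 show ?case
 proof
 assume "y \<in> S"
 then have "y \<in> \<Union>F" unfolding F(3) using e(1) by (intro UnionI[of "ball y (e y)"]) auto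
 then show "P y" using elim by blast
 qed
 qed
qed

text \<open>Off the closed set the mollified weak gradient is the gradient of a mollification of 0,
  and it converges almost everywhere to \<open>g\<close>.\<close>

lemma weak_grad_zero:
 assumes G: "open G" and u: "weak_H1 G u g" and K: "closed K" "!!x. x \<notin> K ==> u x = 0"
 shows "AE x in lborel. x \<in> G - K --> g x = 0"
proof (rule AE_open_local)
 fix x0 assume "x0 \<in> G - K"
 moreover have "open (G - K)" using G K(1) by (rule open_Diff)
 ultimately obtain e where e: "e > 0" "cball x0 e \<subseteq> G - K" using open_contains_cball_eq by blast
 define rh where "rh = e / 2"
 have rh: "rh > 0" "cball x0 (2 * rh) \<subseteq> G - K" using e by (auto simp: rh_def)
 define K1 where "K1 = cball x0 (2 * rh)"
 have K1: "compact K1" "K1 \<subseteq> G" using rh by (auto simp: K1_def)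
 have V: "intl (%y. ind K1 y *R g y)" by (rule weak_H1D(4)[OF u K1])
 define r where "r = (%n. rh / real (Suc n))"
 have r: "r n > 0" "r n <= rh" for n using rh(1) by (auto simp: r_def divide_le_eq)
 have "r >-> 0" unfolding r_def by (rule LIMSEQ_Suc[OF lim_const_over_n])
 then obtain s where s: "AE x in lborel. (%n. mollify (r (s n)) (%y. ind K1 y *R g y) x) >-> ind K1 x *R g x"
 by (rule mollify_AE_subseq[OF V r(1)])
 have "AE y in lborel. y \<in> ball x0 rh --> g y = 0"
 using s
 proof eventually_elim
 case (elim x)
 show ?case
 proof
 assume x: "x \<in> ball x0 rh"
 have "mollify (r n) (%y. ind K1 y *R g y) x = 0" for n
 proof -
 have "cball x (r n) \<subseteq> K1"
 unfolding K1_def using x r(2)[of n] by (intro cball_subset_cball_iff[THEN iffD2]) (auto simp: dist_commute)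
 from mollify_grad_eq[OF u K1 r(1) this, symmetric]
 have "mollify (r n) (%y. ind K1 y *R g y) x = (LBINT y. (ind K1 y *R u y) *R mollifier_grad (r n) (x - y))" .
 also have "(%y. (ind K1 y *R u y) *R mollifier_grad (r n) (x - y)) = (%y. 0)"
 proof
 fix y
 have "ind K1 y *R u y = 0" using K(2)[of y] rh(2) unfolding K1_def by (cases "y \<in> cball x0 (2*rh)") auto
 then show "(ind K1 y *R u y) *R mollifier_grad (r n) (x - y) = 0" by simp
 qed
 finally show ?thesis by simp
 qed
 then have "(%n::nat. 0) >-> ind K1 x *R g x" using elim by simp
 then have "ind K1 x *R g x = 0" using LIMSEQ_unique tendsto_const by blast
 moreover have "x \<in> K1" unfolding K1_def using x rh(1) by auto
 ultimately show "g x = 0" by simp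
 qed
 qed
 then show "\<exists>e>0. AE y in lborel. y \<in> ball x0 e --> g y = 0" using rh(1) by blast
qed

lemma integrable_inner_L2:
 fixes F V :: "'a => 'b::euclidean_space"
 assumes [measurable]: "F \<in> borel_measurable M" "V \<in> borel_measurable M"
 and "integrable M (%x. (norm (F x))^2)" "integrable M (%x. (norm (V x))^2)"
 shows "integrable M (%x. F x <.> V x)"
proof (rule B_integrable_bound[OF B_integrable_add[OF assms(3,4)]])
 show "AE x in M. norm (F x <.> V x) <= norm ((norm (F x))^2 + (norm (V x))^2)"
 proof (rule AE_I2)
 fix x
 have "2 * (norm (F x) * norm (V x)) <= (norm (F x))^2 + (norm (V x))^2"
 using sum_squares_bound[of "norm (F x)" "norm (V x)"] by simp
 moreover have "0 <= norm (F x) * norm (V x)" by simp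
 ultimately show "norm (F x <.> V x) <= norm ((norm (F x))^2 + (norm (V x))^2)"
 using Cauchy_Schwarz_ineq2[of "F x" "V x"] by (simp del: mult_nonneg_nonneg)
 qed
qed measurable

text \<open>Convergence in L1 together with an L2 bound gives weak convergence in L2: where
  \<open>norm (F x)\<close> is at most \<open>k\<close> the L1 distance controls the error,
  elsewhere the small tail of \<open>F\<close> is weighed against the L2 bound.\<close>

lemma integral_inner_tendsto:
 fixes F :: "'a => 'b::euclidean_space"
 assumes F[measurable]: "F \<in> borel_measurable M" and F2: "integrable M (%x. (norm (F x))^2)"
 and V: "!!n. integrable M (V n)" "integrable M h"
 and V2: "!!n. integrable M (%x. (norm (V n x))^2)" "integrable M (%x. (norm (h x))^2)"
 and C: "!!n. (\<integral>x. (norm (V n x))^2 \<partial>M) <= C" "(\<integral>x. (norm (h x))^2 \<partial>M) <= C"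
 and lim: "(%n. \<integral>x. norm (V n x - h x) \<partial>M) >-> 0"
 shows "(%n. \<integral>x. F x <.> V n x \<partial>M) >-> (\<integral>x. F x <.> h x \<partial>M)"
proof (rule LIMSEQ_I)
 fix e :: real assume e: "e > 0"
 have [measurable]: "V n \<in> borel_measurable M" "h \<in> borel_measurable M" for n using V by auto
 have C0: "C >= 0" using C(2) by (rule order.trans[rotated]) (intro integral_nonneg_AE AE_I2, simp)
 \<comment> \<open>Weight in Young's inequality, small enough that the L2 bounds contribute at most
   \<open>e / 4\<close>.\<close>
 define t where "t = e / (16 * (C + 1))"
 have t: "t > 0" using e C0 by (simp add: t_def)
 \<comment> \<open>Tail of \<open>F\<close> above the level \<open>k\<close>; its integral tends to
   0 as \<open>k\<close> grows.\<close>
 define T where "T k x = (if norm (F x) <= real k then 0 else (norm (F x))^2)" for k x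
 have [measurable]: "T k \<in> borel_measurable M" for k unfolding T_def[abs_def] by measurable
 have T0: "0 <= T k x" "T k x <= (norm (F x))^2" for k x by (auto simp: T_def)
 have iT: "integrable M (T k)" for k
 by (rule B_integrable_bound[OF F2]) (use T0 in auto)
 have "(%k. \<integral>x. T k x \<partial>M) >-> (\<integral>x. 0 \<partial>M)"
 proof (rule integral_dominated_convergence[where w="%x. (norm (F x))^2"])
 show "AE x in M. (%k. T k x) >-> 0"
 proof (rule AE_I2)
 fix x
 obtain k0 where k0: "norm (F x) <= real k0" using real_arch_simple by blast
 have "T k x = 0" if "k >= k0" for k using that k0 by (simp add: T_def)
 then show "(%k. T k x) >-> 0" by (intro tendsto_eventually) (auto simp: eventually_sequentially)
 qed
 qed (use F2 T0 in auto)
 then have "eventually (%k. (\<integral>x. T k x \<partial>M) < t * e) sequentially"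
 using order_tendstoD(2)[of _ "0::real" sequentially "t * e"] t e by simp
 then obtain k where k: "(\<integral>x. T k x \<partial>M) < t * e" by (auto simp: eventually_sequentially)
 have "eventually (%n. (\<integral>x. norm (V n x - h x) \<partial>M) < e / (4 * (real k + 1))) sequentially"
 using order_tendstoD(2)[OF lim, of "e / (4 * (real k + 1))"] e by simp
 then obtain n0 where n0: "!!n. n >= n0 ==> (\<integral>x. norm (V n x - h x) \<partial>M) < e / (4 * (real k + 1))"
 by (auto simp: eventually_sequentially)
 have "norm ((\<integral>x. F x <.> V n x \<partial>M) - (\<integral>x. F x <.> h x \<partial>M)) < e" if n: "n >= n0" for n
 proof -
 have i1: "integrable M (%x. F x <.> V n x)" "integrable M (%x. F x <.> h x)"
 using F2 V2 by (auto intro!: integrable_inner_L2)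
 have iw: "integrable M (%x. norm (V n x - h x))" using V by auto
 have "(\<integral>x. F x <.> V n x \<partial>M) - (\<integral>x. F x <.> h x \<partial>M) = (\<integral>x. F x <.> V n x - F x <.> h x \<partial>M)"
 using i1 by simp
 also have "norm ... <= (\<integral>x. real k * norm (V n x - h x) + (1 / (4 * t)) * T k x
 + 2 * t * ((norm (V n x))^2 + (norm (h x))^2) \<partial>M)"
 proof (rule norm_integral_le)
 show "integrable M (%x. F x <.> V n x - F x <.> h x)" using i1 by auto
 show "integrable M (%x. real k * norm (V n x - h x) + (1 / (4 * t)) * T k x + 2 * t * ((norm (V n x))^2 + (norm (h x))^2))"
 using iw iT V2 by (intro B_integrable_add integrable_mult_right)
 show "AE x in M. norm (F x <.> V n x - F x <.> h x) <= real k * norm (V n x - h x) + (1 / (4 * t)) * T k x + 2 * t * ((norm (V n x))^2 + (norm (h x))^2)"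
 proof (rule AE_I2)
 fix x
 define w where "w = norm (V n x - h x)"
 have w0: "w >= 0" by (simp add: w_def)
 have "w^2 <= (norm (V n x) + norm (h x))^2" unfolding w_def by (intro power_mono norm_triangle_ineq4) auto
 also have "... <= 2 * ((norm (V n x))^2 + (norm (h x))^2)"
 using sum_squares_bound[of "norm (V n x)" "norm (h x)"] by (simp add: power2_sum)
 finally have w2: "t * w^2 <= 2 * t * ((norm (V n x))^2 + (norm (h x))^2)"
 using t mult_left_mono[of "w^2" _ t] by (simp add: mult_ac)
 have "norm (F x <.> V n x - F x <.> h x) <= norm (F x) * w"
 using Cauchy_Schwarz_ineq2[of "F x" "V n x - h x"] by (simp add: inner_diff_right w_def)
 also have "... <= real k * w + (1 / (4 * t)) * T k x + t * w^2"
 proof (cases "norm (F x) <= real k")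
 case True
 then have "norm (F x) * w <= real k * w" using w0 by (rule mult_right_mono)
 then show ?thesis using T0(1)[of k x] t by (simp add: add_increasing2)
 next
 case False
 have "0 <= (norm (F x) / (2 * t) - w)^2 * t" using t by simp
 also have "... = (norm (F x))^2 / (4 * t) - norm (F x) * w + t * w^2"
 using t by (simp add: power2_eq_square field_simps)
 finally have "norm (F x) * w <= (1 / (4 * t)) * T k x + t * w^2" using False by (simp add: T_def)
 moreover have "0 <= real k * w" using w0 by simp
 ultimately show ?thesis by linarith
 qed
 finally show "norm (F x <.> V n x - F x <.> h x) <= real k * norm (V n x - h x) + (1 / (4 * t)) * T k x + 2 * t * ((norm (V n x))^2 + (norm (h x))^2)"
 using w2 by (simp add: w_def)
 qed
 qed
 also have "... = real k * (\<integral>x. norm (V n x - h x) \<partial>M) + (1 / (4 * t)) * (\<integral>x. T k x \<partial>M)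
 + 2 * t * ((\<integral>x. (norm (V n x))^2 \<partial>M) + (\<integral>x. (norm (h x))^2 \<partial>M))"
 using iw iT V2 by simp
 also have "... < e / 4 + e / 4 + e / 4 + e / 4"
 proof -
 have "real k * (\<integral>x. norm (V n x - h x) \<partial>M) <= real k * (e / (4 * (real k + 1)))"
 using n0[OF n] by (intro mult_left_mono) auto
 also have "... <= e / 4" using e by (simp add: field_simps)
 finally have 1: "real k * (\<integral>x. norm (V n x - h x) \<partial>M) <= e / 4" .
 have 2: "(1 / (4 * t)) * (\<integral>x. T k x \<partial>M) < e / 4" using k t by (simp add: field_simps)
 have "2 * t * ((\<integral>x. (norm (V n x))^2 \<partial>M) + (\<integral>x. (norm (h x))^2 \<partial>M)) <= 2 * t * (C + C)"
 using C t by (intro mult_left_mono add_mono) auto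
 also have "... = (e / 4) * (C / (C + 1))" using C0 by (simp add: t_def field_simps)
 also have "... <= e / 4 * 1" using C0 e by (intro mult_left_mono) auto
 finally show ?thesis using 1 2 e by linarith
 qed
 finally show ?thesis by simp
 qed
 then show "\<exists>no. \<forall>n\<ge>no. norm ((\<integral>x. F x <.> V n x \<partial>M) - (\<integral>x. F x <.> h x \<partial>M)) < e" by blast
qed

text \<open>A weak inequality tested with C1 functions is carried over to compactly supported H1
  functions by mollifying them. Boundedness of \<open>f\<close> on compact sets controls the left
  side, weak L2 convergence of the gradients the right side.\<close>

lemma test_inequality_extends:
 fixes G :: "(real^'n) set"
 assumes G: "open G"
 and b[measurable]: "b \<in> bmb"
 and b2: "!!K. compact K ==> K \<subseteq> G ==> intl (%x. ind K x * (norm (b x))^2)"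
 and f[measurable]: "f \<in> bmb"
 and fb: "!!K. compact K ==> K \<subseteq> G ==> \<exists>B. \<forall>x\<in>K. \<bar>f x\<bar> <= B"
 and test: "!!et Det. C1c G et Det ==> (!!x. et x >= 0) ==> (LBINT x. f x * et x) <= (LBINT x. b x <.> Det x)"
 and ph: "weak_H1 G ph D" "!!x. ph x >= 0" "compact K0" "K0 \<subseteq> G" "!!x. x \<notin> K0 ==> ph x = 0"
 shows "intl (%x. f x * ph x)"
 and "(LBINT x. f x * ph x) <= (LBINT x. ind G x * (b x <.> D x))"
proof -
 note [measurable] = weak_H1D(1,2)[OF ph(1)]
 \<comment> \<open>Two margins: \<open>K2\<close> contains the supports of the mollified functions,
   and \<open>K1\<close> contains the balls on which their gradients are computed from
   \<open>D\<close>.\<close>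
 obtain K2 d where K2: "compact K2" "K2 \<subseteq> G" "d > 0" "!!x. x \<in> K0 ==> cball x d \<subseteq> K2" "K0 \<subseteq> K2"
 "!!y. y \<in> K2 ==> \<exists>x\<in>K0. dist x y <= d"
 using compact_neighbourhood[OF ph(3) G ph(4)] by metis
 obtain K1 d' where K1: "compact K1" "K1 \<subseteq> G" "d' > 0" "!!x. x \<in> K2 ==> cball x d' \<subseteq> K1" "K2 \<subseteq> K1"
 using compact_neighbourhood[OF K2(1) G K2(2)] by metis
 have [measurable]: "K0 \<in> sets borel" "K1 \<in> sets borel" "K2 \<in> sets borel" "G \<in> sets borel"
 using ph(3) K1(1) K2(1) G borel_compact by auto
 have U0: "(%x. ind K1 x *R ph x) = ph"
 proof
 fix x show "ind K1 x *R ph x = ph x"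
 using ph(5)[of x] K2(5) K1(5) by (cases "x \<in> K0") auto
 qed
 have U: "intl ph" using weak_H1D(3)[OF ph(1) K1(1,2)] unfolding U0 .
 define V where "V = (%x. ind K1 x *R D x)"
 have V: "intl V" unfolding V_def by (rule weak_H1D(4)[OF ph(1) K1(1,2)])
 have V2: "intl (%x. (norm (V x))^2)"
 proof -
 have "(%x. (norm (V x))^2) = (%x. ind K1 x * (norm (D x))^2)" by (auto simp: V_def indicator_def)
 then show ?thesis using weak_H1D(6)[OF ph(1) K1(1,2)] by simp
 qed
 define r where "r = (%n. min d d' / real (Suc n))"
 have r: "r n > 0" "r n <= d" "r n <= d'" for n
 proof -
 have "min d d' / real (Suc n) <= min d d' / 1" using K1(3) K2(3) by (intro divide_left_mono) auto
 then show "r n > 0" "r n <= d" "r n <= d'" using K1(3) K2(3) by (auto simp: r_def)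
 qed
 have r_lim: "r >-> 0" unfolding r_def by (rule LIMSEQ_Suc[OF lim_const_over_n])
 let ?u = "%n. mollify (r n) ph" and ?v = "%n. mollify (r n) V"
 have L1u: "(%n. \<integral>x. norm (?u n x - ph x) \<partial>lborel) >-> 0" by (rule mollify_tendsto_L1[OF U r(1) r_lim])
 have L1v: "(%n. \<integral>x. norm (?v n x - V x) \<partial>lborel) >-> 0" by (rule mollify_tendsto_L1[OF V r(1) r_lim])
 have iu: "intl (?u n)" and iv: "intl (?v n)" for n
 using integrable_mollify[OF r(1)] U V by auto
 let ?Du = "%n x. \<integral>y. ph y *R mollifier_grad (r n) (x - y) \<partial>lborel"
 have off: "?u n x = 0" "?Du n x = 0" if x: "x \<notin> K2" for n x
 proof -
 have "mollifier (r n) (x - y) *R ph y = 0 & ph y *R mollifier_grad (r n) (x - y) = 0" for y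
 proof (cases "y \<in> K0")
 case True
 then have "x \<notin> cball y d" using K2(4)[OF True] x by blast
 then have "norm (x - y) >= r n" using r(2)[of n] by (simp add: dist_norm norm_minus_commute)
 then show ?thesis using mollifier_eq_0[OF r(1), of n "x - y"] mollifier_grad_eq_0[OF r(1), of n "x - y"] by simp
 qed (use ph(5) in simp)
 then have "(%y. mollifier (r n) (x - y) *R ph y) = (%y. 0)" "(%y. ph y *R mollifier_grad (r n) (x - y)) = (%y. 0)"
 by auto
 then show "?u n x = 0" "?Du n x = 0" unfolding mollify_def by (simp_all only: integral_zero)
 qed
 have on: "?Du n x = ?v n x" if x: "x \<in> K2" for n x
 proof -
 have "cball x (r n) \<subseteq> K1" using K1(4)[OF x] r(3)[of n] by (meson subset_cball subset_trans)
 from mollify_grad_eq[OF ph(1) K1(1,2) r(1) this] show ?thesis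
 unfolding V_def fun_cong[OF U0] .
 qed
 have Du: "?Du n x = ind K2 x *R ?v n x" for n x using on off by (cases "x \<in> K2") auto
 have C: "C1c G (?u n) (?Du n)" for n
 by (rule C1cI[OF G C1_on_subset[OF C1_on_mollify[OF r(1) U] subset_UNIV] K2(1,2) off])
 have upos: "?u n x >= 0" for n x by (rule mollify_nonneg[OF r(1)]) (use ph(2) in simp)
 have ineq: "(LBINT x. f x * ?u n x) <= (LBINT x. (ind K2 x *R b x) <.> ?v n x)" for n
 using test[OF C upos, of n] unfolding Du by (simp add: mult.commute)
 have lim1: "(%n. \<integral>x. (ind K2 x *R b x) <.> ?v n x \<partial>lborel) >-> (LBINT x. (ind K2 x *R b x) <.> V x)"
 proof (rule integral_inner_tendsto[OF _ _ iv V _ V2 _ order_refl L1v])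
 have "(%x. (norm (ind K2 x *R b x))^2) = (%x. ind K2 x * (norm (b x))^2)" by (auto simp: indicator_def)
 then show "intl (%x. (norm (ind K2 x *R b x))^2)" using b2[OF K2(1,2)] by simp
 show "intl (%x. (norm (?v n x))^2)" "(LBINT x. (norm (?v n x))^2) <= (LBINT x. (norm (V x))^2)" for n
 by (rule mollify_L2_le[OF r(1) V V2])+
 qed measurable
 obtain B where B: "!!x. x \<in> K2 ==> \<bar>f x\<bar> <= B" using fb[OF K2(1,2)] by blast
 have bf: "\<bar>f x * w\<bar> <= \<bar>B\<bar> * \<bar>w\<bar>" if "x \<notin> K2 ==> w = 0" for x w
 using that B[of x] mult_right_mono[of "\<bar>f x\<bar>" "\<bar>B\<bar>" "\<bar>w\<bar>"] by (cases "x \<in> K2") (auto simp: abs_mult)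
 have ph0: "ph x = 0" if "x \<notin> K2" for x using ph(5) K2(5) that by blast
 show ifph: "intl (%x. f x * ph x)"
 proof (rule B_integrable_bound[OF integrable_mult_right[OF integrable_abs[OF U], of "\<bar>B\<bar>"]])
 show "AE x in lborel. norm (f x * ph x) <= norm (\<bar>B\<bar> * \<bar>ph x\<bar>)"
 by (rule AE_I2) (use bf ph0 in \<open>simp add: abs_mult\<close>)
 qed measurable
 have lim2: "(%n. \<integral>x. f x * ?u n x \<partial>lborel) >-> (LBINT x. f x * ph x)"
 proof (rule integral_tendsto_L1[OF _ ifph], goal_cases)
 case (1 n)
 show ?case
 proof (rule B_integrable_bound[OF integrable_mult_right[OF integrable_abs[OF iu], of "\<bar>B\<bar>"]])
 show "AE x in lborel. norm (f x * ?u n x) <= norm (\<bar>B\<bar> * \<bar>?u n x\<bar>)"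
 by (rule AE_I2) (use bf off(1) in \<open>simp add: abs_mult\<close>)
 qed measurable
 next
 case 2
 show ?case
 proof (rule integral_norm_tendsto_0)
 show "AE x in lborel. norm (f x * ?u n x - f x * ph x) <= \<bar>B\<bar> * norm (?u n x - ph x)" for n
 proof (rule AE_I2)
 fix x show "norm (f x * ?u n x - f x * ph x) <= \<bar>B\<bar> * norm (?u n x - ph x)"
 using bf[of x "?u n x - ph x"] off(1) ph0 by (simp add: right_diff_distrib)
 qed
 show "intl (%x. \<bar>B\<bar> * norm (?u n x - ph x))" for n using iu U by auto
 show "(%n. \<integral>x. \<bar>B\<bar> * norm (?u n x - ph x) \<partial>lborel) >-> 0"
 using tendsto_mult_right_zero[OF L1u, of "\<bar>B\<bar>"] by simp
 qed measurable
 qed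
 have "(LBINT x. f x * ph x) <= (LBINT x. (ind K2 x *R b x) <.> V x)"
 by (rule LIMSEQ_le[OF lim2 lim1]) (use ineq in blast)
 also have "... = (LBINT x. ind G x * (b x <.> D x))"
 proof (rule integral_cong_AE)
 show "AE x in lborel. (ind K2 x *R b x) <.> V x = ind G x * (b x <.> D x)"
 proof -
 \<comment> \<open>\<open>D\<close> is determined only almost everywhere, so its vanishing off the
   support of \<open>ph\<close> has to be derived before \<open>K2\<close> can be replaced by
   \<open>G\<close>.\<close>
 have "AE x in lborel. x \<in> G - K0 --> D x = 0"
 by (rule weak_grad_zero[OF G ph(1) compact_imp_closed[OF ph(3)]]) (rule ph(5))
 then show ?thesis
 proof eventually_elim
 case (elim x)
 show ?case
 proof (cases "x \<in> K2")
 case True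
 then have "x \<in> K1" "x \<in> G" using K1(5) K2(2) by auto
 then show ?thesis using True by (simp add: V_def)
 next
 case False
 then have "x \<in> G ==> D x = 0" using elim K2(5) by blast
 then show ?thesis using False by (cases "x \<in> G") auto
 qed
 qed
 qed
 show "(%x. (ind K2 x *R b x) <.> V x) \<in> borel_measurable lborel" unfolding V_def by measurable
 qed measurable
 finally show "(LBINT x. f x * ph x) <= (LBINT x. ind G x * (b x <.> D x))" .
qed

section \<open>Local integrability of the logarithm\<close>

text \<open>Fundamental theorem along the segment from \<open>x\<close> to \<open>x + h\<close> for
  mollifications, then Fubini. The radius \<open>3 * r\<close> leaves one \<open>r\<close> for the
  ball, one for the shift and one for the mollifier.\<close>

lemma weak_translation_estimate:
 fixes G :: "(real^'n) set"
 assumes u: "weak_H1 G u g" and r: "r > 0" "cball x0 (3 * r) \<subseteq> G" and h: "norm h <= r"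
 shows "(\<integral>\<^sup>+x. ind (ball x0 r) x * ennreal \<bar>u (x + h) - u x\<bar> \<partial>lborel)
 <= ennreal (norm h * (LBINT x. ind (cball x0 (3 * r)) x * norm (g x)))"
proof -
 define K where "K = cball x0 (3 * r)"
 have K: "compact K" "K \<subseteq> G" using r by (auto simp: K_def)
 have [measurable]: "K \<in> sets borel" using K borel_compact by auto
 note [measurable] = weak_H1D(1,2)[OF u]
 define U where "U = (%y. ind K y *R u y)"
 define V where "V = (%y. ind K y *R g y)"
 have U: "intl U" and V: "intl V"
 unfolding U_def V_def by (rule weak_H1D(3)[OF u K] weak_H1D(4)[OF u K])+
 note [measurable] = borel_measurable_integrable[OF U] borel_measurable_integrable[OF V]
 define s where "s = (%n. r / real (Suc n))"
 have s: "s n > 0" "s n <= r" for n using r by (auto simp: s_def divide_le_eq)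
 have s_lim: "s >-> 0" unfolding s_def by (rule LIMSEQ_Suc[OF lim_const_over_n])
 let ?u = "%n. mollify (s n) U" and ?v = "%n. mollify (s n) V"
 let ?B = "ind (ball x0 r) :: _ => ennreal"
 define de where "de n = (LBINT x. norm (?u n x - U x))" for n
 define de' where "de' n = (LBINT x. norm (?v n x - V x))" for n
 have L1: "de >-> 0" "de' >-> 0"
 unfolding de_def[abs_def] de'_def[abs_def]
 by (rule mollify_tendsto_L1[OF U s(1) s_lim] mollify_tendsto_L1[OF V s(1) s_lim])+
 have iu: "intl (?u n)" and iv: "intl (?v n)" for n
 using integrable_mollify[OF s(1)] U V by auto
 have step: "(\<integral>\<^sup>+x. ?B x * ennreal \<bar>?u n (x + h) - ?u n x\<bar> \<partial>lborel) <= ennreal (norm h * ((LBINT x. norm (V x)) + de' n))" for n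
 proof -
 let ?Du = "%x. \<integral>y. U y *R mollifier_grad (s n) (x - y) \<partial>lborel"
 note C1 = C1_on_mollify[OF s(1) U, of n]
 have pw: "?B x * ennreal \<bar>?u n (x + h) - ?u n x\<bar>
 <= (\<integral>\<^sup>+t. ind {0..1} t * ennreal (norm h * norm (?v n (x + t *R h))) \<partial>lborel)" for x
 proof (cases "x \<in> ball x0 r")
 case True
 have inK: "?Du (x + t *R h) = ?v n (x + t *R h)" if t: "t \<in> {0..1}" for t
 proof -
 have "norm (t *R h) <= norm h" using t by (simp add: mult_left_le_one_le)
 then have "dist x0 (x + t *R h) <= 2 * r"
 using True h dist_triangle[of x0 "x + t *R h" x] by (simp add: dist_norm)
 then have "cball (x + t *R h) (s n) \<subseteq> K"
 unfolding K_def using s(2)[of n] by (intro cball_subset_cball_iff[THEN iffD2]) (auto simp: dist_commute)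
 from mollify_grad_eq[OF u K s(1) this] show ?thesis by (simp add: U_def V_def)
 qed
 have der: "((%t. ?u n (x + t *R h)) has_vector_derivative (?Du (x + t *R h) <.> h)) (at t within {0..1})" for t
 proof -
 have "((%t. ?u n (x + t *R h)) has_derivative (%z. ?Du (x + t *R h) <.> (z *R h))) (at t)"
 proof -
 have 1: "((%t. x + t *R h) has_derivative (%z. z *R h)) (at t)" by (auto intro!: derivative_eq_intros)
 show ?thesis by (rule has_derivative_compose[OF 1 C1_onD[OF C1 UNIV_I]])
 qed
 then have "((%t. ?u n (x + t *R h)) has_derivative (%z. z *R (?Du (x + t *R h) <.> h))) (at t)"
 by (simp only: inner_scaleR_right real_scaleR_def)
 then show ?thesis unfolding has_vector_derivative_def by (rule has_derivative_at_withinI)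
 qed
 have cont: "continuous_on {0..1} (%t. ?Du (x + t *R h) <.> h)"
 proof -
 have "continuous_on UNIV ?Du" using C1 unfolding C1_on_def by (rule conjunct2)
 then have "continuous_on {0..1} (%t. ?Du (x + t *R h))"
 by (rule continuous_on_compose2) (intro continuous_intros, simp)
 then show ?thesis by (rule continuous_on_inner) (rule continuous_on_const)
 qed
 have hb: "has_bochner_integral lborel (%t. ind {0..1} t *R (?Du (x + t *R h) <.> h)) (?u n (x + 1 *R h) - ?u n (x + 0 *R h))"
 by (rule has_bochner_integral_FTC_Icc[OF _ der cont]) simp
 have "\<bar>?u n (x + h) - ?u n x\<bar> = norm (LBINT t. ind {0..1} t *R (?Du (x + t *R h) <.> h))"
 using has_bochner_integral_integral_eq[OF hb] by simp
 also have "... <= (LBINT t. norm (ind {0..1} t *R (?Du (x + t *R h) <.> h)))" by (rule integral_norm_bound)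
 finally have "ennreal \<bar>?u n (x + h) - ?u n x\<bar> <= ennreal (LBINT t. norm (ind {0..1} t *R (?Du (x + t *R h) <.> h)))"
 by (rule ennreal_leI)
 also have "... = (\<integral>\<^sup>+t. ennreal (norm (ind {0..1} t *R (?Du (x + t *R h) <.> h))) \<partial>lborel)"
 using has_bochner_integral_iff[THEN iffD1, OF hb] by (intro nn_integral_eq_integral[symmetric] integrable_norm) auto
 also have "... <= (\<integral>\<^sup>+t. ind {0..1} t * ennreal (norm h * norm (?v n (x + t *R h))) \<partial>lborel)"
 proof (rule nn_integral_mono)
 fix t
 show "ennreal (norm (ind {0..1} t *R (?Du (x + t *R h) <.> h))) <= ind {0..1} t * ennreal (norm h * norm (?v n (x + t *R h)))"
 using inK[of t] Cauchy_Schwarz_ineq2[of "?v n (x + t *R h)" h]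
 by (cases "t \<in> {0..1}") (auto intro!: ennreal_leI simp: mult.commute)
 qed
 finally show ?thesis using True by simp
 qed simp
 have "(\<integral>\<^sup>+x. ?B x * ennreal \<bar>?u n (x + h) - ?u n x\<bar> \<partial>lborel)
 <= (\<integral>\<^sup>+x. \<integral>\<^sup>+t. ind {0..1} t * ennreal (norm h * norm (?v n (x + t *R h))) \<partial>lborel \<partial>lborel)"
 by (rule nn_integral_mono) (rule pw)
 also have "... = (\<integral>\<^sup>+t. \<integral>\<^sup>+x. ind {0..1} t * ennreal (norm h * norm (?v n (x + t *R h))) \<partial>lborel \<partial>lborel)"
 by (rule lborel_pair.Fubini'[symmetric]) measurable
 also have "... = (\<integral>\<^sup>+t. ind {0..1} (t::real) * ennreal (norm h * (LBINT x. norm (?v n x))) \<partial>lborel)"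
 proof (rule nn_integral_cong)
 fix t :: real
 have "(\<integral>\<^sup>+x. ind {0..1} t * ennreal (norm h * norm (?v n (x + t *R h))) \<partial>lborel)
 = ind {0..1} t * (\<integral>\<^sup>+x. ennreal (norm h * norm (?v n (x + t *R h))) \<partial>lborel)"
 by (rule nn_integral_cmult) measurable
 also have "(\<integral>\<^sup>+x. ennreal (norm h * norm (?v n (x + t *R h))) \<partial>lborel) = ennreal (LBINT x. norm h * norm (?v n (x + t *R h)))"
 using integrable_lborel_translate[OF iv[of n], of "t *R h"] by (intro nn_integral_eq_integral integrable_mult_right integrable_norm) auto
 also have "(LBINT x. norm h * norm (?v n (x + t *R h))) = norm h * (LBINT x. norm (?v n x))"
 using integral_lborel_translate[of "%x. norm (?v n x)" "t *R h"] by simp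
 finally show "(\<integral>\<^sup>+x. ind {0..1} t * ennreal (norm h * norm (?v n (x + t *R h))) \<partial>lborel) = ind {0..1} t * ennreal (norm h * (LBINT x. norm (?v n x)))" .
 qed
 also have "... = ennreal (norm h * (LBINT x. norm (?v n x)))"
 by (subst nn_integral_multc) auto
 also have "... <= ennreal (norm h * ((LBINT x. norm (V x)) + de' n))"
 proof (intro ennreal_leI mult_left_mono)
 have "(LBINT x. norm (?v n x)) <= (LBINT x. norm (V x) + norm (?v n x - V x))"
 using iv[of n] V by (intro integral_mono) (auto intro: norm_triangle_sub)
 also have "... = (LBINT x. norm (V x)) + de' n" using iv[of n] V by (simp add: de'_def)
 finally show "(LBINT x. norm (?v n x)) <= (LBINT x. norm (V x)) + de' n" .
 qed simp
 finally show ?thesis .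
 qed
 \<comment> \<open>Replacing \<open>U\<close> by its mollification costs \<open>de n\<close> at
   \<open>x\<close> and again at \<open>x + h\<close>.\<close>
 have le: "(\<integral>\<^sup>+x. ?B x * ennreal \<bar>U (x + h) - U x\<bar> \<partial>lborel) <= ennreal (norm h * ((LBINT x. norm (V x)) + de' n) + 2 * de n)" for n
 proof -
 have de0: "de n >= 0" "de' n >= 0" "(LBINT x. norm (V x)) >= 0" unfolding de_def de'_def by (auto intro!: integral_nonneg_AE)
 have n1: "(\<integral>\<^sup>+x. ennreal (norm (?u n x - U x)) \<partial>lborel) = ennreal (de n)"
 unfolding de_def using iu[of n] U by (intro nn_integral_eq_integral) auto
 have n2: "(\<integral>\<^sup>+x. ennreal (norm (?u n (x + h) - U (x + h))) \<partial>lborel) = ennreal (de n)"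
 proof -
 have "(\<integral>\<^sup>+x. ennreal (norm (?u n (x + h) - U (x + h))) \<partial>lborel) = ennreal (LBINT x. norm (?u n (x + h) - U (x + h)))"
 using integrable_lborel_translate[OF iu[of n], of h] integrable_lborel_translate[OF U, of h]
 by (intro nn_integral_eq_integral) auto
 also have "(LBINT x. norm (?u n (x + h) - U (x + h))) = de n"
 unfolding de_def using integral_lborel_translate[of "%x. norm (?u n x - U x)" h] by simp
 finally show ?thesis .
 qed
 have "(\<integral>\<^sup>+x. ?B x * ennreal \<bar>U (x + h) - U x\<bar> \<partial>lborel)
 <= (\<integral>\<^sup>+x. ?B x * ennreal \<bar>?u n (x + h) - ?u n x\<bar> + ennreal (norm (?u n (x + h) - U (x + h))) + ennreal (norm (?u n x - U x)) \<partial>lborel)"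
 proof (rule nn_integral_mono)
 fix x
 have "\<bar>U (x + h) - U x\<bar> <= \<bar>?u n (x + h) - ?u n x\<bar> + norm (?u n (x + h) - U (x + h)) + norm (?u n x - U x)" by simp
 then have "ennreal \<bar>U (x + h) - U x\<bar> <= ennreal \<bar>?u n (x + h) - ?u n x\<bar> + ennreal (norm (?u n (x + h) - U (x + h))) + ennreal (norm (?u n x - U x))"
 by (simp del: real_norm_def flip: ennreal_plus)  
 then show "?B x * ennreal \<bar>U (x + h) - U x\<bar> <= ?B x * ennreal \<bar>?u n (x + h) - ?u n x\<bar> + ennreal (norm (?u n (x + h) - U (x + h))) + ennreal (norm (?u n x - U x))"
 by (auto simp: indicator_def)
 qed
 also have "... = (\<integral>\<^sup>+x. ?B x * ennreal \<bar>?u n (x + h) - ?u n x\<bar> \<partial>lborel)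
 + (\<integral>\<^sup>+x. ennreal (norm (?u n (x + h) - U (x + h))) \<partial>lborel) + (\<integral>\<^sup>+x. ennreal (norm (?u n x - U x)) \<partial>lborel)"
 proof -
 have [measurable]: "ball x0 r \<in> sets borel" by simp
 have 1: "(%x. ?B x * ennreal \<bar>?u n (x + h) - ?u n x\<bar>) \<in> borel_measurable lborel"
 "(%x. ennreal (norm (?u n (x + h) - U (x + h)))) \<in> borel_measurable lborel"
 "(%x. ennreal (norm (?u n x - U x))) \<in> borel_measurable lborel"
 by measurable
 show ?thesis
 using nn_integral_add[OF borel_measurable_add[OF 1(1,2)] 1(3)] nn_integral_add[OF 1(1,2)] by (simp only:)
 qed
 also have "... = (\<integral>\<^sup>+x. ?B x * ennreal \<bar>?u n (x + h) - ?u n x\<bar> \<partial>lborel) + ennreal (de n) + ennreal (de n)"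
 unfolding n1 n2 ..
 also have "... <= ennreal (norm h * ((LBINT x. norm (V x)) + de' n)) + ennreal (de n) + ennreal (de n)"
 by (intro add_mono step order_refl)
 also have "... = ennreal (norm h * ((LBINT x. norm (V x)) + de' n) + 2 * de n)"
 using de0 by (simp flip: ennreal_plus)
 finally show ?thesis .
 qed
 have "(%n. norm h * ((LBINT x. norm (V x)) + de' n) + 2 * de n) >-> norm h * ((LBINT x. norm (V x)) + 0) + 2 * 0"
 by (intro tendsto_intros L1)
 then have lim: "(%n. ennreal (norm h * ((LBINT x. norm (V x)) + de' n) + 2 * de n)) >-> ennreal (norm h * (LBINT x. norm (V x)))"
 by (intro tendsto_ennrealI) simp
 have "(\<integral>\<^sup>+x. ?B x * ennreal \<bar>u (x + h) - u x\<bar> \<partial>lborel) = (\<integral>\<^sup>+x. ?B x * ennreal \<bar>U (x + h) - U x\<bar> \<partial>lborel)"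
 proof (rule nn_integral_cong)
 fix x
 show "?B x * ennreal \<bar>u (x + h) - u x\<bar> = ?B x * ennreal \<bar>U (x + h) - U x\<bar>"
 proof (cases "x \<in> ball x0 r")
 case True
 then have "x \<in> K" "x + h \<in> K" unfolding K_def
 using h r dist_triangle[of x0 "x + h" x] by (auto simp: dist_norm)
 then show ?thesis by (simp add: U_def)
 qed simp
 qed
 also have "... <= ennreal (norm h * (LBINT x. norm (V x)))"
 by (rule LIMSEQ_le_const[OF lim]) (use le in blast)
 also have "(LBINT x. norm (V x)) = (LBINT x. ind (cball x0 (3 * r)) x * norm (g x))"
 unfolding V_def K_def by (intro B_integral_cong) (auto simp: indicator_def)
 finally show ?thesis .
qed

text \<open>The shift by \<open>ep\<close> makes the derivative of the logarithm bounded on the half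
  line, as \<open>weak_chain_rule\<close> requires.\<close>

lemma weak_H1_ln:
 fixes G :: "(real^'n) set"
 assumes G: "open G" and u: "weak_H1 G u g" "!!x. u x >= 0" and ep: "ep > 0"
 shows "weak_H1 G (%x. ln (u x + ep)) (%x. (1 / (u x + ep)) *R g x)"
 unfolding weak_H1_def
proof (intro conjI allI impI)
 note [measurable] = weak_H1D(1,2)[OF u(1)]
 show "(%x. ln (u x + ep)) \<in> bmb" "(%x. (1 / (u x + ep)) *R g x) \<in> bmb"
 by measurable
 {
 fix K assume K: "compact K & K \<subseteq> G"
 then have [measurable]: "K \<in> sets borel" using borel_compact by blast
 have iK: "intl (ind K :: _ => real)" using emeasure_compact_finite[of K] K by simp
 show "set_integrable lborel K (%x. (ln (u x + ep))^2)"
 unfolding set_integrable_def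
 proof (rule B_integrable_bound)
 show "intl (%x. 2 * (ln ep)^2 * ind K x + 2 / ep^2 * (ind K x * (u x)^2))"
 using iK weak_H1D(5)[OF u(1)] K by (intro B_integrable_add integrable_mult_right) auto
 show "AE x in lborel. norm (ind K x *R (ln (u x + ep))^2) <= norm (2 * (ln ep)^2 * ind K x + 2 / ep^2 * (ind K x * (u x)^2))"
 proof (rule AE_I2)
 fix x
 have "ln (u x + ep) = ln ep + ln (1 + u x / ep)"
 proof -
 have "0 < 1 + u x / ep" using ep u(2)[of x] by (intro add_pos_nonneg) auto
 moreover have "u x + ep = ep * (1 + u x / ep)" using ep by (simp add: field_simps)
 ultimately show ?thesis using ep by (simp add: ln_mult)
 qed
 moreover have "0 <= ln (1 + u x / ep)" "ln (1 + u x / ep) <= u x / ep"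
 using ep u(2)[of x] by (auto intro!: ln_add_one_self_le_self)
 ultimately have "\<bar>ln (u x + ep)\<bar> <= \<bar>ln ep\<bar> + u x / ep" by linarith
 then have "(ln (u x + ep))^2 <= (\<bar>ln ep\<bar> + u x / ep)^2" using abs_le_square_iff by fastforce
 also have "... <= 2 * (ln ep)^2 + 2 / ep^2 * (u x)^2"
 using sum_squares_bound[of "\<bar>ln ep\<bar>" "u x / ep"] by (simp add: power2_sum power_divide)
 finally show "norm (ind K x *R (ln (u x + ep))^2) <= norm (2 * (ln ep)^2 * ind K x + 2 / ep^2 * (ind K x * (u x)^2))"
 by (cases "x \<in> K") auto
 qed
 qed measurable
 show "set_integrable lborel K (%x. (norm ((1 / (u x + ep)) *R g x))^2)"
 unfolding set_integrable_def
 proof (rule B_integrable_bound)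
 show "intl (%x. (1/ep)^2 * (ind K x * (norm (g x))^2))"
 using weak_H1D(6)[OF u(1)] K by (intro integrable_mult_right) auto
 show "AE x in lborel. norm (ind K x *R (norm ((1 / (u x + ep)) *R g x))^2) <= norm ((1/ep)^2 * (ind K x * (norm (g x))^2))"
 proof (rule AE_I2)
 fix x
 have "1 / (u x + ep) <= 1 / ep" "1 / (u x + ep) >= 0" using ep u(2)[of x] by (auto intro!: divide_left_mono mult_pos_pos add_nonneg_pos)
 then have "(1 / (u x + ep))^2 * (norm (g x))^2 <= (1/ep)^2 * (norm (g x))^2" by (intro mult_right_mono power_mono) auto
 then show "norm (ind K x *R (norm ((1 / (u x + ep)) *R g x))^2) <= norm ((1/ep)^2 * (ind K x * (norm (g x))^2))"
 using ep u(2)[of x] by (cases "x \<in> K") (auto simp: power_mult_distrib power_divide)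
 qed
 qed measurable
 }
 fix ph Dph assume ph: "C1c G ph Dph"
 have "(LBINT x. ln (u x + ep) *R Dph x) = - (LBINT x. (ph x * (1 / (u x + ep))) *R g x)"
 proof (rule weak_chain_rule[where F = "%s. ln (s + ep)" and F' = "%s. 1 / (s + ep)" and B = "1 / ep", OF G u ph])
 show "((%s. ln (s + ep)) has_real_derivative 1 / (s + ep)) (at s)" if "s >= 0" for s
 using that ep by (auto intro!: derivative_eq_intros)
 show "continuous_on {0..} (%s. 1 / (s + ep))" using ep by (intro continuous_intros) auto
 show "\<bar>1 / (s + ep)\<bar> <= 1 / ep" if "s >= 0" for s using that ep by (auto intro!: divide_left_mono mult_pos_pos)
 qed measurable
 then show "(LBINT x. ln (u x + ep) *R Dph x) = - (LBINT x. ph x *R (1 / (u x + ep)) *R g x)" by simp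
qed

text \<open>The translation estimate, uniform in the regularisation, passes to \<open>ln u\<close>
  by Fatou's lemma. Averaging it over \<open>h\<close> shows that for almost every \<open>x1\<close>
  near \<open>x0\<close> the difference \<open>ln (u (x1 + h)) - ln (u x1)\<close> is integrable in
  \<open>h\<close>; as \<open>ln (u x1)\<close> is just one real number, \<open>ln u\<close> itself
  is integrable near \<open>x1\<close>.\<close>

lemma ln_locally_integrable:
 fixes G :: "(real^'n) set"
 assumes G: "open G" and u: "weak_H1 G u g" "!!x. u x > 0" and r: "r > 0" "cball x0 (3 * r) \<subseteq> G"
 and C: "!!n. (LBINT x. ind (cball x0 (3 * r)) x * norm ((1 / (u x + 1 / real (Suc n))) *R g x)) <= C"
 shows "\<exists>e>0. set_integrable lborel (ball x0 e) (%x. ln (u x))"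
proof -
 note [measurable] = weak_H1D(1,2)[OF u(1)]
 let ?B = "ind (ball x0 r) :: _ => ennreal"
 let ?Z = "ind (ball 0 r) :: real^'n => ennreal"
 have [measurable]: "ball (0::real^'n) r \<in> sets borel" "ball x0 r \<in> sets borel" by simp_all
 have C0: "C >= 0" using C[of 0] by (rule order.trans[rotated]) (intro integral_nonneg_AE AE_I2, simp)
 have u0: "!!x. u x >= 0" using u(2) less_imp_le by blast
 have est: "(\<integral>\<^sup>+x. ?B x * ennreal \<bar>ln (u (x + h)) - ln (u x)\<bar> \<partial>lborel) <= ennreal (r * C)" if h: "norm h <= r" for h
 proof -
 have [measurable]: "ball x0 r \<in> sets borel" by simp
 let ?f = "%n x. ln (u x + 1 / real (Suc n))"
 have lim: "(%n. ?B x * ennreal \<bar>?f n (x + h) - ?f n x\<bar>) >-> ?B x * ennreal \<bar>ln (u (x + h)) - ln (u x)\<bar>" for x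
 proof -
 have z: "(%n. 1 / real (Suc n)) >-> 0" by (rule LIMSEQ_Suc[OF lim_const_over_n])
 have "(%n. \<bar>?f n (x + h) - ?f n x\<bar>) >-> \<bar>ln (u (x + h) + 0) - ln (u x + 0)\<bar>"
 using u(2)[of x] u(2)[of "x + h"] by (intro tendsto_intros z) auto
 then have "(%n. ennreal \<bar>?f n (x + h) - ?f n x\<bar>) >-> ennreal \<bar>ln (u (x + h)) - ln (u x)\<bar>"
 by (intro tendsto_ennrealI) simp
 then show ?thesis by (cases "x \<in> ball x0 r") auto
 qed
 have "(\<integral>\<^sup>+x. ?B x * ennreal \<bar>ln (u (x + h)) - ln (u x)\<bar> \<partial>lborel)
 = (\<integral>\<^sup>+x. liminf (%n. ?B x * ennreal \<bar>?f n (x + h) - ?f n x\<bar>) \<partial>lborel)"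
 by (intro nn_integral_cong lim_imp_Liminf[symmetric] lim) simp
 also have "... <= liminf (%n. \<integral>\<^sup>+x. ?B x * ennreal \<bar>?f n (x + h) - ?f n x\<bar> \<partial>lborel)"
 by (rule nn_integral_liminf) measurable
 also have "... <= ennreal (r * C)"
 proof (rule order.trans[OF Liminf_le_Limsup Limsup_bounded], simp, rule always_eventually, rule allI)
 fix n
 have "(\<integral>\<^sup>+x. ?B x * ennreal \<bar>?f n (x + h) - ?f n x\<bar> \<partial>lborel)
 <= ennreal (norm h * (LBINT x. ind (cball x0 (3 * r)) x * norm ((1 / (u x + 1 / real (Suc n))) *R g x)))"
 by (rule weak_translation_estimate[OF weak_H1_ln[OF G u(1) u0] r h]) simp
 also have "... <= ennreal (r * C)"
 using h C[of n] C0 r(1) by (intro ennreal_leI mult_mono) (auto intro!: integral_nonneg_AE)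
 finally show "(\<integral>\<^sup>+x. ?B x * ennreal \<bar>?f n (x + h) - ?f n x\<bar> \<partial>lborel) <= ennreal (r * C)" .
 qed
 finally show ?thesis .
 qed
 have "(\<integral>\<^sup>+x. \<integral>\<^sup>+h. ?Z h * (?B x * ennreal \<bar>ln (u (x + h)) - ln (u x)\<bar>) \<partial>lborel \<partial>lborel)
 = (\<integral>\<^sup>+h. \<integral>\<^sup>+x. ?Z h * (?B x * ennreal \<bar>ln (u (x + h)) - ln (u x)\<bar>) \<partial>lborel \<partial>lborel)"
 by (rule lborel_pair.Fubini'[symmetric]) measurable
 also have "... <= (\<integral>\<^sup>+h. ?Z h * ennreal (r * C) \<partial>lborel)"
 proof (rule nn_integral_mono)
 fix h :: "real^'n"
 have "(\<integral>\<^sup>+x. ?Z h * (?B x * ennreal \<bar>ln (u (x + h)) - ln (u x)\<bar>) \<partial>lborel)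
 = ?Z h * (\<integral>\<^sup>+x. ?B x * ennreal \<bar>ln (u (x + h)) - ln (u x)\<bar> \<partial>lborel)"
 by (rule nn_integral_cmult) measurable
 also have "... <= ?Z h * ennreal (r * C)"
 using est[of h] by (cases "h \<in> ball 0 r") auto
 finally show "(\<integral>\<^sup>+x. ?Z h * (?B x * ennreal \<bar>ln (u (x + h)) - ln (u x)\<bar>) \<partial>lborel) <= ?Z h * ennreal (r * C)" .
 qed
 also have "... = emeasure lborel (ball (0::real^'n) r) * ennreal (r * C)"
 by (subst nn_integral_multc) auto
 also have "... < \<infinity>" using emeasure_lborel_ball_finite[of "0::real^'n" r] by (simp add: ennreal_mult_less_top)
 finally have fin: "(\<integral>\<^sup>+x. \<integral>\<^sup>+h. ?Z h * (?B x * ennreal \<bar>ln (u (x + h)) - ln (u x)\<bar>) \<partial>lborel \<partial>lborel) ~= \<infinity>" by simp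
 have AE: "AE x in lborel. (\<integral>\<^sup>+h. ?Z h * (?B x * ennreal \<bar>ln (u (x + h)) - ln (u x)\<bar>) \<partial>lborel) ~= \<infinity>"
 by (rule nn_integral_PInf_AE[OF _ fin]) measurable
 \<comment> \<open>A good point this close to \<open>x0\<close> has a ball of radius
   \<open>r\<close> that covers \<open>ball x0 (r/2)\<close>.\<close>
 have "\<exists>x1\<in>ball x0 (r/2). (\<integral>\<^sup>+h. ?Z h * (?B x1 * ennreal \<bar>ln (u (x1 + h)) - ln (u x1)\<bar>) \<partial>lborel) ~= \<infinity>"
 proof (rule ccontr)
 assume "\<not> ?thesis"
 then have "AE x in lebesgue. x \<notin> ball x0 (r/2)"
 using AE unfolding AE_completion_iff by (auto elim!: eventually_mono)
 then have "negligible (ball x0 (r/2))"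
 unfolding negligible_iff_null_sets by (subst AE_iff_null_sets) auto
 then show False using open_not_negligible[of "ball x0 (r/2)"] r by simp
 qed
 then obtain x1 where x1: "x1 \<in> ball x0 (r/2)" "(\<integral>\<^sup>+h. ?Z h * (?B x1 * ennreal \<bar>ln (u (x1 + h)) - ln (u x1)\<bar>) \<partial>lborel) ~= \<infinity>" by blast
 have x1r: "x1 \<in> ball x0 r" using x1(1) r by auto
 have "(\<integral>\<^sup>+h. ?Z h * ennreal \<bar>ln (u (x1 + h)) - ln (u x1)\<bar> \<partial>lborel) < \<infinity>"
 using x1(2) x1r by (simp add: less_top)
 then have "intl (%h. ind (ball 0 r) h *R (ln (u (x1 + h)) - ln (u x1)))"
 unfolding integrable_iff_bounded
 by (auto elim!: order.strict_trans1[rotated] intro!: nn_integral_mono simp: indicator_def)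
 from integrable_lborel_translate[OF this, of "- x1"]
 have 1: "intl (%y. ind (ball 0 r) (y - x1) *R (ln (u y) - ln (u x1)))" by simp
 have 2: "intl (%y. ind (ball x1 r) y *R ln (u x1))"
 using emeasure_lborel_ball_finite[of x1 r] by (intro integrable_scaleR_left) auto
 have "(%y. ind (ball 0 r) (y - x1) *R (ln (u y) - ln (u x1)) + ind (ball x1 r) y *R ln (u x1)) = (%y. ind (ball x1 r) y *R ln (u y))"
 by (auto simp: indicator_def dist_norm norm_minus_commute)
 then have "set_integrable lborel (ball x1 r) (%x. ln (u x))"
 unfolding set_integrable_def using B_integrable_add[OF 1 2] by simp
 then have "set_integrable lborel (ball x0 (r/2)) (%x. ln (u x))"
 proof (rule set_integrable_subset)
 show "ball x0 (r/2) \<subseteq> ball x1 r"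
 using x1(1) r by (intro ball_subset_ball_iff[THEN iffD2]) auto
 qed simp
 then show ?thesis using r(1) by (intro exI[of _ "r/2"]) simp
qed

lemma set_integrable_compact_local:
 fixes f :: "'a::euclidean_space => real"
 assumes K: "compact K" and loc: "!!x. x \<in> K ==> \<exists>e>0. set_integrable lborel (ball x e) f"
 shows "set_integrable lborel K f"
proof -
 obtain e where e: "!!x. x \<in> K ==> e x > 0" "!!x. x \<in> K ==> set_integrable lborel (ball x (e x)) f"
 using loc by metis
 have "K \<subseteq> (\<Union>x\<in>K. ball x (e x))" using e(1) by auto
 then obtain T where T: "T \<subseteq> K" "finite T" "K \<subseteq> (\<Union>x\<in>T. ball x (e x))"
 using compactE_image[OF K, of K "%x. ball x (e x)"] by auto
 have "set_integrable lborel (\<Union>x\<in>T. ball x (e x)) f"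
 using T e by (intro set_integrable_UN) auto
 then show ?thesis
 by (rule set_integrable_subset) (use K T borel_compact in auto)
qed

section \<open>Polar coordinates and homogeneous functions\<close>

text \<open>Up to the factor \<open>ln 2\<close>, the image of this measure under \<open>x \<mapsto> x / |x|\<close>
  is the surface measure of the unit sphere.\<close>

definition annul :: "(real^'n) measure" where
 "annul = density lborel (%x. ennreal (ind annulus12 x / norm x ^ CARD('n)))"

lemma sets_annul [simp, measurable_cong]: "sets annul = sets borel"
 and space_annul [simp]: "space annul = UNIV"
 by (simp_all add: annul_def)

lemma closed_annulus12: "closed (annulus12 :: (real^'n) set)"
 and compact_annulus12: "compact (annulus12 :: (real^'n) set)"
 and annulus12_borel [measurable]: "(annulus12 :: (real^'n) set) \<in> sets borel"
proof -
 have eq: "annulus12 = cball 0 2 - ball (0::real^'n) 1" by (auto simp: annulus12_def)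
 show c: "closed (annulus12 :: (real^'n) set)" unfolding eq by (intro closed_Diff) auto
 show "compact (annulus12 :: (real^'n) set)" unfolding eq by (rule compact_diff) auto
 show "(annulus12 :: (real^'n) set) \<in> sets borel" using c by (rule borel_closed)
qed

lemma annulus12_nz: "x \<in> annulus12 ==> x ~= 0" by (auto simp: annulus12_def)

lemma nn_integral_annular:
 fixes f :: "real^'n => ennreal"
 assumes [measurable]: "f \<in> bmb"
 shows "(\<integral>\<^sup>+x. f x \<partial>annul) = (\<integral>\<^sup>+x. ennreal (ind annulus12 x / norm x ^ CARD('n)) * f x \<partial>lborel)"
 unfolding annul_def by (rule nn_integral_density) measurable

lemma AE_annular: "AE x in annul. x \<in> annulus12"
proof -
 have "AE x in (lborel :: (real^'n) measure). 0 < ennreal (ind annulus12 x / norm x ^ CARD('n)) --> x \<in> annulus12"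
 by (rule AE_I2) (auto simp: indicator_def)
 then show ?thesis unfolding annul_def by (subst AE_density) auto
qed

lemma AE_annular_nz: "AE x in annul. x ~= 0"
 using AE_annular by eventually_elim (rule annulus12_nz)

lemma finite_annul: "finite_measure (annul :: (real^'n) measure)"
proof (rule finite_measureI)
 have "emeasure (annul :: (real^'n) measure) UNIV = (\<integral>\<^sup>+x. ennreal (ind annulus12 (x::real^'n) / norm x ^ CARD('n)) * ind UNIV x \<partial>lborel)"
 unfolding annul_def by (rule emeasure_density) measurable
 also have "... <= (\<integral>\<^sup>+x. ind (annulus12 :: (real^'n) set) x \<partial>lborel)"
 proof (rule nn_integral_mono)
 fix x :: "real^'n"
 show "ennreal (ind annulus12 x / norm x ^ CARD('n)) * ind UNIV x <= ind annulus12 x"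
 proof (cases "x \<in> annulus12")
 case True
 then have "1 <= norm x ^ CARD('n)" by (intro one_le_power) (auto simp: annulus12_def)
 then have "1 / norm x ^ CARD('n) <= 1" by (simp add: divide_le_eq_1)
 then show ?thesis using True by (simp add: ennreal_le_1)
 qed simp
 qed
 also have "... < \<infinity>" using emeasure_compact_finite[OF compact_annulus12] by simp
 finally show "emeasure (annul :: (real^'n) measure) (space annul) ~= \<infinity>" by simp
qed

interpretation annular: finite_measure "annul :: (real^'n) measure"
 by (rule finite_annul)

interpretation annular_pair: pair_sigma_finite "lborel :: real measure" "annul :: (real^'n) measure"
 by (intro pair_sigma_finite.intro sigma_finite_lborel annular.sigma_finite_measure_axioms)

text \<open>\<open>y / t\<close> lies in the annulus exactly for
  \<open>norm y / 2 \<le> t \<le> norm y\<close>, an interval of logarithmic length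
  \<open>ln 2\<close> for every \<open>y\<close>. This is the source of all factors
  \<open>ln 2\<close> in the polar formulas.\<close>

lemma nn_integral_dilations:
 fixes y :: "real^'n"
 assumes "y ~= 0"
 shows "(\<integral>\<^sup>+t. ennreal (ind {0<..} t * inverse t * ind annulus12 ((1 / t) *R y)) \<partial>lborel) = ennreal (ln 2)"
proof -
 have pos: "norm y > 0" using assms by simp
 have "(\<integral>\<^sup>+t. ennreal (ind {0<..} t * inverse t * ind annulus12 ((1 / t) *R y)) \<partial>lborel)
 = (\<integral>\<^sup>+t. ennreal (inverse t) * ind {norm y / 2 .. norm y} t \<partial>lborel)"
 proof (rule nn_integral_cong)
 fix t :: real
 show "ennreal (ind {0<..} t * inverse t * ind annulus12 ((1 / t) *R y)) = ennreal (inverse t) * ind {norm y / 2 .. norm y} t"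
 proof (cases "t > 0")
 case True
 then have "(1 / t) *R y \<in> annulus12 \<longleftrightarrow> t \<in> {norm y / 2 .. norm y}"
 by (auto simp: annulus12_def field_simps)
 then show ?thesis using True by (auto simp: indicator_def)
 next
 case False
 then have "t \<notin> {norm y / 2 .. norm y}" using pos unfolding atLeastAtMost_iff by linarith
 then show ?thesis using False by simp
 qed
 qed
 also have "... = ennreal (ln (norm y) - ln (norm y / 2))"
 proof (rule nn_integral_FTC_Icc)
 show "(ln has_real_derivative inverse x) (at x)" "0 <= inverse x" if "x \<in> {norm y / 2..norm y}" for x
 proof -
 have "x > 0" using that pos by (auto intro: less_le_trans[of 0 "norm y / 2"])
 then show "(ln has_real_derivative inverse x) (at x)" "0 <= inverse x" by (auto intro: DERIV_ln)
 qed
 qed (use pos in auto)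
 also have "ln (norm y) - ln (norm y / 2) = ln 2" using pos by (simp add: ln_div)
 finally show ?thesis .
qed

text \<open>Two substitutions take the place of a surface measure: \<open>s = t * norm x\<close> for
  fixed \<open>x\<close>, then \<open>y = t *R x\<close> for fixed \<open>t\<close>. What remains is
  the total weight of the dilations that carry the annulus over a given \<open>y\<close>.\<close>

lemma polar_nn_integral:
 fixes f :: "real^'n => ennreal"
 assumes f[measurable]: "f \<in> bmb"
 shows "ennreal (ln 2) * (\<integral>\<^sup>+x. f x \<partial>lborel)
 = (\<integral>\<^sup>+s. ennreal (ind {0<..} s * s ^ (CARD('n) - 1)) * (\<integral>\<^sup>+x. f ((s / norm x) *R x) \<partial>annul) \<partial>lborel)"
proof -
 let ?N = "CARD('n)"
 let ?A = "%x::real^'n. ennreal (ind annulus12 x / norm x ^ ?N)"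
 have N: "?N = Suc (?N - 1)" by (simp add: Suc_diff_1)
 have "(\<integral>\<^sup>+s. ennreal (ind {0<..} s * s ^ (?N - 1)) * (\<integral>\<^sup>+x. f ((s / norm x) *R x) \<partial>annul) \<partial>lborel)
 = (\<integral>\<^sup>+s. (\<integral>\<^sup>+x. ennreal (ind {0<..} s * s ^ (?N - 1)) * (?A x * f ((s / norm x) *R x)) \<partial>lborel) \<partial>lborel)"
 by (intro nn_integral_cong) (simp add: nn_integral_annular nn_integral_cmult)
 also have "... = (\<integral>\<^sup>+x. (\<integral>\<^sup>+s. ennreal (ind {0<..} s * s ^ (?N - 1)) * (?A x * f ((s / norm x) *R x)) \<partial>lborel) \<partial>lborel)"
 by (rule lborel_pair.Fubini') measurable
 also have "... = (\<integral>\<^sup>+x. (\<integral>\<^sup>+t. ennreal (ind {0<..} t * t ^ (?N - 1)) * (ind annulus12 x * f (t *R x)) \<partial>lborel) \<partial>lborel)"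
 proof (rule nn_integral_cong)
 fix x :: "real^'n"
 show "(\<integral>\<^sup>+s. ennreal (ind {0<..} s * s ^ (?N - 1)) * (?A x * f ((s / norm x) *R x)) \<partial>lborel)
 = (\<integral>\<^sup>+t. ennreal (ind {0<..} t * t ^ (?N - 1)) * (ind annulus12 x * f (t *R x)) \<partial>lborel)"
 proof (cases "x \<in> annulus12")
 case True
 then have x: "norm x > 0" using annulus12_nz by auto
 have "(\<integral>\<^sup>+s. ennreal (ind {0<..} s * s ^ (?N - 1)) * (?A x * f ((s / norm x) *R x)) \<partial>lborel)
 = ennreal \<bar>norm x\<bar> * (\<integral>\<^sup>+t. ennreal (ind {0<..} (0 + norm x * t) * (0 + norm x * t) ^ (?N - 1)) * (?A x * f (((0 + norm x * t) / norm x) *R x)) \<partial>lborel)"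
 using x by (intro nn_integral_real_affine) auto
 also have "... = (\<integral>\<^sup>+t. ennreal \<bar>norm x\<bar> * (ennreal (ind {0<..} (0 + norm x * t) * (0 + norm x * t) ^ (?N - 1)) * (?A x * f (((0 + norm x * t) / norm x) *R x))) \<partial>lborel)"
 by (rule nn_integral_cmult[symmetric]) measurable
 also have "... = (\<integral>\<^sup>+t. ennreal (ind {0<..} t * t ^ (?N - 1)) * (ind annulus12 x * f (t *R x)) \<partial>lborel)"
 proof (rule nn_integral_cong)
 fix t :: real
 have i: "ind {0<..} (0 + norm x * t) = (ind {0<..} t :: real)"
 using x by (auto simp: indicator_def zero_less_mult_iff)
 have e: "ennreal \<bar>norm x\<bar> * (ennreal (ind {0<..} t * (norm x * t) ^ (?N - 1)) * ennreal (1 / norm x ^ ?N)) = ennreal (ind {0<..} t * t ^ (?N - 1))"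
 proof -
 have pw: "norm x ^ ?N = norm x * norm x ^ (?N - 1)" using N by (metis power_Suc)
 have "\<bar>norm x\<bar> * ((ind {0<..} t * (norm x * t) ^ (?N - 1)) * (1 / norm x ^ ?N)) = ind {0<..} t * t ^ (?N - 1)"
 unfolding pw using x by (simp add: power_mult_distrib)
 moreover have "0 <= ind {0<..} t * (norm x * t) ^ (?N - 1)" by (auto simp: indicator_def)
 ultimately show ?thesis by (metis abs_ge_zero ennreal_mult' mult_nonneg_nonneg zero_le_divide_1_iff zero_le_power norm_ge_zero ennreal_mult'' )
 qed
 show "ennreal \<bar>norm x\<bar> * (ennreal (ind {0<..} (0 + norm x * t) * (0 + norm x * t) ^ (?N - 1)) * (?A x * f (((0 + norm x * t) / norm x) *R x))) = ennreal (ind {0<..} t * t ^ (?N - 1)) * (ind annulus12 x * f (t *R x))"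
 unfolding i e[symmetric] using True x by (simp add: mult_ac)
 qed
 finally show ?thesis .
 qed simp
 qed
 also have "... = (\<integral>\<^sup>+t. (\<integral>\<^sup>+x. ennreal (ind {0<..} t * t ^ (?N - 1)) * (ind annulus12 x * f (t *R x)) \<partial>lborel) \<partial>lborel)"
 by (rule lborel_pair.Fubini'[symmetric]) measurable
 also have "... = (\<integral>\<^sup>+t. (\<integral>\<^sup>+y. ennreal (ind {0<..} t * inverse t * ind annulus12 ((1 / t) *R y)) * f y \<partial>lborel) \<partial>lborel)"
 proof (rule nn_integral_cong)
 fix t :: real
 show "(\<integral>\<^sup>+x. ennreal (ind {0<..} t * t ^ (?N - 1)) * (ind annulus12 x * f (t *R x)) \<partial>lborel)
 = (\<integral>\<^sup>+y. ennreal (ind {0<..} t * inverse t * ind annulus12 ((1 / t) *R y)) * f y \<partial>lborel)"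
 proof (cases "t > 0")
 case True
 have "(\<integral>\<^sup>+y. ennreal (ind {0<..} t * inverse t * ind annulus12 ((1 / t) *R y)) * f y \<partial>lborel)
 = ennreal (\<bar>t\<bar> ^ DIM(real^'n)) * (\<integral>\<^sup>+x. ennreal (ind {0<..} t * inverse t * ind annulus12 ((1 / t) *R (0 + t *R x))) * f (0 + t *R x) \<partial>lborel)"
 using True by (intro nn_integral_lborel_affine) auto
 also have "... = (\<integral>\<^sup>+x. ennreal (t ^ ?N) * (ennreal (inverse t * ind annulus12 x) * f (t *R x)) \<partial>lborel)"
 using True by (subst nn_integral_cmult[symmetric]) auto
 also have "... = (\<integral>\<^sup>+x. ennreal (ind {0<..} t * t ^ (?N - 1)) * (ind annulus12 x * f (t *R x)) \<partial>lborel)"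
 proof (rule nn_integral_cong)
 fix x :: "real^'n"
 have "ennreal (t ^ ?N) * ennreal (inverse t) = ennreal (t ^ (?N - 1))"
 proof -
 have pw: "t ^ ?N = t * t ^ (?N - 1)" using N by (metis power_Suc)
 have "t ^ ?N * inverse t = t ^ (?N - 1)" unfolding pw using True by simp
 then show ?thesis using True by (simp flip: ennreal_mult)
 qed
 then show "ennreal (t ^ ?N) * (ennreal (inverse t * ind annulus12 x) * f (t *R x)) = ennreal (ind {0<..} t * t ^ (?N - 1)) * (ind annulus12 x * f (t *R x))"
 using True by (cases "x \<in> annulus12") (auto simp: mult.assoc[symmetric])
 qed
 finally show ?thesis ..
 qed simp
 qed
 also have "... = (\<integral>\<^sup>+y. (\<integral>\<^sup>+t. ennreal (ind {0<..} t * inverse t * ind annulus12 ((1 / t) *R y)) * f y \<partial>lborel) \<partial>lborel)"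
 by (rule lborel_pair.Fubini') measurable
 also have "... = (\<integral>\<^sup>+y. ennreal (ln 2) * f y \<partial>lborel)"
 proof (rule nn_integral_cong_AE)
 have "AE y in lborel. y ~= (0::real^'n)" by (rule AE_lborel_singleton)
 then show "AE y in lborel. (\<integral>\<^sup>+t. ennreal (ind {0<..} t * inverse t * ind annulus12 ((1 / t) *R y)) * f y \<partial>lborel) = ennreal (ln 2) * f y"
 proof eventually_elim
 case (elim y)
 then show ?case by (subst nn_integral_multc) (auto simp: nn_integral_dilations)
 qed
 qed
 also have "... = ennreal (ln 2) * (\<integral>\<^sup>+x. f x \<partial>lborel)" by (rule nn_integral_cmult) measurable
 finally show ?thesis ..
qed

lemma polar_integral_nonneg:
 fixes f :: "real^'n => real"
 assumes f: "intl f" "!!x. f x >= 0"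
 shows "AE s in lborel. s > 0 --> integrable annul (%x. f ((s / norm x) *R x))"
 and "has_bochner_integral lborel (%s. ind {0<..} s * s ^ (CARD('n) - 1) * (LINT x|annul. f ((s / norm x) *R x))) (ln 2 * (LBINT x. f x))"
proof -
 let ?N = "CARD('n)"
 have [measurable]: "f \<in> bmb" using f(1) by auto
 let ?i = "%s. \<integral>\<^sup>+x. ennreal (f ((s / norm x) *R x)) \<partial>annul"
 let ?w = "%s::real. ind {0<..} s * s ^ (?N - 1)"
 have w0: "?w s >= 0" for s by (auto simp: indicator_def)
 have eq: "(\<integral>\<^sup>+s. ennreal (?w s) * ?i s \<partial>lborel) = ennreal (ln 2 * (LBINT x. f x))"
 using polar_nn_integral[of "%x. ennreal (f x)"] nn_integral_eq_integral[OF f(1)] f(2)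
 by (simp add: ennreal_mult integral_nonneg_AE)
 then have "(\<integral>\<^sup>+s. ennreal (?w s) * ?i s \<partial>lborel) ~= \<infinity>" by simp
 then have "AE s in lborel. ennreal (?w s) * ?i s ~= \<infinity>" by (intro nn_integral_PInf_AE) measurable
 then have AE1: "AE s in lborel. s > 0 --> integrable annul (%x. f ((s / norm x) *R x))"
 proof eventually_elim
 case (elim s)
 show ?case
 proof
 assume s: "s > 0"
 then have "ennreal (?w s) ~= 0" by simp
 then have "?i s ~= \<infinity>" using elim by (auto simp: ennreal_mult_eq_top_iff)
 then show "integrable annul (%x. f ((s / norm x) *R x))"
 unfolding integrable_iff_bounded using f(2) by (auto simp: less_top)
 qed
 qed
 then show "AE s in lborel. s > 0 --> integrable annul (%x. f ((s / norm x) *R x))" .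
 let ?a = "%s. ?w s * (LINT x|annul. f ((s / norm x) *R x))"
 have "(\<integral>\<^sup>+s. ennreal (?a s) \<partial>lborel) = (\<integral>\<^sup>+s. ennreal (?w s) * ?i s \<partial>lborel)"
 proof (rule nn_integral_cong_AE)
 show "AE s in lborel. ennreal (?a s) = ennreal (?w s) * ?i s"
 using AE1
 proof eventually_elim
 case (elim s)
 show ?case
 proof (cases "s > 0")
 case True
 then show ?thesis using elim f(2) by (simp add: nn_integral_eq_integral ennreal_mult integral_nonneg_AE)
 qed simp
 qed
 qed
 then have "(\<integral>\<^sup>+s. ennreal (?a s) \<partial>lborel) = ennreal (ln 2 * (LBINT x. f x))" using eq by simp
 then show "has_bochner_integral lborel ?a (ln 2 * (LBINT x. f x))"
 using f(2) w0 by (intro has_bochner_integral_nn_integral) (auto intro!: mult_nonneg_nonneg integral_nonneg_AE)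
qed

lemma polar_integral:
 fixes f :: "real^'n => real"
 assumes f: "intl f"
 shows "AE s in lborel. s > 0 --> integrable annul (%x. f ((s / norm x) *R x))"
 and "has_bochner_integral lborel (%s. ind {0<..} s * s ^ (CARD('n) - 1) * (LINT x|annul. f ((s / norm x) *R x))) (ln 2 * (LBINT x. f x))"
proof -
 let ?p = "%x. max 0 (f x)" and ?n = "%x. max 0 (- f x)"
 have [measurable]: "f \<in> bmb" using f(1) by auto
 have i: "intl ?p" "intl ?n" using f by auto
 have fe: "f x = ?p x - ?n x" for x by simp
 note P = polar_integral_nonneg[OF i(1)] and M = polar_integral_nonneg[OF i(2)]
 have AE1: "AE s in lborel. s > 0 --> integrable annul (%x. ?p ((s / norm x) *R x)) & integrable annul (%x. ?n ((s / norm x) *R x))"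
 using P(1) M(1) by (auto elim: eventually_elim2)
 then show "AE s in lborel. s > 0 --> integrable annul (%x. f ((s / norm x) *R x))"
 proof eventually_elim
 case (elim s)
 then show ?case by (subst fe) auto
 qed
 have eq: "ln 2 * (LBINT x. f x) = ln 2 * (LBINT x. ?p x) - ln 2 * (LBINT x. ?n x)"
 by (subst fe, subst B_integral_diff[OF i]) (simp add: right_diff_distrib)
 let ?w = "%s::real. ind {0<..} s * s ^ (CARD('n) - 1)"
 have hb: "has_bochner_integral lborel (%s. ?w s * (LINT x|annul. ?p ((s / norm x) *R x)) - ?w s * (LINT x|annul. ?n ((s / norm x) *R x))) (ln 2 * (LBINT x. f x))"
 unfolding eq by (intro has_bochner_integral_diff P(2) M(2)) auto
 show "has_bochner_integral lborel (%s. ?w s * (LINT x|annul. f ((s / norm x) *R x))) (ln 2 * (LBINT x. f x))"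
 proof (rule has_bochner_integral_cong_AE[THEN iffD1, OF _ _ _ hb])
 show "AE s in lborel. ?w s * (LINT x|annul. ?p ((s / norm x) *R x)) - ?w s * (LINT x|annul. ?n ((s / norm x) *R x)) = ?w s * (LINT x|annul. f ((s / norm x) *R x))"
 using AE1
 proof eventually_elim
 case (elim s)
 show ?case
 proof (cases "s > 0")
 case True
 have "(LINT x|annul. f ((s / norm x) *R x)) = (LINT x|annul. ?p ((s / norm x) *R x) - ?n ((s / norm x) *R x))"
 by (intro B_integral_cong) auto
 also have "... = (LINT x|annul. ?p ((s / norm x) *R x)) - (LINT x|annul. ?n ((s / norm x) *R x))"
 using elim True by (intro B_integral_diff) auto
 finally show ?thesis by (simp add: right_diff_distrib)
 qed simp
 qed
 qed measurable
qed

text \<open>Reduces an inequality between integrals over space to its spherical slices; this is how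
  angular inequalities reach the cone.\<close>

lemma polar_integral_mono:
 fixes f g :: "real^'n => real"
 assumes f: "intl f" and g: "intl g"
 and le: "!!s. s > 0 ==> (LINT x|annul. f ((s / norm x) *R x)) <= (LINT x|annul. g ((s / norm x) *R x))"
 shows "(LBINT x. f x) <= (LBINT x. g x)"
proof -
 note F = has_bochner_integral_iff[THEN iffD1, OF polar_integral(2)[OF f]]
 note G = has_bochner_integral_iff[THEN iffD1, OF polar_integral(2)[OF g]]
 have "(\<integral>s. ind {0<..} s * s ^ (CARD('n) - 1) * (LINT x|annul. f ((s / norm x) *R x)) \<partial>lborel)
 <= (\<integral>s. ind {0<..} s * s ^ (CARD('n) - 1) * (LINT x|annul. g ((s / norm x) *R x)) \<partial>lborel)"
 proof (rule integral_mono)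
 fix s :: real
 show "ind {0<..} s * s ^ (CARD('n) - 1) * (LINT x|annul. f ((s / norm x) *R x)) <= ind {0<..} s * s ^ (CARD('n) - 1) * (LINT x|annul. g ((s / norm x) *R x))"
 using le[of s] by (cases "s > 0") (auto intro!: mult_left_mono)
 qed (use F G in auto)
 then have "ln 2 * (LBINT x. f x) <= ln 2 * (LBINT x. g x)" using F G by simp
 then show ?thesis by (simp add: mult_le_cancel_left_pos)
qed

lemma hom0_normalize:
 assumes "!!x t. x ~= 0 ==> t > 0 ==> F (t *R x) = F x" "x ~= 0" "s > 0"
 shows "F ((s / norm x) *R x) = F (x :: 'a::real_normed_vector)"
 using assms by simp

lemma polar_integral_hom0:
 fixes F :: "real^'n => real" and R :: "real => real"
 assumes F: "integrable annul F" "!!x t. x ~= 0 ==> t > 0 ==> F (t *R x) = F x"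
 and R: "intl (%s. ind {0<..} s * s ^ (CARD('n) - 1) * R s)" "R \<in> bmb"
 shows "intl (%x. F x * R (norm x))"
 and "ln 2 * (LBINT x. F x * R (norm x)) = (LINT x|annul. F x) * (LBINT s. ind {0<..} s * s ^ (CARD('n) - 1) * R s)"
proof -
 have Fm: "F \<in> bmb" using borel_measurable_integrable[OF F(1)] by (simp cong: measurable_cong_sets)
 note [measurable] = Fm R(2)
 let ?w = "%s::real. ind {0<..} s * s ^ (CARD('n) - 1)"
 have ae: "AE x in annul. F ((s / norm x) *R x) * R (norm ((s / norm x) *R x)) = F x * R s" if "s > 0" for s
 using AE_annular_nz by eventually_elim (use that hom0_normalize[OF F(2)] in simp)
 have "ennreal (ln 2) * (\<integral>\<^sup>+x. ennreal \<bar>F x * R (norm x)\<bar> \<partial>lborel)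
 = (\<integral>\<^sup>+s. ennreal (?w s) * (\<integral>\<^sup>+x. ennreal \<bar>F ((s / norm x) *R x) * R (norm ((s / norm x) *R x))\<bar> \<partial>annul) \<partial>lborel)"
 by (rule polar_nn_integral) measurable
 also have "... = (\<integral>\<^sup>+s. ennreal \<bar>?w s * R s\<bar> * (\<integral>\<^sup>+x. ennreal \<bar>F x\<bar> \<partial>annul) \<partial>lborel)"
 proof (rule nn_integral_cong)
 fix s :: real
 show "ennreal (?w s) * (\<integral>\<^sup>+x. ennreal \<bar>F ((s / norm x) *R x) * R (norm ((s / norm x) *R x))\<bar> \<partial>annul) = ennreal \<bar>?w s * R s\<bar> * (\<integral>\<^sup>+x. ennreal \<bar>F x\<bar> \<partial>annul)"
 proof (cases "s > 0")
 case True
 have "(\<integral>\<^sup>+x. ennreal \<bar>F ((s / norm x) *R x) * R (norm ((s / norm x) *R x))\<bar> \<partial>annul) = (\<integral>\<^sup>+x. ennreal \<bar>R s\<bar> * ennreal \<bar>F x\<bar> \<partial>annul)"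
 by (rule nn_integral_cong_AE) (use ae[OF True] in \<open>eventually_elim, simp add: abs_mult mult.commute flip: ennreal_mult\<close>)
 also have "... = ennreal \<bar>R s\<bar> * (\<integral>\<^sup>+x. ennreal \<bar>F x\<bar> \<partial>annul)" by (rule nn_integral_cmult) measurable
 finally show ?thesis using True by (simp add: abs_mult ennreal_mult mult.assoc)
 qed simp
 qed
 also have "... = (\<integral>\<^sup>+s. ennreal \<bar>?w s * R s\<bar> \<partial>lborel) * (\<integral>\<^sup>+x. ennreal \<bar>F x\<bar> \<partial>annul)"
 by (rule nn_integral_multc) measurable
 also have "... < \<infinity>"
 using F(1) R(1) unfolding integrable_iff_bounded by (simp add: ennreal_mult_less_top)
 finally have "(\<integral>\<^sup>+x. ennreal \<bar>F x * R (norm x)\<bar> \<partial>lborel) < \<infinity>"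
 by (auto simp: ennreal_mult_less_top)
 then show i: "intl (%x. F x * R (norm x))"
 unfolding integrable_iff_bounded by simp
 have "ln 2 * (LBINT x. F x * R (norm x))
 = (\<integral>s. ?w s * (LINT x|annul. F ((s / norm x) *R x) * R (norm ((s / norm x) *R x))) \<partial>lborel)"
 using has_bochner_integral_integral_eq[OF polar_integral(2)[OF i]] by simp
 also have "... = (\<integral>s. (LINT x|annul. F x) * (?w s * R s) \<partial>lborel)"
 proof (rule B_integral_cong[OF refl])
 fix s :: real
 show "?w s * (LINT x|annul. F ((s / norm x) *R x) * R (norm ((s / norm x) *R x))) = (LINT x|annul. F x) * (?w s * R s)"
 proof (cases "s > 0")
 case True
 have "(LINT x|annul. F ((s / norm x) *R x) * R (norm ((s / norm x) *R x))) = (LINT x|annul. F x * R s)"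
 by (rule integral_cong_AE) (use ae[OF True] in measurable)
 then show ?thesis by simp
 qed simp
 qed
 also have "... = (LINT x|annul. F x) * (LBINT s. ?w s * R s)" by (rule integral_mult_right_zero)
 finally show "ln 2 * (LBINT x. F x * R (norm x)) = (LINT x|annul. F x) * (LBINT s. ?w s * R s)" .
qed

text \<open>\<open>sphere_test\<close> without the nonvanishing clause, so that the class is a
  linear space.\<close>

definition hom0_test :: "(real^'n) set => (real^'n => real) => (real^'n => real^'n) => bool" where
 "hom0_test \<Omega> ps Dps \<longleftrightarrow>
 (\<forall>x t. x ~= 0 & t > 0 --> ps (t *R x) = ps x) & C1_on (- {0}) ps Dps &
 (\<exists>K. compact K & K \<subseteq> \<Omega> & (\<forall>om\<in>sphere 0 1. om \<notin> K --> ps om = 0))"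

lemma sphere_test_iff: "sphere_test \<Omega> ps Dps \<longleftrightarrow> hom0_test \<Omega> ps Dps & (\<exists>om\<in>sphere 0 1. ps om ~= 0)"
 unfolding sphere_test_def hom0_test_def C1_on_def by auto

text \<open>Without a support condition: subsolution inequalities are tested on the whole
  sphere.\<close>

definition hom0_C1 :: "(real^'n => real) => (real^'n => real^'n) => bool" where
 "hom0_C1 ps Dps \<longleftrightarrow> (\<forall>x t. x ~= 0 & t > 0 --> ps (t *R x) = ps x) & C1_on (- {0}) ps Dps"

lemma hom0_test_C1: "hom0_test \<Omega> ps Dps ==> hom0_C1 ps Dps"
 by (simp add: hom0_test_def hom0_C1_def)

text \<open>Both facts come from differentiating \<open>ps (t *R x) = ps x\<close>, in
  \<open>x\<close> and in \<open>t\<close> respectively.\<close>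

lemma hom0_C1_grad:
 assumes "hom0_C1 ps Dps" "x ~= 0"
 shows "t > 0 ==> Dps (t *R x) = (1 / t) *R Dps x" and "Dps x <.> x = 0"
proof -
 have C: "(ps has_derivative (%h. Dps y <.> h)) (at y)" if "y ~= 0" for y
 using assms(1) that by (simp add: hom0_C1_def C1_on_def)
 have hom: "ps (t *R y) = ps y" if "y ~= 0" "t > 0" for y t
 using assms(1) that by (simp add: hom0_C1_def)
 show "Dps (t *R x) = (1 / t) *R Dps x" if t: "t > 0"
 proof -
 have 1: "((%y. t *R y) has_derivative (%h. t *R h)) (at x)" by (auto intro!: derivative_eq_intros)
 have "((%y. ps (t *R y)) has_derivative (%h. Dps (t *R x) <.> (t *R h))) (at x)"
 using t assms(2) by (intro has_derivative_compose[OF 1 C]) auto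
 then have "(ps has_derivative (%h. Dps (t *R x) <.> (t *R h))) (at x)"
 by (rule has_derivative_transform_within_open[of _ _ _ _ "-{0}"]) (use assms(2) hom t in auto)
 from has_derivative_unique[OF this C[OF assms(2)]]
 have "(%h. Dps (t *R x) <.> (t *R h)) = (%h. Dps x <.> h)" .
 from fun_cong[OF this] have "(t *R Dps (t *R x)) <.> h = Dps x <.> h" for h
 by (simp only: inner_scaleR_left inner_scaleR_right)
 then have "t *R Dps (t *R x) = Dps x" using vector_eq_rdot[of "t *R Dps (t *R x)" "Dps x"] by simp
 then have "(1 / t) *R Dps x = (1 / t) *R t *R Dps (t *R x)" by (simp only:)
 then show ?thesis using t by simp
 qed
 have 1: "((%s. s *R x) has_derivative (%h. h *R x)) (at (1::real))" by (auto intro!: derivative_eq_intros)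
 have "((%s. ps (s *R x)) has_derivative (%h. Dps (1 *R x) <.> (h *R x))) (at 1)"
 using assms(2) by (intro has_derivative_compose[OF 1 C]) auto
 then have "((%s::real. ps x) has_derivative (%h. Dps (1 *R x) <.> (h *R x))) (at 1)"
 by (rule has_derivative_transform_within_open[of _ _ _ _ "{0<..}"]) (use assms(2) hom in auto)
 from has_derivative_unique[OF this has_derivative_const]
 have "(%h. Dps (1 *R x) <.> (h *R x)) = (%h::real. 0)" .
 from fun_cong[OF this, of 1] have "Dps (1 *R x) <.> (1 *R x) = 0" .
 then show "Dps x <.> x = 0" by simp
qed

lemma borel_measurable_continuous_off_0:
 fixes f :: "real^'n => 'b::topological_space"
 assumes "continuous_on (- {0}) f" shows "f \<in> bmb"
 using borel_measurable_continuous_countable_exceptions[of "{0}" f] assms by simp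

lemma hom0_C1_measurable:
 assumes "hom0_C1 ps Dps"
 shows "ps \<in> bmb" "Dps \<in> bmb"
 using assms C1_on_continuous[of "-{0}" ps Dps]
 by (auto intro!: borel_measurable_continuous_off_0 simp: hom0_C1_def C1_on_def)

lemma hom0_C1_bounded:
 fixes ps :: "real^'n => real"
 assumes "hom0_C1 ps Dps"
 obtains B where "B > 0" "!!x. x ~= 0 ==> \<bar>ps x\<bar> <= B" "!!x. x ~= 0 ==> norm x * norm (Dps x) <= B"
proof -
 have c: "continuous_on (-{0}) ps" "continuous_on (-{0}) Dps"
 using assms C1_on_continuous[of "-{0}" ps Dps] by (auto simp: hom0_C1_def C1_on_def)
 have "sphere 0 1 \<subseteq> - {0::real^'n}" by auto
 then have "bounded (ps ` sphere 0 1)" "bounded (Dps ` sphere 0 1)"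
 using c by (auto intro!: compact_imp_bounded compact_continuous_image intro: continuous_on_subset)
 then obtain B1 B2 where B: "!!x. x \<in> sphere 0 1 ==> norm (ps x) <= B1" "!!x. x \<in> sphere 0 1 ==> norm (Dps x) <= B2"
 proof -
 assume b: "bounded (ps ` sphere 0 1)" "bounded (Dps ` sphere 0 1)"
 and *: "!!B1 B2. (!!x. x \<in> sphere 0 1 ==> norm (ps x) <= B1) ==> (!!x. x \<in> sphere 0 1 ==> norm (Dps x) <= B2) ==> thesis"
 from b(1) obtain B1 where "\<forall>y\<in>ps ` sphere 0 1. norm y <= B1" unfolding bounded_iff ..
 moreover from b(2) obtain B2 where "\<forall>y\<in>Dps ` sphere 0 1. norm y <= B2" unfolding bounded_iff ..
 ultimately show thesis by (intro *) auto
 qed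
 have sp: "x /R norm x \<in> sphere 0 1" if "x ~= 0" for x :: "real^'n" using that by simp
 show thesis
 proof (rule that[of "max 1 (max B1 B2)"])
 fix x :: "real^'n" assume x: "x ~= 0"
 have "ps (x /R norm x) = ps x" using assms x by (simp add: hom0_C1_def)
 then show "\<bar>ps x\<bar> <= max 1 (max B1 B2)" using B(1)[OF sp[OF x]] by simp
 have "Dps (x /R norm x) = norm x *R Dps x" using hom0_C1_grad(1)[OF assms x, of "inverse (norm x)"] x by (simp add: inverse_eq_divide)
 then show "norm x * norm (Dps x) <= max 1 (max B1 B2)" using B(2)[OF sp[OF x]] by simp
 qed simp
qed

lemma integrable_annular_bounded:
 fixes f :: "real^'n => 'b::{banach, second_countable_topology}"
 assumes "f \<in> bmb" "!!x. x ~= 0 ==> norm (f x) <= B"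
 shows "integrable annul f"
proof (rule annular.integrable_const_bound)
 show "AE x in annul. norm (f x) <= B" using AE_annular_nz by eventually_elim (rule assms(2))
qed (use assms(1) in \<open>simp cong: measurable_cong_sets\<close>)

lemma hom0_C1_integrable:
 assumes "hom0_C1 ps Dps"
 shows "integrable annul ps" "integrable annul (%x. (ps x)^2)"
 "integrable annul (%x. (norm x)^2 * (norm (Dps x))^2)"
proof -
 obtain B where B: "B > 0" "!!x. x ~= 0 ==> \<bar>ps x\<bar> <= B" "!!x. x ~= 0 ==> norm x * norm (Dps x) <= B"
 using hom0_C1_bounded[OF assms] by metis
 note [measurable] = hom0_C1_measurable[OF assms]
 show "integrable annul ps"
 by (rule integrable_annular_bounded[where B=B]) (use B in auto)
 show "integrable annul (%x. (ps x)^2)"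
 proof (rule integrable_annular_bounded[where B="B^2"])
 show "norm ((ps x)^2) <= B^2" if "x ~= 0" for x using power_mono[OF B(2)[OF that], of 2] by simp
 qed measurable
 show "integrable annul (%x. (norm x)^2 * (norm (Dps x))^2)"
 proof (rule integrable_annular_bounded[where B="B^2"])
 show "norm ((norm x)^2 * (norm (Dps x))^2) <= B^2" if "x ~= 0" for x
 using power_mono[OF B(3)[OF that], of 2] by (simp add: power_mult_distrib)
 qed measurable
qed

lemma lebesgue_annulus_integral:
 fixes F :: "real^'n => real"
 assumes F: "integrable annul F" "!!x t. x ~= 0 ==> t > 0 ==> F (t *R x) = F x"
 shows "ln 2 * (LINT x:annulus12|lebesgue. F x) = (LINT x|annul. F x) * (LBINT s. ind {1..2} s * s ^ (CARD('n) - 1))"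
proof -
 have Fm[measurable]: "F \<in> bmb" using borel_measurable_integrable[OF F(1)] by (simp cong: measurable_cong_sets)
 let ?R = "%s::real. ind {1..2} s :: real"
 have e: "ind {0<..} s * s ^ (CARD('n) - 1) * ?R s = ind {1..2} s * s ^ (CARD('n) - 1)" for s :: real
 by (auto simp: indicator_def)
 have R: "intl (%s. ind {0<..} s * s ^ (CARD('n) - 1) * ?R s)"
 proof -
 have "set_integrable lborel {1..2} (%s::real. s ^ (CARD('n) - 1))"
 by (intro borel_integrable_atLeastAtMost') (intro continuous_intros)
 then show ?thesis unfolding e set_integrable_def by simp
 qed
 have "(LINT x:annulus12|lebesgue. F x) = (\<integral>x. F x * ?R (norm x) \<partial>lebesgue)"
 unfolding set_lebesgue_integral_def by (intro B_integral_cong) (auto simp: indicator_def annulus12_def)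
 also have "... = (LBINT x. F x * ?R (norm x))" by (rule integral_completion) measurable
 finally show ?thesis using polar_integral_hom0(2)[OF F R] unfolding e by simp
qed

lemma annular_weight_pos: "(\<integral>s. ind {1..2} s * s ^ n \<partial>(lborel :: real measure)) > (0::real)"
proof -
 have i: "intl (%s::real. ind {1..2} s * s ^ n)"
 proof -
 have "set_integrable lborel {1..2} (%s::real. s ^ n)"
 by (intro borel_integrable_atLeastAtMost') (intro continuous_intros)
 then show ?thesis unfolding set_integrable_def by simp
 qed
 have "(\<integral>s. ind {1..2} s \<partial>(lborel :: real measure)) <= (\<integral>s. ind {1..2} s * s ^ n \<partial>(lborel :: real measure))"
 proof (rule integral_mono)
 show "intl (ind {1..2::real} :: real => real)" by (rule integrable_real_indicator) auto
 show "ind {1..2} s <= ind {1..2} s * s ^ n" for s :: real by (auto simp: indicator_def)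
 qed (rule i)
 then show ?thesis by simp
qed

text \<open>For 0-homogeneous integrands the plain annulus integral and the integral over
  \<open>annul\<close> differ by a radial factor that cancels in the quotient.\<close>

lemma rayleigh_quotient_eq:
 fixes ps :: "real^'n => real"
 assumes "hom0_C1 ps Dps"
 shows "(LINT x:annulus12|lebesgue. (norm x)^2 * (norm (Dps x))^2) / (LINT x:annulus12|lebesgue. (ps x)^2)
 = (LINT x|annul. (norm x)^2 * (norm (Dps x))^2) / (LINT x|annul. (ps x)^2)"
proof -
 let ?W = "(\<integral>s. ind {1..2} s * s ^ (CARD('n) - 1) \<partial>(lborel :: real measure)) :: real"
 have 1: "ln 2 * (LINT x:annulus12|lebesgue. (norm x)^2 * (norm (Dps x))^2) = (LINT x|annul. (norm x)^2 * (norm (Dps x))^2) * ?W"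
 using hom0_C1_integrable(3)[OF assms] hom0_C1_grad(1)[OF assms]
 by (intro lebesgue_annulus_integral) (auto simp: power_mult_distrib power_divide)
 have 2: "ln 2 * (LINT x:annulus12|lebesgue. (ps x)^2) = (LINT x|annul. (ps x)^2) * ?W"
 using hom0_C1_integrable(2)[OF assms] assms by (intro lebesgue_annulus_integral) (auto simp: hom0_C1_def)
 have "(LINT x:annulus12|lebesgue. (norm x)^2 * (norm (Dps x))^2) / (LINT x:annulus12|lebesgue. (ps x)^2)
 = (ln 2 * (LINT x:annulus12|lebesgue. (norm x)^2 * (norm (Dps x))^2)) / (ln 2 * (LINT x:annulus12|lebesgue. (ps x)^2))"
 by simp
 also have "... = (LINT x|annul. (norm x)^2 * (norm (Dps x))^2) / (LINT x|annul. (ps x)^2)"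
 unfolding 1 2 using annular_weight_pos[of "CARD('n) - 1"] by simp
 finally show ?thesis .
qed

lemma lambda1_eq:
 fixes \<Omega> :: "(real^'a) set"
 shows
 "lambda1 \<Omega> = Inf {(LINT x|annul. (norm x)^2 * (norm (Dps x))^2) / (LINT x|annul. (ps x)^2) | ps Dps. sphere_test \<Omega> ps Dps}"
proof -
 have "{(LINT x:annulus12|lebesgue. (norm x)^2 * (norm (Dps x))^2) / (LINT x:annulus12|lebesgue. (ps x)^2) | ps Dps. sphere_test \<Omega> ps Dps}
 = {(LINT x|annul. (norm x)^2 * (norm (Dps x))^2) / (LINT x|annul. (ps x)^2) | ps Dps. sphere_test \<Omega> ps Dps}"
 proof -
 have "(LINT x:annulus12|lebesgue. (norm x)^2 * (norm (Dps x))^2) / (LINT x:annulus12|lebesgue. (ps x)^2)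
 = (LINT x|annul. (norm x)^2 * (norm (Dps x))^2) / (LINT x|annul. (ps x)^2)"
 if "sphere_test \<Omega> ps Dps" for ps Dps
 by (rule rayleigh_quotient_eq, rule hom0_test_C1[of \<Omega>]) (use that in \<open>simp add: sphere_test_iff\<close>)
 note eq = this
 show ?thesis
 proof (intro Collect_cong ex_cong1)
 fix y :: real and ps :: "real^'a => real" and Dps
 show "(y = (LINT x:annulus12|lebesgue. (norm x)^2 * (norm (Dps x))^2) / (LINT x:annulus12|lebesgue. (ps x)^2) & sphere_test \<Omega> ps Dps)
 = (y = (LINT x|annul. (norm x)^2 * (norm (Dps x))^2) / (LINT x|annul. (ps x)^2) & sphere_test \<Omega> ps Dps)"
 proof (cases "sphere_test \<Omega> ps Dps")
 case True
 show ?thesis unfolding eq[OF True] ..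
 qed simp
 qed
 qed
 then show ?thesis unfolding lambda1_def by (rule arg_cong)
qed

lemma bdd_below_rayleigh:
 "bdd_below {(LINT x|annul. (norm x)^2 * (norm (Dps x))^2) / (LINT x|annul. (ps x)^2) | ps Dps. sphere_test \<Omega> ps Dps}"
 by (rule bdd_belowI[of _ 0]) (auto intro!: divide_nonneg_nonneg integral_nonneg_AE)

text \<open>The infimum speaks only of functions that do not vanish identically; when the L2 norm is
  0 the claim is just nonnegativity of the energy.\<close>

lemma lambda1_poincare:
 assumes "hom0_test \<Omega> ps Dps"
 shows "lambda1 \<Omega> * (LINT x|annul. (ps x)^2) <= (LINT x|annul. (norm x)^2 * (norm (Dps x))^2)"
proof -
 let ?E = "\<integral>x. (norm x)^2 * (norm (Dps x))^2 \<partial>annul" and ?L = "\<integral>x. (ps x)^2 \<partial>annul"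
 have E: "?E >= 0" "?L >= 0" by (auto intro!: integral_nonneg_AE)
 show ?thesis
 proof (cases "?L = 0")
 case True then show ?thesis using E by simp
 next
 case False
 have "\<exists>om\<in>sphere 0 1. ps om ~= 0"
 proof (rule ccontr)
 assume *: "\<not> ?thesis"
 have z: "ps x = 0" if "x ~= 0" for x
 using *[simplified, rule_format, of "x /R norm x"] hom0_test_C1[OF assms] that unfolding hom0_C1_def by simp
 have "AE x in annul. (ps x)^2 = 0" using AE_annular_nz by eventually_elim (simp add: z)
 then have "?L = 0" by (rule integral_eq_zero_AE)
 with False show False by simp
 qed
 then have "sphere_test \<Omega> ps Dps" using assms by (simp add: sphere_test_iff)
 then have "lambda1 \<Omega> <= ?E / ?L" unfolding lambda1_eq by (intro cInf_lower bdd_below_rayleigh) auto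
 then show ?thesis using False E by (simp add: pos_le_divide_eq)
 qed
qed

section \<open>A differential inequality without global solutions\<close>

text \<open>\<open>arctan (P t) + e * t\<close> does not increase although \<open>arctan\<close> is
  bounded: \<open>P\<close> would have to reach minus infinity in finite time.\<close>

lemma no_global_riccati:
 fixes P P' :: "real => real"
 assumes d: "!!t. t > T ==> (P has_real_derivative P' t) (at t)"
 and le: "!!t. t > T ==> P' t <= - e * (1 + (P t)^2)" and e: "e > 0"
 shows False
proof -
 define g where "g t = arctan (P t) + e * t" for t
 have dec: "g t <= g (T + 1)" if t: "t >= T + 1" for t
 proof (rule DERIV_nonpos_imp_nonincreasing[OF t])
 fix s assume "T + 1 <= s" "s <= t"
 then have s: "s > T" by simp
 have pos: "1 + (P s)^2 > 0" by (simp add: add_pos_nonneg)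
 have "(g has_real_derivative (inverse (1 + (P s)^2) * P' s + e)) (at s)"
 proof -
 have "((%t. arctan (P t)) has_real_derivative inverse (1 + (P s)^2) * P' s) (at s)"
 by (rule DERIV_chain2[OF DERIV_arctan d[OF s]])
 moreover have "((%t. e * t) has_real_derivative e) (at s)" by (auto intro!: derivative_eq_intros)
 ultimately show ?thesis unfolding g_def[abs_def] by (rule DERIV_add)
 qed
 moreover have "inverse (1 + (P s)^2) * P' s <= inverse (1 + (P s)^2) * (- e * (1 + (P s)^2))"
 using le[OF s] pos by (intro mult_left_mono) auto
 moreover have "inverse (1 + (P s)^2) * (- e * (1 + (P s)^2)) = - e"
 proof -
 have "inverse z * (- e * z) = - e" if "z > 0" for z :: real using that by simp
 from this[OF pos] show ?thesis .
 qed
 ultimately have "(g has_real_derivative (inverse (1 + (P s)^2) * P' s + e)) (at s) & inverse (1 + (P s)^2) * P' s + e <= 0"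
 by linarith
 then show "\<exists>y. (g has_real_derivative y) (at s) & y <= 0" ..
 qed
 \<comment> \<open>By this time the linear term has grown by \<open>pi + 1\<close>, more than
   \<open>arctan\<close> can drop.\<close>
 define t where "t = T + 1 + (pi + 1) / e"
 have t: "t >= T + 1" using e pi_gt_zero by (simp add: t_def)
 have "arctan (P t) + e * t <= arctan (P (T + 1)) + e * (T + 1)" using dec[OF t] by (simp add: g_def)
 moreover have "e * t = e * (T + 1) + (pi + 1)" using e by (simp add: t_def field_simps)
 moreover have "arctan (P t) > - (pi / 2)" "arctan (P (T + 1)) < pi / 2" by (rule arctan_lbound arctan_ubound)+
 ultimately show False by linarith
qed

text \<open>If \<open>f\<close> exceeded \<open>c\<close> at some time, look at the last earlier
  time with \<open>f \<le> c\<close>: there \<open>f = c\<close> and the derivative is negative, so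
  \<open>f\<close> could not rise right after it.\<close>

lemma barrier_from_above:
 fixes f f' :: "real => real"
 assumes d: "!!t. t >= t0 ==> (f has_real_derivative f' t) (at t)"
 and neg: "!!t. t >= t0 ==> f t = c ==> f' t < 0" and f0: "f t0 <= c" and t: "t >= t0"
 shows "f t <= c"
proof (rule ccontr)
 assume "\<not> f t <= c"
 then have ft: "f t > c" by simp
 define S where "S = {s \<in> {t0..t}. f s <= c}"
 have cont: "continuous_on {t0..t} f"
 by (intro continuous_at_imp_continuous_on ballI DERIV_isCont[OF d]) simp
 have "closed S"
 unfolding S_def using continuous_closed_preimage[OF cont closed_real_atLeastAtMost closed_atMost[of c]]
 by (simp add: vimage_def Int_def conj_commute)
 have S: "t0 \<in> S" "S \<subseteq> {t0..t}" using f0 t by (auto simp: S_def)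
 have bdd: "bdd_above S" by (rule bdd_above_mono[OF bdd_above_Icc S(2)])
 define s where "s = Sup S"
 have sS: "s \<in> S" unfolding s_def using \<open>closed S\<close> S(1) bdd by (intro closed_contains_Sup) auto
 then have s: "t0 <= s" "s <= t" "f s <= c" by (auto simp: S_def)
 have st: "s < t" using s ft by (cases "s = t") auto
 have above: "f r > c" if "s < r" "r <= t" for r
 proof (rule ccontr)
 assume "\<not> f r > c"
 then have "r \<in> S" using that s by (auto simp: S_def)
 then have "r <= s" unfolding s_def by (rule cSup_upper[OF _ bdd])
 with that show False by simp
 qed
 have "f s >= c"
 proof (rule tendsto_lowerbound)
 have "isCont f s" using d[OF s(1)] by (rule DERIV_isCont)
 then show "(f \<longlongrightarrow> f s) (at_right s)" unfolding isCont_def by (rule tendsto_within_subset) simp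
 show "\<forall>\<^sub>F r in at_right s. c <= f r"
 using eventually_at_right_less[of s] eventually_at_rightI[of s t "%r. c <= f r"] above st
 by (auto intro: less_imp_le)
 qed simp
 then have "f s = c" using s by simp
 then have "f' s < 0" using neg s by simp
 then obtain e where e: "e > 0" "!!h. h > 0 ==> h < e ==> f (s + h) < f s"
 using DERIV_neg_dec_right[OF d[OF s(1)]] by auto
 define h where "h = min (e / 2) (t - s)"
 have "h > 0" "h < e" "s + h <= t" using e st by (auto simp: h_def)
 then show False using e(2)[of h] above[of "s + h"] \<open>f s = c\<close> by auto
qed

text \<open>Subtracting the line \<open>be * t\<close> from \<open>m\<close> removes
  \<open>t\<close> from the exponent and leaves
  \<open>P' \<le> - (P^2 + bb * P + de) - exp ((q - 1) * M - 2)\<close> with \<open>de > 0\<close>.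
  Since \<open>bb \<le> 0\<close>, the linear term is harmful only for positive \<open>P\<close>. If
  \<open>P\<close> ever falls to a small level it stays there, and the square and \<open>de\<close>
  win; otherwise \<open>M\<close> grows at least linearly and the exponential wins.\<close>

lemma no_global_emden_fowler:
 fixes m m' m'' :: "real => real"
 assumes d1: "!!t. t > t1 ==> (m has_real_derivative m' t) (at t)"
 and d2: "!!t. t > t1 ==> (m' has_real_derivative m'' t) (at t)"
 and ineq: "!!t. t > t1 ==> m'' t + n * m' t + (m' t)^2 + exp (2 * t - 2 + (q - 1) * m t) <= A"
 and q: "q > 1" and be: "be = - 2 / (q - 1)" and b: "2 * be + n <= 0" and A: "A < be * (be + n)"
 shows False
proof -
 define P where "P t = m' t - be" for t
 define M where "M t = m t - be * t" for t
 define bb where "bb = 2 * be + n"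
 define de where "de = be * (be + n) - A"
 have de: "de > 0" using A by (simp add: de_def)
 have dP: "(P has_real_derivative m'' t) (at t)" if "t > t1" for t
 unfolding P_def[abs_def] using d2[OF that] by (auto intro!: derivative_eq_intros)
 have dM: "(M has_real_derivative P t) (at t)" if "t > t1" for t
 unfolding M_def[abs_def] P_def using d1[OF that] by (auto intro!: derivative_eq_intros)
 have qbe: "(q - 1) * be = - 2" unfolding be using q nonzero_mult_div_cancel_left[of "q - 1" "- 2"] by (simp only: times_divide_eq_right)
 have main: "m'' t <= - ((P t)^2 + bb * P t + de) - exp ((q - 1) * M t - 2)" if t: "t > t1" for t
 proof -
 have m': "m' t = P t + be" by (simp add: P_def)
 have "2 * t - 2 + (q - 1) * m t = (q - 1) * M t - 2 + t * (2 + (q - 1) * be)"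
 by (simp add: M_def algebra_simps)
 then have e: "2 * t - 2 + (q - 1) * m t = (q - 1) * M t - 2" by (simp add: qbe)
 show ?thesis
 using ineq[OF t] unfolding e m' by (simp add: bb_def de_def power2_eq_square algebra_simps)
 qed
 have bb: "bb <= 0" using b by (simp add: bb_def)
 \<comment> \<open>Level up to which the linear term takes away at most half of
   \<open>de\<close>.\<close>
 define P0 where "P0 = de / (2 * (\<bar>bb\<bar> + 1))"
 have P0: "P0 > 0" using de by (simp add: P0_def)
 have bP0: "\<bar>bb\<bar> * P0 <= de / 2"
 proof -
 have "\<bar>bb\<bar> * P0 = (de / 2) * (\<bar>bb\<bar> / (\<bar>bb\<bar> + 1))" by (simp add: P0_def field_simps)
 also have "... <= de / 2 * 1" using de by (intro mult_left_mono) auto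
 finally show ?thesis by simp
 qed
 have low: "bb * x >= - de / 2" if "x <= P0" for x
 proof -
 have "\<bar>bb\<bar> * x <= \<bar>bb\<bar> * P0" using that by (intro mult_left_mono) auto
 moreover have "\<bar>bb\<bar> * x = - (bb * x)" using bb by simp
 ultimately show ?thesis using bP0 by linarith
 qed
 show False
 proof (cases "\<exists>t0>t1. P t0 <= P0")
 case True
 then obtain t0 where t0: "t0 > t1" "P t0 <= P0" by blast
 have neg: "m'' t < 0" if "t >= t0" "P t = P0" for t
 proof -
 have tt: "t > t1" using that t0 by simp
 have "0 <= (P t)^2" "0 < exp ((q - 1) * M t - 2)" by auto
 then show ?thesis using main[OF tt] low[of "P t"] that(2) de by linarith
 qed
 have dP0: "(P has_real_derivative m'' t) (at t)" if "t >= t0" for t using dP that t0 by simp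
 have bd: "P t <= P0" if "t >= t0" for t
 using barrier_from_above[of t0 P m'' P0 t] dP0 neg t0(2) that by blast
 show False
 proof (rule no_global_riccati[where P=P and P'=m'' and T=t0 and e="min 1 (de / 2)"])
 show "(P has_real_derivative m'' t) (at t)" if "t > t0" for t using dP that t0 by simp
 show "m'' t <= - min 1 (de / 2) * (1 + (P t)^2)" if "t > t0" for t
 proof -
 have tt: "t > t1" "t >= t0" using that t0 by auto
 have "0 < exp ((q - 1) * M t - 2)" by simp
 then have "m'' t <= - ((P t)^2) - de / 2" using main[OF tt(1)] low[OF bd[OF tt(2)]] by linarith
 moreover have "min 1 (de / 2) * (P t)^2 <= 1 * (P t)^2" by (intro mult_right_mono) auto
 moreover have "min 1 (de / 2) <= de / 2" by simp
 ultimately show ?thesis by (simp add: algebra_simps)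
 qed
 qed (use de in auto)
 next
 case False
 then have big: "P t > P0" if "t > t1" for t using that by force
 have grow: "M t >= M (t1 + 1) + P0 * (t - (t1 + 1))" if t: "t >= t1 + 1" for t
 proof -
 have "M (t1 + 1) - P0 * (t1 + 1) <= M t - P0 * t"
 proof (rule DERIV_nonneg_imp_nondecreasing[OF t])
 fix x assume "t1 + 1 <= x" "x <= t"
 then have x: "x > t1" by simp
 have "((%t. M t - P0 * t) has_real_derivative (P x - P0)) (at x)"
 using dM[OF x] by (auto intro!: derivative_eq_intros)
 then show "\<exists>y. ((%t. M t - P0 * t) has_real_derivative y) (at x) & 0 <= y"
 using big[OF x] by (intro exI conjI) auto
 qed
 then show ?thesis by (simp add: algebra_simps)
 qed
 \<comment> \<open>Makes the exponent at least \<open>bb^2 / 2 + 1\<close>, which pays for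
   completing the square in \<open>P^2 / 2 + bb * P\<close> and for the constant in the Riccati
   inequality.\<close>
 define X where "X = (bb^2 / 2 + 3) / (q - 1)"
 define T where "T = t1 + 1 + (\<bar>X - M (t1 + 1)\<bar>) / P0"
 have T: "T >= t1 + 1" using P0 by (simp add: T_def)
 have MX: "M t >= X" if "t >= T" for t
 proof -
 have "P0 * (t - (t1 + 1)) >= P0 * (\<bar>X - M (t1 + 1)\<bar> / P0)"
 using that P0 by (intro mult_left_mono) (auto simp: T_def)
 then have "P0 * (t - (t1 + 1)) >= \<bar>X - M (t1 + 1)\<bar>" using P0 by simp
 then show ?thesis using grow[of t] that T by linarith
 qed
 show False
 proof (rule no_global_riccati[where P=P and P'=m'' and T=T and e="1/2"])
 show "(P has_real_derivative m'' t) (at t)" if "t > T" for t using dP that T by simp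
 show "m'' t <= - (1/2) * (1 + (P t)^2)" if "t > T" for t
 proof -
 have tt: "t > t1" using that T by simp
 have "(q - 1) * M t >= (q - 1) * X" using MX[of t] that q by (intro mult_left_mono) auto
 then have "(q - 1) * M t - 2 >= bb^2 / 2 + 1" using q by (simp add: X_def)
 then have "exp ((q - 1) * M t - 2) >= bb^2 / 2 + 1" using exp_ge_add_one_self[of "(q - 1) * M t - 2"] by linarith
 moreover have "(P t + bb)^2 >= 0" by simp
 then have "(P t)^2 / 2 + bb * P t + bb^2 / 2 >= 0" by (simp add: power2_sum mult.commute[of bb])
 ultimately show ?thesis using main[OF tt] de by (simp add: algebra_simps)
 qed
 qed simp
 qed
qed

section \<open>The coefficient matrix\<close>

text \<open>The angular part of the operator is multiplied by \<open>d\<close>, the radial part is left unchanged.\<close>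

definition aniso :: "real => real^'n => real^'n^'n" where
 "aniso d x = (\<chi> i j. (if i = j then d else 0) + (1 - d) * (x $ i * x $ j) / (norm x)^2)"

lemma aniso_mult: "aniso d x *v \<xi> = d *R \<xi> + ((1 - d) * (x <.> \<xi>) / (norm x)^2) *R x"
proof (rule vec_eq_iff[THEN iffD2], rule allI)
 fix i
 have "(aniso d x *v \<xi>) $ i = (\<Sum>j\<in>UNIV. (if i = j then d else 0) * \<xi> $ j + ((1 - d) * (x $ i) / (norm x)^2) * (x $ j * \<xi> $ j))"
 unfolding aniso_def matrix_vector_mult_def by (simp add: algebra_simps)
 also have "... = d * \<xi> $ i + ((1 - d) * (x $ i) / (norm x)^2) * (x <.> \<xi>)"
 proof -
 have "(\<Sum>j\<in>UNIV. (if i = j then d else 0) * \<xi> $ j) = d * \<xi> $ i"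
 by (simp add: if_distrib[of "%y. y * _"] cong: if_cong)
 moreover have "(\<Sum>j\<in>UNIV. ((1 - d) * (x $ i) / (norm x)^2) * (x $ j * \<xi> $ j)) = ((1 - d) * (x $ i) / (norm x)^2) * (x <.> \<xi>)"
 unfolding inner_vec_def sum_distrib_left by (simp only: inner_real_def)
 ultimately show ?thesis by (simp only: sum.distrib)
 qed
 finally show "(aniso d x *v \<xi>) $ i = (d *R \<xi> + ((1 - d) * (x <.> \<xi>) / (norm x)^2) *R x) $ i"
 by (simp add: algebra_simps)
qed

lemma aniso_inner: "g <.> (aniso d x *v w) = d * (g <.> w) + (1 - d) * (x <.> g) * (x <.> w) / (norm x)^2"
 by (simp add: aniso_mult inner_add_right inner_commute mult_ac)

lemma radial_part_le: "(x <.> \<xi>)^2 / (norm x)^2 <= (norm \<xi>)^2"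
proof (cases "x = 0")
 case False
 have "\<bar>x <.> \<xi>\<bar>^2 <= (norm x * norm \<xi>)^2" using Cauchy_Schwarz_ineq2[of x \<xi>] by (intro power_mono) auto
 then show ?thesis using False by (simp add: divide_le_eq power_mult_distrib mult.commute)
qed simp

text \<open>\<open>c\<close> is the squared length of the radial part of the vector, on which the
  matrix acts with eigenvalue 1; on the remainder it acts with eigenvalue \<open>d\<close>.\<close>

lemma aniso_bounds:
 assumes "d > 0"
 shows "min 1 d * (norm \<xi>)^2 <= \<xi> <.> (aniso d x *v \<xi>)" "\<xi> <.> (aniso d x *v \<xi>) <= max 1 d * (norm \<xi>)^2"
proof -
 define c where "c = (x <.> \<xi>)^2 / (norm x)^2"
 define z where "z = (norm \<xi>)^2"
 have c: "0 <= c" "c <= z" unfolding c_def z_def using radial_part_le[of x \<xi>] by auto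
 have eq: "\<xi> <.> (aniso d x *v \<xi>) = d * (z - c) + 1 * c"
 proof -
 have "(1 - d) * (x <.> \<xi>) * (x <.> \<xi>) / (norm x)^2 = (1 - d) * c" by (simp add: c_def power2_eq_square)
 moreover have "\<xi> <.> \<xi> = z" by (simp add: z_def power2_norm_eq_inner)
 ultimately show ?thesis unfolding aniso_inner by (simp only:) (simp add: algebra_simps)
 qed
 have "min 1 d * (z - c) <= d * (z - c)" "min 1 d * c <= 1 * c" "d * (z - c) <= max 1 d * (z - c)" "1 * c <= max 1 d * c"
 using c by (intro mult_right_mono; simp)+
 then show "min 1 d * (norm \<xi>)^2 <= \<xi> <.> (aniso d x *v \<xi>)" "\<xi> <.> (aniso d x *v \<xi>) <= max 1 d * (norm \<xi>)^2"
 unfolding eq z_def[symmetric] by (auto simp: algebra_simps)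
qed

lemma borel_measurable_aniso: "aniso d \<in> bmb"
proof (rule borel_measurable_euclidean_space[THEN iffD2], rule ballI)
 fix B :: "real^'a^'a" assume "B \<in> Basis"
 then obtain i v where B: "B = axis i v" "v \<in> Basis" by (auto simp: Basis_vec_def)
 from B(2) obtain j where v: "v = axis j (1::real)" by (auto simp: Basis_vec_def)
 have "(%x. aniso d x <.> B) = (%x. aniso d x $ i $ j)"
 by (simp add: B(1) v inner_axis)
 also have "... = (%x. (if i = j then d else 0) + (1 - d) * (x $ i * x $ j) / (norm x)^2)"
 by (simp add: aniso_def)
 finally show "(%x. aniso d x <.> B) \<in> bmb" by simp
qed

lemma elliptic_aniso:
 assumes d: "d > 0" shows "sym_meas_unif_elliptic (aniso d :: real^'a => _)"
 unfolding sym_meas_unif_elliptic_def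
proof (intro conjI allI)
 show "(aniso d :: real^'a => _) \<in> borel_measurable lebesgue"
 using borel_measurable_aniso by (auto intro!: measurable_completion)
 show "transpose (aniso d x) = aniso d x" for x
 by (simp add: transpose_def aniso_def vec_eq_iff mult.commute)
 define \<nu> where "\<nu> = max (max 1 d) (1 / d)"
 have "\<nu> > 0" using d by (simp add: \<nu>_def)
 have "inverse \<nu> <= min 1 d"
 proof -
 have "inverse \<nu> <= inverse 1" "inverse \<nu> <= inverse (1 / d)"
 using d by (intro le_imp_inverse_le; simp add: \<nu>_def)+
 then show ?thesis by simp
 qed
 then have "inverse \<nu> * (norm \<xi>)^2 <= \<xi> <.> (aniso d x *v \<xi>) & \<xi> <.> (aniso d x *v \<xi>) <= \<nu> * (norm \<xi>)^2" for x \<xi> :: "real^'a"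
 using aniso_bounds[OF d, of \<xi> x] mult_right_mono[of "inverse \<nu>" "min 1 d" "(norm \<xi>)^2"] mult_right_mono[of "max 1 d" \<nu> "(norm \<xi>)^2"]
 by (auto simp: \<nu>_def)
 then show "\<exists>\<nu>>0. AE x in lebesgue. \<forall>\<xi>::real^'a. inverse \<nu> * (norm \<xi>)^2 <= \<xi> <.> (aniso d x *v \<xi>) & \<xi> <.> (aniso d x *v \<xi>) <= \<nu> * (norm \<xi>)^2"
 using \<open>\<nu> > 0\<close> by (intro exI[of _ \<nu>]) simp
qed

lemma measurable_aniso_mult [measurable (raw)]:
 fixes f g :: "'a => real^'n"
 assumes [measurable]: "f \<in> borel_measurable M" "g \<in> borel_measurable M"
 shows "(%x. aniso d (f x) *v g x) \<in> borel_measurable M"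
 unfolding aniso_mult by measurable

lemma norm_aniso_mult_le:
 assumes "d > 0" shows "norm (aniso d x *v \<xi>) <= (2 * d + 1) * norm \<xi>"
proof -
 have "norm (((1 - d) * (x <.> \<xi>) / (norm x)^2) *R x) <= \<bar>1 - d\<bar> * norm \<xi>"
 proof (cases "x = 0")
 case False
 have "norm (((1 - d) * (x <.> \<xi>) / (norm x)^2) *R x) = \<bar>1 - d\<bar> * (\<bar>x <.> \<xi>\<bar> / norm x)"
 using False by (simp add: abs_mult power2_eq_square)
 also have "... <= \<bar>1 - d\<bar> * norm \<xi>"
 using Cauchy_Schwarz_ineq2[of x \<xi>] False by (intro mult_left_mono) (auto simp: divide_le_eq mult.commute)
 finally show ?thesis .
 qed simp
 then have "norm (aniso d x *v \<xi>) <= d * norm \<xi> + \<bar>1 - d\<bar> * norm \<xi>"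
 unfolding aniso_mult using assms by (intro norm_triangle_le add_mono) auto
 also have "... = (d + \<bar>1 - d\<bar>) * norm \<xi>" by (simp add: distrib_right)
 also have "... <= (2 * d + 1) * norm \<xi>" using assms by (intro mult_right_mono) auto
 finally show ?thesis .
qed

section \<open>Testing a supersolution\<close>

text \<open>Working form of \<open>pos_supersolution\<close>: a Borel representative that is
  positive everywhere, so that \<open>ln u\<close> and powers of \<open>u\<close> need no
  exceptional set, a fixed weak gradient, and tests whose sign and support conditions hold
  pointwise.\<close>

definition supersol :: "real => real => (real^'n) set => (real^'n => real) => (real^'n => real^'n) => bool" where
 "supersol d q G u g \<longleftrightarrow> weak_H1 G u g & (\<forall>x. u x > 0) &
 (\<forall>ph Dph. weak_H1 G ph Dph --> (\<forall>x. ph x >= 0) --> (\<exists>K. compact K & K \<subseteq> G & (\<forall>x. x \<notin> K --> ph x = 0)) -->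
 (\<integral>\<^sup>+x. ennreal (u x powr q * ph x) \<partial>lborel) <= ennreal (LBINT x. ind G x * (g x <.> (aniso d x *v Dph x))))"

lemma pos_supersolution_imp_supersol:
 fixes G :: "(real^'n) set"
 assumes G: "open G" and u: "pos_supersolution (aniso d) q G u"
 shows "\<exists>u g. supersol d q G u g"
proof -
 obtain Du where Du: "H1loc G u Du"
 and test: "!!ph Dph. H1loc G ph Dph ==> (AE x in lebesgue. x \<in> G --> 0 <= ph x) ==>
 (\<exists>K. compact K & K \<subseteq> G & (AE x in lebesgue. x \<notin> K --> ph x = 0)) ==>
 (\<integral>\<^sup>+x. ind G x * ennreal (u x powr q * ph x) \<partial>lebesgue)
 <= ennreal (LINT x:G|lebesgue. Du x <.> (aniso d x *v Dph x))"
 using u unfolding pos_supersolution_def by blast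
 have pos: "AE x in lebesgue. x \<in> G --> u x > 0" using u unfolding pos_supersolution_def by blast
 have m: "u \<in> borel_measurable lebesgue" "Du \<in> borel_measurable lebesgue" using Du by (auto simp: H1loc_def)
 obtain v0 where v0: "v0 \<in> borel_measurable lborel" "AE x in lborel. u x = v0 x"
 using completion_ex_borel_measurable_real[OF m(1)] by blast
 obtain g where g: "g \<in> borel_measurable lborel" "AE x in lborel. Du x = g x"
 using completion_ex_borel_measurable_vec[OF m(2)] by blast
 \<comment> \<open>Within \<open>G\<close> the replacement affects a null set only; off
   \<open>G\<close>, where all tests vanish, the value is free.\<close>
 define v where "v x = (if v0 x > 0 then v0 x else 1)" for x
 have [measurable]: "v0 \<in> bmb" "g \<in> bmb" using v0 g by auto
 have vm[measurable]: "v \<in> bmb" unfolding v_def[abs_def] by measurable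
 have ae_v: "AE x in lebesgue. x \<in> G --> u x = v x"
 using AE_completion[OF v0(2)] pos by eventually_elim (auto simp: v_def)
 have ae_g: "AE x in lebesgue. x \<in> G --> Du x = g x"
 using AE_completion[OF g(2)] by eventually_elim simp
 have vH: "weak_H1 G v g" by (rule H1loc_imp_weak_H1[OF G Du vm ae_v _ ae_g]) measurable
 have "(\<integral>\<^sup>+x. ennreal (v x powr q * ph x) \<partial>lborel) <= ennreal (LBINT x. ind G x * (g x <.> (aniso d x *v Dph x)))"
 if ph: "weak_H1 G ph Dph" "\<forall>x. ph x >= 0" and K: "compact K" "K \<subseteq> G" "\<forall>x. x \<notin> K --> ph x = 0" for ph Dph K
 proof -
 note [measurable] = weak_H1D(1,2)[OF ph(1)]
 have [measurable]: "G \<in> sets borel" using G by auto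
 have "(\<integral>\<^sup>+x. ennreal (v x powr q * ph x) \<partial>lborel) = (\<integral>\<^sup>+x. ennreal (v x powr q * ph x) \<partial>lebesgue)"
 by (simp add: nn_integral_completion)
 also have "... = (\<integral>\<^sup>+x. ind G x * ennreal (u x powr q * ph x) \<partial>lebesgue)"
 proof (rule nn_integral_cong_AE)
 show "AE x in lebesgue. ennreal (v x powr q * ph x) = ind G x * ennreal (u x powr q * ph x)"
 using ae_v
 proof eventually_elim
 case (elim x)
 then show ?case using K(2,3) by (cases "x \<in> G") auto
 qed
 qed
 also have "... <= ennreal (LINT x:G|lebesgue. Du x <.> (aniso d x *v Dph x))"
 using ph(2) K by (intro test weak_H1_imp_H1loc[OF ph(1)] exI[of _ K]) auto
 also have "(LINT x:G|lebesgue. Du x <.> (aniso d x *v Dph x)) = (\<integral>x. ind G x * (g x <.> (aniso d x *v Dph x)) \<partial>lebesgue)"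
 unfolding set_lebesgue_integral_def
 proof (rule integral_cong_AE)
 have mm: "(%x. ind G x * (g x <.> (aniso d x *v Dph x))) \<in> borel_measurable lborel" by measurable
 then show "(%x. ind G x * (g x <.> (aniso d x *v Dph x))) \<in> borel_measurable lebesgue" by (rule measurable_completion)
 have "(%x. aniso d x *v Dph x) \<in> borel_measurable lborel" by measurable
 then have [measurable]: "(%x. aniso d x *v Dph x) \<in> borel_measurable lebesgue" by (rule measurable_completion)
 note m(2)[measurable]
 have [measurable]: "G \<in> sets lebesgue" using G by auto
 show "(%x. ind G x *R (Du x <.> (aniso d x *v Dph x))) \<in> borel_measurable lebesgue" by measurable
 show "AE x in lebesgue. ind G x *R (Du x <.> (aniso d x *v Dph x)) = ind G x * (g x <.> (aniso d x *v Dph x))"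
 using ae_g by eventually_elim (auto simp: indicator_def)
 qed
 also have "... = (LBINT x. ind G x * (g x <.> (aniso d x *v Dph x)))"
 by (rule integral_completion) measurable
 finally show ?thesis .
 qed
 then have "supersol d q G v g" unfolding supersol_def using vH by (auto simp: v_def)
 then show ?thesis by blast
qed

lemma C1c_zero_grad:
 assumes "C1c G ze Dze" "!!x. ze x = 0" shows "Dze x = 0"
proof -
 have "(ze has_derivative (%h. Dze x <.> h)) (at x)" using assms(1) by (simp add: C1c_def)
 moreover have "ze = (%_. 0)" using assms(2) by auto
 ultimately have "((%_. 0::real) has_derivative (%h. Dze x <.> h)) (at x)" by simp
 from has_derivative_unique[OF this has_derivative_const] have "(%h. Dze x <.> h) = (%h. 0)" .
 from fun_cong[OF this, of "Dze x"] show ?thesis by simp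
qed

lemma continuous_AE_zero:
 fixes f :: "'a::euclidean_space => real"
 assumes "continuous_on UNIV f" "AE x in lborel. f x = 0"
 shows "f x = 0"
proof (rule ccontr)
 assume "f x ~= 0"
 have o: "open {x. f x ~= 0}" using assms(1) by (intro open_Collect_neq) auto
 have "AE x in lebesgue. x \<notin> {x. f x ~= 0}" unfolding AE_completion_iff using assms(2) by simp
 then have "negligible {x. f x ~= 0}"
 unfolding negligible_iff_null_sets using o by (subst AE_iff_null_sets) auto
 then show False using open_not_negligible[OF o] \<open>f x ~= 0\<close> by blast
qed

text \<open>The factor \<open>1 / (u x + ep)\<close> is bounded by \<open>1 / ep\<close>, so local
  square integrability of \<open>g\<close> carries over to \<open>w\<close>.\<close>

lemma integrable_test_quad:
 fixes G :: "(real^'n) set"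
 assumes u: "weak_H1 G u g" "!!x. u x > 0" and ze: "C1c G ze Dze" and d: "d > 0" and e: "ep > 0"
 defines "w \<equiv> %x. (1 / (u x + ep)) *R g x"
 shows "intl (%x. w x <.> (aniso d x *v Dze x))" "intl (%x. ze x * (w x <.> (aniso d x *v w x)))"
 "w \<in> bmb"
proof -
 note [measurable] = weak_H1D(1,2)[OF u(1)] C1c_measurable[OF ze]
 show wm[measurable]: "w \<in> bmb" unfolding w_def by measurable
 obtain K where K: "compact K" "K \<subseteq> G" "!!x. x \<notin> K ==> ze x = 0" "!!x. x \<notin> K ==> Dze x = 0"
 using C1c_support[OF ze] by metis
 have [measurable]: "K \<in> sets borel" using K(1) borel_compact by auto
 obtain C1 where C1: "C1 > 0" "!!x. norm (ze x) <= C1 * ind K x"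
 using bounded_compact_support[OF C1c_continuous(1)[OF ze] K(1,3)] by blast
 obtain C2 where C2: "C2 > 0" "!!x. norm (Dze x) <= C2 * ind K x"
 using bounded_compact_support[OF C1c_continuous(2)[OF ze] K(1,4)] by blast
 have wle: "norm (w x) <= (1/ep) * norm (g x)" for x
 proof -
 have "1 / (u x + ep) <= 1 / ep" "0 <= 1 / (u x + ep)" using e u(2)[of x] by (auto intro!: divide_left_mono mult_pos_pos add_pos_pos)
 then show ?thesis unfolding w_def norm_scaleR by (intro mult_right_mono) auto
 qed
 have gi: "intl (%x. ind K x * norm (g x))"
 using integrable_norm[OF weak_H1D(4)[OF u(1) K(1,2)]] by (simp add: abs_indicator)
 have g2: "intl (%x. ind K x * (norm (g x))^2)" by (rule weak_H1D(6)[OF u(1) K(1,2)])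
 show "intl (%x. w x <.> (aniso d x *v Dze x))"
 proof (rule B_integrable_bound[OF integrable_mult_right[OF gi, of "(1/ep) * ((2 * d + 1) * C2)"]])
 show "AE x in lborel. norm (w x <.> (aniso d x *v Dze x)) <= norm ((1/ep) * ((2 * d + 1) * C2) * (ind K x * norm (g x)))"
 proof (rule AE_I2)
 fix x
 have "norm (w x <.> (aniso d x *v Dze x)) <= norm (w x) * norm (aniso d x *v Dze x)" using Cauchy_Schwarz_ineq2 by simp
 also have "... <= ((1/ep) * norm (g x)) * ((2 * d + 1) * (C2 * ind K x))"
 using wle[of x] norm_aniso_mult_le[OF d, of x "Dze x"] C2(2)[of x] d e
 by (intro mult_mono order.trans[OF norm_aniso_mult_le[OF d]] mult_left_mono) auto
 also have "... = (1/ep) * ((2 * d + 1) * C2) * (ind K x * norm (g x))" by simp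
 also have "... <= norm ((1/ep) * ((2 * d + 1) * C2) * (ind K x * norm (g x)))" unfolding real_norm_def by (rule abs_ge_self)
 finally show "norm (w x <.> (aniso d x *v Dze x)) <= norm ((1/ep) * ((2 * d + 1) * C2) * (ind K x * norm (g x)))" .
 qed
 qed measurable
 show "intl (%x. ze x * (w x <.> (aniso d x *v w x)))"
 proof (rule B_integrable_bound[OF integrable_mult_right[OF g2, of "C1 * (max 1 d * (1/ep)^2)"]])
 show "AE x in lborel. norm (ze x * (w x <.> (aniso d x *v w x))) <= norm (C1 * (max 1 d * (1/ep)^2) * (ind K x * (norm (g x))^2))"
 proof (rule AE_I2)
 fix x
 have "0 <= min 1 d * (norm (w x))^2" using d by simp
 then have "0 <= w x <.> (aniso d x *v w x)" using aniso_bounds(1)[OF d, of "w x" x] by linarith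
 moreover have "w x <.> (aniso d x *v w x) <= max 1 d * ((1/ep)^2 * (norm (g x))^2)"
 proof -
 have "(norm (w x))^2 <= ((1/ep) * norm (g x))^2" using wle[of x] by (intro power_mono) auto
 then have "max 1 d * (norm (w x))^2 <= max 1 d * ((1/ep)^2 * (norm (g x))^2)"
 by (intro mult_left_mono) (auto simp: power_mult_distrib power_divide)
 then show ?thesis using aniso_bounds(2)[OF d, of "w x" x] by linarith
 qed
 ultimately have "\<bar>ze x\<bar> * \<bar>w x <.> (aniso d x *v w x)\<bar> <= (C1 * ind K x) * (max 1 d * ((1/ep)^2 * (norm (g x))^2))"
 using C1(2)[of x] C1(1) by (intro mult_mono) auto
 also have "... <= norm (C1 * (max 1 d * (1/ep)^2) * (ind K x * (norm (g x))^2))" by (auto simp: indicator_def)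
 finally show "norm (ze x * (w x <.> (aniso d x *v w x))) <= norm (C1 * (max 1 d * (1/ep)^2) * (ind K x * (norm (g x))^2))"
 by (simp add: abs_mult)
 qed
 qed measurable
qed

lemma aniso_add: "aniso d x *v (p + q) = aniso d x *v p + aniso d x *v q"
 by (rule matrix_vector_right_distrib)

lemma aniso_scaleR: "aniso d x *v (c *R p) = c *R (aniso d x *v p)"
 unfolding aniso_mult by (simp add: algebra_simps)

text \<open>Testing with \<open>ze / (u + ep)\<close> turns the inequality into one for \<open>ln (u + ep)\<close>.\<close>

lemma supersol_log_test:
 fixes G :: "(real^'n) set"
 assumes G: "open G" and u: "supersol d q G u g" and d: "d > 0"
 and ze: "C1c G ze Dze" "!!x. ze x >= 0" and e: "ep > 0"
 defines "w \<equiv> %x. (1 / (u x + ep)) *R g x"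
 defines "I \<equiv> (LBINT x. w x <.> (aniso d x *v Dze x)) - (LBINT x. ze x * (w x <.> (aniso d x *v w x)))"
 shows "(\<integral>\<^sup>+x. ennreal (u x powr q * (ze x / (u x + ep))) \<partial>lborel) <= ennreal I" and "0 <= I"
proof -
 have uH: "weak_H1 G u g" and upos: "!!x. u x > 0" using u by (auto simp: supersol_def)
 have u0: "!!x. u x >= 0" using upos less_imp_le by blast
 obtain K where K: "compact K" "K \<subseteq> G" "!!x. x \<notin> K ==> ze x = 0" "!!x. x \<notin> K ==> Dze x = 0"
 using C1c_support[OF ze(1)] by metis
 have int: "intl (%x. w x <.> (aniso d x *v Dze x))" "intl (%x. ze x * (w x <.> (aniso d x *v w x)))"
 unfolding w_def by (rule integrable_test_quad[OF uH upos ze(1) d e])+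
 let ?F = "%s. 1 / (\<bar>s\<bar> + ep)" and ?F' = "%s. - 1 / (s + ep)^2"
 let ?F0 = "%s. 1 / (s + ep)"
 have H: "weak_H1 G (%x. ze x * ?F0 (u x)) (%x. ?F0 (u x) *R Dze x + (ze x * ?F' (u x)) *R g x)"
 proof (rule weak_H1_C1c_mult_compose[where F="?F0" and F'="?F'" and B="max (1/ep) (1/ep^2)", OF G uH u0 ze(1)])
 fix s :: real assume s: "s >= 0"
 show "((%s. 1 / (s + ep)) has_real_derivative - 1 / (s + ep)^2) (at s)"
 using s e by (auto intro!: derivative_eq_intros simp: power2_eq_square)
 have "1 / (s + ep) <= 1 / ep" using s e by (intro divide_left_mono mult_pos_pos) auto
 then show "\<bar>1 / (s + ep)\<bar> <= max (1/ep) (1/ep^2)" using s e by simp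
 have "1 / (s + ep)^2 <= 1 / ep^2" using s e by (intro divide_left_mono mult_pos_pos power_mono) auto
 then show "\<bar>- 1 / (s + ep)^2\<bar> <= max (1/ep) (1/ep^2)" using s e by simp
 next
 show "continuous_on {0..} (%s. - 1 / (s + ep)^2)" using e by (intro continuous_intros) auto
 qed measurable
 have eqI: "(LBINT x. ind G x * (g x <.> (aniso d x *v (?F0 (u x) *R Dze x + (ze x * ?F' (u x)) *R g x)))) = I"
 proof -
 have "ind G x * (g x <.> (aniso d x *v (?F0 (u x) *R Dze x + (ze x * ?F' (u x)) *R g x)))
 = w x <.> (aniso d x *v Dze x) - ze x * (w x <.> (aniso d x *v w x))" for x
 proof (cases "x \<in> K")
 case True
 then have "x \<in> G" using K by blast
 define s where "s = 1 / (u x + ep)"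
 have "- 1 / (u x + ep)^2 = - (s * s)" by (simp add: s_def power2_eq_square)
 then show ?thesis
 using \<open>x \<in> G\<close> unfolding w_def s_def[symmetric] aniso_add aniso_scaleR
 by (simp add: inner_add_right inner_diff_right)
 next
 case False
 then show ?thesis using K(3,4)[of x] by (simp add: aniso_mult)
 qed
 then show ?thesis unfolding I_def using int(1,2) by simp
 qed
 have "(\<integral>\<^sup>+x. ennreal (u x powr q * (ze x * ?F0 (u x))) \<partial>lborel) <= ennreal I"
 unfolding eqI[symmetric]
 proof (rule u[unfolded supersol_def, THEN conjunct2, THEN conjunct2, rule_format, OF H])
 show "0 <= ze x * ?F0 (u x)" for x using ze(2)[of x] u0[of x] e by (intro mult_nonneg_nonneg) auto
 show "\<exists>K. compact K & K \<subseteq> G & (\<forall>x. x \<notin> K --> ze x * ?F0 (u x) = 0)" using K by (intro exI[of _ K]) auto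
 qed
 then show le: "(\<integral>\<^sup>+x. ennreal (u x powr q * (ze x / (u x + ep))) \<partial>lborel) <= ennreal I" by simp
 \<comment> \<open>\<open>ennreal\<close> sends negative numbers to 0, so the sign is settled
   separately: a negative \<open>I\<close> would make the left integral vanish, hence
   \<open>ze\<close> and its gradient, and then \<open>I = 0\<close>.\<close>
 show "0 <= I"
 proof (rule ccontr)
 assume "\<not> 0 <= I"
 then have "(\<integral>\<^sup>+x. ennreal (u x powr q * (ze x / (u x + ep))) \<partial>lborel) = 0" using le by (simp add: ennreal_neg)
 moreover note [measurable] = weak_H1D(1,2)[OF uH] C1c_measurable[OF ze(1)]
 ultimately have "AE x in lborel. ennreal (u x powr q * (ze x / (u x + ep))) = 0"
 by (subst (asm) nn_integral_0_iff_AE) auto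
 then have "AE x in lborel. ze x = 0"
 proof eventually_elim
 case (elim x)
 then have "u x powr q * (ze x / (u x + ep)) <= 0" by (simp add: ennreal_eq_0_iff)
 moreover have "u x powr q > 0" "u x + ep > 0" using upos[of x] e by auto
 ultimately have "ze x <= 0" by (simp add: mult_le_0_iff divide_le_0_iff)
 then show ?case using ze(2)[of x] by simp
 qed
 then have z: "ze x = 0" for x using continuous_AE_zero[OF C1c_continuous(1)[OF ze(1)]] by blast
 then have "Dze x = 0" for x using C1c_zero_grad[OF ze(1)] by blast
 then have "I = 0" unfolding I_def by (simp add: z aniso_mult)
 with \<open>\<not> 0 <= I\<close> show False by simp
 qed
qed

text \<open>Caccioppoli estimate for the logarithm: testing with \<open>et^2\<close> gives a
  quadratic term of good sign, and Young's inequality absorbs the cross term into half of it. The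
  bound does not depend on \<open>ep\<close>.\<close>

lemma supersol_log_energy:
 fixes G :: "(real^'n) set"
 assumes G: "open G" and u: "supersol d q G u g" and d: "d > 0" and et: "C1c G et Det" and e: "ep > 0"
 shows "min 1 d * (LBINT x. (et x)^2 * (norm ((1 / (u x + ep)) *R g x))^2) <= 4 * (LBINT x. Det x <.> (aniso d x *v Det x))"
proof -
 define w where "w x = (1 / (u x + ep)) *R g x" for x
 have uH: "weak_H1 G u g" and upos: "!!x. u x > 0" using u by (auto simp: supersol_def)
 note [measurable] = weak_H1D(1,2)[OF uH] C1c_measurable[OF et]
 have wm[measurable]: "w \<in> bmb" unfolding w_def[abs_def] by measurable
 have ze: "C1c G (%x. (et x)^2) (%x. (2 * et x) *R Det x)"
 proof -
 have "(%x. et x *R Det x + et x *R Det x) = (%x. (2 * et x) *R Det x)"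
 by (simp add: scaleR_add_left[symmetric])
 then show ?thesis
 using C1c_mult[OF G C1_on_subset[OF C1cD1[OF et] subset_UNIV] et] by (simp only: power2_eq_square)
 qed
 have int: "intl (%x. w x <.> (aniso d x *v ((2 * et x) *R Det x)))" "intl (%x. (et x)^2 * (w x <.> (aniso d x *v w x)))"
 unfolding w_def by (rule integrable_test_quad[OF uH upos ze d e])+
 have I0: "(LBINT x. (et x)^2 * (w x <.> (aniso d x *v w x))) <= (LBINT x. w x <.> (aniso d x *v ((2 * et x) *R Det x)))"
 using supersol_log_test(2)[OF G u d ze _ e] by (simp add: w_def)
 obtain K where K: "compact K" "K \<subseteq> G" "!!x. x \<notin> K ==> et x = 0" "!!x. x \<notin> K ==> Det x = 0"
 using C1c_support[OF et] by metis
 obtain C2 where C2: "C2 > 0" "!!x. norm (Det x) <= C2 * ind K x"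
 using bounded_compact_support[OF C1c_continuous(2)[OF et] K(1,4)] by blast
 have a0: "0 <= v <.> (aniso d x *v v)" for x v :: "real^'n"
 proof -
 have "0 <= min 1 d * (norm v)^2" using d by simp
 then show ?thesis using aniso_bounds(1)[OF d, of v x] by linarith
 qed
 have iD: "intl (%x. Det x <.> (aniso d x *v Det x))"
 proof (rule B_integrable_bound)
 show "intl (%x. max 1 d * C2^2 * ind K x :: real)"
 using emeasure_compact_finite[OF K(1)] borel_compact[OF K(1)] by simp
 show "AE x in lborel. norm (Det x <.> (aniso d x *v Det x)) <= norm (max 1 d * C2^2 * ind K x)"
 proof (rule AE_I2)
 fix x
 have "(norm (Det x))^2 <= (C2 * ind K x)^2" using C2(2)[of x] by (intro power_mono) auto
 then have "max 1 d * (norm (Det x))^2 <= max 1 d * (C2 * ind K x)^2" by (intro mult_left_mono) auto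
 moreover have "(C2 * ind K x)^2 = C2^2 * ind K x" by (auto simp: indicator_def)
 ultimately show "norm (Det x <.> (aniso d x *v Det x)) <= norm (max 1 d * C2^2 * ind K x)"
 using a0[of "Det x" x] aniso_bounds(2)[OF d, of "Det x" x] by simp
 qed
 qed measurable
 have pw: "w x <.> (aniso d x *v ((2 * et x) *R Det x)) <= (1/2) * ((et x)^2 * (w x <.> (aniso d x *v w x))) + 2 * (Det x <.> (aniso d x *v Det x))" for x
 proof -
 \<comment> \<open>Young's inequality in the metric of the matrix: half the squared length of this
   vector is expanded.\<close>
 let ?v = "et x *R w x - 2 *R Det x"
 have "0 <= (1/2) * (?v <.> (aniso d x *v ?v))" using a0[of ?v x] by simp
 also have "... = (1/2) * ((et x)^2 * (w x <.> (aniso d x *v w x))) + 2 * (Det x <.> (aniso d x *v Det x)) - w x <.> (aniso d x *v ((2 * et x) *R Det x))"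
 unfolding aniso_inner by (simp add: inner_diff_left inner_diff_right inner_commute algebra_simps power2_eq_square add_divide_distrib diff_divide_distrib)
 finally show ?thesis by simp
 qed
 have "(LBINT x. w x <.> (aniso d x *v ((2 * et x) *R Det x)))
 <= (LBINT x. (1/2) * ((et x)^2 * (w x <.> (aniso d x *v w x))) + 2 * (Det x <.> (aniso d x *v Det x)))"
 using int(1,2) iD pw by (intro integral_mono) auto
 also have "... = (1/2) * (LBINT x. (et x)^2 * (w x <.> (aniso d x *v w x))) + 2 * (LBINT x. Det x <.> (aniso d x *v Det x))"
 using int(2) iD by simp
 finally have 1: "(LBINT x. (et x)^2 * (w x <.> (aniso d x *v w x))) <= 4 * (LBINT x. Det x <.> (aniso d x *v Det x))"
 using I0 by simp
 have "min 1 d * (LBINT x. (et x)^2 * (norm (w x))^2) = (LBINT x. min 1 d * ((et x)^2 * (norm (w x))^2))"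
 by (rule integral_mult_right_zero[symmetric])
 also have "... <= (LBINT x. (et x)^2 * (w x <.> (aniso d x *v w x)))"
 proof (rule integral_mono_AE'[OF int(2)])
 show "AE x in lborel. min 1 d * ((et x)^2 * (norm (w x))^2) <= (et x)^2 * (w x <.> (aniso d x *v w x))"
 proof (rule AE_I2)
 fix x
 show "min 1 d * ((et x)^2 * (norm (w x))^2) <= (et x)^2 * (w x <.> (aniso d x *v w x))"
 using mult_left_mono[OF aniso_bounds(1)[OF d, of "w x" x], of "(et x)^2"] by (simp add: mult_ac)
 qed
 show "AE x in lborel. 0 <= (et x)^2 * (w x <.> (aniso d x *v w x))"
 using a0 by simp
 qed
 finally show ?thesis using 1 unfolding w_def by linarith
qed

text \<open>The energy bound for a cut-off that is bounded below on the ball of radius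
  \<open>3 * r\<close> gives the uniform L1 bound on logarithmic gradients that
  \<open>ln_locally_integrable\<close> asks for.\<close>

lemma supersol_ln_integrable:
 fixes G :: "(real^'n) set"
 assumes G: "open G" and u: "supersol d q G u g" and d: "d > 0" and K: "compact K" "K \<subseteq> G"
 shows "set_integrable lborel K (%x. ln (u x))"
proof (rule set_integrable_compact_local[OF K(1)])
 fix x0 assume "x0 \<in> K"
 then have "x0 \<in> G" using K by blast
 then obtain R where R: "R > 0" "cball x0 R \<subseteq> G" using G open_contains_cball_eq by blast
 define r where "r = R / 4"
 have r: "r > 0" "cball x0 (4 * r) \<subseteq> G" using R by (auto simp: r_def)
 have uH: "weak_H1 G u g" and upos: "!!x. u x > 0" using u by (auto simp: supersol_def)
 note [measurable] = weak_H1D(1,2)[OF uH]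
 define et where "et = (%x. max 0 ((4 * r)^2 - (norm (x - x0))^2) ^ Suc (Suc 0))"
 define Det where "Det = (%x. (- 2 * of_nat (Suc (Suc 0)) * max 0 ((4 * r)^2 - (norm (x - x0))^2) ^ Suc 0) *R (x - x0))"
 have z: "max 0 ((4 * r)^2 - (norm (x - x0))^2) = 0" if "x \<notin> cball x0 (4 * r)" for x
 using that r by (intro max0_sq_diff_eq_0) (auto simp: dist_norm norm_minus_commute)
 have et: "C1c G et Det"
 proof (rule C1cI[of G _ _ "cball x0 (4 * r)"])
 show "C1_on G et Det" unfolding et_def Det_def by (rule C1_on_subset[OF C1_on_radial_bump]) simp
 show "et x = 0" "Det x = 0" if "x \<notin> cball x0 (4 * r)" for x
 unfolding et_def Det_def z[OF that] by simp_all
 qed (use r G in auto)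
 \<comment> \<open>The factor 7 is \<open>16 - 9\<close>, from the squares of the radii
   \<open>4 * r\<close> and \<open>3 * r\<close>.\<close>
 have etl: "et x >= (7 * r^2)^2" if "x \<in> cball x0 (3 * r)" for x
 proof -
 have "(norm (x - x0))^2 <= (3 * r)^2" using that by (intro power_mono) (auto simp: dist_norm norm_minus_commute)
 then have "7 * r^2 <= max 0 ((4 * r)^2 - (norm (x - x0))^2)" by (simp add: power_mult_distrib)
 then have "(7 * r^2)^2 <= (max 0 ((4 * r)^2 - (norm (x - x0))^2))^2" by (intro power_mono) auto
 then show ?thesis by (simp add: et_def numeral_2_eq_2)
 qed
 define c where "c = ((7 * r^2)^2)^2"
 have c: "c > 0" using r by (simp add: c_def)
 define E where "E = 4 * (LBINT x. Det x <.> (aniso d x *v Det x)) / min 1 d"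
 have cube: "intl (ind (cball x0 (3 * r)) :: _ => real)" using emeasure_compact_finite[of "cball x0 (3*r)"] by simp
 have "(LBINT x. ind (cball x0 (3 * r)) x * norm ((1 / (u x + 1 / real (Suc n))) *R g x)) <= (LBINT x. ind (cball x0 (3 * r)) x) + E / c" for n
 proof -
 let ?w = "%x. (1 / (u x + 1 / real (Suc n))) *R g x"
 have e: "1 / real (Suc n) > 0" by simp
 obtain K1 where K1: "compact K1" "K1 \<subseteq> G" "!!x. x \<notin> K1 ==> et x = 0" using et by (auto simp: C1c_def)
 have i2: "intl (%x. (et x)^2 * (norm (?w x))^2)"
 proof -
 have H: "weak_H1 G (%x. ln (u x + 1 / real (Suc n))) ?w"
 using upos by (intro weak_H1_ln[OF G uH _ e]) (auto intro: less_imp_le)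
 note [measurable] = weak_H1D(2)[OF H]
 obtain B where B: "B > 0" "!!x. norm (et x) <= B * ind K1 x"
 using bounded_compact_support[OF C1c_continuous(1)[OF et] K1(1,3)] by blast
 note [measurable] = C1c_measurable[OF et]
 show ?thesis
 proof (rule B_integrable_bound[OF integrable_mult_right[OF weak_H1D(6)[OF H K1(1,2)], of "B^2"]])
 show "AE x in lborel. norm ((et x)^2 * (norm (?w x))^2) <= norm (B^2 * (ind K1 x * (norm (?w x))^2))"
 proof (rule AE_I2)
 fix x
 have "(et x)^2 <= (B * ind K1 x)^2" using power_mono[OF B(2)[of x], of 2] by simp
 then have "(et x)^2 * (norm (?w x))^2 <= (B * ind K1 x)^2 * (norm (?w x))^2" by (rule mult_right_mono) simp
 also have "... = B^2 * (ind K1 x * (norm (?w x))^2)" by (auto simp: indicator_def)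
 finally have fin: "(et x)^2 * (norm (?w x))^2 <= B^2 * (ind K1 x * (norm (?w x))^2)" .
 show "norm ((et x)^2 * (norm (?w x))^2) <= norm (B^2 * (ind K1 x * (norm (?w x))^2))"
 proof -
 have "\<bar>a\<bar> <= \<bar>b\<bar>" if "0 <= a" "a <= b" for a b :: real using that by simp
 from this[OF _ fin] show ?thesis by (simp del: norm_scaleR)
 qed
 qed
 qed measurable
 qed
 have le: "(LBINT x. (et x)^2 * (norm (?w x))^2) <= E"
 using supersol_log_energy[OF G u d et e] d by (simp add: E_def pos_le_divide_eq mult.commute del: norm_scaleR)
 have "(LBINT x. ind (cball x0 (3 * r)) x * norm (?w x)) <= (LBINT x. ind (cball x0 (3 * r)) x + (1/c) * ((et x)^2 * (norm (?w x))^2))"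
 proof (rule integral_mono_AE')
 show "intl (%x. ind (cball x0 (3 * r)) x + (1/c) * ((et x)^2 * (norm (?w x))^2))"
 using cube i2 by (intro B_integrable_add integrable_mult_right)
 show "AE x in lborel. ind (cball x0 (3 * r)) x * norm (?w x) <= ind (cball x0 (3 * r)) x + (1/c) * ((et x)^2 * (norm (?w x))^2)"
 proof (rule AE_I2)
 fix x
 show "ind (cball x0 (3 * r)) x * norm (?w x) <= ind (cball x0 (3 * r)) x + (1/c) * ((et x)^2 * (norm (?w x))^2)"
 proof (cases "x \<in> cball x0 (3 * r)")
 case True
 have "c <= (et x)^2" unfolding c_def using etl[OF True] by (intro power_mono) auto
 then have "1 <= (1/c) * (et x)^2" using c by (simp add: le_divide_eq)
 then have "1 * (norm (?w x))^2 <= ((1/c) * (et x)^2) * (norm (?w x))^2" by (intro mult_right_mono) auto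
 moreover have "norm (?w x) <= 1 + (norm (?w x))^2"
 proof -
 have "0 <= (norm (?w x) - 1)^2" by simp
 then have "2 * norm (?w x) <= 1 + (norm (?w x))^2" by (simp only: power2_diff) simp
 then show ?thesis using norm_ge_zero[of "?w x"] by linarith
 qed
 ultimately show ?thesis using True by (simp del: norm_scaleR)
 qed (use c in simp)
 qed
 show "AE x in lborel. 0 <= ind (cball x0 (3 * r)) x + (1/c) * ((et x)^2 * (norm (?w x))^2)"
 using c by (intro AE_I2) (simp add: indicator_def)
 qed
 also have "... = (LBINT x. ind (cball x0 (3 * r)) x) + (1/c) * (LBINT x. (et x)^2 * (norm (?w x))^2)"
 by (subst B_integral_add[OF cube integrable_mult_right[OF i2]]) (simp only: integral_mult_right_zero)
 also have "... <= (LBINT x. ind (cball x0 (3 * r)) x) + (1/c) * E"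
 using le c by (intro add_left_mono mult_left_mono) auto
 finally show ?thesis by simp
 qed
 note bound = this
 have "cball x0 (3 * r) \<subseteq> cball x0 (4 * r)" using r(1) by (intro subset_cball) simp
 then have sub: "cball x0 (3 * r) \<subseteq> G" using r(2) by (rule order.trans)
 show "\<exists>e>0. set_integrable lborel (ball x0 e) (%x. ln (u x))"
 by (rule ln_locally_integrable[OF G uH upos r(1) sub bound])
qed

section \<open>Cones\<close>

lemma in_cone_over: "sphere_domain \<Omega> ==> x \<in> cone_over \<Omega> \<longleftrightarrow> x ~= 0 & x /R norm x \<in> \<Omega>"
proof
 assume S: "sphere_domain \<Omega>" and x: "x \<in> cone_over \<Omega>"
 then obtain r om where r: "r > 0" "om \<in> \<Omega>" "x = r *R om" unfolding cone_over_def by blast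
 have "om \<in> sphere 0 1" using S r(2) unfolding sphere_domain_def openin_subtopology by auto
 then show "x ~= 0 & x /R norm x \<in> \<Omega>" using r by auto
next
 assume "x ~= 0 & x /R norm x \<in> \<Omega>"
 then have "norm x > 0" "x /R norm x \<in> \<Omega>" "x = norm x *R (x /R norm x)" by auto
 then show "x \<in> cone_over \<Omega>" unfolding cone_over_def by blast
qed

lemma open_cone_over:
 fixes \<Omega> :: "(real^'n) set"
 assumes "sphere_domain \<Omega>" shows "open (cone_over \<Omega>)"
proof -
 obtain T where T: "open T" "\<Omega> = sphere 0 1 \<inter> T"
 using assms unfolding sphere_domain_def openin_open by blast
 have "continuous_on (- {0}) (%x. x /R norm x)" by (intro continuous_intros) auto
 then have "open (- {0} \<inter> (%x. x /R norm x) -` T)"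
 by (rule continuous_open_preimage[OF _ _ T(1)]) (rule open_Compl, rule closed_singleton)
 moreover have "cone_over \<Omega> = - {0} \<inter> (%x. x /R norm x) -` T"
 proof (rule set_eqI)
 fix x :: "real^'n"
 have "x ~= 0 ==> x /R norm x \<in> sphere 0 1" by simp
 moreover have "x /R norm x \<in> \<Omega> \<longleftrightarrow> x /R norm x \<in> sphere 0 1 & x /R norm x \<in> T"
 by (subst T(2)) (rule Int_iff)
 ultimately show "x \<in> cone_over \<Omega> \<longleftrightarrow> x \<in> - {0} \<inter> (%x. x /R norm x) -` T"
 unfolding in_cone_over[OF assms] Int_iff vimage_eq Compl_iff singleton_iff by blast
 qed
 ultimately show ?thesis by simp
qed

lemma C1_on_norm: "C1_on (- {0}) norm (%x. x /R norm x)"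
 unfolding C1_on_def
proof (intro conjI ballI)
 fix x :: "real^'a" assume "x \<in> - {0}"
 then have "(norm has_derivative (%h. h <.> sgn x)) (at x)"
 using has_derivative_norm[of x] by simp
 then show "(norm has_derivative (%h. (x /R norm x) <.> h)) (at x)"
 by (simp add: sgn_div_norm inner_commute)
qed (intro continuous_intros, auto)

text \<open>The support is swept out by the radii in \<open>{a..b}\<close> and the compact angular
  support of \<open>ps\<close>. The factors are differentiable only off the origin, so the claim is
  proved on \<open>G\<close> without 0 and then enlarged.\<close>

lemma C1c_hom0_radial:
 fixes ps :: "real^'n => real"
 assumes S: "sphere_domain \<Omega>" and ps: "hom0_test \<Omega> ps Dps" and G: "open G"
 and ab: "0 < a" "!!x. x \<in> cone_over \<Omega> ==> a <= norm x ==> norm x <= b ==> x \<in> G"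
 and R: "!!s. s > 0 ==> (R has_real_derivative R' s) (at s)" "continuous_on {0<..} R'"
 "!!s. s < a \<or> b < s ==> R s = 0" "!!s. s < a \<or> b < s ==> R' s = 0"
 shows "C1c G (%x. ps x * R (norm x)) (%x. R (norm x) *R Dps x + (ps x * R' (norm x)) *R (x /R norm x))"
proof -
 have hC: "hom0_C1 ps Dps" using ps by (rule hom0_test_C1)
 obtain K where K: "compact K" "K \<subseteq> \<Omega>" "!!om. om \<in> sphere 0 1 ==> om \<notin> K ==> ps om = 0"
 using ps unfolding hom0_test_def by blast
 have sph: "\<Omega> \<subseteq> sphere 0 1" using S unfolding sphere_domain_def openin_subtopology by auto
 define L where "L = (%(r, om). r *R om) ` ({a..b} \<times> K)"
 have "compact L" unfolding L_def
 by (intro compact_continuous_image compact_Times K(1)) (auto intro!: continuous_intros simp: case_prod_unfold)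
 have LG: "L \<subseteq> G \<inter> - {0}"
 proof
 fix x assume "x \<in> L"
 then obtain r om where r: "r \<in> {a..b}" "om \<in> K" "x = r *R om" unfolding L_def by auto
 then have "norm om = 1" "om \<in> \<Omega>" using K(2) sph by auto
 then have "norm x = r" using r ab(1) by simp
 have "x \<in> cone_over \<Omega>"
 unfolding cone_over_def using r ab(1) \<open>om \<in> \<Omega>\<close> by (intro CollectI exI[of _ r] exI[of _ om]) simp
 then show "x \<in> G \<inter> - {0}" using ab r \<open>norm x = r\<close> by auto
 qed
 have C: "C1_on (- {0}) (%x. ps x * R (norm x)) (%x. ps x *R (R' (norm x) *R (x /R norm x)) + R (norm x) *R Dps x)"
 proof (rule C1_on_mult)
 show "C1_on (- {0}) ps Dps" using hC by (simp add: hom0_C1_def)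
 show "C1_on (- {0}) (%x. R (norm x)) (%x. R' (norm x) *R (x /R norm x))"
 using R(1,2) by (intro C1_on_compose[OF C1_on_norm]) (auto intro: continuous_on_subset)
 qed
 have "C1c (G \<inter> - {0}) (%x. ps x * R (norm x)) (%x. ps x *R (R' (norm x) *R (x /R norm x)) + R (norm x) *R Dps x)"
 proof (rule C1cI[OF _ C1_on_subset[OF C] \<open>compact L\<close> LG])
 fix x assume x: "x \<notin> L"
 consider "norm x < a \<or> b < norm x" | "ps x = 0" "x ~= 0" "a <= norm x" "norm x <= b"
 proof (cases "norm x < a \<or> b < norm x")
 case False
 then have ax: "a <= norm x" "norm x <= b" by auto
 then have x0: "x ~= 0" using ab(1) by auto
 have "x /R norm x \<notin> K"
 proof
 assume "x /R norm x \<in> K"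
 then have "norm x *R (x /R norm x) \<in> L" unfolding L_def using ax by (intro image_eqI[of _ _ "(norm x, x /R norm x)"]) auto
 then show False using x x0 by simp
 qed
 then have "ps (x /R norm x) = 0" using K(3) x0 by simp
 then have "ps x = 0" using hC x0 by (simp add: hom0_C1_def)
 then show thesis using that ax x0 by blast
 qed blast
 then have "ps x * R (norm x) = 0 & ps x *R (R' (norm x) *R (x /R norm x)) + R (norm x) *R Dps x = 0"
 proof cases
 case 1 then show ?thesis using R(3,4) by simp
 next
 case 2
 \<comment> \<open>Off \<open>L\<close> the product vanishes on a whole neighbourhood of
   \<open>x\<close>, so the gradient formula must give 0 there.\<close>
 have o: "open (- {0} \<inter> - L)" using \<open>compact L\<close> by (intro open_Int) (auto simp: compact_imp_closed open_Compl)
 have z: "ps y * R (norm y) = 0" if "y \<in> - {0} \<inter> - L" for y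
 proof (cases "norm y < a \<or> b < norm y")
 case True then show ?thesis using R(3) by simp
 next
 case False
 have "y /R norm y \<notin> K"
 proof
 assume "y /R norm y \<in> K"
 then have "norm y *R (y /R norm y) \<in> L" unfolding L_def using False by (intro image_eqI[of _ _ "(norm y, y /R norm y)"]) auto
 then show False using that by simp
 qed
 then have "ps (y /R norm y) = 0" using K(3) that by simp
 then show ?thesis using hC that by (simp add: hom0_C1_def)
 qed
 have "((%x. ps x * R (norm x)) has_derivative (%h. 0)) (at x)"
 using z x 2 by (intro has_derivative_transform_within_open[OF has_derivative_const[of 0] o]) auto
 moreover have "((%x. ps x * R (norm x)) has_derivative (%h. (ps x *R (R' (norm x) *R (x /R norm x)) + R (norm x) *R Dps x) <.> h)) (at x)"
 using 2 by (intro C1_onD[OF C]) auto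
 ultimately have "(%h. 0) = (%h. (ps x *R (R' (norm x) *R (x /R norm x)) + R (norm x) *R Dps x) <.> h)"
 by (rule has_derivative_unique)
 from fun_cong[OF this, of "ps x *R (R' (norm x) *R (x /R norm x)) + R (norm x) *R Dps x"] show ?thesis using 2 by simp
 qed
 then show "ps x * R (norm x) = 0" "ps x *R (R' (norm x) *R (x /R norm x)) + R (norm x) *R Dps x = 0" by auto
 qed (use G in auto)
 then have "C1c G (%x. ps x * R (norm x)) (%x. ps x *R (R' (norm x) *R (x /R norm x)) + R (norm x) *R Dps x)"
 by (rule C1c_mono) simp
 then show ?thesis by (simp add: add.commute mult.assoc)
qed

text \<open>The Euler identity for weak gradients: testing with the vector field \<open>(x - a) f(x)\<close>.\<close>

lemma weak_H1_radial_test_at: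
 fixes G :: "(real^'n) set"
 assumes G: "open G" and u: "weak_H1 G u g" and f: "C1c G f Df"
 shows "(LBINT x. u x * (real CARD('n) * f x + Df x <.> (x - a))) = - (LBINT x. f x * (g x <.> (x - a)))"
 and "intl (%x. u x * (real CARD('n) * f x + Df x <.> (x - a)))" "intl (%x. f x * (g x <.> (x - a)))"
proof -
 \<comment> \<open>The coordinates of the vector field are admissible scalar test functions; summing
   their identities over \<open>i\<close> produces the divergence.\<close>
 have comp: "C1c G (%x. (x - a) $ i * f x) (%x. (x - a) $ i *R Df x + f x *R axis i 1)" for i
 proof (rule C1c_mult[OF G _ f])
 have "((%x. (x - a) <.> axis i 1) has_derivative (%h. h <.> axis i 1)) (at x)" for x :: "real^'n"
 by (auto intro!: derivative_eq_intros)
 moreover have "(%h::real^'n. h <.> axis i 1) = (%h. axis i 1 <.> h)" "(%x. (x - a) <.> axis i 1) = (%x. (x - a) $ i)"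
 by (auto simp: inner_commute) (rule ext, simp only: inner_axis inner_commute[of "axis i 1"] inner_real_def mult_1_right flip: vector_minus_component)
 ultimately have "((%x. (x - a) $ i) has_derivative (%h. axis i 1 <.> h)) (at x)" for x :: "real^'n"
 by (simp only:)
 then show "C1_on G (%x. (x - a) $ i) (%x. axis i 1)"
 unfolding C1_on_def by (intro conjI ballI continuous_on_const)
 qed
 have e1: "(LBINT x. u x * ((x - a) $ i * Df x $ i + f x)) = - (LBINT x. f x * (g x $ i * (x - a) $ i))"
 and i1: "intl (%x. u x * ((x - a) $ i * Df x $ i + f x))" and i2: "intl (%x. f x * (g x $ i * (x - a) $ i))" for i
 proof -
 note t = weak_H1_integrable_test[OF u comp[of i]]
 have a: "(u x *R ((x - a) $ i *R Df x + f x *R axis i 1)) $ i = u x * ((x - a) $ i * Df x $ i + f x)"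
 "(((x - a) $ i * f x) *R g x) $ i = f x * (g x $ i * (x - a) $ i)" for x by (simp_all add: mult_ac)
 show "intl (%x. u x * ((x - a) $ i * Df x $ i + f x))" "intl (%x. f x * (g x $ i * (x - a) $ i))"
 using integrable_bounded_linear[OF bounded_linear_vec_nth[of i] t(1)] integrable_bounded_linear[OF bounded_linear_vec_nth[of i] t(2)]
 unfolding a by simp_all
 show "(LBINT x. u x * ((x - a) $ i * Df x $ i + f x)) = - (LBINT x. f x * (g x $ i * (x - a) $ i))"
 using integral_bounded_linear[OF bounded_linear_vec_nth[of i] t(1)] integral_bounded_linear[OF bounded_linear_vec_nth[of i] t(2)]
 weak_H1D(7)[OF u comp[of i]] unfolding a by simp
 qed
 have s1: "u x * (real CARD('n) * f x + Df x <.> (x - a)) = (\<Sum>i\<in>UNIV. u x * ((x - a) $ i * Df x $ i + f x))" for x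
 by (simp add: sum_distrib_left[symmetric] sum.distrib inner_vec_def mult.commute)
 have s2: "f x * (g x <.> (x - a)) = (\<Sum>i\<in>UNIV. f x * (g x $ i * (x - a) $ i))" for x
 by (simp add: sum_distrib_left[symmetric] inner_vec_def)
 show "intl (%x. u x * (real CARD('n) * f x + Df x <.> (x - a)))" "intl (%x. f x * (g x <.> (x - a)))"
 unfolding s1 s2 using i1 i2 by (intro B_integrable_sum; blast)+
 show "(LBINT x. u x * (real CARD('n) * f x + Df x <.> (x - a))) = - (LBINT x. f x * (g x <.> (x - a)))"
 unfolding s1 s2 using i1 i2 e1 by (subst (1 2) B_integral_sum) (auto simp: sum_negf)
qed

lemmas weak_H1_radial_test = weak_H1_radial_test_at[where a=0, unfolded diff_0_right]

section \<open>Nonexistence below the critical exponent\<close>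

text \<open>The third power makes the bump twice continuously differentiable, since two derivatives
  in \<open>t\<close> are taken later.\<close>

definition bumpf :: "real => real" where "bumpf s = max 0 (1 - s^2) ^ 3"
definition bumpf' :: "real => real" where "bumpf' s = - 6 * s * max 0 (1 - s^2) ^ 2"
definition bumpf'' :: "real => real" where "bumpf'' s = - 6 * max 0 (1 - s^2) ^ 2 + 24 * s^2 * max 0 (1 - s^2)"

lemma DERIV_bumpf: "(bumpf has_real_derivative bumpf' s) (at s)"
 and DERIV_bumpf': "(bumpf' has_real_derivative bumpf'' s) (at s)"
proof -
 have q: "((%s. 1 - s^2) has_real_derivative (- 2 * s)) (at s)" by (auto intro!: derivative_eq_intros)
 have c3: "((%s. max 0 (1 - s^2) ^ 3) has_real_derivative (3 * max 0 (1 - s^2) ^ 2) * (- 2 * s)) (at s)"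
 using DERIV_chain2[OF DERIV_max0_power[of 1] q] by (simp add: numeral_3_eq_3 numeral_2_eq_2)
 have c2: "((%s. max 0 (1 - s^2) ^ 2) has_real_derivative (2 * max 0 (1 - s^2)) * (- 2 * s)) (at s)"
 using DERIV_chain2[OF DERIV_max0_power[of 0] q] by (simp add: numeral_2_eq_2)
 show "(bumpf has_real_derivative bumpf' s) (at s)"
 unfolding bumpf_def[abs_def] bumpf'_def by (rule DERIV_cong[OF c3]) simp
 have "((%s. - 6 * s) has_real_derivative - 6) (at s)" by (auto intro!: derivative_eq_intros)
 from DERIV_mult[OF this c2]
 show "(bumpf' has_real_derivative bumpf'' s) (at s)"
 unfolding bumpf'_def[abs_def] bumpf''_def by (rule DERIV_cong) (simp add: power2_eq_square)
qed

lemma bumpf_nonneg: "bumpf s >= 0" by (simp add: bumpf_def)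

lemma bumpf_eq_0: "\<bar>s\<bar> >= 1 ==> bumpf s = 0 & bumpf' s = 0 & bumpf'' s = 0"
proof -
 assume "\<bar>s\<bar> >= 1"
 then have "1 <= s^2" using abs_le_square_iff[of 1 s] by simp
 then have "max 0 (1 - s^2) = 0" by simp
 then show ?thesis unfolding bumpf_def bumpf'_def bumpf''_def by (simp only:) simp
qed

lemma continuous_bumpf: "continuous_on A bumpf" "continuous_on A bumpf'" "continuous_on A bumpf''"
 unfolding bumpf_def[abs_def] bumpf'_def[abs_def] bumpf''_def[abs_def] by (intro continuous_intros)+

lemma measurable_bumpf [measurable]:
 "bumpf \<in> bmb" "bumpf' \<in> bmb" "bumpf'' \<in> bmb"
 by (intro borel_measurable_continuous_onI continuous_bumpf)+

lemma bumpf_bounded: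
 assumes "f \<in> {bumpf, bumpf', bumpf''}"
 obtains B where "B > 0" "!!s. \<bar>f s\<bar> <= B"
proof -
 have "\<exists>B>0. \<forall>s. \<bar>f s\<bar> <= B"
 proof -
 have c: "continuous_on UNIV f" using assms continuous_bumpf by auto
 have z: "f s = 0" if "s \<notin> {-1..1}" for s using assms bumpf_eq_0[of s] that by auto
 have "bounded (f ` {-1..1})"
 by (intro compact_imp_bounded compact_continuous_image continuous_on_subset[OF c] compact_Icc) simp
 then obtain B where B: "B > 0" "\<forall>y\<in>f ` {-1..1}. norm y <= B" unfolding bounded_pos by (elim exE conjE)
 have "\<bar>f s\<bar> <= B" for s using B(2) B(1) z[of s] by (cases "s \<in> {-1..1}") auto
 then show ?thesis using B(1) by blast
 qed
 then obtain B where "B > 0" "\<forall>s. \<bar>f s\<bar> <= B" by (elim exE conjE)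
 then show thesis by (intro that[of B]) auto
qed

text \<open>\<open>logker f t r\<close> is \<open>f (ln r - t) / r ^ N\<close> and vanishes at \<open>r = 0\<close>, since division by zero gives zero.\<close>

definition logker :: "nat => (real => real) => real => real => real" where
 "logker N f t r = f (ln r - t) / r ^ N * ind {0<..} r"

lemma logker_eq_0:
 assumes "!!s. \<bar>s\<bar> >= 1 ==> f s = 0" "r < exp (t - 1) \<or> exp (t + 1) < r"
 shows "logker N f t r = 0"
proof (cases "r > 0")
 case True
 have "\<bar>ln r - t\<bar> >= 1"
 proof -
 have "r < exp (t - 1) ==> ln r < t - 1" "exp (t + 1) < r ==> t + 1 < ln r"
 using True ln_less_cancel_iff[of r "exp (t - 1)"] ln_less_cancel_iff[of "exp (t + 1)" r] by simp_all
 then show ?thesis using assms(2) by linarith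
 qed
 then show ?thesis using assms(1) by (simp add: logker_def)
qed (simp add: logker_def)

lemma DERIV_logker:
 assumes f: "!!s. (f has_real_derivative f' s) (at s)" and r: "r > 0"
 shows "(logker N f t has_real_derivative (f' (ln r - t) - real N * f (ln r - t)) / r ^ Suc N) (at r)"
proof -
 have l: "((%r. ln r - t) has_real_derivative inverse r) (at r)" using r by (auto intro!: derivative_eq_intros simp: divide_inverse)
 have p: "((%r. r ^ N) has_real_derivative real N * r ^ (N - 1)) (at r)" by (auto intro!: derivative_eq_intros)
 have "((%r. f (ln r - t) / r ^ N) has_real_derivative ((f' (ln r - t) * inverse r) * r ^ N - f (ln r - t) * (real N * r ^ (N - 1))) / (r ^ N * r ^ N)) (at r)"
 using r by (intro DERIV_divide DERIV_chain2[OF f l] p) simp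
 moreover have "((f' (ln r - t) * inverse r) * r ^ N - f (ln r - t) * (real N * r ^ (N - 1))) / (r ^ N * r ^ N) = (f' (ln r - t) - real N * f (ln r - t)) / r ^ Suc N"
 proof (cases N)
 case (Suc k)
 then show ?thesis using r by (simp add: field_simps)
 qed (use r in \<open>simp add: inverse_eq_divide field_simps\<close>)
 ultimately have "((%r. f (ln r - t) / r ^ N) has_real_derivative (f' (ln r - t) - real N * f (ln r - t)) / r ^ Suc N) (at r)" by simp
 then show ?thesis
 by (rule has_field_derivative_transform_within_open[of _ _ _ "{0<..}"]) (use r in \<open>auto simp: logker_def\<close>)
qed

lemma logker_time_DERIV:
 assumes f: "!!s. (f has_real_derivative f' s) (at s)"
 shows "((%t. logker N f t r) has_real_derivative - logker N f' t r) (at t)"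
proof -
 have "((%t. f (ln r - t)) has_real_derivative f' (ln r - t) * (- 1)) (at t)"
 by (rule DERIV_chain2[OF f]) (auto intro!: derivative_eq_intros)
 from DERIV_cmult[OF this, of "ind {0<..} r / r ^ N"]
 show ?thesis unfolding logker_def by (simp add: mult_ac)
qed

lemma measurable_logker [measurable]:
 assumes [measurable]: "f \<in> bmb"
 shows "logker N f t \<in> bmb"
 unfolding logker_def[abs_def] by measurable

text \<open>With \<open>s ^ (N - 1)\<close> from polar coordinates the kernel becomes
  \<open>f (ln s - t) / s\<close>, and \<open>ds / s\<close> is invariant under dilations; hence the
  integral does not depend on \<open>t\<close>.\<close>

lemma logker_weight:
 assumes N: "N > 0" and f: "f \<in> {bumpf, bumpf', bumpf''}"
 shows "intl (%s. ind {0<..} s * s ^ (N - 1) * logker N f t s)"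
 and "(LBINT s. ind {0<..} s * s ^ (N - 1) * logker N f t s) = (LBINT s. logker 1 f 0 s)"
proof -
 have fm[measurable]: "f \<in> bmb" using f measurable_bumpf by auto
 have f0: "!!s. \<bar>s\<bar> >= 1 ==> f s = 0" using f bumpf_eq_0 by auto
 have eq: "ind {0<..} s * s ^ (N - 1) * logker N f t s = logker 1 f t s" for s :: real
 proof (cases "s > 0")
 case True
 have "s ^ N = s * s ^ (N - 1)" using N by (metis Suc_diff_1 power_Suc)
 then show ?thesis using True by (simp add: logker_def)
 qed (simp add: logker_def)
 obtain B where B: "B > 0" "!!s. \<bar>f s\<bar> <= B" using bumpf_bounded[OF f] by blast
 have "intl (%s. logker 1 f t s)"
 proof (rule B_integrable_bound)
 show "intl (%s. B / exp (t - 1) * ind {exp (t - 1)..exp (t + 1)} s :: real)" by simp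
 show "AE s in lborel. norm (logker 1 f t s) <= norm (B / exp (t - 1) * ind {exp (t - 1)..exp (t + 1)} s)"
 proof (rule AE_I2)
 fix s :: real
 show "norm (logker 1 f t s) <= norm (B / exp (t - 1) * ind {exp (t - 1)..exp (t + 1)} s)"
 proof (cases "s < exp (t - 1) \<or> exp (t + 1) < s")
 case True then show ?thesis using logker_eq_0[OF f0 True] by simp
 next
 case False
 then have s: "exp (t - 1) <= s" "s <= exp (t + 1)" by auto
 then have "s > 0" by (meson exp_gt_zero less_le_trans)
 then have "\<bar>f (ln s - t)\<bar> / s <= B / exp (t - 1)" using B s(1) by (intro frac_le) auto
 then show ?thesis using s \<open>s > 0\<close> B(1) by (simp add: logker_def)
 qed
 qed
 qed measurable
 then show "intl (%s. ind {0<..} s * s ^ (N - 1) * logker N f t s)" unfolding eq .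
 have "(LBINT s. logker 1 f t s) = \<bar>exp t\<bar> ^ DIM(real) *R (LBINT s. logker 1 f t (0 + exp t *R s))"
 by (rule integral_lborel_affine) auto
 also have "(%s. logker 1 f t (0 + exp t *R s)) = (%s. exp (- t) * logker 1 f 0 s)"
 proof
 fix s :: real
 show "logker 1 f t (0 + exp t *R s) = exp (- t) * logker 1 f 0 s"
 by (cases "s > 0") (simp_all add: logker_def ln_mult exp_minus zero_less_mult_iff inverse_eq_divide)
 qed
 also have "\<bar>exp t\<bar> ^ DIM(real) *R (LBINT s. exp (- t) * logker 1 f 0 s) = (LBINT s. logker 1 f 0 s)"
 by (simp add: exp_minus)
 finally show "(LBINT s. ind {0<..} s * s ^ (N - 1) * logker N f t s) = (LBINT s. logker 1 f 0 s)"
 unfolding eq .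
qed

lemma logker_mass_pos: "(LBINT s. logker 1 bumpf 0 s) > 0"
proof -
 have i: "intl (logker 1 bumpf 0)"
 proof -
 have "(%s. ind {0<..} s * s ^ (1 - 1) * logker 1 bumpf 0 s) = logker 1 bumpf 0" by (rule ext) (simp add: logker_def indicator_def)
 then show ?thesis using logker_weight(1)[of 1 bumpf 0] by simp
 qed
 define c :: real where "c = (3/4)^3 / exp (1/2)"
 have c: "c > 0" by (simp add: c_def)
 have "(LBINT s. c * ind {1..exp (1/2::real)} s) <= (LBINT s. logker 1 bumpf 0 s)"
 proof (rule integral_mono[OF _ i])
 fix s :: real
 show "c * ind {1..exp (1/2)} s <= logker 1 bumpf 0 s"
 proof (cases "s \<in> {1..exp (1/2)}")
 case True
 then have s: "1 <= s" "s <= exp (1/2)" "s > 0" by auto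
 then have l: "0 <= ln s" "ln s <= 1/2" using ln_mono[of s "exp (1/2)"] by auto
 then have "(ln s)^2 <= (1/2)^2" by (intro power_mono) auto
 then have "3/4 <= max 0 (1 - (ln s)^2)" by (simp add: power_divide)
 then have "(3/4)^3 <= bumpf (ln s)" unfolding bumpf_def by (rule power_mono) simp
 then have "c <= bumpf (ln s) / s" unfolding c_def using s bumpf_nonneg[of "ln s"] by (intro frac_le) auto
 then show ?thesis using True s by (simp add: logker_def)
 next
 case False
 then have "ind {1..exp (1/2)} s = (0::real)" by (rule indicator_simps(2))
 moreover have "0 <= logker 1 bumpf 0 s" using bumpf_nonneg[of "ln s"] by (cases "s > 0") (simp_all add: logker_def)
 ultimately show ?thesis by simp
 qed
 qed simp
 moreover have "(LBINT s. c * ind {1..exp (1/2::real)} s) = c * (exp (1/2) - 1)" by simp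
 moreover have "exp (1/2) > (1::real)" by simp
 ultimately show ?thesis using c by (smt (verit) mult_pos_pos)
qed

text \<open>The integrand may change sign; the extended integral sees only its positive
  part.\<close>

lemma ennreal_integral_le_nn_integral:
 assumes "integrable M f" shows "ennreal (\<integral>x. f x \<partial>M) <= (\<integral>\<^sup>+x. ennreal (f x) \<partial>M)"
proof -
 have i: "integrable M (%x. max 0 (f x))" using assms by (intro integrable_max) simp_all
 have "(\<integral>x. f x \<partial>M) <= (\<integral>x. max 0 (f x) \<partial>M)" by (rule integral_mono[OF assms i]) simp
 then have "ennreal (\<integral>x. f x \<partial>M) <= ennreal (\<integral>x. max 0 (f x) \<partial>M)" by (rule ennreal_leI)
 also have "... = (\<integral>\<^sup>+x. ennreal (max 0 (f x)) \<partial>M)" using i by (intro nn_integral_eq_integral[symmetric]) auto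
 also have "... = (\<integral>\<^sup>+x. ennreal (f x) \<partial>M)" by (intro nn_integral_cong) (auto simp: max_def ennreal_neg)
 finally show ?thesis .
qed

text \<open>The logarithmic mean of \<open>u\<close>, weighted by \<open>Th\<^sup>2\<close> on the sphere and by a bump in \<open>ln |x|\<close>,
  satisfies the differential inequality.\<close>

lemma no_supersol:
 fixes Th :: "real^'n => real" and DTh :: "real^'n => real^'n"
 defines "L \<equiv> (LINT x|annul. (Th x)^2)" and "E \<equiv> (LINT x|annul. (norm x)^2 * (norm (DTh x))^2)"
 assumes N3: "CARD('n) >= 3" and S: "sphere_domain \<Omega>" and Th: "hom0_test \<Omega> Th DTh" and L: "L > 0"
 and d: "d > 0" and rh: "rh > 0" and q: "q > 1" and u: "supersol d q (cone_over \<Omega> - cball 0 rh) u g"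
 and be: "be = - 2 / (q - 1)" "2 * be + (real CARD('n) - 2) <= 0" and A: "d * (E / L) < be * (be + (real CARD('n) - 2))"
 shows False
proof -
 let ?N = "CARD('n)"
 define G where "G = cone_over \<Omega> - cball 0 rh"
 have G: "open G" unfolding G_def using open_cone_over[OF S] by auto
 have uG: "supersol d q G u g" using u by (simp add: G_def)
 have uH: "weak_H1 G u g" and upos: "!!x. u x > 0" using uG by (auto simp: supersol_def)
 have u0: "!!x. u x >= 0" using upos less_imp_le by blast
 note hC = hom0_test_C1[OF Th]
 note [measurable] = weak_H1D(1,2)[OF uH] hom0_C1_measurable[OF hC]

 \<comment> \<open>Angular weight and admissible times\<close>
 define p where "p = (%x. (Th x)^2)"
 define Dp where "Dp = (%x. (2 * Th x) *R DTh x)"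
 have p0: "p x >= 0" for x by (simp add: p_def)
 have pm[measurable]: "p \<in> bmb" unfolding p_def by measurable
 have pT: "hom0_test \<Omega> p Dp"
 proof -
 have "C1_on (- {0}) (%x. Th x * Th x) (%x. Th x *R DTh x + Th x *R DTh x)"
 using hC unfolding hom0_C1_def by (intro C1_on_mult) auto
 moreover have "(%x. Th x *R DTh x + Th x *R DTh x) = Dp" by (simp add: Dp_def scaleR_add_left[symmetric])
 moreover have "(%x. Th x * Th x) = p" by (simp add: p_def power2_eq_square)
 ultimately have "C1_on (- {0}) p Dp" by (simp only:)
 then show ?thesis using Th unfolding hom0_test_def p_def by auto
 qed
 note pC = hom0_test_C1[OF pT]
 have perp: "DTh x <.> x = 0" if "x ~= 0" for x by (rule hom0_C1_grad(2)[OF hC that])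
 have sph: "\<Omega> \<subseteq> sphere 0 1" using S unfolding sphere_domain_def openin_subtopology by auto
 \<comment> \<open>Beyond this time the shell around radius \<open>exp t\<close> avoids the removed
   ball.\<close>
 define t1 where "t1 = ln rh + 1"
 have t1: "exp (t - 1) > rh" if "t > t1" for t
 proof -
 have "rh = exp (ln rh)" using rh by simp
 also have "... < exp (t - 1)" using that by (simp add: t1_def)
 finally show ?thesis .
 qed
 have inG: "x \<in> G" if "x \<in> cone_over \<Omega>" "exp (t - 1) <= norm x" "t > t1" for x t
 using that t1[OF that(3)] by (auto simp: G_def)

 \<comment> \<open>Averaging kernels in the logarithmic radius\<close>
 let ?F = "{bumpf, bumpf', bumpf''}"
 have F0: "f s = 0" if "f \<in> ?F" "\<bar>s\<bar> >= 1" for f s using that bumpf_eq_0[of s] by auto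
 have Fm: "f \<in> bmb" if "f \<in> ?F" for f using that measurable_bumpf by auto
 let ?ka = "%f t x. p x * logker ?N f t (norm x)"
 have ka0: "?ka bumpf t x >= 0" for t x using p0 bumpf_nonneg by (simp add: logker_def indicator_def)
 \<comment> \<open>One compact set and one bound serve all \<open>t\<close> in an interval, as
   differentiation under the integral sign requires.\<close>
 have kernel: "\<exists>K B. compact K & K \<subseteq> G & B > 0 & (\<forall>f\<in>?F. \<forall>t x. T0 <= t --> t <= T1 --> \<bar>?ka f t x\<bar> <= B * ind K x)"
 if T0: "T0 > t1" for T0 T1
 proof -
 obtain K0 where K0: "compact K0" "K0 \<subseteq> \<Omega>" "!!om. om \<in> sphere 0 1 ==> om \<notin> K0 ==> p om = 0"
 using pT unfolding hom0_test_def by blast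
 let ?a = "exp (T0 - 1)" and ?b = "exp (T1 + 1)"
 define K where "K = (%(r, om). r *R om) ` ({?a..?b} \<times> K0)"
 have cK: "compact K" unfolding K_def
 by (intro compact_continuous_image compact_Times K0(1)) (auto intro!: continuous_intros simp: case_prod_unfold)
 have KG: "K \<subseteq> G"
 proof
 fix x assume "x \<in> K"
 then obtain r om where r: "r \<in> {?a..?b}" "om \<in> K0" "x = r *R om" unfolding K_def by auto
 have "r > 0" using r(1) by (auto intro: less_le_trans[OF exp_gt_zero])
 have "norm om = 1" "om \<in> \<Omega>" using r(2) K0(2) sph by auto
 then have "norm x = r" using r \<open>r > 0\<close> by simp
 have "x \<in> cone_over \<Omega>" unfolding cone_over_def using r \<open>r > 0\<close> \<open>om \<in> \<Omega>\<close> by (intro CollectI exI[of _ r] exI[of _ om]) simp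
 then show "x \<in> G" using inG[of x T0] T0 r(1) \<open>norm x = r\<close> by simp
 qed
 obtain Bp where Bp: "Bp > 0" "!!x. x ~= 0 ==> \<bar>p x\<bar> <= Bp" using hom0_C1_bounded[OF pC] by metis
 have "\<exists>B. \<forall>f\<in>?F. B f > 0 & (\<forall>s. \<bar>f s\<bar> <= B f)" by (rule bchoice) (metis bumpf_bounded)
 then obtain Bf where Bf: "!!f. f \<in> ?F ==> Bf f > 0" "!!f s. f \<in> ?F ==> \<bar>f s\<bar> <= Bf f" by auto
 define B where "B = Bp * ((Bf bumpf + Bf bumpf' + Bf bumpf'') / ?a ^ ?N)"
 have pos: "Bf bumpf > 0" "Bf bumpf' > 0" "Bf bumpf'' > 0" using Bf(1) by auto
 have B: "B > 0" unfolding B_def using Bp pos by (intro mult_pos_pos divide_pos_pos) auto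
 have "\<bar>?ka f t x\<bar> <= B * ind K x" if f: "f \<in> ?F" and t: "T0 <= t" "t <= T1" for f t x
 proof (cases "norm x < exp (t - 1) \<or> exp (t + 1) < norm x")
 case True
 have "logker ?N f t (norm x) = 0" by (rule logker_eq_0[OF F0[OF f] True])
 then show ?thesis using B by simp
 next
 case False
 have "?a <= exp (t - 1)" "exp (t + 1) <= ?b" using t by auto
 then have x: "?a <= norm x" "norm x <= ?b" using False by linarith+
 then have x0: "norm x > 0" by (meson exp_gt_zero less_le_trans)
 show ?thesis
 proof (cases "x \<in> K")
 case True
 have "\<bar>f (ln (norm x) - t)\<bar> / norm x ^ ?N <= (Bf bumpf + Bf bumpf' + Bf bumpf'') / ?a ^ ?N"
 proof (rule frac_le)
 show "\<bar>f (ln (norm x) - t)\<bar> <= Bf bumpf + Bf bumpf' + Bf bumpf''" using Bf(2)[OF f, of "ln (norm x) - t"] f pos by auto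
 show "?a ^ ?N <= norm x ^ ?N" using x by (intro power_mono) auto
 qed (use pos in auto)
 then have "\<bar>logker ?N f t (norm x)\<bar> <= (Bf bumpf + Bf bumpf' + Bf bumpf'') / ?a ^ ?N" using x0 by (simp add: logker_def abs_divide)
 then have "\<bar>p x\<bar> * \<bar>logker ?N f t (norm x)\<bar> <= B" unfolding B_def using Bp x0 by (intro mult_mono) auto
 then show ?thesis using True by (simp add: abs_mult)
 next
 case False
 have "x /R norm x \<notin> K0"
 proof
 assume "x /R norm x \<in> K0"
 then have "norm x *R (x /R norm x) \<in> K" unfolding K_def using x by (intro image_eqI[of _ _ "(norm x, x /R norm x)"]) auto
 then show False using False x0 by simp
 qed
 then have "p (x /R norm x) = 0" using K0(3) x0 by simp
 then have "p x = 0" using pC x0 by (simp add: hom0_C1_def)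
 then show ?thesis using B by simp
 qed
 qed
 then show ?thesis using cK KG B by (intro exI[of _ K] exI[of _ B]) blast
 qed
 have kam: "?ka f t \<in> bmb" if "f \<in> ?F" for f t
 proof -
 note [measurable] = Fm[OF that]
 show ?thesis by measurable
 qed
 have lnK: "intl (%x. ind K x * \<bar>ln (u x)\<bar>)" if "compact K" "K \<subseteq> G" for K
 using integrable_abs[OF supersol_ln_integrable[OF G uG d that, unfolded set_integrable_def]] by (simp add: abs_mult)
 have ika: "intl (%x. h x * ?ka f t x)"
 if f: "f \<in> ?F" and t: "t > t1" and h: "h \<in> bmb" "!!K. compact K ==> K \<subseteq> G ==> intl (%x. ind K x * \<bar>h x\<bar>)" for f t and h :: "real^'n => real"
 proof -
 obtain K B where KB: "compact K" "K \<subseteq> G" "B > 0" "!!x. \<bar>?ka f t x\<bar> <= B * ind K x"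
 using kernel[of t t] t f by auto
 note [measurable] = kam[OF f] h(1)
 show ?thesis
 proof (rule B_integrable_bound[OF integrable_mult_right[OF h(2)[OF KB(1,2)], of B]])
 show "AE x in lborel. norm (h x * ?ka f t x) <= norm (B * (ind K x * \<bar>h x\<bar>))"
 proof (rule AE_I2)
 fix x
 have "norm (h x * ?ka f t x) = \<bar>h x\<bar> * \<bar>?ka f t x\<bar>" by (simp add: abs_mult)
 also have "... <= \<bar>h x\<bar> * (B * ind K x)" using KB(4)[of x] by (intro mult_left_mono) auto
 also have "... = B * (ind K x * \<bar>h x\<bar>)" by simp
 also have "... <= norm (B * (ind K x * \<bar>h x\<bar>))" unfolding real_norm_def by (rule abs_ge_self)
 finally show "norm (h x * ?ka f t x) <= norm (B * (ind K x * \<bar>h x\<bar>))" .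
 qed
 qed measurable
 qed
 have lnm: "(%x. ln (u x)) \<in> bmb" by measurable
 note iln = ika[OF _ _ lnm lnK]

 \<comment> \<open>The logarithmic mean and its derivatives in \<open>t\<close>\<close>
 define M where "M f t = (LBINT x. ln (u x) * ?ka f t x)" for f t
 \<comment> \<open>The derivative falls on the kernel, with a minus sign because the bump depends on
   \<open>ln r - t\<close>; from \<open>u\<close> this takes only local integrability of
   \<open>ln u\<close>.\<close>
 have DM: "(M f has_real_derivative - M f' t) (at t)"
 if ff: "f \<in> ?F" "f' \<in> ?F" and der: "!!s. (f has_real_derivative f' s) (at s)" and t: "t > t1" for f f' t
 proof -
 define e where "e = (t - t1) / 2"
 have e: "e > 0" "t - e > t1" using t by (auto simp: e_def field_simps)
 obtain K B where KB: "compact K" "K \<subseteq> G" "B > 0" "!!f s x. f \<in> ?F ==> t - e <= s ==> s <= t + e ==> \<bar>?ka f s x\<bar> <= B * ind K x"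
 using kernel[of "t - e" "t + e"] e(2) by blast
 have "((%t. \<integral>x. ln (u x) * ?ka f t x \<partial>lborel) has_real_derivative (LBINT x. ln (u x) * - ?ka f' t x)) (at t)"
 proof (rule DERIV_integral[where e=e and w="%x. B * (ind K x * \<bar>ln (u x)\<bar>)" and f'="%t x. ln (u x) * - ?ka f' t x"])
 fix s assume s: "\<bar>s - t\<bar> < e"
 then have s': "t - e <= s" "s <= t + e" "s > t1" using e by auto
 show "intl (%x. ln (u x) * ?ka f s x)" by (rule iln[OF ff(1) s'(3)])
 fix x
 show "((%s. ln (u x) * ?ka f s x) has_real_derivative ln (u x) * - ?ka f' s x) (at s)"
 using DERIV_cmult[OF logker_time_DERIV[OF der, of ?N "norm x" s], of "ln (u x) * p x"] by (simp add: mult_ac)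
 have "\<bar>ln (u x) * - ?ka f' s x\<bar> = \<bar>ln (u x)\<bar> * \<bar>?ka f' s x\<bar>" by (simp add: abs_mult)
 also have "... <= \<bar>ln (u x)\<bar> * (B * ind K x)" using KB(4)[OF ff(2) s'(1,2)] by (intro mult_left_mono) auto
 finally show "\<bar>ln (u x) * - ?ka f' s x\<bar> <= B * (ind K x * \<bar>ln (u x)\<bar>)" by (simp add: mult_ac)
 next
 show "intl (%x. B * (ind K x * \<bar>ln (u x)\<bar>))" using lnK[OF KB(1,2)] by simp
 note [measurable] = kam[OF ff(2)]
 show "(%x. ln (u x) * - ?ka f' t x) \<in> borel_measurable lborel" by measurable
 qed (use e in auto)
 moreover have "(LBINT x. ln (u x) * - ?ka f' t x) = - M f' t" unfolding M_def by simp
 ultimately show ?thesis unfolding M_def[abs_def] by simp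
 qed
 let ?J = "(LBINT s. logker 1 bumpf 0 s)"
 \<comment> \<open>Total mass of the kernel, the same for every \<open>t\<close>; dividing by it
   turns \<open>M\<close> into a mean.\<close>
 define Z where "Z = L * ?J / ln 2"
 have Z: "Z > 0" unfolding Z_def using L logker_mass_pos by simp
 have iZ: "intl (?ka bumpf t)" and eqZ: "(LBINT x. ?ka bumpf t x) = Z"
 and iE: "intl (%x. ((norm x)^2 * (norm (DTh x))^2) * logker ?N bumpf t (norm x))"
 and eqE: "(LBINT x. ((norm x)^2 * (norm (DTh x))^2) * logker ?N bumpf t (norm x)) = E / L * Z" for t
 proof -
 have w: "intl (%s. ind {0<..} s * s ^ (?N - 1) * logker ?N bumpf t s)"
 "(LBINT s. ind {0<..} s * s ^ (?N - 1) * logker ?N bumpf t s) = ?J"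
 by (rule logker_weight; simp)+
 have m: "logker ?N bumpf t \<in> bmb" by measurable
 have hp: "!!x t. x ~= 0 ==> t > 0 ==> p (t *R x) = p x" using pC by (simp add: hom0_C1_def)
 have hE: "!!x t. x ~= 0 ==> t > 0 ==> (norm (t *R x))^2 * (norm (DTh (t *R x)))^2 = (norm x)^2 * (norm (DTh x))^2"
 using hom0_C1_grad(1)[OF hC] by (simp add: power_mult_distrib power_divide)
 note P1 = polar_integral_hom0[OF hom0_C1_integrable(2)[OF hC, folded p_def] hp w(1) m]
 note P2 = polar_integral_hom0[OF hom0_C1_integrable(3)[OF hC] hE w(1) m]
 show "intl (?ka bumpf t)" by (rule P1(1))
 show "intl (%x. ((norm x)^2 * (norm (DTh x))^2) * logker ?N bumpf t (norm x))" by (rule P2(1))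
 have l2: "ln 2 > (0::real)" by simp
 show "(LBINT x. ?ka bumpf t x) = Z"
 using P1(2) l2 unfolding w(2) Z_def L_def p_def by (simp add: field_simps)
 have "(LBINT x. ((norm x)^2 * (norm (DTh x))^2) * logker ?N bumpf t (norm x)) = E * ?J / ln 2"
 using P2(2) l2 unfolding w(2) E_def by (simp add: field_simps)
 then show "(LBINT x. ((norm x)^2 * (norm (DTh x))^2) * logker ?N bumpf t (norm x)) = E / L * Z"
 unfolding Z_def using L by simp
 qed

 \<comment> \<open>Radial integration by parts\<close>
 have RC: "C1c G (%x. p x * logker n f t (norm x)) (%x. logker n f t (norm x) *R Dp x + (p x * logker (Suc n) (%s. f' s - real n * f s) t (norm x)) *R (x /R norm x))"
 if t: "t > t1" and ff: "f \<in> ?F" "f' \<in> ?F" and der: "!!s. (f has_real_derivative f' s) (at s)" for n f f' t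
 proof (rule C1c_hom0_radial[OF S pT G, where a="exp (t - 1)" and b="exp (t + 1)"])
 show "0 < exp (t - 1)" by simp
 show "x \<in> G" if "x \<in> cone_over \<Omega>" "exp (t - 1) <= norm x" for x by (rule inG[OF that t])
 show "(logker n f t has_real_derivative logker (Suc n) (%s. f' s - real n * f s) t s) (at s)" if "s > 0" for s
 using DERIV_logker[OF der that, of n t] that by (simp add: logker_def)
 show "logker n f t s = 0" if "s < exp (t - 1) \<or> exp (t + 1) < s" for s by (rule logker_eq_0[OF F0[OF ff(1)] that])
 show "logker (Suc n) (%s. f' s - real n * f s) t s = 0" if "s < exp (t - 1) \<or> exp (t + 1) < s" for s
 using F0[OF ff(1)] F0[OF ff(2)] by (intro logker_eq_0[OF _ that]) auto
 have c: "continuous_on UNIV f" "continuous_on UNIV f'" using ff continuous_bumpf by auto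
 have "continuous_on {0<..} (%s. (f' (ln s - t) - real n * f (ln s - t)) / s ^ Suc n)"
 by (intro continuous_intros continuous_on_compose2[OF c(1)] continuous_on_compose2[OF c(2)]) auto
 then show "continuous_on {0<..} (logker (Suc n) (%s. f' s - real n * f s) t)"
 by (rule continuous_on_eq) (simp add: logker_def)
 qed
 have radial: "(LBINT x. v x * ?ka f' t x) = - (LBINT x. ?ka f t x * (w x <.> x))" "intl (%x. ?ka f t x * (w x <.> x))"
 if v: "weak_H1 G v w" and t: "t > t1" and ff: "f \<in> ?F" "f' \<in> ?F" and der: "!!s. (f has_real_derivative f' s) (at s)" for v w f f' t
 proof -
 note T = weak_H1_radial_test[OF G v RC[OF t ff der, where n="?N"]]
 show "intl (%x. ?ka f t x * (w x <.> x))" by (rule T(3))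
 \<comment> \<open>The power \<open>N\<close> in the kernel cancels the divergence \<open>N\<close>
   of the field \<open>x\<close>, so only the derivative of the bump survives.\<close>
 have "real ?N * ?ka f t x + (logker ?N f t (norm x) *R Dp x + (p x * logker (Suc ?N) (%s. f' s - real ?N * f s) t (norm x)) *R (x /R norm x)) <.> x = ?ka f' t x" for x
 proof (cases "x = 0")
 case False
 have "Dp x <.> x = 0" using perp[OF False] by (simp add: Dp_def)
 moreover have "(x /R norm x) <.> x = norm x" using False by (simp add: power2_norm_eq_inner[symmetric] power2_eq_square)
 moreover have "logker (Suc ?N) (%s. f' s - real ?N * f s) t (norm x) * norm x = logker ?N f' t (norm x) - real ?N * logker ?N f t (norm x)"
 using False by (simp add: logker_def field_simps)
 moreover have "(a *R y + (b * c) *R z) <.> x = a * (y <.> x) + b * (c * (z <.> x))" for a b c :: real and y z :: "real^'n"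
 by (simp add: inner_add_left)
 ultimately show ?thesis by (simp only:) (simp add: algebra_simps)
 qed (simp add: logker_def)
 then show "(LBINT x. v x * ?ka f' t x) = - (LBINT x. ?ka f t x * (w x <.> x))" using T(1) by simp
 qed
 define m where "m t = M bumpf t / Z" for t
 define m' where "m' t = - M bumpf' t / Z" for t
 define m'' where "m'' t = M bumpf'' t / Z" for t

 \<comment> \<open>The differential inequality for the logarithmic mean\<close>
 have ineq: "m'' t + (real ?N - 2) * m' t + (m' t)^2 + exp (2 * t - 2 + (q - 1) * m t) <= d * (E / L)" if t: "t > t1" for t
 proof -
 \<comment> \<open>Two powers of \<open>r\<close> more than the averaging kernel, because squared
   gradients scale like \<open>r\<close> to the power -2.\<close>
 define ze where "ze x = p x * logker (?N - 2) bumpf t (norm x)" for x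
 define Dze where "Dze x = logker (?N - 2) bumpf t (norm x) *R Dp x + (p x * logker (Suc (?N - 2)) (%s. bumpf' s - real (?N - 2) * bumpf s) t (norm x)) *R (x /R norm x)" for x
 have zeC: "C1c G ze Dze" unfolding ze_def[abs_def] Dze_def[abs_def] by (rule RC[OF t]) (auto simp: DERIV_bumpf)
 have ze0: "ze x >= 0" for x unfolding ze_def using p0 bumpf_nonneg by (simp add: logker_def indicator_def)
 have zeka: "ze x = (norm x)^2 * ?ka bumpf t x" for x
 proof (cases "x = 0")
 case False
 have "2 + (?N - 2) = ?N" using N3 by linarith
 then have "norm x ^ ?N = (norm x)^2 * norm x ^ (?N - 2)" by (metis power_add)
 then show ?thesis using False by (simp add: ze_def logker_def)
 qed (simp add: ze_def logker_def)
 let ?ep = "%n. 1 / real (Suc n)"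
 define Mn where "Mn n f = (LBINT x. ln (u x + ?ep n) * ?ka f t x)" for n f
 \<comment> \<open>In the limit \<open>a\<close> and \<open>b\<close> become \<open>Z * m' t\<close>
   and \<open>Z * m'' t\<close>; as a continuous function of both, the bound survives the removal of
   \<open>?ep n\<close>.\<close>
 define RHS where "RHS a b = - b - (real ?N - 2) * a + d * (E / L * Z) - a^2 / Z" for a b :: real
 have step: "(\<integral>\<^sup>+x. ennreal (u x powr q * (ze x / (u x + ?ep n))) \<partial>lborel) <= ennreal (RHS (- Mn n bumpf') (Mn n bumpf''))" for n
 proof -
 have e: "?ep n > 0" by simp
 define w where "w x = (1 / (u x + ?ep n)) *R g x" for x
 have wH: "weak_H1 G (%x. ln (u x + ?ep n)) w" unfolding w_def[abs_def] by (rule weak_H1_ln[OF G uH u0 e])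
 note [measurable] = weak_H1D(2)[OF wH]
 have r1: "(LBINT x. ?ka bumpf t x * (w x <.> x)) = - Mn n bumpf'" "intl (%x. ?ka bumpf t x * (w x <.> x))"
 using radial[OF wH t _ _ DERIV_bumpf] by (simp_all add: Mn_def)
 have r2: "(LBINT x. ?ka bumpf' t x * (w x <.> x)) = - Mn n bumpf''" "intl (%x. ?ka bumpf' t x * (w x <.> x))"
 using radial[OF wH t _ _ DERIV_bumpf'] by (simp_all add: Mn_def)
 have int: "intl (%x. w x <.> (aniso d x *v Dze x))" "intl (%x. ze x * (w x <.> (aniso d x *v w x)))"
 unfolding w_def by (rule integrable_test_quad[OF uH upos zeC d e])+
 have wx: "(w x <.> x)^2 <= (norm x)^2 * (norm (w x))^2" for x
 using power_mono[OF Cauchy_Schwarz_ineq2[of "w x" x], of 2] by (simp add: power_mult_distrib mult.commute)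
 have int3: "intl (%x. ?ka bumpf t x * (w x <.> x)^2)"
 proof (rule B_integrable_bound[OF integrable_mult_right[OF int(2), of "1 / min 1 d"]])
 show "AE x in lborel. norm (?ka bumpf t x * (w x <.> x)^2) <= norm (1 / min 1 d * (ze x * (w x <.> (aniso d x *v w x))))"
 proof (rule AE_I2)
 fix x
 have "min 1 d * (?ka bumpf t x * (w x <.> x)^2) <= min 1 d * (?ka bumpf t x * ((norm x)^2 * (norm (w x))^2))"
 using wx[of x] ka0[of x t] d by (intro mult_left_mono) auto
 also have "... = ze x * (min 1 d * (norm (w x))^2)" by (simp add: zeka mult_ac)
 also have "... <= ze x * (w x <.> (aniso d x *v w x))" by (rule mult_left_mono[OF aniso_bounds(1)[OF d] ze0])
 finally have "?ka bumpf t x * (w x <.> x)^2 <= 1 / min 1 d * (ze x * (w x <.> (aniso d x *v w x)))"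
 using d by (simp add: pos_le_divide_eq mult.commute)
 moreover have "0 <= ?ka bumpf t x * (w x <.> x)^2" using ka0[of x t] by simp
 ultimately show "norm (?ka bumpf t x * (w x <.> x)^2) <= norm (1 / min 1 d * (ze x * (w x <.> (aniso d x *v w x))))"
 unfolding real_norm_def by linarith
 qed
 note [measurable] = kam[of bumpf t, simplified]
 show "(%x. ?ka bumpf t x * (w x <.> x)^2) \<in> borel_measurable lborel" by measurable
 qed
 \<comment> \<open>Radial and tangential parts of \<open>w\<close> separate: the radial part yields
   the terms with \<open>w x <.> x\<close>, and the tangential part is removed by completing a
   square, at the price of the Dirichlet density of \<open>Th\<close>.\<close>
 have pw: "w x <.> (aniso d x *v Dze x) - ze x * (w x <.> (aniso d x *v w x))
 <= ?ka bumpf' t x * (w x <.> x) - (real ?N - 2) * (?ka bumpf t x * (w x <.> x))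
 + d * (((norm x)^2 * (norm (DTh x))^2) * logker ?N bumpf t (norm x)) - ?ka bumpf t x * (w x <.> x)^2" for x
 proof (cases "x = 0")
 case True
 then show ?thesis by (simp add: ze_def Dze_def logker_def aniso_mult)
 next
 case False
 define r where "r = norm x"
 define k where "k = logker ?N bumpf t r"
 define k' where "k' = logker ?N bumpf' t r"
 define a where "a = w x <.> x"
 define b where "b = w x <.> DTh x"
 have r: "r > 0" using False by (simp add: r_def)
 have k0: "k >= 0" unfolding k_def using bumpf_nonneg r by (simp add: logker_def)
 have pw2: "r ^ ?N = r^2 * r ^ (?N - 2)" "Suc (?N - 2) = ?N - 1" "real (?N - 2) = real ?N - 2" "r ^ ?N = r * r ^ (?N - 1)"
 proof -
 have "2 + (?N - 2) = ?N" "1 + (?N - 1) = ?N" using N3 by linarith+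
 then show "r ^ ?N = r^2 * r ^ (?N - 2)" "r ^ ?N = r * r ^ (?N - 1)" by (metis power_add, metis power_add power_one_right)
 show "Suc (?N - 2) = ?N - 1" "real (?N - 2) = real ?N - 2" using N3 by linarith+
 qed
 have R2: "logker (?N - 2) bumpf t r = r^2 * k" unfolding k_def using r pw2(1) by (simp add: logker_def)
 have R2': "logker (Suc (?N - 2)) (%s. bumpf' s - real (?N - 2) * bumpf s) t r = r * (k' - (real ?N - 2) * k)"
 unfolding k_def k'_def pw2(2,3) using r pw2(4) by (simp add: logker_def field_simps)
 have xx: "x <.> x = r^2" by (simp add: r_def power2_norm_eq_inner)
 have xD: "x <.> DTh x = 0" using perp[OF False] by (simp add: inner_commute)
 have Dz: "Dze x = (2 * Th x * (r^2 * k)) *R DTh x + (p x * (k' - (real ?N - 2) * k)) *R x"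
 unfolding Dze_def r_def[symmetric] R2 R2' Dp_def using r by (simp add: mult_ac)
 have 1: "w x <.> (aniso d x *v Dze x) = d * (2 * Th x * (r^2 * k)) * b + (p x * (k' - (real ?N - 2) * k)) * a"
 proof -
 have "x <.> Dze x = (p x * (k' - (real ?N - 2) * k)) * r^2" unfolding Dz by (simp add: inner_add_right xD xx)
 moreover have "w x <.> Dze x = (2 * Th x * (r^2 * k)) * b + (p x * (k' - (real ?N - 2) * k)) * a"
 unfolding Dz by (simp add: inner_add_right a_def b_def)
 moreover have "x <.> w x = a" by (simp add: a_def inner_commute)
 moreover have "(1 - d) * (q * r^2) * a / r^2 = (1 - d) * q * a" "(1 - d) * a * (q * r^2) / r^2 = (1 - d) * q * a" for q using r by simp_all
 ultimately show ?thesis unfolding aniso_inner r_def[symmetric] by (simp only: inner_commute) (simp add: algebra_simps)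
 qed
 have 2: "ze x * (w x <.> (aniso d x *v w x)) = p x * k * (d * (r^2 * (norm (w x))^2 - a^2) + a^2)"
 proof -
 have "w x <.> (aniso d x *v w x) = d * (norm (w x))^2 + (1 - d) * a^2 / r^2"
 unfolding aniso_inner r_def[symmetric] by (simp add: a_def inner_commute power2_norm_eq_inner mult.assoc power2_eq_square[of "x <.> w x"] power2_eq_square[of "w x <.> x"])
 moreover have "ze x = p x * (r^2 * k)" unfolding ze_def r_def[symmetric] R2 ..
 moreover have "r^2 * (d * (norm (w x))^2 + (1 - d) * a^2 / r^2) = d * (r^2 * (norm (w x))^2 - a^2) + a^2"
 using r by (simp add: distrib_left) (simp add: algebra_simps)
 moreover have "p x * (r^2 * k) * Q = p x * k * (r^2 * Q)" for Q by (simp add: mult_ac)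
 ultimately show ?thesis by (simp only:)
 qed
 \<comment> \<open>The difference \<open>w x - (a / r^2) *R x\<close> is the tangential part of
   \<open>w x\<close>; this square absorbs its cross term with \<open>DTh x\<close>.\<close>
 have "0 <= r^2 * (norm (Th x *R (w x - (a / r^2) *R x) - DTh x))^2" by simp
 also have "... = p x * (r^2 * (norm (w x))^2 - a^2) - 2 * r^2 * Th x * b + r^2 * (norm (DTh x))^2"
 proof -
 define y where "y = w x - (a / r^2) *R x"
 have "y <.> DTh x = b" using xD by (simp add: y_def inner_diff_left b_def)
 moreover have "y <.> y = w x <.> w x - 2 * (a / r^2) * a + (a / r^2)^2 * r^2"
 unfolding y_def a_def xx[symmetric] by (simp add: inner_diff_left inner_diff_right inner_commute[of x "w x"] power2_eq_square)
 moreover have "(norm (Th x *R y - DTh x))^2 = (Th x)^2 * (y <.> y) - 2 * Th x * (y <.> DTh x) + DTh x <.> DTh x"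
 by (simp add: power2_norm_eq_inner inner_diff_left inner_diff_right inner_commute[of "DTh x" y]) (simp add: power2_eq_square algebra_simps)
 ultimately have "(norm (Th x *R (w x - (a / r^2) *R x) - DTh x))^2
 = p x * (w x <.> w x - 2 * (a / r^2) * a + (a / r^2)^2 * r^2) - 2 * Th x * b + DTh x <.> DTh x"
 by (simp only: y_def p_def)
 moreover have "(a / r^2)^2 * r^2 = a * a / r^2" using r by (simp add: power2_eq_square)
 ultimately have e: "(norm (Th x *R (w x - (a / r^2) *R x) - DTh x))^2
 = p x * (w x <.> w x - 2 * (a / r^2) * a + a * a / r^2) - 2 * Th x * b + DTh x <.> DTh x" by (simp only:)
 have "r^2 * (P * (W - 2 * (a / r^2) * a + a * a / r^2) - c + D) = P * (r^2 * W - a^2) - r^2 * c + r^2 * D" for P W c D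
 using r by (simp add: field_simps power2_eq_square)
 then show ?thesis unfolding e power2_norm_eq_inner[of "w x"] power2_norm_eq_inner[of "DTh x"] by (simp add: mult_ac)
 qed
 finally have "0 <= d * k * (p x * (r^2 * (norm (w x))^2 - a^2) - 2 * r^2 * Th x * b + r^2 * (norm (DTh x))^2)"
 using d k0 by simp
 then show ?thesis
 unfolding 1 2 r_def[symmetric] k_def[symmetric] k'_def[symmetric] a_def[symmetric] by (simp add: algebra_simps)
 qed
 have le: "(LBINT x. w x <.> (aniso d x *v Dze x)) - (LBINT x. ze x * (w x <.> (aniso d x *v w x)))
 <= - Mn n bumpf'' - (real ?N - 2) * (- Mn n bumpf') + d * (E / L * Z) - (LBINT x. ?ka bumpf t x * (w x <.> x)^2)"
 proof -
 have "(LBINT x. w x <.> (aniso d x *v Dze x) - ze x * (w x <.> (aniso d x *v w x)))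
 <= (\<integral>x. ?ka bumpf' t x * (w x <.> x) - (real ?N - 2) * (?ka bumpf t x * (w x <.> x))
 + d * (((norm x)^2 * (norm (DTh x))^2) * logker ?N bumpf t (norm x)) - ?ka bumpf t x * (w x <.> x)^2 \<partial>lborel)"
 using int int3 r1(2) r2(2) iE[of t]
 by (intro integral_mono pw B_integrable_diff B_integrable_add integrable_mult_right)
 also have "... = - Mn n bumpf'' - (real ?N - 2) * (- Mn n bumpf') + d * (E / L * Z) - (LBINT x. ?ka bumpf t x * (w x <.> x)^2)"
 proof -
 have lin: "(LBINT x. A x - c * B x + e * C x - D x) = (LBINT x. A x) - c * (LBINT x. B x) + e * (LBINT x. C x) - (LBINT x. D x)"
 if "intl A" "intl B" "intl C" "intl D" for A B C D :: "real^'n => real" and c e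
 using that by simp
 show ?thesis unfolding lin[OF r2(2) r1(2) iE[of t] int3] r1(1) r2(1) eqE[of t] ..
 qed
 finally show ?thesis using int by simp
 qed
 \<comment> \<open>Jensen's inequality for the square, by expanding the variance about the mean
   \<open>c\<close>; this is the origin of \<open>(m' t)^2\<close>.\<close>
 have CS: "(Mn n bumpf')^2 / Z <= (LBINT x. ?ka bumpf t x * (w x <.> x)^2)"
 proof -
 define c where "c = - Mn n bumpf' / Z"
 have "0 <= (LBINT x. ?ka bumpf t x * (w x <.> x - c)^2)"
 using ka0[where t=t] by (intro integral_nonneg_AE AE_I2 mult_nonneg_nonneg[OF _ zero_le_power2])
 also have "... = (LBINT x. ?ka bumpf t x * (w x <.> x)^2 - 2 * c * (?ka bumpf t x * (w x <.> x)) + c^2 * ?ka bumpf t x)"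
 by (intro B_integral_cong) (simp_all add: power2_diff algebra_simps)
 also have "... = (LBINT x. ?ka bumpf t x * (w x <.> x)^2) - 2 * c * (- Mn n bumpf') + c^2 * Z"
 using int3 r1 iZ[of t] eqZ[of t] by simp
 also have "... = (LBINT x. ?ka bumpf t x * (w x <.> x)^2) - (Mn n bumpf')^2 / Z"
 unfolding c_def using Z by (simp add: power2_eq_square)
 finally show ?thesis by simp
 qed
 have "(\<integral>\<^sup>+x. ennreal (u x powr q * (ze x / (u x + ?ep n))) \<partial>lborel)
 <= ennreal ((LBINT x. w x <.> (aniso d x *v Dze x)) - (LBINT x. ze x * (w x <.> (aniso d x *v w x))))"
 unfolding w_def by (rule supersol_log_test(1)[OF G uG d zeC ze0 e])
 also have "... <= ennreal (RHS (- Mn n bumpf') (Mn n bumpf''))"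
 unfolding RHS_def using le CS by (intro ennreal_leI) simp
 finally show ?thesis .
 qed
 \<comment> \<open>For \<open>ep \<le> 1\<close> the regularised logarithm lies between
   \<open>ln u\<close> and \<open>u\<close>, which gives an integrable majorant.\<close>
 have limM: "(%n. Mn n f) >-> M f t" if f: "f \<in> ?F" for f
 unfolding Mn_def M_def
 proof (rule integral_dominated_convergence[where w="%x. norm (ln (u x) * ?ka f t x) + norm (u x * ?ka f t x)"])
 note [measurable] = kam[OF f]
 show "(%x. ln (u x) * ?ka f t x) \<in> borel_measurable lborel" "(%x. ln (u x + ?ep n) * ?ka f t x) \<in> borel_measurable lborel" for n by measurable
 have "intl (%x. ind K x * \<bar>u x\<bar>)" if "compact K" "K \<subseteq> G" for K
 using integrable_abs[OF weak_H1D(3)[OF uH that]] by (simp add: abs_mult)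
 then have "intl (%x. u x * ?ka f t x)" by (intro ika[OF f t]) auto
 then show "intl (%x. norm (ln (u x) * ?ka f t x) + norm (u x * ?ka f t x))"
 using iln[OF f t] by (intro B_integrable_add integrable_norm)
 show "AE x in lborel. (%n. ln (u x + ?ep n) * ?ka f t x) >-> ln (u x) * ?ka f t x"
 proof (rule AE_I2)
 fix x
 have z: "(%n. 1 / real (Suc n)) >-> 0" by (rule LIMSEQ_Suc[OF lim_const_over_n])
 have "(%n. ln (u x + ?ep n) * ?ka f t x) >-> ln (u x + 0) * ?ka f t x"
 using upos[of x] by (intro tendsto_intros z) auto
 then show "(%n. ln (u x + ?ep n) * ?ka f t x) >-> ln (u x) * ?ka f t x" by simp
 qed
 show "AE x in lborel. norm (ln (u x + ?ep n) * ?ka f t x) <= norm (ln (u x) * ?ka f t x) + norm (u x * ?ka f t x)" for n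
 proof (rule AE_I2)
 fix x
 have e: "0 < ?ep n" "?ep n <= 1" by auto
 have "ln (u x) <= ln (u x + ?ep n)" by (rule ln_mono) (use upos[of x] e in linarith)+
 moreover have "ln (u x + ?ep n) <= u x + ?ep n - 1" by (rule ln_le_minus_one[OF add_pos_pos[OF upos e(1)]])
 ultimately have "\<bar>ln (u x + ?ep n)\<bar> <= \<bar>ln (u x)\<bar> + u x" using upos[of x] e by linarith
 then have "\<bar>ln (u x + ?ep n)\<bar> * \<bar>?ka f t x\<bar> <= (\<bar>ln (u x)\<bar> + u x) * \<bar>?ka f t x\<bar>" by (intro mult_right_mono) auto
 then show "norm (ln (u x + ?ep n) * ?ka f t x) <= norm (ln (u x) * ?ka f t x) + norm (u x * ?ka f t x)"
 using upos[of x] by (simp add: abs_mult distrib_right)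
 qed
 qed
 let ?R = "RHS (- M bumpf' t) (M bumpf'' t)"
 have "(%n. RHS (- Mn n bumpf') (Mn n bumpf'')) >-> ?R"
 unfolding RHS_def using Z by (intro tendsto_intros limM) auto
 then have limR: "(%n. ennreal (RHS (- Mn n bumpf') (Mn n bumpf''))) >-> ennreal ?R" by (rule tendsto_ennrealI)
 have "(\<integral>\<^sup>+x. ennreal (u x powr (q - 1) * ze x) \<partial>lborel)
 = (\<integral>\<^sup>+x. liminf (%n. ennreal (u x powr q * (ze x / (u x + ?ep n)))) \<partial>lborel)"
 proof (rule nn_integral_cong, rule lim_imp_Liminf[symmetric])
 fix x
 have z: "(%n. 1 / real (Suc n)) >-> 0" by (rule LIMSEQ_Suc[OF lim_const_over_n])
 have "(%n. u x powr q * (ze x / (u x + ?ep n))) >-> u x powr q * (ze x / (u x + 0))"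
 using upos[of x] by (intro tendsto_intros z) auto
 moreover have "u x powr q * (ze x / (u x + 0)) = u x powr (q - 1) * ze x"
 using upos[of x] by (simp add: powr_diff)
 ultimately show "(%n. ennreal (u x powr q * (ze x / (u x + ?ep n)))) >-> ennreal (u x powr (q - 1) * ze x)"
 by (intro tendsto_ennrealI) simp
 qed simp
 also have "... <= liminf (%n. \<integral>\<^sup>+x. ennreal (u x powr q * (ze x / (u x + ?ep n))) \<partial>lborel)"
 proof (rule nn_integral_liminf)
 note [measurable] = C1c_measurable(1)[OF zeC]
 show "(%x. ennreal (u x powr q * (ze x / (u x + ?ep n)))) \<in> borel_measurable lborel" for n by measurable
 qed
 also have "... <= liminf (%n. ennreal (RHS (- Mn n bumpf') (Mn n bumpf'')))"
 by (intro Liminf_mono always_eventually allI step)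
 also have "... = ennreal ?R" by (rule lim_imp_Liminf[OF _ limR]) simp
 finally have up: "(\<integral>\<^sup>+x. ennreal (u x powr (q - 1) * ze x) \<partial>lborel) <= ennreal ?R" .
 define c where "c = exp (2 * t - 2 + (q - 1) * m t)"
 have c: "c > 0" by (simp add: c_def)
 \<comment> \<open>Tangent to the exponential at the mean \<open>m t\<close>, with
   \<open>exp (2 * t - 2)\<close> as lower bound for \<open>r^2\<close> on the shell. Being affine
   in \<open>ln u\<close> it integrates exactly to \<open>c * Z\<close>: Jensen's inequality by
   hand.\<close>
 let ?j = "%x. c * (?ka bumpf t x + (q - 1) * (ln (u x) * ?ka bumpf t x - m t * ?ka bumpf t x))"
 have ij: "intl ?j"
 using iZ[of t] iln[of bumpf t] t by (intro integrable_mult_right B_integrable_add B_integrable_diff) auto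
 have eqj: "(LBINT x. ?j x) = c * Z"
 proof -
 have "(LBINT x. ?j x) = c * (Z + (q - 1) * (M bumpf t - m t * Z))"
 using iZ[of t] iln[of bumpf t] t eqZ[of t] by (simp add: M_def)
 then show ?thesis using Z by (simp add: m_def)
 qed
 have "ennreal (c * Z) <= (\<integral>\<^sup>+x. ennreal (?j x) \<partial>lborel)"
 unfolding eqj[symmetric] by (rule ennreal_integral_le_nn_integral[OF ij])
 also have "... <= (\<integral>\<^sup>+x. ennreal (u x powr (q - 1) * ze x) \<partial>lborel)"
 proof (intro nn_integral_mono ennreal_leI)
 fix x
 show "?j x <= u x powr (q - 1) * ze x"
 proof (cases "?ka bumpf t x = 0")
 case True
 then show ?thesis unfolding zeka True by simp
 next
 case False
 then have "\<not> (norm x < exp (t - 1) \<or> exp (t + 1) < norm x)"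
 proof -
 have "!!s. \<bar>s\<bar> >= 1 ==> bumpf s = 0" using bumpf_eq_0 by blast
 from logker_eq_0[where f=bumpf and r="norm x" and t=t and N="?N", OF this] show ?thesis using False by auto
 qed
 then have "exp (t - 1) <= norm x" by simp
 then have "(exp (t - 1))^2 <= (norm x)^2" by (intro power_mono) auto
 moreover have "(exp (t - 1))^2 = exp (2 * t - 2)" by (simp add: exp_double[symmetric] algebra_simps)
 ultimately have n2: "exp (2 * t - 2) <= (norm x)^2" by simp
 have tl: "exp ((q - 1) * m t) * (1 + (q - 1) * (ln (u x) - m t)) <= u x powr (q - 1)"
 proof -
 have "1 + (q - 1) * (ln (u x) - m t) <= exp ((q - 1) * (ln (u x) - m t))" by (rule exp_ge_add_one_self)
 then have "exp ((q - 1) * m t) * (1 + (q - 1) * (ln (u x) - m t)) <= exp ((q - 1) * m t) * exp ((q - 1) * (ln (u x) - m t))"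
 by (intro mult_left_mono) auto
 also have "... = u x powr (q - 1)" using upos[of x] by (simp add: powr_def exp_add[symmetric] algebra_simps)
 finally show ?thesis .
 qed
 have "?j x = exp (2 * t - 2) * (exp ((q - 1) * m t) * (1 + (q - 1) * (ln (u x) - m t))) * ?ka bumpf t x"
 proof -
 have ce: "c = exp (2 * t - 2) * exp ((q - 1) * m t)" unfolding c_def by (rule exp_add)
 have ring: "(A * B) * (K + (q - 1) * (l * K - M * K)) = A * (B * (1 + (q - 1) * (l - M))) * K" for A B K l M
 by (simp add: algebra_simps)
 show ?thesis unfolding ce by (rule ring)
 qed
 also have "... <= exp (2 * t - 2) * (u x powr (q - 1)) * ?ka bumpf t x"
 using tl ka0[of x t] by (intro mult_right_mono mult_left_mono) auto
 also have "... <= (norm x)^2 * (u x powr (q - 1)) * ?ka bumpf t x"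
 using n2 ka0[of x t] by (intro mult_right_mono) auto
 also have "... = u x powr (q - 1) * ze x" by (simp add: zeka mult_ac)
 finally show ?thesis .
 qed
 qed
 finally have cR: "ennreal (c * Z) <= ennreal ?R" using up by (rule order.trans)
 have cZ: "c * Z > 0" using c Z by simp
 \<comment> \<open>Positivity of the left side rules out that \<open>ennreal\<close> has truncated a
   negative \<open>?R\<close>.\<close>
 have "c * Z <= ?R"
 proof (cases "?R >= 0")
 case True then show ?thesis using cR by (simp add: ennreal_le_iff)
 next
 case False
 then have "ennreal (c * Z) <= 0" using cR by (simp add: ennreal_neg)
 then show ?thesis using cZ by (simp add: ennreal_eq_0_iff)
 qed
 moreover have "?R = Z * (- m'' t - (real ?N - 2) * m' t + d * (E / L) - (m' t)^2)"
 unfolding RHS_def m''_def m'_def using Z by (simp add: field_simps power2_eq_square)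
 ultimately have "Z * c <= Z * (- m'' t - (real ?N - 2) * m' t + d * (E / L) - (m' t)^2)" by (simp add: mult.commute)
 then have "c <= - m'' t - (real ?N - 2) * m' t + d * (E / L) - (m' t)^2" using Z by (simp only: mult_le_cancel_left_pos)
 then show ?thesis by (simp add: c_def)
 qed
 show False
 proof (rule no_global_emden_fowler[OF _ _ ineq q be A])
 fix t assume t: "t > t1"
 show "(m has_real_derivative m' t) (at t)"
 unfolding m_def[abs_def] m'_def using DM[OF _ _ DERIV_bumpf t] by (intro DERIV_cdivide) auto
 show "(m' has_real_derivative m'' t) (at t)"
 using DERIV_cdivide[OF DERIV_minus[OF DM[OF _ _ DERIV_bumpf' t]], of Z] unfolding m'_def[abs_def] m''_def by simp
 qed
qed

section \<open>Passing to the limit\<close>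

text \<open>In polar coordinates every slice of a 0-homogeneous exceptional set is the same null set
  for \<open>annul\<close>.\<close>

lemma AE_hom0_lborel:
 fixes P :: "real^'n => bool"
 assumes Pm[measurable]: "Measurable.pred borel P" and hom: "!!x t. x ~= 0 ==> t > 0 ==> P (t *R x) = P x"
 and ae: "AE x in annul. P x"
 shows "AE x in lborel. P x"
proof -
 let ?f = "%x. ind {x. \<not> P x} x :: ennreal"
 have z: "(\<integral>\<^sup>+x. ?f ((s / norm x) *R x) \<partial>annul) = 0" if s: "s > 0" for s
 proof -
 have "AE x in annul. ?f ((s / norm x) *R x) = 0"
 using ae AE_annular_nz
 proof eventually_elim
 case (elim x)
 then show ?case using hom0_normalize[of P, OF hom elim(2) s] by simp
 qed
 then have "(\<integral>\<^sup>+x. ?f ((s / norm x) *R x) \<partial>annul) = (\<integral>\<^sup>+x. 0 \<partial>(annul :: (real^'n) measure))"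
 by (rule nn_integral_cong_AE)
 then show ?thesis by simp
 qed
 have "ennreal (ln 2) * (\<integral>\<^sup>+x. ?f x \<partial>lborel)
 = (\<integral>\<^sup>+s. ennreal (ind {0<..} s * s ^ (CARD('n) - 1)) * (\<integral>\<^sup>+x. ?f ((s / norm x) *R x) \<partial>annul) \<partial>lborel)"
 by (rule polar_nn_integral) measurable
 also have "... = (\<integral>\<^sup>+s. 0 \<partial>(lborel :: real measure))"
 proof (rule nn_integral_cong)
 fix s :: real
 show "ennreal (ind {0<..} s * s ^ (CARD('n) - 1)) * (\<integral>\<^sup>+x. ?f ((s / norm x) *R x) \<partial>annul) = 0"
 using z[of s] by (cases "s > 0") auto
 qed
 finally have "ennreal (ln 2) * (\<integral>\<^sup>+x. ?f x \<partial>lborel) = 0" by simp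
 moreover have "ennreal (ln 2) ~= 0" by (simp add: ennreal_eq_0_iff)
 ultimately have "(\<integral>\<^sup>+x. ?f x \<partial>lborel) = 0" by simp
 moreover have "?f \<in> borel_measurable lborel" by measurable
 ultimately have "AE x in lborel. ?f x = 0" by (simp only: nn_integral_0_iff_AE)
 then show ?thesis by eventually_elim (simp split: split_indicator_asm)
qed

text \<open>The limit is the explicit pointwise \<open>lim\<close>: identities that hold for every
  term, homogeneity in particular, then pass to \<open>F\<close> at every point and not just almost
  everywhere.\<close>

lemma L1_cauchy_limit:
 fixes f :: "nat => 'a => 'b::{banach, second_countable_topology}"
 assumes f: "!!n. integrable M (f n)"
 and e: "!!n m. n <= m ==> (\<integral>x. norm (f m x - f n x) \<partial>M) <= e n" "summable e"
 defines "F \<equiv> %x. lim (%n. f n x)"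
 shows "AE x in M. (%n. f n x) >-> F x" "F \<in> borel_measurable M" "integrable M F"
 "!!n. (\<integral>x. norm (F x - f n x) \<partial>M) <= e n"
proof -
 note [measurable] = borel_measurable_integrable[OF f]
 show Fm[measurable]: "F \<in> borel_measurable M" unfolding F_def by (rule borel_measurable_lim_metric) simp
 have i: "integrable M (%x. norm (f m x - f n x))" for m n
 by (intro integrable_norm B_integrable_diff f)
 have e0: "e n >= 0" for n
 proof -
 have "0 <= (\<integral>x. norm (f n x - f n x) \<partial>M)" by (rule integral_nonneg_AE) simp
 also have "... <= e n" by (rule e(1)) (rule order_refl)
 finally show ?thesis .
 qed
 have "(\<integral>\<^sup>+x. (\<Sum>n. ennreal (norm (f (Suc n) x - f n x))) \<partial>M) = (\<Sum>n. \<integral>\<^sup>+x. ennreal (norm (f (Suc n) x - f n x)) \<partial>M)"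
 by (rule nn_integral_suminf, measurable)
 also have "... <= (\<Sum>n. ennreal (e n))"
 proof (intro suminf_le summableI)
 fix n
 show "(\<integral>\<^sup>+x. ennreal (norm (f (Suc n) x - f n x)) \<partial>M) <= ennreal (e n)"
 by (subst nn_integral_eq_integral[OF i]) (auto intro!: ennreal_leI e(1))
 qed
 also have "... = ennreal (suminf e)" by (rule suminf_ennreal2[OF e0 e(2)])
 also have "ennreal (suminf e) < \<infinity>" by simp
 finally have "(\<integral>\<^sup>+x. (\<Sum>n. ennreal (norm (f (Suc n) x - f n x))) \<partial>M) ~= \<infinity>"
 by (rule less_imp_neq)
 then have "AE x in M. (\<Sum>n. ennreal (norm (f (Suc n) x - f n x))) ~= \<infinity>"
 by (rule nn_integral_PInf_AE[rotated], measurable)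
 then show lim: "AE x in M. (%n. f n x) >-> F x"
 proof eventually_elim
 case (elim x)
 have "(\<Sum>n. ennreal (norm (f (Suc n) x - f n x))) ~= top" using elim by (simp only: infinity_ennreal_def not_False_eq_True)
 then have "summable (%n. norm (f (Suc n) x - f n x))"
 by (rule summable_suminf_not_top[rotated]) (rule norm_ge_zero)
 then have "summable (%n. f (Suc n) x - f n x)" by (rule summable_norm_cancel)
 then have "(%n. \<Sum>k<n. f (Suc k) x - f k x) >-> (\<Sum>k. f (Suc k) x - f k x)"
 by (rule summable_LIMSEQ)
 then have "(%n. f n x - f 0 x) >-> (\<Sum>k. f (Suc k) x - f k x)"
 unfolding sum_lessThan_telescope[of "%k. f k x"] .
 from tendsto_add[OF this tendsto_const[of "f 0 x"]]
 have "(%n. f n x) >-> (\<Sum>k. f (Suc k) x - f k x) + f 0 x" by (simp only: diff_add_cancel)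
 then have "convergent (%n. f n x)" by (rule convergentI)
 then show ?case unfolding F_def by (simp only: convergent_LIMSEQ_iff)
 qed
 have nn: "(\<integral>\<^sup>+x. ennreal (norm (F x - f n x)) \<partial>M) <= ennreal (e n)" for n
 proof -
 have "(\<integral>\<^sup>+x. ennreal (norm (F x - f n x)) \<partial>M) = (\<integral>\<^sup>+x. liminf (%m. ennreal (norm (f (m + n) x - f n x))) \<partial>M)"
 proof (rule nn_integral_cong_AE)
 show "AE x in M. ennreal (norm (F x - f n x)) = liminf (%m. ennreal (norm (f (m + n) x - f n x)))"
 using lim
 proof eventually_elim
 case (elim x)
 then have "(%m. f (m + n) x) >-> F x" by (rule LIMSEQ_ignore_initial_segment)
 then have "(%m. ennreal (norm (f (m + n) x - f n x))) >-> ennreal (norm (F x - f n x))"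
 by (intro tendsto_ennrealI tendsto_norm tendsto_diff tendsto_const)
 then show ?case by (intro lim_imp_Liminf[symmetric]) auto
 qed
 qed
 also have "... <= liminf (%m. \<integral>\<^sup>+x. ennreal (norm (f (m + n) x - f n x)) \<partial>M)"
 by (rule nn_integral_liminf) measurable
 also have "... <= liminf (%m. ennreal (e n))"
 proof (intro Liminf_mono always_eventually allI)
 fix m
 show "(\<integral>\<^sup>+x. ennreal (norm (f (m + n) x - f n x)) \<partial>M) <= ennreal (e n)"
 by (subst nn_integral_eq_integral[OF i]) (auto intro!: ennreal_leI e(1))
 qed
 also have "... = ennreal (e n)" by (simp add: Liminf_const)
 finally show ?thesis .
 qed
 have iF: "integrable M (%x. F x - f n x)" for n
 proof (rule integrableI_bounded)
 show "(\<integral>\<^sup>+x. ennreal (norm (F x - f n x)) \<partial>M) < \<infinity>"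
 using nn[of n] by (rule le_less_trans) simp
 qed measurable
 have "integrable M (%x. (F x - f 0 x) + f 0 x)" by (rule B_integrable_add[OF iF f])
 then show "integrable M F" by simp
 fix n
 have "ennreal (\<integral>x. norm (F x - f n x) \<partial>M) = (\<integral>\<^sup>+x. ennreal (norm (F x - f n x)) \<partial>M)"
 by (rule nn_integral_eq_integral[symmetric, OF integrable_norm[OF iF]]) simp
 then have "ennreal (\<integral>x. norm (F x - f n x) \<partial>M) <= ennreal (e n)" using nn[of n] by simp
 then show "(\<integral>x. norm (F x - f n x) \<partial>M) <= e n" using e0 by (simp add: ennreal_le_iff)
qed

lemma Fatou_norm_sq:
 fixes f :: "nat => 'a => 'b::{banach, second_countable_topology}"
 assumes lim: "AE x in M. (%n. f n x) >-> F x" and m[measurable]: "F \<in> borel_measurable M" "!!n. f n \<in> borel_measurable M"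
 and i: "!!n. integrable M (%x. (norm (f n x))^2)" "!!n. (\<integral>x. (norm (f n x))^2 \<partial>M) <= C"
 shows "integrable M (%x. (norm (F x))^2)"
proof (rule integrableI_bounded)
 have "(\<integral>\<^sup>+x. ennreal (norm ((norm (F x))^2)) \<partial>M) = (\<integral>\<^sup>+x. liminf (%n. ennreal ((norm (f n x))^2)) \<partial>M)"
 proof (rule nn_integral_cong_AE)
 show "AE x in M. ennreal (norm ((norm (F x))^2)) = liminf (%n. ennreal ((norm (f n x))^2))"
 using lim
 proof eventually_elim
 case (elim x)
 then have "(%n. ennreal ((norm (f n x))^2)) >-> ennreal ((norm (F x))^2)"
 by (intro tendsto_ennrealI tendsto_power tendsto_norm)
 then have "liminf (%n. ennreal ((norm (f n x))^2)) = ennreal ((norm (F x))^2)" by (intro lim_imp_Liminf) auto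
 then show ?case by simp
 qed
 qed
 also have "... <= liminf (%n. \<integral>\<^sup>+x. ennreal ((norm (f n x))^2) \<partial>M)" by (rule nn_integral_liminf) measurable
 also have "... <= liminf (%n. ennreal C)"
 proof (intro Liminf_mono always_eventually allI)
 fix n
 show "(\<integral>\<^sup>+x. ennreal ((norm (f n x))^2) \<partial>M) <= ennreal C"
 by (subst nn_integral_eq_integral[OF i(1)]) (auto intro!: ennreal_leI i(2))
 qed
 also have "... < \<infinity>" by (simp add: Liminf_const)
 finally show "(\<integral>\<^sup>+x. ennreal (norm ((norm (F x))^2)) \<partial>M) < \<infinity>" .
qed measurable

lemma weak_H1_cong_AE:
 assumes u: "weak_H1 G u g" and m: "u' \<in> bmb" and ae: "AE x in lborel. u x = u' x"
 shows "weak_H1 G u' g"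
 unfolding weak_H1_def
proof (intro conjI allI impI)
 note [measurable] = m weak_H1D(1,2)[OF u]
 show "u' \<in> bmb" "g \<in> bmb" by measurable
 fix K assume K: "compact K & K \<subseteq> G"
 then have [measurable]: "K \<in> sets borel" by (auto intro: borel_compact)
 have "intl (%x. ind K x * (u x)^2)" using K by (intro weak_H1D(5)[OF u]) auto
 moreover have "AE x in lborel. ind K x * (u x)^2 = ind K x * (u' x)^2" using ae by eventually_elim simp
 ultimately have "intl (%x. ind K x * (u' x)^2)"
 by (subst integrable_cong_AE[symmetric, where g="%x. ind K x * (u' x)^2"]) auto
 then show "set_integrable lborel K (%x. (u' x)^2)" by (simp add: set_integrable_def)
 show "set_integrable lborel K (%x. (norm (g x))^2)" using weak_H1D(6)[OF u, of K] K by (simp add: set_integrable_def)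
next
 note [measurable] = m weak_H1D(1,2)[OF u]
 fix ph Dph assume ph: "C1c G ph Dph"
 note [measurable] = C1c_measurable[OF ph]
 have "(LBINT x. u' x *R Dph x) = (LBINT x. u x *R Dph x)"
 proof (rule integral_cong_AE)
 show "AE x in lborel. u' x *R Dph x = u x *R Dph x" using ae by eventually_elim simp
 qed measurable
 then show "(LBINT x. u' x *R Dph x) = - (LBINT x. ph x *R g x)" using weak_H1D(7)[OF u ph] by simp
qed

lemma weak_H1_mono:
 assumes "weak_H1 G u g" "H \<subseteq> G" shows "weak_H1 H u g"
 using assms unfolding weak_H1_def by (meson C1c_mono order_trans)

text \<open>\<open>f * ph\<close> is again a C1 test function supported in \<open>G\<close>, which
  admits factors unbounded on \<open>G\<close>, such as powers of \<open>norm x\<close>.\<close>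

lemma weak_H1_C1_mult:
 fixes G :: "(real^'n) set"
 assumes G: "open G" and u: "weak_H1 G u g" and f: "C1_on G f Df"
 and m[measurable]: "f \<in> bmb" "Df \<in> bmb"
 shows "weak_H1 G (%x. f x * u x) (%x. f x *R g x + u x *R Df x)"
 unfolding weak_H1_def
proof (intro conjI allI impI)
 note [measurable] = weak_H1D(1,2)[OF u]
 show "(%x. f x * u x) \<in> bmb" "(%x. f x *R g x + u x *R Df x) \<in> bmb" by measurable
 fix K assume K: "compact K & K \<subseteq> G"
 then have [measurable]: "K \<in> sets borel" by (auto intro: borel_compact)
 have iu: "intl (%x. ind K x * (u x)^2)" and ig: "intl (%x. ind K x * (norm (g x))^2)"
 using K by (intro weak_H1D(5)[OF u] weak_H1D(6)[OF u]; simp)+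
 have "continuous_on K f" "continuous_on K Df"
 using K f C1_on_continuous[OF f] by (auto simp: C1_on_def intro: continuous_on_subset)
 then have "bounded (f ` K)" "bounded (Df ` K)" using K by (auto intro!: compact_imp_bounded compact_continuous_image)
 then obtain B1 B2 where B: "B1 > 0" "\<forall>y\<in>f ` K. norm y <= B1" "B2 > 0" "\<forall>y\<in>Df ` K. norm y <= B2"
 unfolding bounded_pos by (elim exE conjE)
 show "set_integrable lborel K (%x. (f x * u x)^2)" unfolding set_integrable_def
 proof (rule B_integrable_bound[OF integrable_mult_right[OF iu, of "B1^2"]])
 show "AE x in lborel. norm (ind K x *R (f x * u x)^2) <= norm (B1^2 * (ind K x * (u x)^2))"
 proof (rule AE_I2)
 fix x
 show "norm (ind K x *R (f x * u x)^2) <= norm (B1^2 * (ind K x * (u x)^2))"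
 proof (cases "x \<in> K")
 case True
 then have "\<bar>f x\<bar> <= B1" using B by auto
 then have "\<bar>f x\<bar>^2 <= B1^2" by (intro power_mono) auto
 then have "(f x)^2 <= B1^2" by (simp only: power2_abs)
 then have "(f x)^2 * (u x)^2 <= B1^2 * (u x)^2" by (rule mult_right_mono) simp
 then show ?thesis using True by (simp add: power_mult_distrib)
 qed simp
 qed
 qed measurable
 show "set_integrable lborel K (%x. (norm (f x *R g x + u x *R Df x))^2)" unfolding set_integrable_def
 proof (rule B_integrable_bound[OF B_integrable_add[OF integrable_mult_right[OF ig, of "2 * B1^2"] integrable_mult_right[OF iu, of "2 * B2^2"]]])
 show "AE x in lborel. norm (ind K x *R (norm (f x *R g x + u x *R Df x))^2) <= norm (2 * B1^2 * (ind K x * (norm (g x))^2) + 2 * B2^2 * (ind K x * (u x)^2))"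
 proof (rule AE_I2)
 fix x
 show "norm (ind K x *R (norm (f x *R g x + u x *R Df x))^2) <= norm (2 * B1^2 * (ind K x * (norm (g x))^2) + 2 * B2^2 * (ind K x * (u x)^2))"
 proof (cases "x \<in> K")
 case True
 then have b: "\<bar>f x\<bar> <= B1" "norm (Df x) <= B2" using B by auto
 have "norm (f x *R g x + u x *R Df x) <= \<bar>f x\<bar> * norm (g x) + \<bar>u x\<bar> * norm (Df x)"
 by (rule norm_triangle_le) simp
 also have "... <= B1 * norm (g x) + \<bar>u x\<bar> * B2" using B(1,3) by (intro add_mono mult_mono b) auto
 finally have "(norm (f x *R g x + u x *R Df x))^2 <= (B1 * norm (g x) + \<bar>u x\<bar> * B2)^2" by (intro power_mono) auto
 also have "... <= 2 * (B1 * norm (g x))^2 + 2 * (\<bar>u x\<bar> * B2)^2"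
 using zero_le_power2[of "B1 * norm (g x) - \<bar>u x\<bar> * B2"] unfolding power2_sum power2_diff by linarith
 finally show ?thesis using True by (simp add: power_mult_distrib mult_ac)
 qed simp
 qed
 qed measurable
next
 fix ph Dph assume ph: "C1c G ph Dph"
 note P = C1c_mult[OF G f ph]
 have e: "(LBINT x. u x *R (f x *R Dph x + ph x *R Df x)) = - (LBINT x. (f x * ph x) *R g x)"
 by (rule weak_H1D(7)[OF u P])
 note i1 = weak_H1_integrable_test[OF u P]
 obtain K where K: "compact K" "K \<subseteq> G" "!!x. x \<notin> K ==> ph x = 0" "!!x. x \<notin> K ==> Dph x = 0" using C1c_support[OF ph] by metis
 have i2: "intl (%x. u x *R (ph x *R Df x))"
 proof (rule integrable_compact_support_mult[OF _ K(1)])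
 show "continuous_on UNIV (%x. ph x *R Df x)"
 proof -
 have "continuous_on G (%x. ph x *R Df x)"
 using f C1c_continuous(1)[OF ph] by (intro continuous_intros) (auto simp: C1_on_def intro: continuous_on_subset)
 moreover have "continuous_on (- K) (%x. ph x *R Df x)"
 by (rule continuous_on_eq[OF continuous_on_const[of _ 0]]) (simp add: K(3))
 ultimately have "continuous_on (G \<union> - K) (%x. ph x *R Df x)"
 using G K(1) by (intro continuous_on_open_Un) (auto simp: compact_imp_closed open_Compl)
 moreover have "G \<union> - K = UNIV" using K(2) by auto
 ultimately show ?thesis by simp
 qed
 show "set_integrable lborel K u" using weak_H1D(3)[OF u K(1,2)] by (simp add: set_integrable_def)
 qed (use K(3) weak_H1D(1)[OF u] in auto)
 have i3: "intl (%x. u x *R (f x *R Dph x))"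
 using B_integrable_diff[OF i1(1) i2] by (simp add: scaleR_add_right)
 have "(LBINT x. u x *R (f x *R Dph x)) + (LBINT x. u x *R (ph x *R Df x)) = - (LBINT x. (f x * ph x) *R g x)"
 unfolding B_integral_add[OF i3 i2, symmetric] using e by (simp add: scaleR_add_right)
 moreover have "(LBINT x. ph x *R (f x *R g x + u x *R Df x)) = (LBINT x. (f x * ph x) *R g x) + (LBINT x. u x *R (ph x *R Df x))"
 unfolding B_integral_add[OF i1(2) i2, symmetric]
 by (intro B_integral_cong refl) (simp add: scaleR_add_right mult.commute)
 moreover have "(LBINT x. (f x * u x) *R Dph x) = (LBINT x. u x *R (f x *R Dph x))"
 by (simp add: mult.commute)
 moreover have "a = - (c + b)" if "a + b = - c" for a b c :: "real^'n"
 using that by (simp add: eq_diff_eq flip: diff_conv_add_uminus)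
 ultimately show "(LBINT x. (f x * u x) *R Dph x) = - (LBINT x. ph x *R (f x *R g x + u x *R Df x))"
 by (simp only:)
qed

section \<open>Local boundedness of subharmonic functions\<close>

text \<open>Radius derivative of \<open>mollifier\<close> in closed form; its joint continuity in
  radius and position supplies the majorant for differentiation under the integral sign.\<close>

definition mollifier_rate :: "real => 'a::euclidean_space => real" where
 "mollifier_rate rh y = (6 * rh * max 0 (rh^2 - (norm y)^2) ^ 2 / rh ^ (DIM('a) + 6)
 - real (DIM('a) + 6) * max 0 (rh^2 - (norm y)^2) ^ 3 / rh ^ (DIM('a) + 7)) / bump_mass TYPE('a)"

lemma DERIV_mollifier:
 assumes rh: "rh > 0"
 shows "((%rh. mollifier rh (y::'a::euclidean_space)) has_real_derivative mollifier_rate rh y) (at rh)"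
proof -
 let ?k = "DIM('a) + 6" and ?c = "bump_mass TYPE('a)"
 have c: "?c ~= 0" using bump_mass_pos[where ?'a='a] by simp
 have q: "((%rh. rh^2 - (norm y)^2) has_real_derivative (2 * rh)) (at rh)" by (auto intro!: derivative_eq_intros)
 have n: "((%rh. max 0 (rh^2 - (norm y)^2) ^ 3) has_real_derivative (3 * max 0 (rh^2 - (norm y)^2) ^ 2) * (2 * rh)) (at rh)"
 using DERIV_chain2[OF DERIV_max0_power[of 1] q] by (simp add: numeral_3_eq_3 numeral_2_eq_2)
 have p: "((%rh. ?c * rh ^ ?k) has_real_derivative ?c * (real ?k * rh ^ (DIM('a) + 5))) (at rh)"
 by (auto intro!: derivative_eq_intros simp: add.commute)
 have "((%rh. max 0 (rh^2 - (norm y)^2) ^ 3 / (?c * rh ^ ?k)) has_real_derivative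
 ((3 * max 0 (rh^2 - (norm y)^2) ^ 2) * (2 * rh) * (?c * rh ^ ?k) - max 0 (rh^2 - (norm y)^2) ^ 3 * (?c * (real ?k * rh ^ (DIM('a) + 5)))) / ((?c * rh ^ ?k) * (?c * rh ^ ?k))) (at rh)"
 using rh c by (intro DERIV_divide n p) simp
 moreover have "((3 * A) * (2 * rh) * (?c * rh ^ ?k) - B * (?c * (real ?k * rh ^ (DIM('a) + 5)))) / ((?c * rh ^ ?k) * (?c * rh ^ ?k))
 = (6 * rh * A / rh ^ ?k - real ?k * B / rh ^ (DIM('a) + 7)) / ?c" for A B
 proof -
 define P where "P = rh ^ (DIM('a) + 5)"
 have P: "rh ^ ?k = rh * P" "rh ^ (DIM('a) + 7) = rh * (rh * P)" "P ~= 0" using rh by (simp_all add: P_def power_add numeral_eq_Suc)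
 show ?thesis unfolding P P_def[symmetric] using rh c P(3) by (simp add: field_simps)
 qed
 ultimately show ?thesis unfolding mollifier_def mollifier_rate_def by simp
qed

text \<open>Mollifiers of different radii are dilates with equal mass, so changing the radius is a
  transport along the field \<open>y\<close>; the identity is its continuity equation.\<close>

lemma mollifier_rate_div:
 assumes rh: "rh > 0"
 shows "rh * mollifier_rate rh y = - (real (DIM('a)) * mollifier rh y + mollifier_grad rh y <.> (y::'a::euclidean_space))"
proof -
 let ?c = "bump_mass TYPE('a)"
 define m where "m = max 0 (rh^2 - (norm y)^2)"
 define P where "P = rh ^ (DIM('a) + 6)"
 have c: "?c ~= 0" using bump_mass_pos[where ?'a='a] by simp
 have P: "rh ^ (DIM('a) + 7) = rh * P" "P ~= 0" using rh by (simp_all add: P_def power_add numeral_eq_Suc)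
 have m: "m ^ 2 * (y <.> y) = m ^ 2 * rh^2 - m ^ 3"
 proof -
 have "m = 0 \<or> y <.> y = rh^2 - m" by (auto simp: m_def max_def power2_norm_eq_inner)
 then show ?thesis
 proof
 assume y: "y <.> y = rh^2 - m"
 show ?thesis unfolding y by (simp add: power2_eq_square power3_eq_cube algebra_simps)
 qed simp
 qed
 have "rh * mollifier_rate rh y = (6 * (m ^ 2 * rh^2) - real (DIM('a) + 6) * m ^ 3) / (?c * P)"
 unfolding mollifier_rate_def m_def[symmetric] P(1) P_def[symmetric] using rh c P(2) by (simp add: field_simps power2_eq_square)
 moreover have "mollifier_grad rh y <.> y = - 6 * (m ^ 2 * (y <.> y)) / (?c * P)"
 unfolding mollifier_grad_def m_def[symmetric] P_def[symmetric] by simp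
 moreover have "mollifier rh y = m ^ 3 / (?c * P)" unfolding mollifier_def m_def[symmetric] P_def[symmetric] ..
 ultimately show ?thesis unfolding m by (simp add: add_divide_distrib diff_divide_distrib algebra_simps)
qed

text \<open>The mean over \<open>mollifier rh\<close> increases with \<open>rh\<close>: its derivative is \<open>-1/rh\<close> times the
  divergence of \<open>y mollifier rh y\<close>, which is itself minus the gradient of a nonnegative bump.\<close>

lemma mollifier_mean_mono:
 fixes G :: "(real^'n) set"
 assumes G: "open G" and W: "weak_H1 G W DW"
 and sub: "!!et Det. C1c G et Det ==> (!!y. et y >= 0) ==> (LBINT y. DW y <.> Det y) <= 0"
 and R: "cball x R \<subseteq> G" "0 < s" "s <= r" "r < R"
 shows "(LBINT y. W y * mollifier s (y - x)) <= (LBINT y. W y * mollifier r (y - x))"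
proof (rule DERIV_nonneg_imp_nondecreasing[OF R(3)])
 fix rh assume rh: "s <= rh" "rh <= r"
 then have rh0: "rh > 0" "rh < R" using R by auto
 note [measurable] = weak_H1D(1,2)[OF W]
 \<comment> \<open>Keeps the radius away from 0, where the kernel degenerates, and at most
   \<open>R\<close>, so that its support stays in \<open>G\<close>.\<close>
 define e where "e = min (rh / 2) (R - rh)"
 have e: "e > 0" using rh0 by (simp add: e_def)
 have t: "rh / 2 <= t" "t <= R" "t > 0" if "\<bar>t - rh\<bar> < e" for t
 proof -
 have "\<bar>t - rh\<bar> < rh / 2" "\<bar>t - rh\<bar> < R - rh" using that by (auto simp: e_def)
 then show "rh / 2 <= t" "t <= R" "t > 0" using rh0 by linarith+
 qed
 have iW: "intl (%y. ind (cball x R) y * W y)" using weak_H1D(3)[OF W _ R(1)] by simp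
 have sh: "mollifier t (y - x) = 0" if "y \<notin> cball x R" "t > 0" "t <= R" for t y
 using that by (intro mollifier_eq_0) (auto simp: dist_norm norm_minus_commute)
 have Mc: "continuous_on UNIV (%y. mollifier t (y - x))" for t
 by (rule continuous_on_compose2[OF continuous_mollifier(1)]) (auto intro!: continuous_intros)
 have int: "intl (%y. W y * mollifier t (y - x))" if "\<bar>t - rh\<bar> < e" for t
 proof -
 have "intl (%y. mollifier t (y - x) *R W y)"
 by (rule integrable_scaleR_compact_support[OF Mc compact_cball[of x R] sh[OF _ t(3)[OF that] t(2)[OF that]] _ weak_H1D(1)[OF W]])
 (use iW in simp_all)
 then show ?thesis by (simp add: mult.commute)
 qed
 have rm[measurable]: "(%y. mollifier_rate t (y - x)) \<in> bmb" for t
 unfolding mollifier_rate_def by measurable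
 have "compact ({rh / 2..R} \<times> cball (0::real^'n) R)" by (intro compact_Times) auto
 moreover have "continuous_on ({rh / 2..R} \<times> cball (0::real^'n) R) (%(t, y). mollifier_rate t y)"
 unfolding mollifier_rate_def case_prod_unfold using rh0 bump_mass_pos[where ?'a="real^'n"] by (intro continuous_intros) auto
 ultimately have "bounded ((%(t, y). mollifier_rate t y) ` ({rh / 2..R} \<times> cball (0::real^'n) R))"
 by (intro compact_imp_bounded compact_continuous_image)
 then obtain B where B: "B > 0" "\<forall>z\<in>(%(t, y). mollifier_rate t y) ` ({rh / 2..R} \<times> cball (0::real^'n) R). norm z <= B"
 unfolding bounded_pos by (elim exE conjE)
 have D: "((%t. \<integral>y. W y * mollifier t (y - x) \<partial>lborel) has_real_derivative (LBINT y. W y * mollifier_rate rh (y - x))) (at rh)"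
 proof (rule DERIV_integral[OF e int])
 show "((%t. W y * mollifier t (y - x)) has_real_derivative W y * mollifier_rate t (y - x)) (at t)" if "\<bar>t - rh\<bar> < e" for t y
 using t[OF that] by (intro DERIV_cmult DERIV_mollifier)
 show "intl (%y. B * \<bar>ind (cball x R) y * W y\<bar>)" by (intro integrable_mult_right integrable_abs iW)
 show "\<bar>W y * mollifier_rate t (y - x)\<bar> <= B * \<bar>ind (cball x R) y * W y\<bar>" if te: "\<bar>t - rh\<bar> < e" for t y
 proof (cases "y \<in> cball x R")
 case True
 then have "(t, y - x) \<in> {rh / 2..R} \<times> cball 0 R" using t[OF te] by (auto simp: dist_norm norm_minus_commute)
 then have "mollifier_rate t (y - x) \<in> (%(t, y). mollifier_rate t y) ` ({rh / 2..R} \<times> cball (0::real^'n) R)"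
 by (rule rev_image_eqI) simp
 then have "\<bar>mollifier_rate t (y - x)\<bar> <= B" using B(2) by (metis real_norm_def)
 then have "\<bar>W y\<bar> * \<bar>mollifier_rate t (y - x)\<bar> <= \<bar>W y\<bar> * B" by (rule mult_left_mono) simp
 then show ?thesis using True by (simp add: abs_mult mult.commute)
 next
 case False
 then have "max 0 (t^2 - (norm (y - x))^2) = 0"
 using t[OF te] by (intro max0_sq_diff_eq_0) (auto simp: dist_norm norm_minus_commute)
 then have "mollifier_rate t (y - x) = 0" unfolding mollifier_rate_def by (simp only:) simp
 then show ?thesis using False by simp
 qed
 qed measurable
 have C: "C1c G (%y. mollifier rh (y - x)) (%y. mollifier_grad rh (y - x))"
 proof -
 have "cball x rh \<subseteq> G" using R(1) rh0 by (meson less_imp_le order_trans subset_cball)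
 have m: "- mollifier_grad rh (x - y) = mollifier_grad rh (y - x)" for y
 unfolding mollifier_grad_def norm_minus_commute[of x y] by (subst scaleR_minus_right[symmetric]) (simp only: minus_diff_eq)
 from C1c_mollifier_reflect[OF rh0(1) \<open>cball x rh \<subseteq> G\<close>] show ?thesis
 unfolding m mollifier_minus[of rh x] .
 qed
 note T = weak_H1_radial_test_at[OF G W C, of x]
 have "(LBINT y. W y * mollifier_rate rh (y - x)) = (LBINT y. (- 1 / rh) * (W y * (real CARD('n) * mollifier rh (y - x) + mollifier_grad rh (y - x) <.> (y - x))))"
 proof (intro B_integral_cong refl)
 fix y
 have "mollifier_rate rh (y - x) = (- 1 / rh) * (real CARD('n) * mollifier rh (y - x) + mollifier_grad rh (y - x) <.> (y - x))"
 using mollifier_rate_div[OF rh0(1), of "y - x"] rh0 by (simp add: field_simps)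
 then show "W y * mollifier_rate rh (y - x) = (- 1 / rh) * (W y * (real CARD('n) * mollifier rh (y - x) + mollifier_grad rh (y - x) <.> (y - x)))"
 by (simp only: mult.left_commute)
 qed
 also have "... = (- 1 / rh) * (LBINT y. W y * (real CARD('n) * mollifier rh (y - x) + mollifier_grad rh (y - x) <.> (y - x)))"
 by (rule integral_mult_right_zero)
 also have "... = (1 / rh) * (LBINT y. mollifier rh (y - x) * (DW y <.> (y - x)))" unfolding T(1) by simp
 finally have Deq: "(LBINT y. W y * mollifier_rate rh (y - x)) = (1 / rh) * (LBINT y. mollifier rh (y - x) * (DW y <.> (y - x)))" .
 \<comment> \<open>Chosen so that the fourth power below has gradient
   \<open>- mollifier rh (y - x) *R (y - x)\<close>: differentiation brings down
   \<open>4 * 2 = 8\<close>.\<close>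
 define c where "c = 1 / (8 * (bump_mass TYPE(real^'n) * rh ^ (DIM(real^'n) + 6)))"
 have c0: "c >= 0" using bump_mass_pos[where ?'a="real^'n"] rh0 by (simp add: c_def)
 let ?Q = "%y. c * max 0 (rh^2 - (norm (y - x))^2) ^ Suc (Suc 2)"
 let ?DQ = "%y. c *R ((- 2 * of_nat (Suc (Suc 2)) * max 0 (rh^2 - (norm (y - x))^2) ^ Suc 2) *R (y - x))"
 have "C1c G ?Q ?DQ"
 proof (rule C1cI[OF G C1_on_subset[OF C1_on_cmult[OF C1_on_radial_bump]] compact_cball R(1)])
 fix y assume "y \<notin> cball x R"
 then have "max 0 (rh^2 - (norm (y - x))^2) = 0"
 using rh0 by (intro max0_sq_diff_eq_0) (auto simp: dist_norm norm_minus_commute)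
 then show "?Q y = 0" "?DQ y = 0" by (simp_all only:) simp_all
 qed simp
 moreover have "?Q y >= 0" for y using c0 by simp
 ultimately have "(LBINT y. DW y <.> ?DQ y) <= 0" by (rule sub)
 moreover have "DW y <.> ?DQ y = - (mollifier rh (y - x) * (DW y <.> (y - x)))" for y
 unfolding mollifier_def c_def by (simp add: numeral_3_eq_3 numeral_2_eq_2)
 ultimately have "(LBINT y. - (mollifier rh (y - x) * (DW y <.> (y - x)))) <= 0" by (simp only:)
 then have "0 <= (LBINT y. mollifier rh (y - x) * (DW y <.> (y - x)))" by simp
 then have "0 <= (LBINT y. W y * mollifier_rate rh (y - x))" unfolding Deq using rh0 by simp
 with D show "\<exists>y. ((%t. \<integral>y. W y * mollifier t (y - x) \<partial>lborel) has_real_derivative y) (at rh) & 0 <= y" by blast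
qed

text \<open>Means over small balls are dominated by those over radius 1/2, which the L1 norm over a
  compact set bounds uniformly; almost everywhere the small means converge to
  \<open>W\<close>.\<close>

lemma subharmonic_bounded_annulus:
 fixes W :: "real^'n => real"
 assumes W: "weak_H1 (- {0}) W DW"
 and sub: "!!et Det. C1c (- {0}) et Det ==> (!!y. et y >= 0) ==> (LBINT y. DW y <.> Det y) <= 0"
 obtains C where "AE x in lborel. x \<in> annulus12 --> W x <= (C :: real)"
proof -
 note [measurable] = weak_H1D(1,2)[OF W]
 \<comment> \<open>Contains every ball of radius 1/2 about a point of the annulus and stays away
   from the singular point 0.\<close>
 define L where "L = cball 0 3 - ball (0::real^'n) (1/4)"
 have L: "compact L" "L \<subseteq> - {0}" unfolding L_def by (auto intro: compact_diff)
 define f where "f = (%y. ind L y * W y)"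
 have fi: "intl f" using weak_H1D(3)[OF W L] by (simp add: f_def)
 define X where "X n = 1 / real (n + 2)" for n
 have X: "X n > 0" "X n <= 1/2" for n by (auto simp: X_def field_simps)
 have "(%n. 1 / real (n + 2)) >-> 0" using LIMSEQ_ignore_initial_segment[OF lim_const_over_n[of 1], of 2] by simp
 then have X0: "X >-> 0" by (simp add: X_def[abs_def])
 obtain s where s: "strict_mono s" "AE x in lborel. (%n. mollify (X (s n)) f x) >-> f x"
 by (rule mollify_AE_subseq[OF fi X(1) X0])
 obtain B where B: "B > 0" "!!y::real^'n. mollifier (1/2) y <= B" "!!y::real^'n. norm (mollifier_grad (1/2) y) <= B"
 using mollifier_bounded[where ?'a="real^'n", OF half_gt_zero[OF zero_less_one]] by metis
 have eq: "mollify rh f x = (LBINT y. W y * mollifier rh (y - x))" if x: "x \<in> annulus12" and rh: "0 < rh" "rh <= 1/2" for x rh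
 unfolding mollify_def
 proof (intro B_integral_cong refl)
 fix y
 show "mollifier rh (x - y) *R f y = W y * mollifier rh (y - x)"
 proof (cases "norm (y - x) < rh")
 case True
 then have "norm y <= 3" "norm y >= 1/4" using x rh norm_triangle_ineq[of "y - x" x] norm_triangle_ineq2[of x "x - y"]
 by (auto simp: annulus12_def norm_minus_commute)
 then show ?thesis by (simp add: f_def L_def mollifier_minus[of rh x y])
 next
 case False
 then have "mollifier rh (y - x) = 0" using rh by (intro mollifier_eq_0) auto
 then show ?thesis by (simp add: mollifier_minus[of rh x y])
 qed
 qed
 define C where "C = B * (LBINT y. \<bar>f y\<bar>)"
 have le: "mollify rh f x <= C" if x: "x \<in> annulus12" and rh: "0 < rh" "rh <= 1/2" for x rh
 proof -
 have cb: "cball x (3/4) \<subseteq> - {0}" using x by (auto simp: annulus12_def dist_norm)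
 have "open (- {0::real^'n})" by auto
 then have "mollify rh f x <= mollify (1/2) f x"
 unfolding eq[OF x rh] eq[OF x, of "1/2", simplified] using mollifier_mean_mono[OF _ W sub cb rh] by simp
 also have "... <= \<bar>mollify (1/2) f x\<bar>" by simp
 also have "... <= (LBINT y. B * \<bar>f y\<bar>)"
 unfolding mollify_def real_norm_def[symmetric]
 proof (rule norm_integral_le)
 show "intl (%y. mollifier (1/2) (x - y) *R f y)" by (rule integrable_mollifier_mult[OF _ fi]) simp
 show "intl (%y. B * norm (f y))" by (intro integrable_mult_right integrable_norm fi)
 show "AE y in lborel. norm (mollifier (1/2) (x - y) *R f y) <= B * norm (f y)"
 proof (rule AE_I2)
 fix y show "norm (mollifier (1/2) (x - y) *R f y) <= B * norm (f y)"
 using B(2)[of "x - y"] mollifier_nonneg[of "1/2" "x - y"] by (auto simp: abs_mult intro!: mult_right_mono)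
 qed
 qed
 also have "... = C" unfolding C_def by (rule integral_mult_right_zero)
 finally show ?thesis .
 qed
 have "AE x in lborel. x \<in> annulus12 --> W x <= C"
 using s(2)
 proof eventually_elim
 case (elim x)
 show ?case
 proof
 assume x: "x \<in> annulus12"
 then have "f x <= C" using le[OF x X] by (intro LIMSEQ_le_const2[OF elim]) auto
 moreover have "x \<in> L" using x by (auto simp: annulus12_def L_def)
 ultimately show "W x <= C" by (simp add: f_def)
 qed
 qed
 then show thesis by (rule that)
qed

section \<open>The Dirichlet problem on the sphere\<close>

lemma hom0_C1_lin:
 assumes a: "hom0_C1 a Da" and b: "hom0_C1 b Db"
 shows "hom0_C1 (%x. s * a x + t * b x) (%x. s *R Da x + t *R Db x)"
 unfolding hom0_C1_def
proof (intro conjI allI impI)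
 show "C1_on (- {0}) (%x. s * a x + t * b x) (%x. s *R Da x + t *R Db x)"
 using a b unfolding hom0_C1_def by (intro C1_on_add C1_on_cmult) simp_all
 show "s * a (r *R x) + t * b (r *R x) = s * a x + t * b x" if "x ~= 0 & r > 0" for x r
 using a b that unfolding hom0_C1_def by simp
qed

lemma hom0_testI:
 assumes "hom0_C1 a Da" "compact K" "K \<subseteq> \<Omega>" "!!om. om \<in> sphere 0 1 ==> om \<notin> K ==> a om = 0"
 shows "hom0_test \<Omega> a Da"
 using assms unfolding hom0_C1_def hom0_test_def by blast

lemma hom0_test_support:
 assumes "hom0_test \<Omega> a Da"
 obtains K where "compact K" "K \<subseteq> \<Omega>" "!!om. om \<in> sphere 0 1 ==> om \<notin> K ==> a om = 0"
 using assms unfolding hom0_test_def by blast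

lemma hom0_test_lin:
 assumes a: "hom0_test \<Omega> a Da" and b: "hom0_test \<Omega> b Db"
 shows "hom0_test \<Omega> (%x. s * a x + t * b x) (%x. s *R Da x + t *R Db x)"
proof -
 obtain K where K: "compact K" "K \<subseteq> \<Omega>" "!!om. om \<in> sphere 0 1 ==> om \<notin> K ==> a om = 0" using hom0_test_support[OF a] by metis
 obtain L where L: "compact L" "L \<subseteq> \<Omega>" "!!om. om \<in> sphere 0 1 ==> om \<notin> L ==> b om = 0" using hom0_test_support[OF b] by metis
 show ?thesis
 proof (rule hom0_testI[OF hom0_C1_lin[OF hom0_test_C1[OF a] hom0_test_C1[OF b]], of "K \<union> L"])
 show "compact (K \<union> L)" using K(1) L(1) by (rule compact_Un)
 qed (use K L in auto)
qed

lemma hom0_C1_products_integrable: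
 assumes a: "hom0_C1 a Da" and b: "hom0_C1 b Db"
 shows "integrable annul (%x. a x * b x)" "integrable annul (%x. (norm x)^2 * (Da x <.> Db x))"
proof -
 note [measurable] = hom0_C1_measurable[OF a] hom0_C1_measurable[OF b]
 obtain A where A: "A > 0" "!!x. x ~= 0 ==> \<bar>a x\<bar> <= A" "!!x. x ~= 0 ==> norm x * norm (Da x) <= A" using hom0_C1_bounded[OF a] by metis
 obtain B where B: "B > 0" "!!x. x ~= 0 ==> \<bar>b x\<bar> <= B" "!!x. x ~= 0 ==> norm x * norm (Db x) <= B" using hom0_C1_bounded[OF b] by metis
 show "integrable annul (%x. a x * b x)"
 proof (rule integrable_annular_bounded[where B="A * B"])
 show "norm (a x * b x) <= A * B" if "x ~= 0" for x
 unfolding real_norm_def abs_mult using A(1) by (intro mult_mono A(2) B(2) that) auto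
 qed measurable
 show "integrable annul (%x. (norm x)^2 * (Da x <.> Db x))"
 proof (rule integrable_annular_bounded[where B="A * B"])
 fix x :: "real^'a" assume x: "x ~= 0"
 have "\<bar>(norm x)^2 * (Da x <.> Db x)\<bar> <= (norm x)^2 * (norm (Da x) * norm (Db x))"
 unfolding abs_mult by (simp add: mult_left_mono Cauchy_Schwarz_ineq2)
 also have "... = (norm x * norm (Da x)) * (norm x * norm (Db x))" by (simp add: power2_eq_square mult_ac)
 also have "... <= A * B" using A(1) by (intro mult_mono A(3) B(3) x) auto
 finally show "norm ((norm x)^2 * (Da x <.> Db x)) <= A * B" by simp
 qed measurable
qed

lemma norm_sq_lin: "(norm (s *R u + t *R v))^2 = s^2 * (norm u)^2 + 2 * s * t * (u <.> v) + t^2 * (norm (v :: 'a::real_inner))^2"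
 unfolding power2_norm_eq_inner by (simp add: inner_add_left inner_add_right inner_commute[of v u] power2_eq_square algebra_simps)

lemma hom0_lin_integrals:
 fixes a b :: "real^'n => real"
 assumes a: "hom0_C1 a Da" and b: "hom0_C1 b Db"
 shows "(LINT x|annul. s * a x + t * b x) = s * (LINT x|annul. a x) + t * (LINT x|annul. b x)"
 and "(LINT x|annul. (s * a x + t * b x)^2) = s^2 * (LINT x|annul. (a x)^2) + 2 * s * t * (LINT x|annul. a x * b x) + t^2 * (LINT x|annul. (b x)^2)"
 and "(LINT x|annul. (norm x)^2 * (norm (s *R Da x + t *R Db x))^2)
 = s^2 * (LINT x|annul. (norm x)^2 * (norm (Da x))^2) + 2 * s * t * (LINT x|annul. (norm x)^2 * (Da x <.> Db x)) + t^2 * (LINT x|annul. (norm x)^2 * (norm (Db x))^2)"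
proof -
 have lin: "(LINT x|annul. p * f x + q * g x + r * h x) = p * (LINT x|annul. f x) + q * (LINT x|annul. g x) + r * (LINT x|annul. h x)"
 if "integrable annul f" "integrable annul g" "integrable annul h" for f g h :: "real^'n => real" and p q r
 using that by simp
 show "(LINT x|annul. s * a x + t * b x) = s * (LINT x|annul. a x) + t * (LINT x|annul. b x)"
 using hom0_C1_integrable(1)[OF a] hom0_C1_integrable(1)[OF b] by simp
 have "(s * a x + t * b x)^2 = s^2 * (a x)^2 + 2 * s * t * (a x * b x) + t^2 * (b x)^2" for x
 by (simp add: power2_eq_square algebra_simps)
 then show "(LINT x|annul. (s * a x + t * b x)^2) = s^2 * (LINT x|annul. (a x)^2) + 2 * s * t * (LINT x|annul. a x * b x) + t^2 * (LINT x|annul. (b x)^2)"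
 by (simp only: lin[OF hom0_C1_integrable(2)[OF a] hom0_C1_products_integrable(1)[OF a b] hom0_C1_integrable(2)[OF b]])
 have "(norm x)^2 * (norm (s *R Da x + t *R Db x))^2 = s^2 * ((norm x)^2 * (norm (Da x))^2) + 2 * s * t * ((norm x)^2 * (Da x <.> Db x)) + t^2 * ((norm x)^2 * (norm (Db x))^2)" for x
 unfolding norm_sq_lin by (simp add: algebra_simps)
 then show "(LINT x|annul. (norm x)^2 * (norm (s *R Da x + t *R Db x))^2)
 = s^2 * (LINT x|annul. (norm x)^2 * (norm (Da x))^2) + 2 * s * t * (LINT x|annul. (norm x)^2 * (Da x <.> Db x)) + t^2 * (LINT x|annul. (norm x)^2 * (norm (Db x))^2)"
 by (simp only: lin[OF hom0_C1_integrable(3)[OF a] hom0_C1_products_integrable(2)[OF a b] hom0_C1_integrable(3)[OF b]])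
qed

text \<open>The Euler-Lagrange equation of this functional is
  \<open>- \<Delta> a = \<mu> (1 + a)\<close> on the sphere, and its second variation is the
  quadratic form that \<open>lambda1_poincare\<close> makes positive for
  \<open>\<mu> < lambda1 \<Omega>\<close>.\<close>

definition hom0_energy :: "real => (real^'n => real) => (real^'n => real^'n) => real" where
 "hom0_energy \<mu> a Da = (LINT x|annul. (norm x)^2 * (norm (Da x))^2) / 2
 - \<mu> * ((LINT x|annul. a x) + (LINT x|annul. (a x)^2) / 2)"

definition hom0_variation :: "real => (real^'n => real) => (real^'n => real^'n) => (real^'n => real) => (real^'n => real^'n) => real" where
 "hom0_variation \<mu> a Da b Db = (LINT x|annul. (norm x)^2 * (Da x <.> Db x))
 - \<mu> * ((LINT x|annul. b x) + (LINT x|annul. a x * b x))"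

lemma hom0_energy_add:
 assumes a: "hom0_C1 a Da" and b: "hom0_C1 b Db"
 shows "hom0_energy \<mu> (%x. 1 * a x + t * b x) (%x. 1 *R Da x + t *R Db x)
 = hom0_energy \<mu> a Da + t * hom0_variation \<mu> a Da b Db
 + t^2 / 2 * ((LINT x|annul. (norm x)^2 * (norm (Db x))^2) - \<mu> * (LINT x|annul. (b x)^2))"
 unfolding hom0_energy_def hom0_variation_def hom0_lin_integrals[OF a b] by (simp add: field_simps)

text \<open>Parallelogram identity for the quadratic part; the linear part cancels. Two functions of
  almost minimal energy are therefore close, since their midpoint cannot fall below the
  infimum.\<close>

lemma hom0_energy_midpoint:
 assumes a: "hom0_C1 a Da" and b: "hom0_C1 b Db"
 shows "(LINT x|annul. (norm x)^2 * (norm (1 *R Da x + (-1) *R Db x))^2) - \<mu> * (LINT x|annul. (1 * a x + (-1) * b x)^2)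
 = 4 * (hom0_energy \<mu> a Da + hom0_energy \<mu> b Db) - 8 * hom0_energy \<mu> (%x. (1/2) * a x + (1/2) * b x) (%x. (1/2) *R Da x + (1/2) *R Db x)"
proof -
 have ring: "1^2 * A + 2 * 1 * (- 1) * AB + (- 1)^2 * B - \<mu> * (1^2 * C + 2 * 1 * (- 1) * CD + (- 1)^2 * D)
 = 4 * (A / 2 - \<mu> * (p + C / 2) + (B / 2 - \<mu> * (q + D / 2)))
 - 8 * (((1/2)^2 * A + 2 * (1/2) * (1/2) * AB + (1/2)^2 * B) / 2 - \<mu> * (1/2 * p + 1/2 * q + ((1/2)^2 * C + 2 * (1/2) * (1/2) * CD + (1/2)^2 * D) / 2))"
 for A B C D AB CD p q :: real
 proof -
 have h: "(1/2::real)^2 = 1/4" "(1::real)^2 = 1" "(- 1::real)^2 = 1" by (simp_all add: power2_eq_square)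
 have e1: "1 * C + 2 * 1 * (- 1) * CD + 1 * D = C - 2 * CD + D"
 "1/2 * p + 1/2 * q + (1/4 * C + 2 * (1/2) * (1/2) * CD + 1/4 * D) / 2 = p / 2 + q / 2 + C / 8 + CD / 4 + D / 8" by (simp_all add: field_simps)
 have e2: "\<mu> * (C - 2 * CD + D) = \<mu> * C - 2 * (\<mu> * CD) + \<mu> * D" "\<mu> * (p + C / 2) = \<mu> * p + \<mu> * C / 2" "\<mu> * (q + D / 2) = \<mu> * q + \<mu> * D / 2"
 "\<mu> * (p / 2 + q / 2 + C / 8 + CD / 4 + D / 8) = \<mu> * p / 2 + \<mu> * q / 2 + \<mu> * C / 8 + \<mu> * CD / 4 + \<mu> * D / 8"
 by (simp_all only: distrib_left right_diff_distrib times_divide_eq_right mult.left_commute[of \<mu> 2])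
 define m1 m2 m3 m4 m5 where "m1 = \<mu> * C" and "m2 = \<mu> * CD" and "m3 = \<mu> * D" and "m4 = \<mu> * p" and "m5 = \<mu> * q"
 have "1 * A + 2 * 1 * (- 1) * AB + 1 * B - (m1 - 2 * m2 + m3) = 4 * (A / 2 - (m4 + m1 / 2) + (B / 2 - (m5 + m3 / 2)))
 - 8 * ((1/4 * A + 2 * (1/2) * (1/2) * AB + 1/4 * B) / 2 - (m4 / 2 + m5 / 2 + m1 / 8 + m2 / 4 + m3 / 8))"
 by (simp add: add_divide_distrib)
 then show ?thesis unfolding h e1 e2 m1_def m2_def m3_def m4_def m5_def .
 qed
 show ?thesis unfolding hom0_energy_def hom0_lin_integrals[OF a b] by (rule ring)
qed

text \<open>A C1 substitute for the positive part. The last inequality says that truncating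
  \<open>a - y\<close> loses no more of \<open>s + s^2 / 2\<close> than the linear term
  \<open>y * (1 + a)\<close>, up to the smoothing error \<open>e * (1 + a)\<close>.\<close>

lemma smooth_positive_part:
 fixes e :: real
 assumes e: "e > 0"
 defines "P \<equiv> %s. sqrt (max 0 s ^ 2 + e^2) - e" and "P' \<equiv> %s. max 0 s / sqrt (max 0 s ^ 2 + e^2)"
 shows "(P has_real_derivative P' s) (at s)" "continuous_on A P'" "\<bar>P' s\<bar> <= 1" "P s >= 0" "s <= 0 ==> P s = 0"
 "0 <= a ==> 0 <= y ==> a + a^2 / 2 - y * (1 + a) - e * (1 + a) <= P (a - y) + (P (a - y))^2 / 2"
proof -
 have pos: "max 0 s ^ 2 + e^2 > 0" for s using e by (simp add: add_nonneg_pos)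
 have "((%s. max 0 s ^ 2 + e^2) has_real_derivative 2 * max 0 s) (at s)" for s
 using DERIV_add[OF DERIV_max0_power[of 0 s] DERIV_const[of "e^2"]] by (simp add: numeral_2_eq_2)
 from DERIV_chain2[OF DERIV_real_sqrt[OF pos] this]
 have "((%s. sqrt (max 0 s ^ 2 + e^2)) has_real_derivative inverse (sqrt (max 0 s ^ 2 + e^2)) / 2 * (2 * max 0 s)) (at s)" for s .
 from DERIV_diff[OF this DERIV_const[of e]]
 have d: "((%s. sqrt (max 0 s ^ 2 + e^2) - e) has_real_derivative inverse (sqrt (max 0 s ^ 2 + e^2)) / 2 * (2 * max 0 s) - 0) (at s)" for s .
 show "(P has_real_derivative P' s) (at s)"
 proof -
 have g: "inverse S / 2 * (2 * m) - 0 = m / S" for S m :: real by (cases "S = 0") (simp_all add: field_simps)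
 show ?thesis using d[of s] unfolding P_def P'_def g .
 qed
 have sq: "max 0 s <= sqrt (max 0 s ^ 2 + e^2)" for s by (rule real_le_rsqrt) simp
 have sp: "sqrt (max 0 s ^ 2 + e^2) > 0" for s by (rule real_sqrt_gt_zero[OF pos])
 have sn: "sqrt (max 0 s ^ 2 + e^2) ~= 0" for s using sp[of s] by linarith
 show "continuous_on A P'" unfolding P'_def by (intro continuous_intros ballI sn)
 have "0 <= P' s" unfolding P'_def by (rule divide_nonneg_pos[OF _ sp]) simp
 moreover have "P' s <= 1" unfolding P'_def using sq[of s] sp[of s] by (simp only: divide_le_eq_1_pos)
 ultimately show "\<bar>P' s\<bar> <= 1" by linarith
 have Pe: "e <= sqrt (max 0 s ^ 2 + e^2)" for s by (rule real_le_rsqrt) simp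
 then show "P s >= 0" by (simp add: P_def)
 show "P s = 0" if "s <= 0" using that e by (simp add: P_def)
 assume ay: "0 <= a" "0 <= y"
 define m where "m = max 0 (a - y)"
 define c where "c = P (a - y)"
 have m: "0 <= m" "m <= a" "a - y <= m" using ay by (auto simp: m_def)
 have ce: "c + e = sqrt (m^2 + e^2)" by (simp add: c_def P_def m_def)
 have "(c + e)^2 = m^2 + e^2" unfolding ce by (rule real_sqrt_pow2) simp
 then have c2: "c^2 = m^2 - 2 * e * c" by (simp add: power2_sum algebra_simps)
 have "m <= c + e" unfolding ce by (rule real_le_rsqrt) simp
 moreover have "c <= m"
 proof -
 have "m^2 + e^2 <= (m + e)^2" using m e by (simp add: power2_sum)
 then have "sqrt (m^2 + e^2) <= m + e" using m e by (intro real_le_lsqrt) auto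
 then show ?thesis using ce by simp
 qed
 then have "e * c <= e * m" using e by simp
 ultimately have 1: "m + m^2 / 2 - e - e * m <= c + c^2 / 2" unfolding c2 by (simp add: field_simps)
 have "e * m <= e * a" using m e by simp
 moreover have "(1 + a) * (a - y - m) <= 0" using m ay by (intro mult_nonneg_nonpos) auto
 moreover have "0 <= (m - a)^2" by simp
 ultimately have "a + a^2 / 2 - y * (1 + a) - e * (1 + a) <= m + m^2 / 2 - e - e * m"
 by (simp add: power2_eq_square algebra_simps)
 then show "a + a^2 / 2 - y * (1 + a) - e * (1 + a) <= P (a - y) + (P (a - y))^2 / 2" using 1 by (simp add: c_def)
qed

text \<open>\<open>et\<close> need not vanish outside \<open>\<Omega>\<close>: the smooth positive part of \<open>a - t et\<close> still does.\<close>

lemma hom0_energy_competitor: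
 fixes a et :: "real^'n => real"
 assumes a: "hom0_test \<Omega> a Da" "!!x. x ~= 0 ==> a x >= 0" and et: "hom0_C1 et Det" "!!x. x ~= 0 ==> et x >= 0"
 and t: "t > 0" and de: "de > 0" and \<mu>: "\<mu> > 0"
 shows "\<exists>b Db. hom0_test \<Omega> b Db & (\<forall>x. x ~= 0 --> b x >= 0) &
 hom0_energy \<mu> b Db <= hom0_energy \<mu> a Da - t * hom0_variation \<mu> a Da et Det
 + t^2 / 2 * (LINT x|annul. (norm x)^2 * (norm (Det x))^2) + de"
proof -
 note aC = hom0_test_C1[OF a(1)]
 note ia = hom0_C1_integrable[OF aC] and iet = hom0_C1_integrable[OF et(1)] and iaet = hom0_C1_products_integrable[OF aC et(1)]
 have i1: "integrable annul (%x::real^'n. 1 :: real)" by simp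
 define I where "I = (LINT x|annul. 1 + a x)"
 have I0: "I >= 0" unfolding I_def
 proof (rule integral_nonneg_AE)
 show "AE x in annul. 0 <= 1 + a x" using AE_annular_nz by eventually_elim (use a(2) in \<open>simp add: add_nonneg_nonneg\<close>)
 qed
 \<comment> \<open>The smoothing costs \<open>\<mu> * (e * I)\<close>, which this choice keeps at
   most \<open>de\<close>.\<close>
 define e where "e = de / (1 + \<mu> * I)"
 have e: "e > 0" unfolding e_def using de \<mu> I0 by (intro divide_pos_pos add_pos_nonneg mult_nonneg_nonneg) auto
 define P where "P = (%s. sqrt (max 0 s ^ 2 + e^2) - e)"
 define P' where "P' = (%s. max 0 s / sqrt (max 0 s ^ 2 + e^2))"
 have PP: "(P has_real_derivative P' s) (at s)" "continuous_on A P'" "\<bar>P' s\<bar> <= 1" "P s >= 0" "s <= 0 ==> P s = 0"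
 "0 <= c ==> 0 <= y ==> c + c^2 / 2 - y * (1 + c) - e * (1 + c) <= P (c - y) + (P (c - y))^2 / 2" for s A c y
 unfolding P_def P'_def by (rule smooth_positive_part[OF e]; assumption?)+
 define s where "s = (%x. 1 * a x + (- t) * et x)"
 define Ds where "Ds = (%x. 1 *R Da x + (- t) *R Det x)"
 have sC: "hom0_C1 s Ds" unfolding s_def Ds_def by (rule hom0_C1_lin[OF aC et(1)])
 define b where "b = (%x. P (s x))"
 define Db where "Db = (%x. P' (s x) *R Ds x)"
 have bC: "hom0_C1 b Db" unfolding hom0_C1_def
 proof (intro conjI allI impI)
 show "b (r *R x) = b x" if "x ~= 0 & r > 0" for x r using sC that by (simp add: hom0_C1_def b_def)
 show "C1_on (- {0}) b Db" unfolding b_def Db_def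
 using sC by (intro C1_on_compose PP(1,2)) (simp add: hom0_C1_def)
 qed
 obtain K where K: "compact K" "K \<subseteq> \<Omega>" "!!om. om \<in> sphere 0 1 ==> om \<notin> K ==> a om = 0" using hom0_test_support[OF a(1)] by metis
 have bT: "hom0_test \<Omega> b Db"
 proof (rule hom0_testI[OF bC K(1,2)])
 fix om :: "real^'n" assume w: "om \<in> sphere 0 1" "om \<notin> K"
 then have "om ~= 0" by auto
 then have "s om <= 0" using K(3)[OF w] et(2)[of om] t by (simp add: s_def)
 then show "b om = 0" by (simp add: b_def PP(5))
 qed
 \<comment> \<open>The smooth truncation has slope at most 1, so it does not raise the Dirichlet
   energy.\<close>
 have E: "(LINT x|annul. (norm x)^2 * (norm (Db x))^2) <= (LINT x|annul. (norm x)^2 * (norm (Ds x))^2)"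
 proof (rule integral_mono[OF hom0_C1_integrable(3)[OF bC] hom0_C1_integrable(3)[OF sC]])
 fix x
 have "norm (Db x) <= 1 * norm (Ds x)" unfolding Db_def norm_scaleR by (intro mult_right_mono PP(3)) simp
 then have "(norm (Db x))^2 <= (norm (Ds x))^2" by (intro power_mono) auto
 then show "(norm x)^2 * (norm (Db x))^2 <= (norm x)^2 * (norm (Ds x))^2" by (rule mult_left_mono) simp
 qed
 have Es: "(LINT x|annul. (norm x)^2 * (norm (Ds x))^2) = (LINT x|annul. (norm x)^2 * (norm (Da x))^2)
 - 2 * t * (LINT x|annul. (norm x)^2 * (Da x <.> Det x)) + t^2 * (LINT x|annul. (norm x)^2 * (norm (Det x))^2)"
 unfolding Ds_def hom0_lin_integrals(3)[OF aC et(1)] by simp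
 let ?l = "%x. a x + (1/2) * (a x)^2 - t * (et x + a x * et x) - e * (1 + a x)"
 have il1: "integrable annul ?l"
 by (intro B_integrable_add B_integrable_diff integrable_mult_right ia(1,2) iet(1) iaet(1) i1)
 have il2: "integrable annul (%x. b x + (1/2) * (b x)^2)"
 by (intro B_integrable_add integrable_mult_right hom0_C1_integrable(1,2)[OF bC])
 have "(LINT x|annul. ?l x) <= (LINT x|annul. b x + (1/2) * (b x)^2)"
 proof (rule integral_mono_AE[OF il1 il2])
 show "AE x in annul. ?l x <= b x + (1/2) * (b x)^2"
 using AE_annular_nz
 proof eventually_elim
 case (elim x)
 have "a x + (a x)^2 / 2 - t * et x * (1 + a x) - e * (1 + a x) <= P (a x - t * et x) + (P (a x - t * et x))^2 / 2"
 using a(2)[OF elim] et(2)[OF elim] t by (intro PP(6)) auto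
 moreover have "b x = P (a x - t * et x)" by (simp add: b_def s_def)
 ultimately show ?case by (simp add: algebra_simps)
 qed
 qed
 moreover have "(LINT x|annul. ?l x) = (LINT x|annul. a x) + (1/2) * (LINT x|annul. (a x)^2)
 - t * ((LINT x|annul. et x) + (LINT x|annul. a x * et x)) - e * I"
 unfolding I_def using ia(1,2) iet(1) iaet(1) i1 by simp
 moreover have "(LINT x|annul. b x + (1/2) * (b x)^2) = (LINT x|annul. b x) + (1/2) * (LINT x|annul. (b x)^2)"
 using hom0_C1_integrable(1,2)[OF bC] by simp
 ultimately have lb: "(LINT x|annul. a x) + (LINT x|annul. (a x)^2) / 2
 - t * ((LINT x|annul. et x) + (LINT x|annul. a x * et x)) - e * I
 <= (LINT x|annul. b x) + (LINT x|annul. (b x)^2) / 2" by simp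
 have eI: "\<mu> * (e * I) <= de"
 proof -
 have "\<mu> * (e * I) = de * (\<mu> * I / (1 + \<mu> * I))" by (simp add: e_def)
 also have "... <= de * 1" using de \<mu> I0 by (intro mult_left_mono) (auto simp: divide_le_eq_1 add_pos_nonneg)
 finally show ?thesis by simp
 qed
 have "hom0_energy \<mu> b Db <= hom0_energy \<mu> a Da - t * hom0_variation \<mu> a Da et Det
 + t^2 / 2 * (LINT x|annul. (norm x)^2 * (norm (Det x))^2) + de"
 using mult_left_mono[OF lb less_imp_le[OF \<mu>]] E eI unfolding Es hom0_energy_def hom0_variation_def by (simp add: algebra_simps)
 then show ?thesis using bT PP(4) by (intro exI[of _ b] exI[of _ Db]) (simp add: b_def)
qed

lemma annular_measurable:
 fixes f :: "real^'n => 'b::topological_space"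
 shows "f \<in> borel_measurable annul \<longleftrightarrow> f \<in> bmb"
 by (simp only: measurable_cong_sets[OF sets_annul refl])

text \<open>The constant depends on \<open>K\<close> only, so for 0-homogeneous functions
  convergence in L1 over the annulus implies local L1 convergence off the origin.\<close>

lemma annular_compact_bound:
 fixes K :: "(real^'n) set"
 assumes K: "compact K" "K \<subseteq> - {0}"
 shows "\<exists>C\<ge>0. \<forall>F :: real^'n => real. integrable annul F --> (\<forall>x t. x ~= 0 --> t > 0 --> F (t *R x) = F x) --> (\<forall>x. F x >= 0)
 --> intl (%x. ind K x * F x) & (LBINT x. ind K x * F x) <= C * (LINT x|annul. F x)"
proof -
 have Kb[measurable]: "K \<in> sets borel" using K(1) by (rule borel_compact)
 obtain a b where ab: "a > 0" "!!x. x \<in> K ==> a <= norm x & norm x <= b"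
 proof (cases "K = {}")
 case False
 have c: "continuous_on K norm" by (intro continuous_intros)
 obtain x where x: "x \<in> K" "!!y. y \<in> K ==> norm x <= norm y"
 using continuous_attains_inf[OF K(1) False c] by blast
 obtain z where z: "z \<in> K" "!!y. y \<in> K ==> norm y <= norm z"
 using continuous_attains_sup[OF K(1) False c] by blast
 show thesis by (rule that[of "norm x" "norm z"]) (use x z K(2) in auto)
 qed (rule that[of 1], auto)
 let ?R = "%s. ind {a..b} s :: real"
 have R: "intl (%s. ind {0<..} s * s ^ (CARD('n) - 1) * ?R s)"
 proof (rule B_integrable_bound)
 show "intl (%s. \<bar>b\<bar> ^ (CARD('n) - 1) * ?R s)"
 by (intro integrable_mult_right integrable_real_indicator) (simp_all add: emeasure_lborel_Icc_eq)
 show "AE s in lborel. norm (ind {0<..} s * s ^ (CARD('n) - 1) * ?R s) <= norm (\<bar>b\<bar> ^ (CARD('n) - 1) * ?R s)"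
 proof (rule AE_I2)
 fix s :: real
 show "norm (ind {0<..} s * s ^ (CARD('n) - 1) * ?R s) <= norm (\<bar>b\<bar> ^ (CARD('n) - 1) * ?R s)"
 using ab(1) by (auto simp: indicator_def intro!: power_mono)
 qed
 qed measurable
 define C where "C = (LBINT s. ind {0<..} s * s ^ (CARD('n) - 1) * ?R s) / ln 2"
 show ?thesis
 proof (intro exI[of _ C] conjI[of "0 <= C"] allI impI)
 show "C >= 0" unfolding C_def by (intro divide_nonneg_nonneg integral_nonneg_AE AE_I2) (auto simp: indicator_def)
 fix F :: "real^'n => real"
 assume F1: "integrable annul F" and F2: "\<forall>x t. x ~= 0 --> t > 0 --> F (t *R x) = F x" and F3: "\<forall>x. F x >= 0"
 have F: "integrable annul F" "!!x t. x ~= 0 ==> t > 0 ==> F (t *R x) = F x" "!!x. F x >= 0"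
 using F1 F2 F3 by blast+
 have [measurable]: "F \<in> bmb" using borel_measurable_integrable[OF F(1)] unfolding annular_measurable .
 have p: "intl (%x. F x * ?R (norm x))"
 "ln 2 * (LBINT x. F x * ?R (norm x)) = (LINT x|annul. F x) * (LBINT s. ind {0<..} s * s ^ (CARD('n) - 1) * ?R s)"
 by (rule polar_integral_hom0[OF F(1,2) R]; simp)+
 have le: "ind K x * F x <= F x * ?R (norm x)" "0 <= ind K x * F x" for x
 using ab(2)[of x] F(3)[of x] by (auto simp: indicator_def)
 have i: "intl (%x. ind K x * F x)"
 proof (rule B_integrable_bound[OF p(1)])
 show "AE x in lborel. norm (ind K x * F x) <= norm (F x * ?R (norm x))"
 proof (rule AE_I2)
 fix x show "norm (ind K x * F x) <= norm (F x * ?R (norm x))" using le[of x] by simp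
 qed
 qed measurable
 have "(LBINT x. ind K x * F x) <= (LBINT x. F x * ?R (norm x))" by (rule integral_mono[OF i p(1) le(1)])
 also have "... = C * (LINT x|annul. F x)" using p(2) unfolding C_def by (simp add: field_simps)
 finally show "intl (%x. ind K x * F x) & (LBINT x. ind K x * F x) <= C * (LINT x|annul. F x)" using i by blast
 qed
qed

lemma integral_inner_bounded_tendsto:
 fixes f :: "nat => 'a => 'b::euclidean_space"
 assumes f: "!!n. integrable M (f n)" "integrable M F" "(%n. \<integral>x. norm (F x - f n x) \<partial>M) >-> 0"
 and g[measurable]: "g \<in> borel_measurable M" and B: "AE x in M. norm (g x) <= B"
 shows "(%n. \<integral>x. f n x <.> g x \<partial>M) >-> (\<integral>x. F x <.> g x \<partial>M)" "integrable M (%x. F x <.> g x)"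
proof -
 note [measurable] = borel_measurable_integrable[OF f(1)] borel_measurable_integrable[OF f(2)]
 have B': "AE x in M. norm (h x <.> g x) <= norm (B * norm (h x))" for h :: "'a => 'b"
 using B
 proof eventually_elim
 case (elim x)
 have "\<bar>h x <.> g x\<bar> <= norm (h x) * norm (g x)" by (rule Cauchy_Schwarz_ineq2)
 also have "... <= norm (h x) * B" using elim by (rule mult_left_mono) simp
 finally have "\<bar>h x <.> g x\<bar> <= B * norm (h x)" by (simp add: mult.commute)
 then show ?case by simp
 qed
 have i: "integrable M (%x. h x <.> g x)" if "integrable M h" for h
 proof (rule B_integrable_bound[OF integrable_mult_right[OF integrable_norm[OF that]] _ B'])
 show "(%x. h x <.> g x) \<in> borel_measurable M" using borel_measurable_integrable[OF that] by measurable
 qed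
 show "integrable M (%x. F x <.> g x)" by (rule i[OF f(2)])
 show "(%n. \<integral>x. f n x <.> g x \<partial>M) >-> (\<integral>x. F x <.> g x \<partial>M)"
 proof (rule integral_tendsto_L1[OF i[OF f(1)] i[OF f(2)]])
 show "(%n. \<integral>x. norm (f n x <.> g x - F x <.> g x) \<partial>M) >-> 0"
 proof (rule integral_norm_tendsto_0[where h="%n x. \<bar>B\<bar> * norm (F x - f n x)"])
 show "AE x in M. norm (f n x <.> g x - F x <.> g x) <= \<bar>B\<bar> * norm (F x - f n x)" for n
 using B'[of "%x. f n x - F x"] by eventually_elim (simp add: inner_diff_left abs_mult norm_minus_commute)
 show "integrable M (%x. \<bar>B\<bar> * norm (F x - f n x))" for n
 using f(1,2) by (intro integrable_mult_right integrable_norm B_integrable_diff)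
 show "(%n. \<integral>x. \<bar>B\<bar> * norm (F x - f n x) \<partial>M) >-> 0"
 unfolding integral_mult_right_zero using tendsto_mult_left[OF f(3), of "\<bar>B\<bar>"] by simp
 qed measurable
 qed
qed

lemma norm_sq_le_double: "(norm a)^2 <= 2 * (norm b)^2 + 2 * (norm (a - b :: 'a::real_normed_vector))^2"
proof -
 have "norm a <= norm b + norm (a - b)" using norm_triangle_ineq[of b "a - b"] by simp
 then have "(norm a)^2 <= (norm b + norm (a - b))^2" by (intro power_mono) auto
 also have "... <= 2 * (norm b)^2 + 2 * (norm (a - b))^2"
 using zero_le_power2[of "norm b - norm (a - b)"] unfolding power2_sum power2_diff by linarith
 finally show ?thesis .
qed

text \<open>The rate \<open>(1/4) ^ n\<close> for squared distances becomes \<open>(1/2) ^ n\<close>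
  for L1 distances by Young's inequality with weight \<open>2 ^ n\<close>; that rate is summable, as
  \<open>L1_cauchy_limit\<close> requires.\<close>

lemma L2_cauchy_limit:
 fixes f :: "nat => real^'n => 'b::euclidean_space"
 assumes f: "!!n. integrable annul (f n)" "!!n. integrable annul (%x. (norm (f n x))^2)"
 and c: "!!n m. n <= m ==> (LINT x|annul. (norm (f m x - f n x))^2) <= c * (1/4) ^ n"
 defines "F \<equiv> %x. lim (%n. f n x)"
 shows "AE x in annul. (%n. f n x) >-> F x" "F \<in> bmb" "integrable annul F"
 "integrable annul (%x. (norm (F x))^2)" "(%n. \<integral>x. norm (F x - f n x) \<partial>annul) >-> 0"
proof -
 note m[measurable] = borel_measurable_integrable[OF f(1), unfolded annular_measurable]
 have id: "integrable annul (%x. f m x - f n x)" for m n by (intro B_integrable_diff f)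
 have id2: "integrable annul (%x. (norm (f m x - f n x))^2)" for m n
 proof (rule B_integrable_bound)
 show "integrable annul (%x. 2 * (norm (f n x))^2 + 2 * (norm (f m x))^2)"
 by (intro B_integrable_add integrable_mult_right f)
 show "AE x in annul. norm ((norm (f m x - f n x))^2) <= norm (2 * (norm (f n x))^2 + 2 * (norm (f m x))^2)"
 proof (rule AE_I2)
 fix x show "norm ((norm (f m x - f n x))^2) <= norm (2 * (norm (f n x))^2 + 2 * (norm (f m x))^2)"
 using norm_sq_le_double[of "f m x - f n x" "- f n x"] by simp
 qed
 qed (simp add: annular_measurable)
 define N1 where "N1 = (\<integral>x. (1::real) \<partial>(annul :: (real^'n) measure))"
 define e where "e n = (N1 + c) / 2 * (1/2) ^ n" for n :: nat
 have le: "(LINT x|annul. norm (f m x - f n x)) <= e n" if nm: "n <= m" for n m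
 proof -
 let ?a = "(1/2::real) ^ n" and ?b = "(2::real) ^ n"
 have ab: "?a * ?b = 1" "?b * (1/4) ^ n = ?a" by (simp_all flip: power_mult_distrib)
 have "(LINT x|annul. norm (f m x - f n x)) <= (LINT x|annul. (?a / 2) * 1 + (?b / 2) * (norm (f m x - f n x))^2)"
 proof (rule integral_mono)
 show "integrable annul (%x. (?a / 2) * 1 + (?b / 2) * (norm (f m x - f n x))^2)"
 by (intro B_integrable_add integrable_mult_right id2) simp
 fix x
 let ?s = "norm (f m x - f n x)"
 have "0 <= ?b * (?a - ?s)^2" by simp
 also have "... = (?a * ?b) * ?a - 2 * (?a * ?b) * ?s + ?b * ?s^2" by (simp add: power2_eq_square algebra_simps)
 finally show "?s <= (?a / 2) * 1 + (?b / 2) * ?s^2" unfolding ab by simp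
 qed (intro integrable_norm id)
 also have "... = (?a / 2) * N1 + (?b / 2) * (LINT x|annul. (norm (f m x - f n x))^2)"
 unfolding N1_def
 by (subst B_integral_add) (auto intro!: integrable_mult_right id2)
 also have "... <= (?a / 2) * N1 + (?b / 2) * (c * (1/4) ^ n)" by (intro add_left_mono mult_left_mono c nm) simp
 also have "... = e n"
 proof -
 have "(?b / 2) * (c * (1/4) ^ n) = c / 2 * (?b * (1/4) ^ n)" by simp
 then show ?thesis unfolding ab e_def by (simp add: algebra_simps)
 qed
 finally show ?thesis .
 qed
 have es: "summable e" unfolding e_def by (intro summable_mult summable_geometric) simp
 have L: "AE x in annul. (%n. f n x) >-> F x" "F \<in> borel_measurable annul" "integrable annul F"
 "(LINT x|annul. norm (F x - f n x)) <= e n" for n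
 unfolding F_def by (rule L1_cauchy_limit[OF f(1) le es]; assumption?)+
 show "AE x in annul. (%n. f n x) >-> F x" by (rule L(1))
 show "integrable annul F" by (rule L(3))
 show Fb: "F \<in> bmb" using L(2) unfolding annular_measurable .
 show "(%n. \<integral>x. norm (F x - f n x) \<partial>annul) >-> 0"
 proof (rule real_tendsto_sandwich[OF _ _ tendsto_const summable_LIMSEQ_zero[OF es]])
 show "\<forall>\<^sub>F n in sequentially. 0 <= (LINT x|annul. norm (F x - f n x))"
 by (intro always_eventually allI integral_nonneg_AE AE_I2) simp
 show "\<forall>\<^sub>F n in sequentially. (LINT x|annul. norm (F x - f n x)) <= e n"
 by (intro always_eventually allI L(4))
 qed
 show "integrable annul (%x. (norm (F x))^2)"
 proof (rule Fatou_norm_sq[OF L(1,2) _ f(2)])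
 fix n
 show "f n \<in> borel_measurable annul" by (simp add: annular_measurable)
 have "(LINT x|annul. (norm (f n x))^2) <= (LINT x|annul. 2 * (norm (f 0 x))^2 + 2 * (norm (f n x - f 0 x))^2)"
 by (intro integral_mono f B_integrable_add integrable_mult_right id2 norm_sq_le_double)
 also have "... = 2 * (LINT x|annul. (norm (f 0 x))^2) + 2 * (LINT x|annul. (norm (f n x - f 0 x))^2)"
 using f(2)[of 0] id2[of n 0] by simp
 also have "... <= 2 * (LINT x|annul. (norm (f 0 x))^2) + 2 * c" using c[of 0 n] by simp
 finally show "(LINT x|annul. (norm (f n x))^2) <= 2 * (LINT x|annul. (norm (f 0 x))^2) + 2 * c" .
 qed
qed

text \<open>For small \<open>t\<close> the linear term dominates, whatever the sign of
  \<open>Q\<close>.\<close>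

lemma linear_coeff_nonneg:
 fixes a Q :: real
 assumes "!!t. t > 0 ==> 0 <= t * a + t^2 / 2 * Q"
 shows "0 <= a"
proof (rule ccontr)
 assume "\<not> 0 <= a"
 then have a: "a < 0" by simp
 define t where "t = - a / (\<bar>Q\<bar> + 1)"
 have t: "t > 0" unfolding t_def using a by (intro divide_pos_pos) auto
 have "t * (\<bar>Q\<bar> + 1) = - a" by (simp add: t_def)
 have "t^2 / 2 * Q <= t^2 / 2 * (\<bar>Q\<bar> + 1)" by (intro mult_left_mono) auto
 also have "... = t / 2 * (t * (\<bar>Q\<bar> + 1))" by (simp add: power2_eq_square)
 also have "... = - (t * a) / 2" unfolding \<open>t * (\<bar>Q\<bar> + 1) = - a\<close> by simp
 finally have "t * a + t^2 / 2 * Q <= t * a / 2" by linarith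
 moreover have "t * a < 0" using t a by (rule mult_pos_neg)
 ultimately show False using assms[OF t] by linarith
qed

lemma compact_off_0_bound:
 fixes K :: "(real^'n) set"
 assumes "compact K" "K \<subseteq> - {0}"
 shows "\<exists>M>0. \<forall>x\<in>K. inverse (norm x) <= M"
proof -
 have "continuous_on K (%x. inverse (norm x))" using assms(2) by (intro continuous_intros) auto
 then have "bounded ((%x. inverse (norm x)) ` K)" using assms(1) by (intro compact_imp_bounded compact_continuous_image)
 then obtain M where "M > 0" "\<forall>y\<in>(%x. inverse (norm x)) ` K. norm y <= M" unfolding bounded_pos by (elim exE conjE)
 then show ?thesis by (intro exI[of _ M]) auto
qed

text \<open>Weak gradients are closed under these limits. Multiplication by \<open>norm x\<close>
  makes the gradients 0-homogeneous, so that \<open>annul\<close> controls them; the division that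
  undoes it is bounded on compact sets off the origin.\<close>

lemma hom0_limit_weak_H1:
 fixes f :: "nat => real^'n => real" and Df :: "nat => real^'n => real^'n"
 assumes f: "!!n. hom0_C1 (f n) (Df n)"
 and ph: "ph \<in> bmb" "integrable annul ph" "integrable annul (%x. (ph x)^2)"
 "!!x t. x ~= 0 ==> t > 0 ==> ph (t *R x) = ph x" "(%n. \<integral>x. norm (ph x - f n x) \<partial>annul) >-> 0"
 and V: "V \<in> bmb" "integrable annul V" "integrable annul (%x. (norm (V x))^2)"
 "!!x t. x ~= 0 ==> t > 0 ==> V (t *R x) = V x" "(%n. \<integral>x. norm (V x - norm x *R Df n x) \<partial>annul) >-> 0"
 and iV: "!!n. integrable annul (%x. norm x *R Df n x)"
 shows "weak_H1 (- {0}) ph (%x. V x /R norm x)"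
 unfolding weak_H1_def
proof (intro conjI allI impI)
 note [measurable] = ph(1) V(1)
 show "ph \<in> bmb" "(%x. V x /R norm x) \<in> bmb" by measurable
 fix K :: "(real^'n) set" assume K: "compact K & K \<subseteq> - {0}"
 then have Kb[measurable]: "K \<in> sets borel" by (auto intro: borel_compact)
 obtain C where C: "\<forall>F :: real^'n => real. integrable annul F --> (\<forall>x t. x ~= 0 --> t > 0 --> F (t *R x) = F x) --> (\<forall>x. F x >= 0)
 --> intl (%x. ind K x * F x) & (LBINT x. ind K x * F x) <= C * (LINT x|annul. F x)"
 using annular_compact_bound[of K] K by (elim exE conjE) blast+
 have "intl (%x. ind K x * (ph x)^2)" using C[THEN spec, of "%x. (ph x)^2"] ph(3,4) by simp
 then show "set_integrable lborel K (%x. (ph x)^2)" by (simp add: set_integrable_def)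
 have iV2: "intl (%x. ind K x * (norm (V x))^2)" using C[THEN spec, of "%x. (norm (V x))^2"] V(3,4) by simp
 obtain M where M: "M > 0" "\<forall>x\<in>K. inverse (norm x) <= M" using compact_off_0_bound[of K] K by (elim exE conjE) blast+
 show "set_integrable lborel K (%x. (norm (V x /R norm x))^2)" unfolding set_integrable_def
 proof (rule B_integrable_bound[OF integrable_mult_right[OF iV2, of "M^2"]])
 show "AE x in lborel. norm (ind K x *R (norm (V x /R norm x))^2) <= norm (M^2 * (ind K x * (norm (V x))^2))"
 proof (rule AE_I2)
 fix x
 show "norm (ind K x *R (norm (V x /R norm x))^2) <= norm (M^2 * (ind K x * (norm (V x))^2))"
 proof (cases "x \<in> K")
 case True
 have "(inverse (norm x))^2 <= M^2" using M True by (intro power_mono) auto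
 then have "(inverse (norm x))^2 * (norm (V x))^2 <= M^2 * (norm (V x))^2" by (rule mult_right_mono) simp
 then show ?thesis using True by (simp add: power_mult_distrib)
 qed simp
 qed
 qed measurable
next
 note [measurable] = ph(1) V(1)
 fix ze :: "real^'n => real" and Dze assume ze: "C1c (- {0}) ze Dze"
 note [measurable] = C1c_measurable[OF ze]
 obtain K where K: "compact K" "K \<subseteq> - {0}" "!!x. x \<notin> K ==> ze x = 0" "!!x. x \<notin> K ==> Dze x = 0" using C1c_support[OF ze] by metis
 have Kb[measurable]: "K \<in> sets borel" using K(1) by (rule borel_compact)
 obtain B1 where B1: "B1 > 0" "!!x. norm (ze x) <= B1 * ind K x" using bounded_compact_support[OF C1c_continuous(1)[OF ze] K(1,3)] by metis
 obtain B2 where B2: "B2 > 0" "!!x. norm (Dze x) <= B2 * ind K x" using bounded_compact_support[OF C1c_continuous(2)[OF ze] K(1,4)] by metis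
 obtain C where C: "\<forall>F :: real^'n => real. integrable annul F --> (\<forall>x t. x ~= 0 --> t > 0 --> F (t *R x) = F x) --> (\<forall>x. F x >= 0)
 --> intl (%x. ind K x * F x) & (LBINT x. ind K x * F x) <= C * (LINT x|annul. F x)"
 using annular_compact_bound[OF K(1,2)] by (elim exE conjE) blast+
 obtain M where M: "M > 0" "\<forall>x\<in>K. inverse (norm x) <= M" using compact_off_0_bound[OF K(1,2)] by (elim exE conjE) blast+
 have bnd1: "norm (a *R Dze x) <= B2 * (ind K x * norm a)" for a x
 using mult_left_mono[OF B2(2)[of x], of "\<bar>a\<bar>"] by (simp add: mult_ac)
 have bnd2: "norm (ze x *R (w /R norm x)) <= (B1 * M) * (ind K x * norm w)" for w x
 proof (cases "x \<in> K")
 case True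
 have "\<bar>ze x\<bar> * inverse (norm x) <= B1 * M" using B1(1) B1(2)[of x] M True by (intro mult_mono) auto
 then have "\<bar>ze x\<bar> * inverse (norm x) * norm w <= B1 * M * norm w" by (rule mult_right_mono) simp
 then show ?thesis using True by (simp add: mult_ac abs_mult)
 qed (simp add: K(3))
 have homf: "f n (t *R x) = f n x" "norm (t *R x) *R Df n (t *R x) = norm x *R Df n x" if "x ~= 0" "t > 0" for n t x
 using f[of n] hom0_C1_grad(1)[OF f[of n] that(1,2)] that by (auto simp: hom0_C1_def)
 have d1: "intl (%x. ind K x * norm (ph x - f n x)) & (LBINT x. ind K x * norm (ph x - f n x)) <= C * (LINT x|annul. norm (ph x - f n x))" for n
 using C[THEN spec, of "%x. norm (ph x - f n x)"] ph(2,4) hom0_C1_integrable(1)[OF f[of n]] homf by simp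
 have d2: "intl (%x. ind K x * norm (V x - norm x *R Df n x)) & (LBINT x. ind K x * norm (V x - norm x *R Df n x)) <= C * (LINT x|annul. norm (V x - norm x *R Df n x))" for n
 using C[THEN spec, of "%x. norm (V x - norm x *R Df n x)"] V(2,4) iV[of n] homf[of _ _ n] by simp
 have i1: "intl (%x. ph x *R Dze x)"
 proof (rule B_integrable_bound)
 show "intl (%x. B2 * (ind K x * norm (ph x)))"
 using C[THEN spec, of "%x. norm (ph x)"] ph(2,4) by (intro integrable_mult_right) simp
 show "AE x in lborel. norm (ph x *R Dze x) <= norm (B2 * (ind K x * norm (ph x)))"
 by (rule AE_I2, rule order_trans[OF bnd1]) (simp only: real_norm_def abs_ge_self)
 qed measurable
 have i2: "intl (%x. ze x *R (V x /R norm x))"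
 proof (rule B_integrable_bound)
 show "intl (%x. (B1 * M) * (ind K x * norm (V x)))"
 using C[THEN spec, of "%x. norm (V x)"] V(2,4) by (intro integrable_mult_right) simp
 show "AE x in lborel. norm (ze x *R (V x /R norm x)) <= norm ((B1 * M) * (ind K x * norm (V x)))"
 by (rule AE_I2, rule order_trans[OF bnd2]) (simp only: real_norm_def abs_ge_self)
 qed measurable
 let ?w = "%n x. f n x *R Dze x + ze x *R Df n x"
 have P: "C1c (- {0}) (%x. f n x * ze x) (?w n)" for n
 using f[of n] by (intro C1c_mult[OF _ _ ze]) (auto simp: hom0_C1_def)
 have iw: "intl (?w n)" for n
 proof -
 obtain L where L: "compact L" "!!x. x \<notin> L ==> ?w n x = 0" using C1c_support[OF P[of n]] by metis
 show ?thesis by (rule integrable_compact_support[OF C1c_continuous(2)[OF P] L])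
 qed
 have "(%n. \<integral>x. ?w n x \<partial>lborel) >-> (LBINT x. ph x *R Dze x + ze x *R (V x /R norm x))"
 proof (rule integral_tendsto_L1[OF iw B_integrable_add[OF i1 i2]])
 let ?h = "%n x. B2 * (ind K x * norm (ph x - f n x)) + (B1 * M) * (ind K x * norm (V x - norm x *R Df n x))"
 have ih: "intl (?h n)" for n
 using d1[of n] d2[of n] by (intro B_integrable_add integrable_mult_right) auto
 show "(%n. \<integral>x. norm (?w n x - (ph x *R Dze x + ze x *R (V x /R norm x))) \<partial>lborel) >-> 0"
 proof (rule integral_norm_tendsto_0[OF _ ih])
 show "(%x. ?w n x - (ph x *R Dze x + ze x *R (V x /R norm x))) \<in> borel_measurable lborel" for n
 using borel_measurable_integrable[OF iw[of n]] borel_measurable_integrable[OF i1] borel_measurable_integrable[OF i2] by measurable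
 show "AE x in lborel. norm (?w n x - (ph x *R Dze x + ze x *R (V x /R norm x))) <= ?h n x" for n
 proof (rule AE_I2)
 fix x :: "real^'n"
 have "?w n x - (ph x *R Dze x + ze x *R (V x /R norm x)) = - ((ph x - f n x) *R Dze x + ze x *R ((V x - norm x *R Df n x) /R norm x))"
 proof (cases "x = 0")
 case True
 then have "ze x = 0" using K(2,3) by auto
 then show ?thesis by (simp add: scaleR_diff_left)
 next
 case False
 then have "(V x - norm x *R Df n x) /R norm x = V x /R norm x - Df n x" by (simp add: scaleR_diff_right)
 then show ?thesis by (simp only: scaleR_diff_left scaleR_diff_right) simp
 qed
 then have "norm (?w n x - (ph x *R Dze x + ze x *R (V x /R norm x))) <= norm ((ph x - f n x) *R Dze x) + norm (ze x *R ((V x - norm x *R Df n x) /R norm x))"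
 by (simp only: norm_minus_cancel norm_triangle_ineq)
 also have "... <= ?h n x" by (intro add_mono bnd1 bnd2)
 finally show "norm (?w n x - (ph x *R Dze x + ze x *R (V x /R norm x))) <= ?h n x" .
 qed
 let ?u = "%n. B2 * (C * (LINT x|annul. norm (ph x - f n x))) + (B1 * M) * (C * (LINT x|annul. norm (V x - norm x *R Df n x)))"
 have "?u >-> B2 * (C * 0) + (B1 * M) * (C * 0)" by (intro tendsto_add tendsto_mult_left ph(5) V(5))
 then have u0: "?u >-> 0" by simp
 show "(%n. \<integral>x. ?h n x \<partial>lborel) >-> 0"
 proof (rule real_tendsto_sandwich[OF _ _ tendsto_const u0])
 show "\<forall>\<^sub>F n in sequentially. 0 <= (LBINT x. ?h n x)"
 using B1(1) B2(1) M(1) by (intro always_eventually allI integral_nonneg_AE AE_I2 add_nonneg_nonneg mult_nonneg_nonneg) auto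
 show "\<forall>\<^sub>F n in sequentially. (LBINT x. ?h n x) <= ?u n"
 proof (intro always_eventually allI)
 fix n
 have "(LBINT x. ?h n x) = B2 * (LBINT x. ind K x * norm (ph x - f n x)) + (B1 * M) * (LBINT x. ind K x * norm (V x - norm x *R Df n x))"
 using conjunct1[OF d1[of n]] conjunct1[OF d2[of n]]
 by (subst B_integral_add) (simp_all only: integrable_mult_right integral_mult_right_zero)
 also have "... <= ?u n" using B1(1) B2(1) M(1) d1[of n] d2[of n] by (intro add_mono mult_left_mono) auto
 finally show "(LBINT x. ?h n x) <= ?u n" .
 qed
 qed
 qed
 qed
 moreover have "(LBINT x. ?w n x) = 0" for n by (rule C1c_integral_grad_eq_0[OF P])
 ultimately have "(%n. 0) >-> (LBINT x. ph x *R Dze x + ze x *R (V x /R norm x))" by (simp only:)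
 then have "(LBINT x. ph x *R Dze x + ze x *R (V x /R norm x)) = 0" by (rule LIMSEQ_unique[OF _ tendsto_const])
 then show "(LBINT x. ph x *R Dze x) = - (LBINT x. ze x *R (V x /R norm x))"
 unfolding B_integral_add[OF i1 i2] by (simp only: add_eq_0_iff minus_minus)
qed

text \<open>Direct method over nonnegative admissible functions. Adding a small multiple of an
  admissible \<open>et\<close> to the minimising sequence gives the supersolution inequality;
  subtracting and truncating gives the reverse one, even for \<open>et\<close> that do not vanish
  off \<open>\<Omega>\<close>.\<close>

lemma exists_dirichlet_solution:
 fixes \<Omega> :: "(real^'n) set"
 assumes \<mu>: "0 < \<mu>" "\<mu> < lambda1 \<Omega>"
 shows "\<exists>(ph :: real^'n => real) (V :: real^'n => real^'n).
 (\<forall>x t. x ~= 0 --> t > 0 --> ph (t *R x) = ph x & V (t *R x) = V x) &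
 V \<in> bmb & integrable annul ph & integrable annul V &
 (AE x in annul. 0 <= ph x & V x <.> x = 0) &
 weak_H1 (- {0}) ph (%x. V x /R norm x) &
 (\<forall>et Det. hom0_test \<Omega> et Det --> (\<forall>x. x ~= 0 --> 0 <= et x) -->
 \<mu> * ((LINT x|annul. et x) + (LINT x|annul. ph x * et x)) <= (LINT x|annul. V x <.> (norm x *R Det x))) &
 (\<forall>et Det. hom0_C1 et Det --> (\<forall>x. x ~= 0 --> 0 <= et x) -->
 (LINT x|annul. V x <.> (norm x *R Det x)) <= \<mu> * ((LINT x|annul. et x) + (LINT x|annul. ph x * et x)))"
proof -
 define de where "de = lambda1 \<Omega> - \<mu>"
 have de: "de > 0" using \<mu> by (simp add: de_def)

 \<comment> \<open>Coercivity of the energy and a minimising sequence\<close>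
 define N1 where "N1 = (\<integral>x. (1::real) \<partial>(annul :: (real^'n) measure))"
 \<comment> \<open>Nonnegativity of the competitors is inherited by the limit, and all variations
   used below stay in this class.\<close>
 define S where "S = {hom0_energy \<mu> b Db | b Db. hom0_test \<Omega> b Db & (\<forall>x. x ~= 0 --> b x >= 0)}"
 \<comment> \<open>Young's inequality turns the linear term into a multiple of the squared L2 norm
   that the spectral gap \<open>de\<close> absorbs.\<close>
 have lower: "- (\<mu> * \<mu> / (2 * de) * N1) <= hom0_energy \<mu> b Db" if b: "hom0_test \<Omega> b Db" for b Db
 proof -
 note bC = hom0_test_C1[OF b]
 let ?N = "\<integral>x. (b x)^2 \<partial>annul" and ?E = "\<integral>x. (norm x)^2 * (norm (Db x))^2 \<partial>annul"
 have "(LINT x|annul. b x) <= (LINT x|annul. de / (2 * \<mu>) * (b x)^2 + \<mu> / (2 * de) * 1)"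
 proof (rule integral_mono[OF hom0_C1_integrable(1)[OF bC]])
 show "integrable annul (%x. de / (2 * \<mu>) * (b x)^2 + \<mu> / (2 * de) * 1)"
 by (intro B_integrable_add integrable_mult_right hom0_C1_integrable(2)[OF bC]) simp
 fix x
 have "0 <= (de * b x - \<mu>)^2 / (2 * \<mu> * de)" using \<mu> de by simp
 also have "... = de / (2 * \<mu>) * (b x)^2 + \<mu> / (2 * de) * 1 - b x"
 using \<mu> de by (simp add: power2_eq_square field_simps)
 finally show "b x <= de / (2 * \<mu>) * (b x)^2 + \<mu> / (2 * de) * 1" by simp
 qed
 also have "... = de / (2 * \<mu>) * ?N + \<mu> / (2 * de) * N1"
 unfolding N1_def using hom0_C1_integrable(2)[OF bC] by (subst B_integral_add) auto
 finally have "\<mu> * (LINT x|annul. b x) <= \<mu> * (de / (2 * \<mu>) * ?N + \<mu> / (2 * de) * N1)" using \<mu> by (intro mult_left_mono) auto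
 also have "... = de / 2 * ?N + \<mu> * \<mu> / (2 * de) * N1" using \<mu> by (simp add: distrib_left)
 finally have 1: "\<mu> * (LINT x|annul. b x) <= de / 2 * ?N + \<mu> * \<mu> / (2 * de) * N1" .
 have "(de + \<mu>) * ?N <= ?E" using lambda1_poincare[OF b] by (simp add: de_def)
 then have 2: "de * ?N + \<mu> * ?N <= ?E" by (simp only: distrib_right)
 have "\<mu> * ((LINT x|annul. b x) + ?N / 2) = \<mu> * (LINT x|annul. b x) + (\<mu> * ?N) / 2" by (simp add: distrib_left)
 then show ?thesis unfolding hom0_energy_def using 1 2 by linarith
 qed
 then have bdd: "bdd_below S" unfolding S_def bdd_below_def by blast
 have zero: "hom0_test \<Omega> (%x. 0) (%x. 0)"
 proof (rule hom0_testI[where K="{}"])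
 have z: "(%h::real^'n. (0::real^'n) <.> h) = (%h. 0)" by (rule ext) (rule inner_zero_left)
 have "((%x::real^'n. 0::real) has_derivative (%h. (0::real^'n) <.> h)) (at x)" for x
 unfolding z by (rule has_derivative_const)
 then show "hom0_C1 (%x::real^'n. 0) (%x. 0)" unfolding hom0_C1_def C1_on_def
 by (intro conjI allI impI ballI refl continuous_on_const)
 qed simp_all
 have ne: "S ~= {}" unfolding S_def using zero by force
 define I where "I = Inf S"
 have I: "I <= hom0_energy \<mu> b Db" if "hom0_test \<Omega> b Db" "!!x. x ~= 0 ==> b x >= 0" for b Db
 unfolding I_def by (rule cInf_lower[OF _ bdd]) (use that in \<open>auto simp: S_def\<close>)
 have "\<forall>n::nat. \<exists>p. hom0_test \<Omega> (fst p) (snd p) & (\<forall>x. x ~= 0 --> fst p x >= 0) & hom0_energy \<mu> (fst p) (snd p) < I + (1/4) ^ n"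
 proof
 fix n :: nat
 have "Inf S < I + (1/4) ^ n" by (simp add: I_def)
 then obtain s where s: "s \<in> S" "s < I + (1/4) ^ n" using cInf_lessD[OF ne] by blast
 then obtain b Db where "s = hom0_energy \<mu> b Db" "hom0_test \<Omega> b Db" "\<forall>x. x ~= 0 --> b x >= 0" unfolding S_def by blast
 then show "\<exists>p. hom0_test \<Omega> (fst p) (snd p) & (\<forall>x. x ~= 0 --> fst p x >= 0) & hom0_energy \<mu> (fst p) (snd p) < I + (1/4) ^ n"
 using s(2) by (intro exI[of _ "(b, Db)"]) simp
 qed
 from choice[OF this] obtain p where p: "\<forall>n::nat. hom0_test \<Omega> (fst (p n)) (snd (p n)) & (\<forall>x. x ~= 0 --> fst (p n) x >= 0) & hom0_energy \<mu> (fst (p n)) (snd (p n)) < I + (1/4) ^ n"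
 by (elim exE)
 define f where "f n = fst (p n)" for n
 define Df where "Df n = snd (p n)" for n
 have fT: "hom0_test \<Omega> (f n) (Df n)" and f0: "x ~= 0 ==> f n x >= 0" and fE: "hom0_energy \<mu> (f n) (Df n) < I + (1/4) ^ n" for n x
 using p by (auto simp: f_def Df_def)
 note fC = hom0_test_C1[OF fT]
 note [measurable] = hom0_C1_measurable[OF fC]
 define c where "c = 8 + 8 / de + 8 * \<mu> / de"
 \<comment> \<open>The midpoint has energy at least \<open>I\<close>, so the quadratic form of the
   difference is at most \<open>8 * (1/4) ^ n\<close>; the gap \<open>de\<close> splits this into
   bounds for the function and for its gradient.\<close>
 have cauchy: "(LINT x|annul. (f m x - f n x)^2) <= c * (1/4) ^ n & (LINT x|annul. (norm x)^2 * (norm (Df m x - Df n x))^2) <= c * (1/4) ^ n"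
 if nm: "n <= m" for n m
 proof -
 let ?N = "\<integral>x. (f m x - f n x)^2 \<partial>annul" and ?E = "\<integral>x. (norm x)^2 * (norm (Df m x - Df n x))^2 \<partial>annul"
 have "I <= hom0_energy \<mu> (%x. (1/2) * f m x + (1/2) * f n x) (%x. (1/2) *R Df m x + (1/2) *R Df n x)"
 by (rule I[OF hom0_test_lin[OF fT fT]]) (simp add: f0)
 moreover have "?E - \<mu> * ?N = 4 * (hom0_energy \<mu> (f m) (Df m) + hom0_energy \<mu> (f n) (Df n)) - 8 * hom0_energy \<mu> (%x. (1/2) * f m x + (1/2) * f n x) (%x. (1/2) *R Df m x + (1/2) *R Df n x)"
 using hom0_energy_midpoint[OF fC[of m] fC[of n], of \<mu>] by simp
 moreover have "(1/4::real) ^ m <= (1/4) ^ n" using nm by (intro power_decreasing) auto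
 moreover have "I <= Jm ==> X = 4 * (J1 + J2) - 8 * Jm ==> p <= q ==> J1 < I + p ==> J2 < I + q ==> X <= 8 * q" for X J1 J2 Jm p q :: real
 proof -
 assume h: "I <= Jm" "X = 4 * (J1 + J2) - 8 * Jm" "p <= q" "J1 < I + p" "J2 < I + q"
 define k where "k = I"
 have h': "k <= Jm" "p <= q" "J1 < k + p" "J2 < k + q" using h by (simp_all only: k_def)
 have "J1 + J2 <= 2 * Jm + 2 * q" using h' by (smt (verit))
 then show "X <= 8 * q" unfolding h(2) by (smt (verit))
 qed
 ultimately have 1: "?E - \<mu> * ?N <= 8 * (1/4) ^ n" using fE[of m] fE[of n] by blast
 have "lambda1 \<Omega> * ?N <= ?E" using lambda1_poincare[OF hom0_test_lin[OF fT[of m] fT[of n], of 1 "- 1"]] by simp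
 then have "(de + \<mu>) * ?N <= ?E" by (simp add: de_def)
 then have "de * ?N + \<mu> * ?N <= ?E" by (simp only: distrib_right)
 then have "de * ?N <= 8 * (1/4) ^ n" using 1 by linarith
 then have N: "?N <= 8 / de * (1/4) ^ n" using de by (simp add: field_simps)
 have "\<mu> * ?N <= \<mu> * (8 / de * (1/4) ^ n)" using N \<mu> by (intro mult_left_mono) auto
 then have E: "?E <= 8 * (1/4) ^ n + 8 * \<mu> / de * (1/4) ^ n" using 1 by (simp add: mult_ac)
 have "c * (1/4) ^ n = 8 * (1/4) ^ n + 8 / de * (1/4) ^ n + 8 * \<mu> / de * (1/4) ^ n" by (simp only: c_def distrib_right)
 moreover have "0 <= 8 / de * (1/4) ^ n" "0 <= 8 * \<mu> / de * (1/4) ^ n" "0 <= 8 * (1/4::real) ^ n" using \<mu> de by simp_all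
 ultimately show ?thesis using N E by linarith
 qed

 \<comment> \<open>Passage to the limit\<close>
 let ?V = "%n x. norm x *R Df n x"
 have iV: "integrable annul (?V n)" for n
 proof -
 obtain B where B: "B > 0" "!!x. x ~= 0 ==> \<bar>f n x\<bar> <= B" "!!x. x ~= 0 ==> norm x * norm (Df n x) <= B" using hom0_C1_bounded[OF fC[of n]] by metis
 show ?thesis by (rule integrable_annular_bounded[where B=B]) (use B(3) in auto)
 qed
 have nV: "(norm (?V n x))^2 = (norm x)^2 * (norm (Df n x))^2" "(norm (?V m x - ?V n x))^2 = (norm x)^2 * (norm (Df m x - Df n x))^2" for m n x
 by (simp_all add: power_mult_distrib flip: scaleR_diff_right)
 define ph where "ph = (%x. lim (%n. f n x))"
 define V where "V = (%x. lim (%n. ?V n x))"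
 have F: "AE x in annul. (%n. f n x) >-> ph x" "ph \<in> bmb" "integrable annul ph"
 "integrable annul (%x. (norm (ph x))^2)" "(%n. \<integral>x. norm (ph x - f n x) \<partial>annul) >-> 0"
 unfolding ph_def using hom0_C1_integrable(1,2)[OF fC] cauchy by (intro L2_cauchy_limit[where c=c]; simp)+
 have W: "AE x in annul. (%n. ?V n x) >-> V x" "V \<in> bmb" "integrable annul V"
 "integrable annul (%x. (norm (V x))^2)" "(%n. \<integral>x. norm (V x - ?V n x) \<partial>annul) >-> 0"
 unfolding V_def using iV hom0_C1_integrable(3)[OF fC] cauchy by (intro L2_cauchy_limit[where c=c]; simp only: nV)+
 note [measurable] = F(2) W(2)
 have homf: "f n (t *R x) = f n x" "?V n (t *R x) = ?V n x" if "x ~= 0" "t > 0" for n t x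
 using fC[of n] hom0_C1_grad(1)[OF fC[of n] that(1,2)] that by (auto simp: hom0_C1_def)
 have hom: "ph (t *R x) = ph x" "V (t *R x) = V x" if "x ~= 0" "t > 0" for t x
 unfolding ph_def V_def homf[OF that] by (rule refl)+
 have ae: "AE x in annul. 0 <= ph x & V x <.> x = 0"
 using F(1) W(1) AE_annular_nz
 proof eventually_elim
 case (elim x)
 have "0 <= ph x" by (rule LIMSEQ_le_const[OF elim(1)]) (use f0[OF elim(3)] in auto)
 moreover have "(%n. ?V n x <.> x) >-> V x <.> x" by (intro tendsto_inner elim(2) tendsto_const)
 then have "(%n. 0) >-> V x <.> x" using hom0_C1_grad(2)[OF fC elim(3)] by simp
 then have "V x <.> x = 0" by (rule LIMSEQ_unique[OF _ tendsto_const])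
 ultimately show ?case ..
 qed
 have wH: "weak_H1 (- {0}) ph (%x. V x /R norm x)"
 by (rule hom0_limit_weak_H1[OF fC F(2,3) _ hom(1) F(5) W(2,3,4) hom(2) W(5) iV]) (use F(4) in simp_all)
 have lim: "(%n. hom0_variation \<mu> (f n) (Df n) et Det) >-> (LINT x|annul. V x <.> (norm x *R Det x)) - \<mu> * ((LINT x|annul. et x) + (LINT x|annul. ph x * et x))"
 if et: "hom0_C1 et Det" for et Det
 proof -
 note [measurable] = hom0_C1_measurable[OF et]
 obtain B where B: "B > 0" "!!x. x ~= 0 ==> \<bar>et x\<bar> <= B" "!!x. x ~= 0 ==> norm x * norm (Det x) <= B" using hom0_C1_bounded[OF et] by metis
 have "(%n. \<integral>x. ?V n x <.> (norm x *R Det x) \<partial>annul) >-> (LINT x|annul. V x <.> (norm x *R Det x))"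
 proof (rule integral_inner_bounded_tendsto(1)[OF iV W(3,5)])
 show "AE x in annul. norm (norm x *R Det x) <= B" using AE_annular_nz by eventually_elim (use B(3) in simp)
 qed (simp add: annular_measurable)
 moreover have "?V n x <.> (norm x *R Det x) = (norm x)^2 * (Df n x <.> Det x)" for n x by (simp add: power2_eq_square)
 ultimately have 1: "(%n. \<integral>x. (norm x)^2 * (Df n x <.> Det x) \<partial>annul) >-> (LINT x|annul. V x <.> (norm x *R Det x))"
 by (simp only:)
 have "(%n. \<integral>x. f n x <.> et x \<partial>annul) >-> (LINT x|annul. ph x <.> et x)"
 proof (rule integral_inner_bounded_tendsto(1)[OF hom0_C1_integrable(1)[OF fC] F(3,5)])
 show "AE x in annul. norm (et x) <= B" using AE_annular_nz by eventually_elim (use B(2) in simp)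
 qed (simp add: annular_measurable)
 then have 2: "(%n. \<integral>x. f n x * et x \<partial>annul) >-> (LINT x|annul. ph x * et x)" by (simp only: inner_real_def)
 show ?thesis unfolding hom0_variation_def by (intro tendsto_diff tendsto_mult_left tendsto_add tendsto_const 1 2)
 qed

 \<comment> \<open>The two variational inequalities\<close>
 have p0: "(%n. (1/4::real) ^ n) >-> 0" by (rule LIMSEQ_power_zero) simp
 have super: "\<mu> * ((LINT x|annul. et x) + (LINT x|annul. ph x * et x)) <= (LINT x|annul. V x <.> (norm x *R Det x))"
 if et: "hom0_test \<Omega> et Det" "\<forall>x. x ~= 0 --> 0 <= et x" for et Det
 proof -
 note etC = hom0_test_C1[OF et(1)]
 define Q where "Q = (LINT x|annul. (norm x)^2 * (norm (Det x))^2) - \<mu> * (LINT x|annul. (et x)^2)"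
 have "0 <= (LINT x|annul. V x <.> (norm x *R Det x)) - \<mu> * ((LINT x|annul. et x) + (LINT x|annul. ph x * et x))" (is "0 <= ?v")
 proof (rule linear_coeff_nonneg[of _ Q])
 fix t :: real assume t: "t > 0"
 have "0 <= (1/4) ^ n + (t * hom0_variation \<mu> (f n) (Df n) et Det + t^2 / 2 * Q)" for n
 proof -
 have "I <= hom0_energy \<mu> (%x. 1 * f n x + t * et x) (%x. 1 *R Df n x + t *R Det x)"
 by (rule I[OF hom0_test_lin[OF fT et(1)]]) (use f0 et(2) t in \<open>simp add: add_nonneg_nonneg\<close>)
 also have "... = hom0_energy \<mu> (f n) (Df n) + t * hom0_variation \<mu> (f n) (Df n) et Det + t^2 / 2 * Q"
 unfolding Q_def by (rule hom0_energy_add[OF fC etC])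
 finally show ?thesis using fE[of n] by linarith
 qed
 moreover have "(%n. (1/4) ^ n + (t * hom0_variation \<mu> (f n) (Df n) et Det + t^2 / 2 * Q)) >-> 0 + (t * ?v + t^2 / 2 * Q)"
 by (intro tendsto_add p0 tendsto_mult_left lim[OF etC] tendsto_const)
 ultimately have "0 <= 0 + (t * ?v + t^2 / 2 * Q)" by (intro LIMSEQ_le_const) auto
 then show "0 <= t * ?v + t^2 / 2 * Q" by simp
 qed
 then show ?thesis by simp
 qed
 have sub: "(LINT x|annul. V x <.> (norm x *R Det x)) <= \<mu> * ((LINT x|annul. et x) + (LINT x|annul. ph x * et x))"
 if et: "hom0_C1 et Det" "\<forall>x. x ~= 0 --> 0 <= et x" for et Det
 proof -
 define Q where "Q = (LINT x|annul. (norm x)^2 * (norm (Det x))^2)"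
 have "0 <= - ((LINT x|annul. V x <.> (norm x *R Det x)) - \<mu> * ((LINT x|annul. et x) + (LINT x|annul. ph x * et x)))" (is "0 <= - ?v")
 proof (rule linear_coeff_nonneg[of _ Q])
 fix t :: real assume t: "t > 0"
 \<comment> \<open>One \<open>(1/4) ^ n\<close> bounds the excess of \<open>f n\<close> over the
   infimum, the other is the error allowed to the competitor.\<close>
 have "0 <= 2 * (1/4) ^ n + (t * (- hom0_variation \<mu> (f n) (Df n) et Det) + t^2 / 2 * Q)" for n
 proof -
 have "\<exists>b Db. hom0_test \<Omega> b Db & (\<forall>x. x ~= 0 --> b x >= 0) &
 hom0_energy \<mu> b Db <= hom0_energy \<mu> (f n) (Df n) - t * hom0_variation \<mu> (f n) (Df n) et Det + t^2 / 2 * Q + (1/4) ^ n"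
 unfolding Q_def using et(2) by (intro hom0_energy_competitor[OF fT f0 et(1) _ t _ \<mu>(1)]) auto
 then obtain b Db where b: "hom0_test \<Omega> b Db" "\<forall>x. x ~= 0 --> b x >= 0"
 "hom0_energy \<mu> b Db <= hom0_energy \<mu> (f n) (Df n) - t * hom0_variation \<mu> (f n) (Df n) et Det + t^2 / 2 * Q + (1/4) ^ n"
 by (elim exE conjE)
 have "I <= hom0_energy \<mu> b Db" by (rule I[OF b(1)]) (use b(2) in blast)
 then show ?thesis using b(3) fE[of n] by (simp only: mult_minus_right)
 qed
 moreover have "(%n. 2 * (1/4) ^ n + (t * (- hom0_variation \<mu> (f n) (Df n) et Det) + t^2 / 2 * Q)) >-> 2 * 0 + (t * (- ?v) + t^2 / 2 * Q)"
 by (intro tendsto_add p0 tendsto_mult_left tendsto_minus lim[OF et(1)] tendsto_const)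
 ultimately have "0 <= 2 * 0 + (t * (- ?v) + t^2 / 2 * Q)" by (intro LIMSEQ_le_const) auto
 then show "0 <= t * (- ?v) + t^2 / 2 * Q" by simp
 qed
 then show ?thesis by simp
 qed
 show ?thesis
 proof (rule exI[of _ ph], rule exI[of _ V], intro conjI)
 show "\<forall>x t. x ~= 0 --> t > 0 --> ph (t *R x) = ph x & V (t *R x) = V x" by (simp add: hom)
 show "V \<in> bmb" by (rule W(2))
 show "integrable annul ph" by (rule F(3))
 show "integrable annul V" by (rule W(3))
 show "AE x in annul. 0 <= ph x & V x <.> x = 0" by (rule ae)
 show "weak_H1 (- {0}) ph (%x. V x /R norm x)" by (rule wH)
 qed (use super in blast, use sub in blast)
qed

section \<open>From the sphere to the cone\<close>

lemma C1_on_norm_powr: "C1_on (- {0}) (%x. norm x powr a) (%x. (a * norm x powr (a - 2)) *R x)"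
proof -
 have F: "((%t. t powr a) has_real_derivative a * t powr (a - 1)) (at t)" if "t > 0" for t
 using has_real_derivative_powr[OF that, of a] .
 have "continuous_on (norm ` (- {0::real^'a})) (%t. a * t powr (a - 1))" by (intro continuous_intros) auto
 then have C: "C1_on (- {0::real^'a}) (%x. norm x powr a) (%x. (a * norm x powr (a - 1)) *R (x /R norm x))"
 by (intro C1_on_compose[OF C1_on_norm] F) auto
 have eq: "(a * norm x powr (a - 1)) *R (x /R norm x) = (a * norm x powr (a - 2)) *R x" if "x \<in> - {0}" for x :: "real^'a"
 proof -
 have "norm x powr (a - 1) = norm x powr (a - 2) * norm x powr 1" unfolding powr_add[symmetric] by simp
 then show ?thesis using that by simp
 qed
 have "continuous_on (- {0::real^'a}) (%x. (a * norm x powr (a - 2)) *R x)"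
 using C unfolding C1_on_def by (elim conjE) (rule continuous_on_eq, assumption, rule eq)
 moreover have "((%x. norm x powr a) has_derivative (%h. ((a * norm x powr (a - 2)) *R x) <.> h)) (at x)" if "x \<in> - {0}" for x :: "real^'a"
 using C1_onD[OF C that] unfolding eq[OF that] .
 ultimately show ?thesis unfolding C1_on_def by (intro conjI ballI)
qed

text \<open>The power may be singular at 0, but the support of \<open>Y\<close> keeps away from
  it.\<close>

lemma continuous_norm_powr_mult:
 fixes Y :: "'a::euclidean_space => 'b::real_normed_vector"
 assumes Y: "continuous_on UNIV Y" and K: "compact K" "K \<subseteq> - {0}" "!!x. x \<notin> K ==> Y x = 0"
 shows "continuous_on UNIV (%x. norm x powr a *R Y x)"
proof -
 have "continuous_on (- {0}) (%x. norm x powr a *R Y x)"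
 by (intro continuous_intros continuous_on_subset[OF Y]) auto
 moreover have "continuous_on (- K) (%x. norm x powr a *R Y x)"
 by (rule continuous_on_eq[OF continuous_on_const[of _ 0]]) (simp add: K(3))
 ultimately have "continuous_on (- {0} \<union> - K) (%x. norm x powr a *R Y x)"
 using K(1) by (intro continuous_on_open_Un) (auto simp: compact_imp_closed open_Compl)
 moreover have "- {0} \<union> - K = UNIV" using K(2) by auto
 ultimately show ?thesis by simp
qed

lemma integrable_inner_compact_support:
 fixes w Y :: "'a::euclidean_space => 'b::euclidean_space"
 assumes Y: "continuous_on UNIV Y" and K: "compact K" "!!x. x \<notin> K ==> Y x = 0"
 and w: "intl (%x. ind K x *R w x)" "w \<in> bmb"
 shows "intl (%x. w x <.> Y x)"
proof -
 note [measurable] = w(2) borel_measurable_continuous_onI[OF Y]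
 obtain B where B: "B > 0" "!!x. norm (Y x) <= B * ind K x" using bounded_compact_support[OF Y K] by metis
 show ?thesis
 proof (rule B_integrable_bound[OF integrable_mult_right[OF integrable_norm[OF w(1)], of B]])
 show "AE x in lborel. norm (w x <.> Y x) <= norm (B * norm (ind K x *R w x))"
 proof (rule AE_I2)
 fix x
 have "\<bar>w x <.> Y x\<bar> <= norm (w x) * norm (Y x)" by (rule Cauchy_Schwarz_ineq2)
 also have "... <= norm (w x) * (B * ind K x)" by (intro mult_left_mono B) simp
 also have "... = norm (B * norm (ind K x *R w x))" using B(1) by (simp add: abs_mult)
 finally show "norm (w x <.> Y x) <= norm (B * norm (ind K x *R w x))" by simp
 qed
 qed measurable
qed

lemma weak_H1_add_1:
 fixes G :: "(real^'n) set"
 assumes u: "weak_H1 G u g" shows "weak_H1 G (%x. 1 + u x) g"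
 unfolding weak_H1_def
proof (intro conjI allI impI)
 note [measurable] = weak_H1D(1,2)[OF u]
 show "(%x. 1 + u x) \<in> bmb" "g \<in> bmb" by measurable
 fix K assume K: "compact K & K \<subseteq> G"
 then have Kb[measurable]: "K \<in> sets borel" by (auto intro: borel_compact)
 have i1: "intl (%x. ind K x :: real)" using K by (intro integrable_real_indicator Kb) (use emeasure_compact_finite[of K] in simp_all)
 have iu: "intl (%x. ind K x * (u x)^2)" using K by (intro weak_H1D(5)[OF u]) auto
 show "set_integrable lborel K (%x. (1 + u x)^2)" unfolding set_integrable_def
 proof (rule B_integrable_bound[OF B_integrable_add[OF integrable_mult_right[OF i1, of 2] integrable_mult_right[OF iu, of 2]]])
 show "AE x in lborel. norm (ind K x *R (1 + u x)^2) <= norm (2 * ind K x + 2 * (ind K x * (u x)^2))"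
 proof (rule AE_I2)
 fix x
 have "(1 + u x)^2 <= 2 + 2 * (u x)^2" using zero_le_power2[of "1 - u x"] by (simp add: power2_sum power2_diff)
 then show "norm (ind K x *R (1 + u x)^2) <= norm (2 * ind K x + 2 * (ind K x * (u x)^2))"
 by (cases "x \<in> K") simp_all
 qed
 qed measurable
 show "set_integrable lborel K (%x. (norm (g x))^2)" using weak_H1D(6)[OF u, of K] K by (simp add: set_integrable_def)
next
 fix ph Dph assume ph: "C1c G ph Dph"
 obtain K where K: "compact K" "!!x. x \<notin> K ==> Dph x = 0" using C1c_support[OF ph] by metis
 have i: "intl Dph" by (rule integrable_compact_support[OF C1c_continuous(2)[OF ph] K])
 have "(LBINT x. (1 + u x) *R Dph x) = (LBINT x. Dph x) + (LBINT x. u x *R Dph x)"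
 unfolding B_integral_add[OF i weak_H1_integrable_test(1)[OF u ph], symmetric]
 by (simp add: scaleR_add_left)
 then show "(LBINT x. (1 + u x) *R Dph x) = - (LBINT x. ph x *R g x)"
 using C1c_integral_grad_eq_0[OF ph] weak_H1D(7)[OF u ph] by simp
qed

text \<open>The restriction to the sphere of radius \<open>s\<close>, extended constantly along
  rays; the stated gradient is the rescaled tangential part of \<open>Det\<close>. Compact support
  in the cone gives compact angular support in \<open>\<Omega>\<close>.\<close>

lemma slice_hom0_test:
 fixes et :: "real^'n => real"
 assumes \<Omega>: "\<Omega> \<subseteq> sphere 0 1" and et: "C1c (cone_over \<Omega>) et Det" and s: "s > 0"
 shows "hom0_test \<Omega> (%x. et ((s / norm x) *R x))
 (%x. (s / norm x) *R (Det ((s / norm x) *R x) - ((x <.> Det ((s / norm x) *R x)) / (norm x)^2) *R x))"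
 (is "hom0_test \<Omega> ?h ?D")
proof -
 obtain K where K: "compact K" "K \<subseteq> cone_over \<Omega>" "!!x. x \<notin> K ==> et x = 0" using C1c_support[OF et] by metis
 define L where "L = (%y. (1 / s) *R y) ` (K \<inter> sphere 0 s)"
 have C: "C1_on (- {0}) ?h ?D" unfolding C1_on_def
 proof (intro conjI ballI)
 fix x :: "real^'n" assume "x \<in> - {0}"
 then have x: "x ~= 0" "norm x > 0" by auto
 define n where "n = norm x"
 have n0: "n > 0" using x by (simp add: n_def)
 have "(norm has_derivative (%h. (x /R n) <.> h)) (at x)" using C1_onD[OF C1_on_norm, of x] x by (simp add: n_def)
 moreover have "((%t. s / t) has_derivative (*) (- s / n^2)) (at n)"
 proof -
 have "((%t. s / t) has_real_derivative (- s / n^2)) (at n)"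
 using n0 by (auto intro!: derivative_eq_intros simp: power2_eq_square)
 then show ?thesis by (simp add: has_field_derivative_def)
 qed
 ultimately have "((%x. s / norm x) has_derivative (%h. (- s / n^2) * ((x /R n) <.> h))) (at x)"
 unfolding n_def by (rule has_derivative_compose)
 from has_derivative_scaleR[OF this has_derivative_ident]
 have y: "((%x. (s / norm x) *R x) has_derivative (%h. (s / n) *R h + ((- s / n^2) * ((x /R n) <.> h)) *R x)) (at x)"
 by (simp only: n_def)
 let ?y = "(s / norm x) *R x"
 have "(et has_derivative (%h. Det ?y <.> h)) (at ?y)" using et by (simp add: C1c_def)
 from has_derivative_compose[OF y this]
 have d: "(?h has_derivative (%h. Det ?y <.> ((s / n) *R h + ((- s / n^2) * ((x /R n) <.> h)) *R x))) (at x)" .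
 have "Det ?y <.> ((s / n) *R h + ((- s / n^2) * ((x /R n) <.> h)) *R x) = ?D x <.> h" for h
 proof -
 define A where "A = Det ?y"
 have "A <.> ((s / n) *R h + ((- s / n^2) * ((x /R n) <.> h)) *R x) = (s / n) * (A <.> h) + ((- s / n^2) * (inverse n * (x <.> h))) * (x <.> A)"
 by (simp only: inner_add_right inner_scaleR_right inner_scaleR_left inner_commute[of A x])
 also have "... = (s / n) * (A <.> h - ((x <.> A) / n^2) * (x <.> h))" using n0 by (simp add: field_simps)
 also have "... = ((s / n) *R (A - ((x <.> A) / n^2) *R x)) <.> h" by (simp only: inner_diff_left inner_scaleR_left)
 finally show ?thesis by (simp only: A_def n_def)
 qed
 then show "(?h has_derivative (%h. ?D x <.> h)) (at x)" using d by (simp only:)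
 next
 have y: "continuous_on (- {0}) (%x::real^'n. (s / norm x) *R x)" by (intro continuous_intros) auto
 have "continuous_on (- {0}) (%x. Det ((s / norm x) *R x))" by (rule continuous_on_compose2[OF C1c_continuous(2)[OF et] y]) simp
 then show "continuous_on (- {0}) ?D" by (intro continuous_intros) auto
 qed
 have hom: "(s / norm (t *R x)) *R (t *R x) = (s / norm x) *R x" if "x ~= 0" "t > 0" for x :: "real^'n" and t
 using that by simp
 have hC: "hom0_C1 ?h ?D" unfolding hom0_C1_def
 proof (intro conjI allI impI C)
 fix x :: "real^'n" and t :: real assume "x ~= 0 & t > 0"
 then have xt: "x ~= 0" "t > 0" by auto
 show "?h (t *R x) = ?h x" unfolding hom[OF xt] ..
 qed
 show ?thesis
 proof (rule hom0_testI[OF hC, of L])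
 show "compact L" unfolding L_def by (intro compact_continuous_image compact_Int_closed K(1) continuous_intros) auto
 show "L \<subseteq> \<Omega>"
 proof
 fix om assume "om \<in> L"
 then obtain y where y: "y \<in> K" "norm y = s" "om = (1 / s) *R y" unfolding L_def by auto
 then obtain r om0 where r: "r > 0" "om0 \<in> \<Omega>" "y = r *R om0" using K(2) unfolding cone_over_def by blast
 have "norm om0 = 1" using r(2) \<Omega> by auto
 then have "r = s" using y(2) r by simp
 then show "om \<in> \<Omega>" using y(3) r s by simp
 qed
 fix om :: "real^'n" assume w: "om \<in> sphere 0 1" "om \<notin> L"
 have "s *R om \<notin> K"
 proof
 assume "s *R om \<in> K"
 moreover have "s *R om \<in> sphere 0 s" using w(1) s by simp
 ultimately have "(1 / s) *R (s *R om) \<in> L" unfolding L_def by blast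
 then show False using w(2) s by simp
 qed
 then show "et ((s / norm om) *R om) = 0" using K(3) w(1) by simp
 qed
qed

text \<open>\<open>V\<close> is the weak gradient multiplied by \<open>norm x\<close>, which makes
  it 0-homogeneous like \<open>ph\<close>; orthogonality to \<open>x\<close> says that this gradient
  is tangential.\<close>

definition dirichlet_pair :: "(real^'n => real) => (real^'n => real^'n) => bool" where
 "dirichlet_pair ph V \<longleftrightarrow>
 (\<forall>x t. x ~= 0 --> t > 0 --> ph (t *R x) = ph x & V (t *R x) = V x) &
 V \<in> bmb & integrable annul ph & integrable annul V &
 (AE x in annul. 0 <= ph x & V x <.> x = 0) &
 weak_H1 (- {0}) ph (%x. V x /R norm x)"

lemma dirichlet_pairD:
 assumes "dirichlet_pair ph V"
 shows "!!x t. x ~= 0 ==> t > 0 ==> ph (t *R x) = ph x" "!!x t. x ~= 0 ==> t > 0 ==> V (t *R x) = V x"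
 "V \<in> bmb" "integrable annul ph" "integrable annul V"
 "AE x in annul. 0 <= ph x & V x <.> x = 0" "weak_H1 (- {0}) ph (%x. V x /R norm x)"
 using assms unfolding dirichlet_pair_def by auto

lemma dirichlet_pair_AE_lborel:
 assumes D: "dirichlet_pair ph V" shows "AE x in lborel. 0 <= ph x & V x <.> x = 0"
proof (rule AE_hom0_lborel[OF _ _ dirichlet_pairD(6)[OF D]])
 note [measurable] = dirichlet_pairD(3)[OF D] weak_H1D(1)[OF dirichlet_pairD(7)[OF D]]
 show "Measurable.pred borel (%x. 0 <= ph x & V x <.> x = 0)" by measurable
 fix x :: "real^'a" and t :: real assume "x ~= 0" "t > 0"
 then show "(0 <= ph (t *R x) & V (t *R x) <.> (t *R x) = 0) = (0 <= ph x & V x <.> x = 0)"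
 using dirichlet_pairD(1,2)[OF D, of x t] by simp
qed

lemma cone_over_nz: "\<Omega> \<subseteq> sphere 0 1 ==> cone_over \<Omega> \<subseteq> - {0}"
 unfolding cone_over_def by auto

lemma dirichlet_pair_integrable:
 fixes ph :: "real^'n => real"
 assumes D: "dirichlet_pair ph V" and et: "C1c (- {0}) et Det"
 shows "intl (%x. norm x powr a * (1 + ph x) * et x)"
 "intl (%x. norm x powr a * ((V x /R norm x) <.> Det x))"
proof -
 obtain K where K: "compact K" "K \<subseteq> - {0}" "!!x. x \<notin> K ==> et x = 0" "!!x. x \<notin> K ==> Det x = 0" using C1c_support[OF et] by metis
 note W = weak_H1_add_1[OF dirichlet_pairD(7)[OF D]]
 have "intl (%x. (norm x powr a *R et x) *R (1 + ph x))"
 by (rule integrable_scaleR_compact_support[OF continuous_norm_powr_mult[OF C1c_continuous(1)[OF et] K(1,2,3)] K(1) _ weak_H1D(3)[OF W K(1,2)] weak_H1D(1)[OF W]])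
 (simp_all add: K(3))
 then show "intl (%x. norm x powr a * (1 + ph x) * et x)" by (simp add: mult_ac)
 have "intl (%x. (V x /R norm x) <.> (norm x powr a *R Det x))"
 by (rule integrable_inner_compact_support[OF continuous_norm_powr_mult[OF C1c_continuous(2)[OF et] K(1,2,4)] K(1) _ weak_H1D(4)[OF W K(1,2)] weak_H1D(2)[OF W]])
 (simp_all add: K(4))
 then show "intl (%x. norm x powr a * ((V x /R norm x) <.> Det x))" by (simp only: inner_scaleR_right)
qed

text \<open>\<open>si = 1\<close> gives the supersolution and \<open>si = -1\<close> the subsolution inequality.\<close>

lemma sphere_to_cone_inequality:
 fixes ph :: "real^'n => real"
 assumes \<Omega>: "\<Omega> \<subseteq> sphere 0 1" and D: "dirichlet_pair ph V"
 and ineq: "!!ps Dps. hom0_test \<Omega> ps Dps ==> \<forall>x. x ~= 0 --> 0 <= ps x ==>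
 si * (\<mu> * ((LINT x|annul. ps x) + (LINT x|annul. ph x * ps x))) <= si * (LINT x|annul. V x <.> (norm x *R Dps x))"
 and et: "C1c (cone_over \<Omega>) et Det" "!!x. et x >= 0"
 shows "si * (\<mu> * (LBINT x. norm x powr (ga - 2) * (1 + ph x) * et x)) <= si * (LBINT x. norm x powr ga * ((V x /R norm x) <.> Det x))"
proof -
 note i = dirichlet_pair_integrable[OF D C1c_mono[OF et(1) cone_over_nz[OF \<Omega>]]]
 note [measurable] = dirichlet_pairD(3)[OF D] weak_H1D(1)[OF dirichlet_pairD(7)[OF D]] C1c_measurable[OF et(1)]
 have "(LBINT x. si * (\<mu> * (norm x powr (ga - 2) * (1 + ph x) * et x))) <= (LBINT x. si * (norm x powr ga * ((V x /R norm x) <.> Det x)))"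
 proof (rule polar_integral_mono)
 show "intl (%x. si * (\<mu> * (norm x powr (ga - 2) * (1 + ph x) * et x)))" "intl (%x. si * (norm x powr ga * ((V x /R norm x) <.> Det x)))"
 by (intro integrable_mult_right i)+
 fix s :: real assume s: "s > 0"
 define y where "y x = (s / norm x) *R x" for x :: "real^'n"
 define h where "h = (%x. et (y x))"
 define Dh where "Dh = (%x. (s / norm x) *R (Det (y x) - ((x <.> Det (y x)) / (norm x)^2) *R x))"
 have hT: "hom0_test \<Omega> h Dh" unfolding h_def Dh_def y_def by (rule slice_hom0_test[OF \<Omega> et(1) s])
 note hC = hom0_test_C1[OF hT]
 have ym[measurable]: "y \<in> bmb" unfolding y_def by measurable
 note [measurable] = hom0_C1_measurable[OF hC]
 have ny: "norm (y x) = s" if "x ~= 0" for x using that s by (simp add: y_def)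
 have hy: "ph (y x) = ph x" "V (y x) = V x" if "x ~= 0" for x
 unfolding y_def using that s by (intro dirichlet_pairD(1,2)[OF D]; simp)+
 have ihh: "integrable annul (%x. ph x * h x)"
 proof -
 obtain B where B: "B > 0" "!!x. x ~= 0 ==> \<bar>h x\<bar> <= B" "!!x. x ~= 0 ==> norm x * norm (Dh x) <= B" using hom0_C1_bounded[OF hC] by metis
 show ?thesis
 proof (rule B_integrable_bound[OF integrable_mult_right[OF integrable_norm[OF dirichlet_pairD(4)[OF D]], of B]])
 show "AE x in annul. norm (ph x * h x) <= norm (B * norm (ph x))"
 using AE_annular_nz
 proof eventually_elim
 case (elim x)
 have "\<bar>ph x\<bar> * \<bar>h x\<bar> <= \<bar>ph x\<bar> * B" by (intro mult_left_mono B(2) elim) simp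
 then show ?case using B(1) by (simp add: abs_mult mult.commute)
 qed
 qed (simp add: annular_measurable)
 qed
 have "(LINT x|annul. si * (\<mu> * (norm (y x) powr (ga - 2) * (1 + ph (y x)) * et (y x))))
 = (LINT x|annul. (si * \<mu> * s powr (ga - 2)) * (h x + ph x * h x))"
 proof (rule integral_cong_AE)
 show "AE x in annul. si * (\<mu> * (norm (y x) powr (ga - 2) * (1 + ph (y x)) * et (y x))) = (si * \<mu> * s powr (ga - 2)) * (h x + ph x * h x)"
 using AE_annular_nz by eventually_elim (simp add: ny hy h_def algebra_simps)
 qed (simp_all add: annular_measurable)
 also have "... = s powr (ga - 2) * (si * (\<mu> * ((LINT x|annul. h x) + (LINT x|annul. ph x * h x))))"
 using hom0_C1_integrable(1)[OF hC] ihh by simp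
 also have "... <= s powr (ga - 2) * (si * (LINT x|annul. V x <.> (norm x *R Dh x)))"
 by (rule mult_left_mono[OF ineq[OF hT]]) (simp_all add: h_def et(2))
 also have "... = (LINT x|annul. (s powr (ga - 2) * si) * (V x <.> (norm x *R Dh x)))"
 unfolding integral_mult_right_zero by simp
 also have "... = (LINT x|annul. si * (norm (y x) powr ga * ((V (y x) /R norm (y x)) <.> Det (y x))))"
 proof (rule integral_cong_AE)
 show "AE x in annul. (s powr (ga - 2) * si) * (V x <.> (norm x *R Dh x)) = si * (norm (y x) powr ga * ((V (y x) /R norm (y x)) <.> Det (y x)))"
 using AE_annular_nz dirichlet_pairD(6)[OF D]
 proof eventually_elim
 case (elim x)
 \<comment> \<open>The radial part removed in \<open>Dh\<close> is invisible to \<open>V x\<close>,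
   which is orthogonal to \<open>x\<close>.\<close>
 have "V x <.> (norm x *R Dh x) = s * (V x <.> Det (y x))"
 using elim by (simp add: Dh_def inner_diff_right)
 moreover have "s powr ga = s powr (ga - 2) * (s * s)"
 proof -
 have "s powr ga = s powr (ga - 2) * s powr 2" unfolding powr_add[symmetric] by simp
 then show ?thesis using s by (simp add: power2_eq_square)
 qed
 ultimately show ?case using elim(1) s by (simp add: ny hy)
 qed
 qed (simp_all add: annular_measurable)
 finally show "(LINT x|annul. si * (\<mu> * (norm ((s / norm x) *R x) powr (ga - 2) * (1 + ph ((s / norm x) *R x)) * et ((s / norm x) *R x))))
 <= (LINT x|annul. si * (norm ((s / norm x) *R x) powr ga * ((V ((s / norm x) *R x) /R norm ((s / norm x) *R x)) <.> Det ((s / norm x) *R x))))"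
 unfolding y_def .
 qed
 then show ?thesis by (simp only: integral_mult_right_zero)
qed

text \<open>The gradient of \<open>r\<^sup>ga (1 + ph)\<close>; its radial part integrates by parts.\<close>

lemma power_times_hom0_form:
 fixes ph :: "real^'n => real" and V :: "real^'n => real^'n" and ga d :: real
 assumes D: "dirichlet_pair ph V" and et: "C1c (- {0}) et Det"
 defines "DU \<equiv> %x. norm x powr ga *R (V x /R norm x) + (1 + ph x) *R ((ga * norm x powr (ga - 2)) *R x)"
 shows "(LBINT x. DU x <.> (aniso d x *v Det x)) = d * (LBINT x. norm x powr ga * ((V x /R norm x) <.> Det x))
 - ga * (ga + (real CARD('n) - 2)) * (LBINT x. norm x powr (ga - 2) * (1 + ph x) * et x)"
proof -
 note i = dirichlet_pair_integrable[OF D et]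
 note W = weak_H1_add_1[OF dirichlet_pairD(7)[OF D]]
 note [measurable] = dirichlet_pairD(3)[OF D] weak_H1D(1)[OF dirichlet_pairD(7)[OF D]] C1c_measurable[OF et]
 note ae = dirichlet_pair_AE_lborel[OF D]
 have o: "open (- {0::real^'n})" by auto
 \<comment> \<open>The Euler identity is applied with the test function
   \<open>norm x powr (ga - 2) * et x\<close>; as \<open>V\<close> is tangential its gradient side
   vanishes, which evaluates the integral of the radial derivative of \<open>et\<close>.\<close>
 note F = C1c_mult[OF o C1_on_norm_powr[of "ga - 2"] et]
 note T = weak_H1_radial_test[OF o W F]
 have et0: "et 0 = 0" "Det 0 = 0" using C1c_support[OF et] by (metis ComplD singletonI subsetD)+
 let ?A = "%x. norm x powr (ga - 2) * (1 + ph x) * et x"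
 let ?B = "%x. norm x powr (ga - 2) * (1 + ph x) * (x <.> Det x)"
 have "(LBINT x. (norm x powr (ga - 2) * et x) * ((V x /R norm x) <.> x)) = (\<integral>x. 0 \<partial>(lborel :: (real^'n) measure))"
 proof (rule integral_cong_AE)
 show "AE x in lborel. (norm x powr (ga - 2) * et x) * ((V x /R norm x) <.> x) = 0" using ae by eventually_elim simp
 qed measurable
 then have z: "(LBINT x. (norm x powr (ga - 2) * et x) * ((V x /R norm x) <.> x)) = 0" by simp
 have eq: "(1 + ph x) * (real CARD('n) * (norm x powr (ga - 2) * et x) + (norm x powr (ga - 2) *R Det x + et x *R (((ga - 2) * norm x powr (ga - 2 - 2)) *R x)) <.> x)
 = (ga + (real CARD('n) - 2)) * ?A x + ?B x" for x
 proof (cases "x = 0")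
 case False
 have "norm x powr (ga - 2) = norm x powr (ga - 2 - 2) * norm x powr 2" unfolding powr_add[symmetric] by simp
 then have "norm x powr (ga - 2 - 2) * (x <.> x) = norm x powr (ga - 2)" using False by (simp add: power2_norm_eq_inner)
 moreover have "(p *R Det x + et x *R ((c * q) *R x)) <.> x = p * (x <.> Det x) + et x * c * (q * (x <.> x))" for p c q
 by (simp add: inner_add_left inner_commute[of "Det x"])
 ultimately show ?thesis by (simp only:) (simp add: algebra_simps)
 qed (simp add: et0)
 have iC: "intl (%x. (ga + (real CARD('n) - 2)) * ?A x + ?B x)" using T(2) unfolding eq .
 have iB: "intl ?B" using B_integrable_diff[OF iC integrable_mult_right[OF i(1)[of "ga - 2"], of "ga + (real CARD('n) - 2)"]] by simp
 have "(LBINT x. (ga + (real CARD('n) - 2)) * ?A x + ?B x) = 0" using T(1) unfolding eq z by simp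
 then have B: "(LBINT x. ?B x) = - (ga + (real CARD('n) - 2)) * (LBINT x. ?A x)"
 proof -
 have "(ga + (real CARD('n) - 2)) * (LBINT x. ?A x) + (LBINT x. ?B x) = 0"
 using B_integral_add[OF integrable_mult_right[OF i(1)[of "ga - 2"], of "ga + (real CARD('n) - 2)"] iB]
 \<open>(LBINT x. (ga + (real CARD('n) - 2)) * ?A x + ?B x) = 0\<close> by (simp only: integral_mult_right_zero)
 then have "(LBINT x. ?B x) = - ((ga + (real CARD('n) - 2)) * (LBINT x. ?A x))" by linarith
 then show ?thesis by (simp only: mult_minus_left)
 qed
 have "(LBINT x. DU x <.> (aniso d x *v Det x)) = (LBINT x. d * (norm x powr ga * ((V x /R norm x) <.> Det x)) + ga * ?B x)"
 proof (rule integral_cong_AE)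
 show "(%x. DU x <.> (aniso d x *v Det x)) \<in> borel_measurable lborel" unfolding DU_def by measurable
 show "AE x in lborel. DU x <.> (aniso d x *v Det x) = d * (norm x powr ga * ((V x /R norm x) <.> Det x)) + ga * ?B x"
 using ae
 proof eventually_elim
 case (elim x)
 show ?case
 proof (cases "x = 0")
 case False
 define b where "b = ga * norm x powr (ga - 2) * (1 + ph x)"
 define w where "w = norm x powr ga *R (V x /R norm x)"
 have xw: "x <.> w = 0" using elim by (simp add: w_def inner_commute)
 have DU: "DU x = w + b *R x" by (simp add: DU_def w_def b_def mult_ac)
 have "(1 - d) * (x <.> DU x) * (x <.> Det x) / (norm x)^2 = (1 - d) * b * (x <.> Det x)"
 unfolding DU inner_add_right xw using False by (simp add: power2_norm_eq_inner)
 moreover have "DU x <.> Det x = w <.> Det x + b * (x <.> Det x)" unfolding DU by (simp add: inner_add_left)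
 ultimately have "DU x <.> (aniso d x *v Det x) = d * (w <.> Det x) + b * (x <.> Det x)"
 unfolding aniso_inner by (simp add: algebra_simps)
 moreover have "w <.> Det x = norm x powr ga * ((V x /R norm x) <.> Det x)" unfolding w_def by (rule inner_scaleR_left)
 ultimately show ?thesis by (simp add: b_def)
 qed (simp add: et0)
 qed
 qed measurable
 also have "... = d * (LBINT x. norm x powr ga * ((V x /R norm x) <.> Det x)) + ga * (LBINT x. ?B x)"
 unfolding B_integral_add[OF integrable_mult_right[OF i(2)] integrable_mult_right[OF iB]] integral_mult_right_zero ..
 finally show ?thesis unfolding B by (simp add: algebra_simps)
qed

lemma cone_over_sphere: "cone_over (sphere 0 1) = - {0 :: real^'n}"
proof (rule set_eqI)
 fix x :: "real^'n"
 show "x \<in> cone_over (sphere 0 1) \<longleftrightarrow> x \<in> - {0}"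
 proof
 assume "x \<in> - {0}"
 then have "norm x > 0" "x /R norm x \<in> sphere 0 1" "x = norm x *R (x /R norm x)" by auto
 then show "x \<in> cone_over (sphere 0 1)" unfolding cone_over_def by blast
 qed (auto simp: cone_over_def)
qed

text \<open>For \<open>ga (ga + N - 2) \<ge> \<mu>\<close> the function \<open>r\<^sup>ga (1 + ph)\<close> is subharmonic, hence locally bounded.\<close>

lemma dirichlet_pair_bounded:
 fixes ph :: "real^'n => real"
 assumes N: "CARD('n) >= 3" and \<mu>: "\<mu> > 0" and D: "dirichlet_pair ph V"
 and sub: "!!ps Dps. hom0_C1 ps Dps ==> \<forall>x. x ~= 0 --> 0 <= ps x ==>
 (LINT x|annul. V x <.> (norm x *R Dps x)) <= \<mu> * ((LINT x|annul. ps x) + (LINT x|annul. ph x * ps x))"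
 shows "\<exists>C. AE x in lborel. ph x <= C"
proof -
 define n where "n = real CARD('n) - 2"
 have n: "n >= 1" using N by (simp add: n_def)
 \<comment> \<open>Already \<open>ga * n = \<mu>\<close>, and the extra \<open>ga^2\<close> only
   helps.\<close>
 define ga where "ga = \<mu> / n"
 have ga: "ga >= 0" "\<mu> <= ga * (ga + n)"
 proof -
 show "ga >= 0" unfolding ga_def using \<mu> n by simp
 moreover have "ga * n = \<mu>" unfolding ga_def using n by simp
 ultimately show "\<mu> <= ga * (ga + n)" by (simp add: distrib_left)
 qed
 note [measurable] = dirichlet_pairD(3)[OF D] weak_H1D(1)[OF dirichlet_pairD(7)[OF D]]
 note ae = dirichlet_pair_AE_lborel[OF D]
 define W where "W = (%x. norm x powr ga * (1 + ph x))"
 define DW where "DW = (%x. norm x powr ga *R (V x /R norm x) + (1 + ph x) *R ((ga * norm x powr (ga - 2)) *R x))"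
 have o: "open (- {0::real^'n})" by auto
 have WH: "weak_H1 (- {0}) W DW" unfolding W_def DW_def
 by (rule weak_H1_C1_mult[OF o weak_H1_add_1[OF dirichlet_pairD(7)[OF D]] C1_on_norm_powr]) measurable
 have "(LBINT y. DW y <.> Det y) <= 0" if et: "C1c (- {0}) et Det" "!!y. et y >= 0" for et Det
 proof -
 let ?A = "\<integral>x. norm x powr (ga - 2) * (1 + ph x) * et x \<partial>lborel"
 \<comment> \<open>Subsolution tests may be supported on the whole sphere, so the inequality holds
   in the entire punctured space.\<close>
 have "(- 1) * (\<mu> * ?A) <= (- 1) * (LBINT x. norm x powr ga * ((V x /R norm x) <.> Det x))"
 proof (rule sphere_to_cone_inequality[OF order_refl D _ _ et(2)])
 show "C1c (cone_over (sphere 0 1)) et Det" unfolding cone_over_sphere by (rule et(1))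
 fix ps Dps assume "hom0_test (sphere 0 1) ps Dps" "\<forall>x::real^'n. x ~= 0 --> 0 <= ps x"
 then show "(- 1) * (\<mu> * ((LINT x|annul. ps x) + (LINT x|annul. ph x * ps x))) <= (- 1) * (LINT x|annul. V x <.> (norm x *R Dps x))"
 using sub[OF hom0_test_C1] by simp
 qed
 moreover have "0 <= ?A"
 proof (rule integral_nonneg_AE)
 show "AE x in lborel. 0 <= norm x powr (ga - 2) * (1 + ph x) * et x"
 using ae by eventually_elim (intro mult_nonneg_nonneg et(2), auto)
 qed
 then have "\<mu> * ?A <= ga * (ga + n) * ?A" by (intro mult_right_mono ga(2))
 moreover have "DW y <.> (aniso 1 y *v Det y) = DW y <.> Det y" for y by (simp add: aniso_mult)
 ultimately show ?thesis
 using power_times_hom0_form[OF D et(1), of ga 1] unfolding DW_def n_def[symmetric] by simp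
 qed
 then obtain C where C: "AE x in lborel. x \<in> annulus12 --> W x <= C" by (rule subharmonic_bounded_annulus[OF WH])
 \<comment> \<open>On the annulus \<open>norm x powr ga \<ge> 1\<close>, so the bound for
   \<open>W\<close> bounds \<open>ph\<close> there, and homogeneity spreads it everywhere.\<close>
 have "AE x in annul. x \<in> annulus12 --> W x <= C"
 unfolding annul_def by (subst AE_density) (measurable, use C in \<open>eventually_elim, simp\<close>)
 then have "AE x in annul. ph x <= C"
 using AE_annular dirichlet_pairD(6)[OF D]
 proof eventually_elim
 case (elim x)
 then have "1 <= norm x" by (simp add: annulus12_def)
 then have "1 <= norm x powr ga" using ga(1) by (rule ge_one_powr_ge_zero)
 then have "1 * (1 + ph x) <= W x" unfolding W_def using elim(3) by (intro mult_right_mono) auto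
 then show ?case using elim by simp
 qed
 then have "AE x in lborel. ph x <= C"
 by (rule AE_hom0_lborel[rotated 2]) (measurable, simp add: dirichlet_pairD(1)[OF D])
 then show ?thesis by (rule exI)
qed

text \<open>Cutting \<open>ph\<close> off between 0 and its essential bound yields pointwise bounds;
  the change affects a null set only and keeps homogeneity.\<close>

lemma exists_bounded_supersolution:
 fixes \<Omega> :: "(real^'n) set"
 assumes N: "CARD('n) >= 3" and \<Omega>: "\<Omega> \<subseteq> sphere 0 1" and \<mu>: "0 < \<mu>" "\<mu> < lambda1 \<Omega>"
 shows "\<exists>(v :: real^'n => real) w C. weak_H1 (- {0}) v w & (\<forall>x. 1 <= v x & v x <= C) &
 (\<forall>d ga et Det. d > 0 --> C1c (cone_over \<Omega>) et Det --> (\<forall>x. et x >= 0) -->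
 (d * \<mu> - ga * (ga + (real CARD('n) - 2))) * (LBINT x. norm x powr (ga - 2) * v x * et x)
 <= (LBINT x. (norm x powr ga *R w x + v x *R ((ga * norm x powr (ga - 2)) *R x)) <.> (aniso d x *v Det x)))"
proof -
 have "\<exists>(ph :: real^'n => real) V. dirichlet_pair ph V &
 (\<forall>et Det. hom0_test \<Omega> et Det --> (\<forall>x. x ~= 0 --> 0 <= et x) -->
 \<mu> * ((LINT x|annul. et x) + (LINT x|annul. ph x * et x)) <= (LINT x|annul. V x <.> (norm x *R Det x))) &
 (\<forall>et Det. hom0_C1 et Det --> (\<forall>x. x ~= 0 --> 0 <= et x) -->
 (LINT x|annul. V x <.> (norm x *R Det x)) <= \<mu> * ((LINT x|annul. et x) + (LINT x|annul. ph x * et x)))"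
 using exists_dirichlet_solution[OF \<mu>] unfolding dirichlet_pair_def conj_assoc .
 then obtain ph :: "real^'n => real" and V where P: "dirichlet_pair ph V"
 and super: "\<forall>et Det. hom0_test \<Omega> et Det --> (\<forall>x. x ~= 0 --> 0 <= et x) -->
 \<mu> * ((LINT x|annul. et x) + (LINT x|annul. ph x * et x)) <= (LINT x|annul. V x <.> (norm x *R Det x))"
 and sub: "\<forall>et Det. hom0_C1 et Det --> (\<forall>x. x ~= 0 --> 0 <= et x) -->
 (LINT x|annul. V x <.> (norm x *R Det x)) <= \<mu> * ((LINT x|annul. et x) + (LINT x|annul. ph x * et x))"
 by (elim exE conjE)
 obtain C where C: "AE x in lborel. ph x <= C"
 using dirichlet_pair_bounded[OF N \<mu>(1) P] sub by blast
 note [measurable] = dirichlet_pairD(3)[OF P] weak_H1D(1)[OF dirichlet_pairD(7)[OF P]]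
 define ph' where "ph' = (%x. max 0 (min C (ph x)))"
 have [measurable]: "ph' \<in> bmb" unfolding ph'_def by measurable
 have ae: "AE x in lborel. ph x = ph' x"
 using C dirichlet_pair_AE_lborel[OF P] by eventually_elim (simp add: ph'_def max_def min_def)
 have aeA: "AE x in annul. ph' x = ph x"
 unfolding annul_def by (subst AE_density) (measurable, use ae in \<open>eventually_elim, simp\<close>)
 have P': "dirichlet_pair ph' V" unfolding dirichlet_pair_def
 proof (intro conjI allI impI)
 show "ph' (t *R x) = ph' x" if "x ~= 0" "t > 0" for x t using dirichlet_pairD(1)[OF P that] by (simp add: ph'_def)
 show "integrable annul ph'"
 proof (rule integrable_cong_AE_imp[OF dirichlet_pairD(4)[OF P]])
 show "AE x in annul. ph x = ph' x" using aeA by eventually_elim simp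
 qed (simp add: annular_measurable)
 show "AE x in annul. 0 <= ph' x & V x <.> x = 0" using dirichlet_pairD(6)[OF P] by eventually_elim (simp add: ph'_def)
 show "weak_H1 (- {0}) ph' (%x. V x /R norm x)" by (rule weak_H1_cong_AE[OF dirichlet_pairD(7)[OF P] _ ae]) simp
 qed (use dirichlet_pairD[OF P] in auto)
 have super': "1 * (\<mu> * ((LINT x|annul. ps x) + (LINT x|annul. ph' x * ps x))) <= 1 * (LINT x|annul. V x <.> (norm x *R Dps x))"
 if ps: "hom0_test \<Omega> ps Dps" "\<forall>x. x ~= 0 --> 0 <= ps x" for ps Dps
 proof -
 note [measurable] = hom0_C1_measurable[OF hom0_test_C1[OF ps(1)]]
 have "(LINT x|annul. ph' x * ps x) = (LINT x|annul. ph x * ps x)"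
 proof (rule integral_cong_AE)
 show "AE x in annul. ph' x * ps x = ph x * ps x" using aeA by eventually_elim simp
 qed (simp_all add: annular_measurable)
 then show ?thesis using super ps by simp
 qed
 show ?thesis
 proof (rule exI[of _ "%x. 1 + ph' x"], rule exI[of _ "%x. V x /R norm x"], rule exI[of _ "1 + max 0 C"], intro conjI allI impI)
 show "weak_H1 (- {0}) (%x. 1 + ph' x) (%x. V x /R norm x)" by (rule weak_H1_add_1[OF dirichlet_pairD(7)[OF P']])
 show "1 <= 1 + ph' x" "1 + ph' x <= 1 + max 0 C" for x by (auto simp: ph'_def)
 fix d ga :: real and et Det assume d: "d > 0" and et: "C1c (cone_over \<Omega>) et Det" "\<forall>x. et x >= 0"
 have et': "C1c (- {0}) et Det" by (rule C1c_mono[OF et(1) cone_over_nz[OF \<Omega>]])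
 let ?A = "\<integral>x. norm x powr (ga - 2) * (1 + ph' x) * et x \<partial>lborel" and ?B = "\<integral>x. norm x powr ga * ((V x /R norm x) <.> Det x) \<partial>lborel"
 have "1 * (\<mu> * ?A) <= 1 * ?B" by (rule sphere_to_cone_inequality[OF \<Omega> P' super' et(1)]) (use et(2) in auto)
 then have "d * (\<mu> * ?A) <= d * ?B" using d by simp
 then show "(d * \<mu> - ga * (ga + (real CARD('n) - 2))) * ?A
 <= (LBINT x. (norm x powr ga *R (V x /R norm x) + (1 + ph' x) *R ((ga * norm x powr (ga - 2)) *R x)) <.> (aniso d x *v Det x))"
 unfolding power_times_hom0_form[OF P' et'] by (simp only: left_diff_distrib mult.assoc)
 qed
qed

section \<open>The critical exponent\<close>

text \<open>Because \<open>be * (q - 1) = - 2\<close>, the function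
  \<open>U = c * norm x powr be * v x\<close> satisfies
  \<open>U powr q = (c * v x) powr (q - 1) * norm x powr (- 2) * U\<close>. As \<open>v\<close> is
  bounded, a small \<open>c\<close> makes the first factor at most the gap left by the strict
  inequality for \<open>be\<close>.\<close>

lemma exists_pos_supersolution:
 fixes \<Omega> :: "(real^'n) set"
 assumes N: "CARD('n) >= 3" and S: "sphere_domain \<Omega>" and d: "d > 0" and q: "q > 1" and \<mu>: "0 < \<mu>" "\<mu> < lambda1 \<Omega>"
 and be: "be = - 2 / (q - 1)" "be * (be + (real CARD('n) - 2)) < d * \<mu>"
 shows "\<exists>u. pos_supersolution (aniso d) q (cone_over \<Omega> - cball 0 1) u"
proof -
 have \<Omega>: "\<Omega> \<subseteq> sphere 0 1" using S unfolding sphere_domain_def openin_subtopology by auto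
 define G where "G = cone_over \<Omega> - cball 0 1"
 have G: "open G" unfolding G_def using open_cone_over[OF S] by auto
 have Gc: "G \<subseteq> cone_over \<Omega>" "G \<subseteq> - {0}" and G1: "x \<in> G ==> 1 <= norm x" for x
 unfolding G_def using cone_over_nz[OF \<Omega>] by auto
 obtain v w C where vw: "weak_H1 (- {0}) v w" and vC: "\<forall>x. 1 <= v x & v x <= C"
 and v: "\<forall>d ga et Det. d > 0 --> C1c (cone_over \<Omega>) et Det --> (\<forall>x. et x >= 0) -->
 (d * \<mu> - ga * (ga + (real CARD('n) - 2))) * (LBINT x. norm x powr (ga - 2) * v x * et x)
 <= (LBINT x. (norm x powr ga *R w x + v x *R ((ga * norm x powr (ga - 2)) *R x)) <.> (aniso d x *v Det x))"
 using exists_bounded_supersolution[OF N \<Omega> \<mu>] by (elim exE conjE)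
 note [measurable] = weak_H1D(1,2)[OF vw]
 have C: "C > 0" using vC[THEN spec, of 0] by linarith
 define e where "e = d * \<mu> - be * (be + (real CARD('n) - 2))"
 have e: "e > 0" using be(2) by (simp add: e_def)
 \<comment> \<open>Equivalently \<open>(c * C) powr (q - 1) = e\<close>, where \<open>C\<close>
   bounds \<open>v\<close>.\<close>
 define c where "c = e powr (1 / (q - 1)) / C"
 have c: "c > 0" using e C by (simp add: c_def)
 have b0: "be < 0" unfolding be(1) using q by (intro divide_neg_pos) auto
 define U where "U = (%x. (c * norm x powr be) * v x)"
 define D1 where "D1 = (%x. norm x powr be *R w x + v x *R ((be * norm x powr (be - 2)) *R x))"
 define DU where "DU = (%x. c *R D1 x)"
 have [measurable]: "D1 \<in> bmb" unfolding D1_def by measurable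
 have U0: "U x > 0" if "x ~= 0" for x
 unfolding U_def using c that vC[THEN spec, of x] by (intro mult_pos_pos) auto
 have o: "open (- {0::real^'n})" by auto
 have "weak_H1 (- {0}) U (%x. (c * norm x powr be) *R w x + v x *R (c *R ((be * norm x powr (be - 2)) *R x)))"
 unfolding U_def by (rule weak_H1_C1_mult[OF o vw C1_on_cmult[OF C1_on_norm_powr]]) measurable
 moreover have "(%x. (c * norm x powr be) *R w x + v x *R (c *R ((be * norm x powr (be - 2)) *R x))) = DU"
 by (rule ext) (simp add: DU_def D1_def scaleR_add_right mult_ac)
 ultimately have "weak_H1 (- {0}) U DU" by simp
 then have UH: "weak_H1 G U DU" by (rule weak_H1_mono[OF _ Gc(2)])
 note [measurable] = weak_H1D(1,2)[OF UH]
 have Uq: "U x powr q <= c * (e * (norm x powr (be - 2) * v x))" if x: "x ~= 0" for x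
 proof -
 have n: "norm x > 0" using x by simp
 have v1: "1 <= v x" "v x <= C" using vC by auto
 have "(c * v x) powr (q - 1) <= (c * C) powr (q - 1)" using c v1 q by (intro powr_mono2 mult_left_mono mult_nonneg_nonneg) auto
 also have "c * C = e powr (1 / (q - 1))" using C by (simp add: c_def)
 also have "(e powr (1 / (q - 1))) powr (q - 1) = e" using e q by (simp add: powr_powr)
 finally have 1: "(c * v x) powr (q - 1) <= e" .
 have "q - 1 ~= 0" using q by simp
 from iffD1[OF nonzero_divide_eq_eq[OF this] be(1)[symmetric]] have "be * (q - 1) = - 2" by (rule sym)
 then have 2: "(norm x powr be) powr (q - 1) = norm x powr (- 2)" by (simp only: powr_powr)
 have Ueq: "U x = (c * v x) * norm x powr be" by (simp add: U_def mult_ac)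
 have "U x powr q = U x powr (1 + (q - 1))" by simp
 also have "... = U x * U x powr (q - 1)" unfolding powr_add using U0[OF x] by simp
 also have "U x powr (q - 1) = (c * v x) powr (q - 1) * norm x powr (- 2)"
 unfolding Ueq using c v1(1) by (subst powr_mult) (simp_all only: 2)
 also have "U x * ((c * v x) powr (q - 1) * norm x powr (- 2)) <= U x * (e * norm x powr (- 2))"
 by (intro mult_left_mono mult_right_mono 1) (use U0[OF x] in auto)
 also have "... = c * (e * ((norm x powr be * norm x powr (- 2)) * v x))" by (simp add: U_def mult_ac)
 also have "norm x powr be * norm x powr (- 2) = norm x powr (be - 2)" by (simp flip: powr_add)
 finally show ?thesis .
 qed
 have UB: "U x <= c * C" if "x \<in> G" for x
 proof -
 have "norm x powr be <= norm x powr 0" using G1[OF that] b0 by (intro powr_mono) auto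
 moreover have "x ~= 0" using Gc(2) that by auto
 ultimately have "norm x powr be <= 1" by simp
 moreover have "0 <= v x" "v x <= C" using vC[THEN spec, of x] by linarith+
 ultimately have "(c * norm x powr be) * v x <= (c * 1) * C" using c by (intro mult_mono mult_left_mono) auto
 then show ?thesis by (simp add: U_def)
 qed
 \<comment> \<open>By symmetry the matrix acts on \<open>DU\<close> instead of the test gradient,
   which brings the inequality to the form treated in
   \<open>test_inequality_extends\<close>.\<close>
 define b where "b = (%x. aniso d x *v DU x)"
 have bm[measurable]: "b \<in> bmb" unfolding b_def by measurable
 have bsym: "b x <.> z = DU x <.> (aniso d x *v z)" for x z
 unfolding b_def inner_commute[of "aniso d x *v DU x"] aniso_inner by (simp add: inner_commute mult_ac)
 have fm[measurable]: "(%x. U x powr q) \<in> bmb" by measurable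
 have b2: "intl (%x. ind K x * (norm (b x))^2)" if K: "compact K" "K \<subseteq> G" for K
 proof -
 have Kb[measurable]: "K \<in> sets borel" using K(1) by (rule borel_compact)
 show ?thesis
 proof (rule B_integrable_bound[OF integrable_mult_right[OF weak_H1D(6)[OF UH K], of "(2 * d + 1)^2"]])
 show "AE x in lborel. norm (ind K x * (norm (b x))^2) <= norm ((2 * d + 1)^2 * (ind K x * (norm (DU x))^2))"
 proof (rule AE_I2)
 fix x
 have "(norm (b x))^2 <= ((2 * d + 1) * norm (DU x))^2" unfolding b_def by (intro power_mono norm_aniso_mult_le[OF d]) simp
 then have "(norm (b x))^2 <= (2 * d + 1)^2 * (norm (DU x))^2" by (simp only: power_mult_distrib)
 then show "norm (ind K x * (norm (b x))^2) <= norm ((2 * d + 1)^2 * (ind K x * (norm (DU x))^2))"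
 by (cases "x \<in> K") simp_all
 qed
 qed measurable
 qed
 have fb: "\<exists>B. \<forall>x\<in>K. \<bar>U x powr q\<bar> <= B" if K: "compact K" "K \<subseteq> G" for K
 proof (intro exI[of _ "(c * C) powr q"] ballI)
 fix x assume "x \<in> K"
 then have "x \<in> G" using K by auto
 then have "0 <= U x" "U x <= c * C" using U0[of x] UB[of x] Gc(2) by force+
 then show "\<bar>U x powr q\<bar> <= (c * C) powr q" using q by (simp add: powr_mono2)
 qed
 have test: "(LBINT x. U x powr q * et x) <= (LBINT x. b x <.> Det x)" if et: "C1c G et Det" "!!x. et x >= 0" for et Det
 proof -
 note etc = C1c_mono[OF et(1) Gc(1)] and et0 = C1c_mono[OF et(1) Gc(2)]
 note [measurable] = C1c_measurable[OF et(1)]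
 obtain K where K: "compact K" "K \<subseteq> - {0}" "!!x. x \<notin> K ==> et x = 0" using C1c_support[OF et0] by metis
 have "intl (%x. (norm x powr (be - 2) *R et x) *R v x)"
 by (rule integrable_scaleR_compact_support[OF continuous_norm_powr_mult[OF C1c_continuous(1)[OF et(1)] K] K(1) _ weak_H1D(3)[OF vw K(1,2)] weak_H1D(1)[OF vw]])
 (simp_all add: K(3))
 then have i: "intl (%x. norm x powr (be - 2) * v x * et x)" by (simp add: mult_ac)
 have i2: "intl (%x. c * (e * (norm x powr (be - 2) * v x * et x)))" by (intro integrable_mult_right i)
 have pw: "U x powr q * et x <= c * (e * (norm x powr (be - 2) * v x * et x))" for x
 proof (cases "x = 0")
 case True
 then have "et x = 0" using K(2,3) by auto
 then show ?thesis by simp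
 next
 case False
 from mult_right_mono[OF Uq[OF False] et(2)[of x]] show ?thesis by (simp only: mult.assoc)
 qed
 have "intl (%x. U x powr q * et x)"
 proof (rule B_integrable_bound[OF i2])
 show "AE x in lborel. norm (U x powr q * et x) <= norm (c * (e * (norm x powr (be - 2) * v x * et x)))"
 proof (rule AE_I2)
 fix x
 have "0 <= U x powr q * et x" using et(2)[of x] by simp
 then show "norm (U x powr q * et x) <= norm (c * (e * (norm x powr (be - 2) * v x * et x)))" using pw[of x] by simp
 qed
 qed measurable
 from integral_mono[OF this i2 pw]
 have "(LBINT x. U x powr q * et x) <= (LBINT x. c * (e * (norm x powr (be - 2) * v x * et x)))" .
 also have "... = c * (e * (LBINT x. norm x powr (be - 2) * v x * et x))" by (simp only: integral_mult_right_zero)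
 also have "... <= c * (LBINT x. D1 x <.> (aniso d x *v Det x))"
 unfolding e_def D1_def using v d etc et(2) c by (intro mult_left_mono) auto
 also have "... = (LBINT x. b x <.> Det x)"
 unfolding bsym DU_def inner_scaleR_left integral_mult_right_zero ..
 finally show ?thesis .
 qed
 have "pos_supersolution (aniso d) q G U" unfolding pos_supersolution_def
 proof (intro conjI exI[of _ DU] allI impI)
 show "AE x in lebesgue. x \<in> G --> U x > 0"
 proof (rule AE_I2, rule impI)
 fix x assume "x \<in> G"
 then have "x ~= 0" using Gc(2) by auto
 then show "U x > 0" by (rule U0)
 qed
 show "H1loc G U DU" by (rule weak_H1_imp_H1loc[OF UH])
 fix ph Dph
 assume A: "H1loc G ph Dph & (AE x in lebesgue. x \<in> G --> 0 <= ph x) & (\<exists>K. compact K & K \<subseteq> G & (AE x in lebesgue. x \<notin> K --> ph x = 0))"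
 then obtain K where K: "compact K" "K \<subseteq> G" and KA: "AE x in lebesgue. x \<notin> K --> ph x = 0" by (elim exE conjE)
 have H: "H1loc G ph Dph" and pos: "AE x in lebesgue. x \<in> G --> 0 <= ph x" using A by auto
 have m: "ph \<in> borel_measurable lebesgue" "Dph \<in> borel_measurable lebesgue" using H by (auto simp: H1loc_def)
 obtain ph1 where ph1: "ph1 \<in> borel_measurable lborel" "AE x in lborel. ph x = ph1 x" using completion_ex_borel_measurable_real[OF m(1)] by blast
 obtain D1ph where Dph1: "D1ph \<in> borel_measurable lborel" "AE x in lborel. Dph x = D1ph x" using completion_ex_borel_measurable_vec[OF m(2)] by blast
 have [measurable]: "K \<in> sets borel" using K(1) by (rule borel_compact)
 have [measurable]: "ph1 \<in> bmb" "D1ph \<in> bmb" using ph1(1) Dph1(1) by simp_all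
 \<comment> \<open>Borel representative of the test function, made nonnegative and supported in
   \<open>K\<close> at every point.\<close>
 define ps where "ps = (%x. max 0 (ph1 x) * ind K x)"
 have psm[measurable]: "ps \<in> bmb" unfolding ps_def by measurable
 have ae: "AE x in lebesgue. x \<in> G --> ph x = ps x"
 using AE_completion[OF ph1(2)] pos KA
 proof eventually_elim
 case (elim x)
 then show ?case by (cases "x \<in> K") (auto simp: ps_def)
 qed
 have aeD: "AE x in lebesgue. x \<in> G --> Dph x = D1ph x" using AE_completion[OF Dph1(2)] by eventually_elim simp
 have psH: "weak_H1 G ps D1ph" by (rule H1loc_imp_weak_H1[OF G H psm ae _ aeD]) measurable
 have ps0: "ps x >= 0" "x \<notin> K ==> ps x = 0" for x by (auto simp: ps_def)
 note T = test_inequality_extends[OF G bm b2 fm fb test psH ps0(1) K ps0(2)]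
 have [measurable]: "G \<in> sets borel" using G by simp
 have "(\<integral>\<^sup>+x. ind G x * ennreal (U x powr q * ph x) \<partial>lebesgue) = (\<integral>\<^sup>+x. ennreal (U x powr q * ps x) \<partial>lebesgue)"
 proof (rule nn_integral_cong_AE)
 show "AE x in lebesgue. ind G x * ennreal (U x powr q * ph x) = ennreal (U x powr q * ps x)"
 using ae
 proof eventually_elim
 case (elim x)
 have "x \<notin> G ==> ps x = 0" using K(2) ps0(2) by blast
 then show ?case using elim by (cases "x \<in> G") simp_all
 qed
 qed
 also have "... = (\<integral>\<^sup>+x. ennreal (U x powr q * ps x) \<partial>lborel)" by (simp add: nn_integral_completion)
 also have "... = ennreal (LBINT x. U x powr q * ps x)"
 proof -
 have i: "intl (%x. U x powr q * ps x)" by (rule T(1))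
 have "AE x in lborel. 0 <= U x powr q * ps x" by (intro AE_I2 mult_nonneg_nonneg powr_ge_zero ps0(1))
 with i show ?thesis by (rule nn_integral_eq_integral)
 qed
 also have "... <= ennreal (LBINT x. ind G x * (b x <.> D1ph x))" by (rule ennreal_leI[OF T(2)])
 also have "(LBINT x. ind G x * (b x <.> D1ph x)) = (\<integral>x. ind G x * (b x <.> D1ph x) \<partial>lebesgue)"
 by (rule integral_completion[symmetric]) measurable
 also have "... = (LINT x:G|lebesgue. DU x <.> (aniso d x *v Dph x))"
 unfolding set_lebesgue_integral_def
 proof (rule integral_cong_AE)
 have "(%x. ind G x * (b x <.> D1ph x)) \<in> borel_measurable lborel" by measurable
 then show "(%x. ind G x * (b x <.> D1ph x)) \<in> borel_measurable lebesgue" by (rule measurable_completion)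
 have "b \<in> borel_measurable lborel" by measurable
 then have [measurable]: "b \<in> borel_measurable lebesgue" by (rule measurable_completion)
 note [measurable] = m(2)
 have [measurable]: "G \<in> sets lebesgue" using G by auto
 show "(%x. ind G x *R (DU x <.> (aniso d x *v Dph x))) \<in> borel_measurable lebesgue" unfolding bsym[symmetric] by measurable
 show "AE x in lebesgue. ind G x * (b x <.> D1ph x) = ind G x *R (DU x <.> (aniso d x *v Dph x))"
 using aeD unfolding bsym[symmetric] by eventually_elim (simp add: indicator_def)
 qed
 finally show "(\<integral>\<^sup>+x. ind G x * ennreal (U x powr q * ph x) \<partial>lebesgue) <= ennreal (LINT x:G|lebesgue. DU x <.> (aniso d x *v Dph x))" .
 qed
 then show ?thesis unfolding G_def by (rule exI[of _ U])
qed

text \<open>The slice at radius 1 of a bump around a point of \<open>\<Omega>\<close>. It makes the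
  set of Rayleigh quotients nonempty, so that its infimum can be approached.\<close>

lemma ex_sphere_test:
 fixes \<Omega> :: "(real^'n) set"
 assumes S: "sphere_domain \<Omega>"
 shows "\<exists>ps Dps. sphere_test \<Omega> ps Dps"
proof -
 have \<Omega>: "\<Omega> \<subseteq> sphere 0 1" using S unfolding sphere_domain_def openin_subtopology by auto
 obtain om where w: "om \<in> \<Omega>" using S unfolding sphere_domain_def by blast
 then have w1: "norm om = 1" using \<Omega> by auto
 then have "om \<in> cone_over \<Omega>" using w unfolding in_cone_over[OF S] by auto
 then obtain r where r: "r > 0" "cball om r \<subseteq> cone_over \<Omega>" using open_cone_over[OF S] unfolding open_contains_cball by blast
 let ?et = "%y. max 0 (r^2 - (norm (y - om))^2) ^ Suc (Suc 0)"
 let ?D = "%y. (- 2 * of_nat (Suc (Suc 0)) * max 0 (r^2 - (norm (y - om))^2) ^ Suc 0) *R (y - om)"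
 have "C1c (cone_over \<Omega>) ?et ?D"
 proof (rule C1cI[OF open_cone_over[OF S] C1_on_subset[OF C1_on_radial_bump] compact_cball r(2)])
 fix y assume "y \<notin> cball om r"
 then have "max 0 (r^2 - (norm (y - om))^2) = 0"
 using r(1) by (intro max0_sq_diff_eq_0) (auto simp: dist_norm norm_minus_commute)
 then show "?et y = 0" "?D y = 0" by (simp_all only:) simp_all
 qed simp
 from slice_hom0_test[OF \<Omega> this zero_less_one]
 obtain ps Dps where ps: "hom0_test \<Omega> ps Dps" "ps = (%x. ?et ((1 / norm x) *R x))" by blast
 have "ps om ~= 0" unfolding ps(2) using r(1) w1 by simp
 then show ?thesis unfolding sphere_test_iff using ps(1) w1 by (intro exI[of _ ps] exI[of _ Dps] conjI bexI[of _ om]) auto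
qed

lemma sphere_test_L2_pos:
 fixes ps :: "real^'n => real"
 assumes "sphere_test \<Omega> ps Dps"
 shows "(LINT x|annul. (ps x)^2) > 0"
proof -
 obtain om where w: "om \<in> sphere 0 1" "ps om ~= 0" and T: "hom0_test \<Omega> ps Dps" using assms unfolding sphere_test_iff by blast
 note C = hom0_test_C1[OF T]
 note [measurable] = hom0_C1_measurable[OF C]
 note i = hom0_C1_integrable(2)[OF C]
 have "(LINT x|annul. (ps x)^2) ~= 0"
 proof
 assume "(LINT x|annul. (ps x)^2) = 0"
 then have "AE x in annul. (ps x)^2 = 0" using integral_nonneg_eq_0_iff_AE[OF i] by simp
 then have "AE x in annul. ps x = 0" by eventually_elim simp
 then have ae: "AE x in lborel. ps x = 0"
 proof (rule AE_hom0_lborel[rotated 2])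
 show "Measurable.pred borel (%x. ps x = 0)" by measurable
 show "(ps (t *R x) = 0) = (ps x = 0)" if "x ~= 0" "t > 0" for x t using C that by (simp add: hom0_C1_def)
 qed
 \<comment> \<open>\<open>ps\<close> is in general discontinuous at 0; the radial factor vanishes
   near 0 and equals 1/2 on the unit sphere.\<close>
 let ?f = "%x::real^'n. ps x * max 0 (norm x - 1/2)"
 have "continuous_on (- {0}) ?f"
 using C unfolding hom0_C1_def by (intro continuous_intros C1_on_continuous[of _ ps Dps]) auto
 moreover have "continuous_on (ball 0 (1/2)) ?f"
 by (rule continuous_on_eq[OF continuous_on_const[of _ 0]]) auto
 ultimately have "continuous_on (- {0} \<union> ball 0 (1/2)) ?f" by (intro continuous_on_open_Un) auto
 moreover have "- {0} \<union> ball 0 (1/2) = (UNIV :: (real^'n) set)" by auto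
 ultimately have c: "continuous_on UNIV ?f" by simp
 have "AE x in lborel. ?f x = 0" using ae by eventually_elim simp
 from continuous_AE_zero[OF c this, of om] show False using w by simp
 qed
 moreover have "(LINT x|annul. (ps x)^2) >= 0" by (intro integral_nonneg_AE AE_I2) simp
 ultimately show ?thesis by linarith
qed

text \<open>The strict inequality for the infimum \<open>lambda1 \<Omega>\<close> passes to the
  Rayleigh quotient of some test function, which then serves as the angular weight.\<close>

lemma no_pos_supersolution:
 fixes \<Omega> :: "(real^'n) set"
 assumes N: "CARD('n) >= 3" and S: "sphere_domain \<Omega>" and d: "d > 0" and rh: "rh > 0" and q: "q > 1"
 and be: "be = - 2 / (q - 1)" "2 * be + (real CARD('n) - 2) <= 0" and L: "d * lambda1 \<Omega> < be * (be + (real CARD('n) - 2))"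
 shows "\<not> pos_supersolution (aniso d) q (cone_over \<Omega> - cball 0 rh) u"
proof
 assume u: "pos_supersolution (aniso d) q (cone_over \<Omega> - cball 0 rh) u"
 have "open (cone_over \<Omega> - cball 0 rh)" using open_cone_over[OF S] by auto
 then obtain u' g where u': "supersol d q (cone_over \<Omega> - cball 0 rh) u' g" using pos_supersolution_imp_supersol[OF _ u] by blast
 let ?X = "{(LINT x|annul. (norm x)^2 * (norm (Dps x))^2) / (LINT x|annul. (ps x)^2) | ps Dps. sphere_test \<Omega> ps Dps}"
 have "Inf ?X < be * (be + (real CARD('n) - 2)) / d" using L d unfolding lambda1_eq by (simp add: field_simps)
 moreover have "?X ~= {}" using ex_sphere_test[OF S] by blast
 ultimately obtain ps Dps where ps: "sphere_test \<Omega> ps Dps"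
 "(LINT x|annul. (norm x)^2 * (norm (Dps x))^2) / (LINT x|annul. (ps x)^2) < be * (be + (real CARD('n) - 2)) / d"
 using cInf_lessD[of ?X] by blast
 have "hom0_test \<Omega> ps Dps" using ps(1) by (simp add: sphere_test_iff)
 moreover have "d * ((LINT x|annul. (norm x)^2 * (norm (Dps x))^2) / (LINT x|annul. (ps x)^2)) < be * (be + (real CARD('n) - 2))"
 using ps(2) d by (simp only: pos_less_divide_eq) (simp only: mult.commute)
 ultimately show False
 by (intro no_supersol[OF N S _ sphere_test_L2_pos[OF ps(1)] d rh q u' be])
qed

theorem theorem1p3:
  fixes \<Omega> :: "(real^'n) set" and p :: real
  assumes "CARD('n) \<ge> 3"
    and "sphere_domain \<Omega>"
    and "lambda1 \<Omega> > 0"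
    and "1 < p" and "p < real CARD('n) / (real CARD('n) - 2)"
  shows "\<exists>a :: real^'n \<Rightarrow> real^'n^'n. sym_meas_unif_elliptic a \<and> crit_exp a (cone_over \<Omega>) = ereal p"
proof -
 define n where "n = real CARD('n) - 2"
 have n: "n > 0" using assms(1) by (simp add: n_def)
 \<comment> \<open>\<open>b q\<close> is minus the homogeneity exponent that belongs to
   \<open>q\<close>, and \<open>ka q\<close> is \<open>\<beta> (\<beta> + N - 2)\<close> rewritten
   in terms of it.\<close>
 define b where "b q = 2 / (q - 1)" for q :: real
 define ka where "ka q = b q * (b q - n)" for q
 have anti: "b r < b q" "0 < b r" if "1 < q" "q < r" for q r
 unfolding b_def using that by (auto intro!: divide_strict_left_mono)
 \<comment> \<open>Here the upper bound on \<open>p\<close> enters: it makes \<open>ka p\<close>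
   positive and puts \<open>p\<close> on the branch where \<open>ka\<close> decreases in
   \<open>q\<close>.\<close>
 have bp: "n < b p"
 proof -
 have "p * n < n + 2" using assms(5) n by (simp add: n_def field_simps)
 then have "n * (p - 1) < 2" by (simp add: algebra_simps)
 then show ?thesis unfolding b_def using assms(4) by (simp add: pos_less_divide_eq)
 qed
 have kap: "ka p > 0" unfolding ka_def using bp n by (intro mult_pos_pos) auto
 define d where "d = ka p / lambda1 \<Omega>"
 have d: "d > 0" "d * lambda1 \<Omega> = ka p" using kap assms(3) by (simp_all add: d_def)
 have kaeq: "(- 2 / (q - 1)) * (- 2 / (q - 1) + (real CARD('n) - 2)) = ka q" for q
 unfolding ka_def b_def n_def by (simp add: algebra_simps)
 let ?X = "{ereal q | q. q > 1 & (\<exists>rh>0. \<exists>u. pos_supersolution (aniso d) q (cone_over \<Omega> - cball 0 rh) u)}"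
 have up: "ereal q \<in> ?X" if q: "q > p" for q
 proof -
 have b: "b q < b p" "0 < b q" using anti[OF assms(4) q] by auto
 have "ka q < ka p"
 \<comment> \<open>For large \<open>q\<close> the exponent leaves that branch, but then
   \<open>ka q\<close> is nonpositive.\<close>
 proof (cases "b q <= n")
 case True
 then have "ka q <= 0" unfolding ka_def using b by (intro mult_nonneg_nonpos) auto
 then show ?thesis using kap by linarith
 next
 case False
 then show ?thesis unfolding ka_def using b by (intro mult_strict_mono) auto
 qed
 then have k: "ka q / d < lambda1 \<Omega>" using d by (simp add: pos_divide_less_eq mult.commute)
 \<comment> \<open>Strictly below \<open>lambda1 \<Omega>\<close>, as the Dirichlet problem
   requires, yet large enough to leave a positive factor; the 0 keeps \<open>\<mu>\<close> positive
   when \<open>ka q\<close> is not.\<close>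
 obtain \<mu> where \<mu>: "max 0 (ka q / d) < \<mu>" "\<mu> < lambda1 \<Omega>" using dense[of "max 0 (ka q / d)" "lambda1 \<Omega>"] k assms(3) by auto
 then have "ka q < d * \<mu>" using d(1) by (simp add: pos_divide_less_eq mult.commute)
 then have ka\<mu>: "(- 2 / (q - 1)) * (- 2 / (q - 1) + (real CARD('n) - 2)) < d * \<mu>" unfolding kaeq .
 have "q > 1" "\<mu> > 0" using \<mu>(1) q assms(4) by simp_all
 then have "\<exists>u. pos_supersolution (aniso d) q (cone_over \<Omega> - cball 0 1) u"
 by (rule exists_pos_supersolution[OF assms(1,2) d(1) _ _ \<mu>(2) refl ka\<mu>])
 then show ?thesis using q assms(4) by (intro CollectI exI[of _ q] conjI refl exI[of _ 1]) auto
 qed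
 have low: "p <= q" if q: "q > 1" "rh > 0" "pos_supersolution (aniso d) q (cone_over \<Omega> - cball 0 rh) u" for q rh u
 proof (rule ccontr)
 assume "\<not> p <= q"
 then have b: "b p < b q" using anti[OF q(1), of p] by simp
 have "ka p < ka q" unfolding ka_def using b bp n by (intro mult_strict_mono) auto
 then have "d * lambda1 \<Omega> < (- 2 / (q - 1)) * (- 2 / (q - 1) + (real CARD('n) - 2))" unfolding d(2) kaeq .
 \<comment> \<open>From \<open>b q > b p > n\<close> and \<open>n > 0\<close>.\<close>
 moreover have "2 * (- 2 / (q - 1)) + (real CARD('n) - 2) <= 0" using b bp n unfolding b_def n_def[symmetric] by simp
 ultimately show False using no_pos_supersolution[OF assms(1,2) d(1) q(2,1) refl] q(3) by blast
 qed
 have "crit_exp (aniso d) (cone_over \<Omega>) = ereal p"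
 unfolding crit_exp_def
 proof (rule antisym)
 show "Inf ?X <= ereal p"
 proof (rule ccontr)
 assume "\<not> Inf ?X <= ereal p"
 then have "ereal p < Inf ?X" by simp
 \<comment> \<open>Solvability is known for exponents above \<open>p\<close> and left open at
   \<open>p\<close> itself, so the infimum is compared with exponents slightly larger than
   \<open>p\<close>.\<close>
 then obtain z where z: "ereal p < ereal z" "ereal z < Inf ?X" using ereal_dense2 by blast
 then have "Inf ?X <= ereal z" by (intro Inf_lower up) simp
 then show False using z(2) by simp
 qed
 show "ereal p <= Inf ?X"
 by (rule Inf_greatest) (use low in auto)
 qed
 then show ?thesis using elliptic_aniso[OF d(1)] by blast
qed

end
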